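(* Let $A\in\mathbb{R}^{m\times n}$, and let $\Phi\in\mathbb{R}^{n\times l}$, $\Omega\in\mathbb{R}^{n\times s}$, $\Psi\in\mathbb{R}^{d\times m}$ be independent standard Gaussian matrices. Let $Q\in\mathbb{R}^{m\times s}$ and $B\in\mathbb{R}^{s\times n}$ be generated by the TYUC17-SPI algorithm (described in the context) with $q=1$. Let $\varrho\ge 1$ be an integer with $l>s\ge \varrho+4$, and let $d>s+1$. For a given $\xi>1$ let $$E_F=\left\{(\Omega,\Phi):\ \left\|\left(I+\Phi_1\Phi_2^{T}\Sigma_2^2\Omega_2\Omega_1^\dagger\Sigma_1^{-2}(\Phi_1\Phi_1^{T})^{-1}\right)^{-1}\right\|<\xi\right\},$$ assume $\mathbb{P}(E_F)>0$, and put $\hat\xi=\xi/\sqrt{\mathbb{P}(E_F)}$. Then $$\mathbb{E}\left[\|A-QB\|_F^2\,\middle|\,E_F\right]\le \frac{d}{d-s-1}\left[(1+\epsilon\hat\xi^2)\,\tau_{\varrho+1}^2(A)+\delta\hat\xi^2\,\frac{\sum_{j=\varrho+1}^n\sigma_j^6}{\sigma_\varrho^4}+\mu\hat\xi^2\,\tau_{\varrho+1}^2(A)\,\frac{\sum_{j=\varrho+1}^n\sigma_j^4}{\sigma_\varrho^4}\right],$$ where $$\epsilon=\frac{2\varrho}{l-\varrho-1},\qquad \delta=\frac{e^2(s+\varrho)\varrho(l-1)(l^2+2l)}{(s-\varrho)^2(l-\varrho)(l-\varrho-1)(l-\varrho-3)},\qquad \mu=\frac{e^2(s+\varrho)\v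arrho(l-1)l}{(s-\varrho)^2(l-\varrho)(l-\varrho-1)(l-\varrho-3)}.$$
   Context: A standard Gaussian matrix has i.i.d. $N(0,1)$ entries. $\|\cdot\|$ is the spectral norm, $\|\cdot\|_F$ the Frobenius norm, $^\dagger$ the Moore–Penrose inverse. $\sigma_1\ge\dots\ge\sigma_n\ge0$ are the singular values of $A$ (with $\sigma_i=0$ for $i>\min\{m,n\}$), and $\tau_k^2(A)=\sum_{i\ge k}\sigma_i^2$. Sketch sizes $l,s,d$ are positive integers smaller than $\min\{m,n\}$, with $\min\{l,d\}>s$. TYUC17-SPI algorithm (QB approximation, parameter $q$): form $Y=A\Omega\in\mathbb{R}^{m\times s}$, $W=\Psi A\in\mathbb{R}^{d\times n}$, $Z=A\Phi\in\mathbb{R}^{m\times l}$. Set $\hat Y=Y$ and repeat $q$ times: $[X,\sim]=\mathrm{QR}(Z^T\hat Y,0)$, $\hat Y=ZX$. Then $[Q,\sim]=\mathrm{QR}(\hat Y,0)$ and $B=(\Psi Q)^\dagger W$. Here $\mathrm{QR}(M,0)$ is the thin QR factorization: its first output is a matrix of the same size as $M$ with orthonormal columns whose range contains $\mathrm{range}(M)$, and it is a deterministic (measurable) function of $M$. Partition: let $V\in\mathbb{R}^{n\times n}$ be an orthogonal matrix of right singular vectors of $A$, so $A^TA=V\Sigma^2V^T$ with $\Sigma=\mathrm{diag}(\sigma_1,\dots,\sigma_n)$. Write $\Sigma=\mathrm{diag}(\Sigma_1,\Sigma_2)$ with $\Sigma_1\in\mathbb{R}^{\varrho\times\varrho}$,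 $\Sigma_2\in\mathbb{R}^{(n-\varrho)\times(n-\varrho)}$, and $V=[V_1\ V_2]$ with $V_1\in\mathbb{R}^{n\times\varrho}$, $V_2\in\mathbb{R}^{n\times(n-\varrho)}$. Set $\Omega_i=V_i^T\Omega$, $\Phi_i=V_i^T\Phi$ for $i=1,2$. Convention: if $\Sigma_1$ is singular (so that $\Sigma_2=0$ and $\sigma_\varrho=0$), the product $\Sigma_2^2\Omega_2\Omega_1^\dagger\Sigma_1^{-2}$ and the quotients with denominator $\sigma_\varrho^4$ are read as $0$. *)

theory Defs
  imports
    "HOL-Probability.Probability"
    "Jordan_Normal_Form.Char_Poly"
    "Jordan_Normal_Form.VS_Connect"
    "Jordan_Normal_Form.Gauss_Jordan_Elimination"
begin

definition frob_norm :: "real mat \<Rightarrow> real" where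
  "frob_norm A = sqrt (\<Sum>i<dim_row A. \<Sum>j<dim_col A. (A $$ (i, j))\<^sup>2)"

definition vec2_norm :: "real vec \<Rightarrow> real" where
  "vec2_norm x = sqrt (Matrix.scalar_prod x x)"

definition spec_norm :: "real mat \<Rightarrow> real" where
  "spec_norm A = (SUP x \<in> {x \<in> carrier_vec (dim_col A). vec2_norm x = 1}. vec2_norm (A *\<^sub>v x))"

text \<open>Only meaningful for invertible matrices.\<close>
definition mat_inv :: "real mat \<Rightarrow> real mat" where
  "mat_inv A = the (mat_inverse A)"

text \<open>The Moore--Penrose inverse, by the four Penrose conditions.\<close>
definition is_pinv :: "real mat \<Rightarrow> real mat \<Rightarrow> bool" where
  "is_pinv A X \<longleftrightarrow>
     X \<in> carrier_mat (dim_col A) (dim_row A) \<and>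
     A * X * A = A \<and> X * A * X = X \<and>
     (A * X)\<^sup>T = A * X \<and> (X * A)\<^sup>T = X * A"

definition pinv :: "real mat \<Rightarrow> real mat" where
  "pinv A = (THE X. is_pinv A X)"

text \<open>
  The square roots of the eigenvalues of \<open>A\<^sup>T A\<close> with multiplicity, in decreasing order.
  The list has length \<open>n = dim_col A\<close>, so for \<open>n > m\<close> it contains the zeros
  \<open>\<sigma>\<^sub>i = 0\<close>, \<open>i > min m n\<close>.
\<close>
definition sing_vals :: "real mat \<Rightarrow> real list" where
  "sing_vals A = rev (sorted_list_of_multiset (image_mset sqrt (proots (char_poly (A\<^sup>T * A)))))"

text \<open>Indices run over \<open>1, ..., n\<close>, whereas matrix and list positions start at 0.\<close>
definition sing_val :: "real mat \<Rightarrow> nat \<Rightarrow> real" where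
  "sing_val A i = sing_vals A ! (i - 1)"

definition tau_sq :: "nat \<Rightarrow> real mat \<Rightarrow> real" where
  "tau_sq k A = (\<Sum>i = k..dim_col A. (sing_val A i)\<^sup>2)"

definition Sigma_mat :: "real mat \<Rightarrow> real mat" where
  "Sigma_mat A = mat_diag (dim_col A) (\<lambda>j. sing_val A (j + 1))"

definition right_singular_basis :: "real mat \<Rightarrow> real mat \<Rightarrow> bool" where
  "right_singular_basis A V \<longleftrightarrow>
     V \<in> carrier_mat (dim_col A) (dim_col A) \<and>
     V\<^sup>T * V = 1\<^sub>m (dim_col A) \<and>
     A\<^sup>T * A = V * (Sigma_mat A ^\<^sub>m 2) * V\<^sup>T"

text \<open>The Borel sigma-algebra on the \<open>r \<times> c\<close> matrices, transported from \<open>\<real>\<^bsup>r \<times> c\<^esup>\<close>.\<close>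
definition mat_borel :: "nat \<Rightarrow> nat \<Rightarrow> real mat measure" where
  "mat_borel r c =
     vimage_algebra (carrier_mat r c)
       (\<lambda>A. \<lambda>p \<in> {..<r} \<times> {..<c}. A $$ p)
       (PiM ({..<r} \<times> {..<c}) (\<lambda>_. borel))"

definition std_gaussian_mat :: "'w measure \<Rightarrow> nat \<Rightarrow> nat \<Rightarrow> ('w \<Rightarrow> real mat) \<Rightarrow> bool" where
  "std_gaussian_mat M r c X \<longleftrightarrow>
     X \<in> measurable M (mat_borel r c) \<and>
     prob_space.indep_vars M (\<lambda>_. borel) (\<lambda>p \<omega>. X \<omega> $$ p) ({..<r} \<times> {..<c}) \<and>
     (\<forall>p \<in> {..<r} \<times> {..<c}.
        distributed M lborel (\<lambda>\<omega>. X \<omega> $$ p) (\<lambda>x. ennreal (std_normal_density x)))"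

text \<open>
  \<open>qr\<close> is the first output of \<open>QR(\<cdot>, 0)\<close>, on matrices of all shapes with at least as many
  rows as columns (the only ones admitting a factor with orthonormal columns).
\<close>
definition thin_qr :: "(real mat \<Rightarrow> real mat) \<Rightarrow> bool" where
  "thin_qr qr \<longleftrightarrow>
     (\<forall>r c. c \<le> r \<longrightarrow>
        qr \<in> measurable (mat_borel r c) (mat_borel r c) \<and>
        (\<forall>M \<in> carrier_mat r c.
           qr M \<in> carrier_mat r c \<and>
           (qr M)\<^sup>T * qr M = 1\<^sub>m c \<and>
           vec_space.col_space r M \<subseteq> vec_space.col_space r (qr M)))"

definition spi_Q :: "(real mat \<Rightarrow> real mat) \<Rightarrow> nat \<Rightarrow> real mat \<Rightarrow> real mat \<Rightarrow> real mat \<Rightarrow> real mat" where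
  "spi_Q qr q A \<Omega> \<Phi> =
     (let Y = A * \<Omega>; Z = A * \<Phi> in
      qr (((\<lambda>Yh. Z * qr (Z\<^sup>T * Yh)) ^^ q) Y))"

definition spi_B ::
    "(real mat \<Rightarrow> real mat) \<Rightarrow> nat \<Rightarrow> real mat \<Rightarrow> real mat \<Rightarrow> real mat \<Rightarrow> real mat \<Rightarrow> real mat" where
  "spi_B qr q A \<Omega> \<Phi> \<Psi> =
     (let W = \<Psi> * A; Q = spi_Q qr q A \<Omega> \<Phi> in pinv (\<Psi> * Q) * W)"

text \<open>
  The set \<open>E\<^sub>F\<close> of pairs \<open>(\<Omega>, \<Phi>)\<close>. The inverses in its definition are required to exist;
  for Gaussian \<open>\<Omega>\<close>, \<open>\<Phi>\<close> this excludes a null set only. The product \<open>G\<close> is read as 0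
  if \<open>\<Sigma>\<^sub>1\<close> is singular.
\<close>
definition event_EF :: "real mat \<Rightarrow> real mat \<Rightarrow> nat \<Rightarrow> real \<Rightarrow> (real mat \<times> real mat) set" where
  "event_EF A V \<rho> \<xi> = {(\<Omega>, \<Phi>).
     let n = dim_col A;
         \<Sigma>1 = mat_diag \<rho> (\<lambda>j. sing_val A (j + 1));
         \<Sigma>2 = mat_diag (n - \<rho>) (\<lambda>j. sing_val A (\<rho> + j + 1));
         V1 = mat_of_cols n (take \<rho> (cols V));
         V2 = mat_of_cols n (drop \<rho> (cols V));
         \<Omega>1 = V1\<^sup>T * \<Omega>; \<Omega>2 = V2\<^sup>T * \<Omega>;
         \<Phi>1 = V1\<^sup>T * \<Phi>; \<Phi>2 = V2\<^sup>T * \<Phi>;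
         G = (if invertible_mat \<Sigma>1
              then (\<Sigma>2 ^\<^sub>m 2) * \<Omega>2 * pinv \<Omega>1 * (mat_inv \<Sigma>1 ^\<^sub>m 2)
              else 0\<^sub>m (n - \<rho>) \<rho>);
         T = 1\<^sub>m \<rho> + \<Phi>1 * \<Phi>2\<^sup>T * G * mat_inv (\<Phi>1 * \<Phi>1\<^sup>T)
     in invertible_mat (\<Phi>1 * \<Phi>1\<^sup>T) \<and> invertible_mat T \<and> spec_norm (mat_inv T) < \<xi>}"

end

theory Submission
  imports Defs
begin

text \<open>
  Conditionally on \<open>\<Omega>\<close> and \<open>\<Phi>\<close>, the sketch \<open>\<Psi> Q\<close> is independent of the part of \<open>\<Psi>\<close> acting on the residual
  \<open>R = A - Q Q\<^sup>T A\<close>, and the inverse moment \<open>E |(\<Psi> Q)\<^sup>\<dagger> \<Psi> R|\<^sub>F\<^sup>2 = |R|\<^sub>F\<^sup>2 s / (d - s - 1)\<close> turns the error of \<open>Q B\<close> into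
  \<open>d / (d - s - 1)\<close> times that of \<open>Q Q\<^sup>T A\<close>.  For the latter, compare \<open>Q Q\<^sup>T A\<close> with the matrix
  \<open>K V\<^sub>1\<^sup>T\<close>, where \<open>K = A V\<^sub>1 + A V\<^sub>2 J\<close> lies in the range of \<open>Q\<close> and
  \<open>J = \<Phi>\<^sub>2 (\<Phi>\<^sub>1\<^sup>T + \<Phi>\<^sub>2\<^sup>T G) (\<Phi>\<^sub>1 \<Phi>\<^sub>1\<^sup>T)\<^sup>-\<^sup>1 T\<^sup>-\<^sup>1\<close> with \<open>G\<close> and \<open>T\<close> as in the definition of \<open>E\<^sub>F\<close>: the error is at most
  \<open>|\<Sigma>\<^sub>2|\<^sub>F\<^sup>2 + |\<Sigma>\<^sub>2 J|\<^sub>F\<^sup>2\<close>, and on \<open>E\<^sub>F\<close> the factor \<open>T\<^sup>-\<^sup>1\<close> costs at most \<open>\<xi>\<^sup>2\<close>.  By rotation invariance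
  \<open>\<Phi>\<^sub>1, \<Phi>\<^sub>2, \<Omega>\<^sub>1, \<Omega>\<^sub>2\<close> are independent Gaussian blocks, so the expectation of the remaining factor follows from
  fourth moments of Gaussian matrices and first and second inverse moments of Wishart matrices; the
  indicator of \<open>E\<^sub>F\<close> can be dropped there, at the price of dividing by \<open>P(E\<^sub>F)\<close>.  If \<open>\<Sigma>\<^sub>1\<close> is singular,
  then \<open>A\<close> has rank less than \<open>\<rho>\<close> and \<open>A = Q Q\<^sup>T A\<close> almost surely.
\<close>

section \<open>Matrix algebra, Frobenius norms and pseudoinverses\<close>

unbundle no vec_syntax
unbundle no inner_syntax

text \<open>\<open>J\<close> comes from a normalisation. The range of \<open>Q\<close> contains that
  of Z Z^T A \<Omega>, where Z = A \<Phi>. Multiplying Z^T A \<Omega> on the right by the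
  pseudoinverse of \<Omega>_1 and by \<Sigma>_1^(-2) gives H = \<Phi>_1^T + \<Phi>_2^T G. With M the
  inverse of \<Phi>_1 \<Phi>_1^T, the matrix Z H M has V_1-coefficient \<Phi>_1 H M = T; dividing by
  T makes it the identity. The term |\<Sigma>_2|^2 keeps the indicator of the event, so its
  coefficient stays 1 after conditioning; only the \<open>J\<close> term is divided by the
  probability, which produces \<open>\<xi>h\<close>. Splitting H into its two summands costs the
  factor 2 in \<open>\<epsilon>\<close>; \<open>\<delta>\<close> and \<open>\<mu>\<close> are larger
  than what the moments give (\<open>spi_constant_bound\<close>). Expectations are
  \<open>ennreal\<close> integrals, so integrability is a conclusion and iterated integrals may be
  exchanged. They are moved from \<open>M\<close> to Gaussian laws on matrices, where conditioning
  means integrating one block of rows with the others fixed. Inverses are written with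
  \<open>minv\<close>, total and rational in the entries, hence measurable.\<close>

abbreviation mdet :: "real mat \<Rightarrow> real" where "mdet \<equiv> Determinant.det"

lemma mult_assoc_dim:
  fixes A :: "real mat"
  assumes "dim_col A = dim_row B" "dim_col B = dim_row C"
  shows "(A * B) * C = A * (B * C)"
  using assms by (intro assoc_mult_mat[of _ "dim_row A" "dim_col A" _ "dim_col B" _ "dim_col C"]) auto

lemma transpose_mult_dim:
  fixes A :: "real mat"
  assumes "dim_col A = dim_row B"
  shows "(A * B)\<^sup>T = B\<^sup>T * A\<^sup>T"
  using assms by (intro transpose_mult[of _ "dim_row A" "dim_col A" _ "dim_col B"]) auto

lemma add_mult_dim:
  fixes A :: "real mat"
  assumes "dim_row A = dim_row B" "dim_col A = dim_col B" "dim_col A = dim_row C"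
  shows "(A + B) * C = A * C + B * C"
  using assms by (intro add_mult_distrib_mat[of _ "dim_row A" "dim_col A" _ _ "dim_col C"]) auto

lemma mult_add_dim:
  fixes A :: "real mat"
  assumes "dim_row C = dim_row B" "dim_col C = dim_col B" "dim_col A = dim_row B"
  shows "A * (B + C) = A * B + A * C"
  using assms by (intro mult_add_distrib_mat[of _ "dim_row A" "dim_col A" _ "dim_col B"]) auto

lemma minus_mult_dim:
  fixes A :: "real mat"
  assumes "dim_row A = dim_row B" "dim_col A = dim_col B" "dim_col A = dim_row C"
  shows "(A - B) * C = A * C - B * C"
  using assms by (intro minus_mult_distrib_mat[of _ "dim_row A" "dim_col A" _ _ "dim_col C"]) auto

lemma mult_minus_dim:
  fixes A :: "real mat"
  assumes "dim_row C = dim_row B" "dim_col C = dim_col B" "dim_col A = dim_row B"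
  shows "A * (B - C) = A * B - A * C"
  using assms by (intro mult_minus_distrib_mat[of _ "dim_row A" "dim_col A" _ "dim_col B"]) auto

lemma one_mult_dim: "dim_row (A :: real mat) = n \<Longrightarrow> 1\<^sub>m n * A = A"
  by (intro left_mult_one_mat[of _ _ "dim_col A"]) auto

lemma mult_one_dim: "dim_col (A :: real mat) = n \<Longrightarrow> A * 1\<^sub>m n = A"
  by (intro right_mult_one_mat[of _ "dim_row A"]) auto

lemmas mat_ring = mult_assoc_dim transpose_mult_dim add_mult_dim mult_add_dim minus_mult_dim
  mult_minus_dim one_mult_dim mult_one_dim

lemma mat_mult_cancel_left:
  fixes A B C :: "real mat"
  assumes "A * B = 1\<^sub>m n" "dim_col A = dim_row B" "dim_col B = dim_row C"
  shows "A * (B * C) = C"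
proof -
  have "n = dim_col B" using arg_cong[OF assms(1), of dim_col] by simp
  then show ?thesis using assms mult_assoc_dim[of A B C] by (simp add: one_mult_dim)
qed

section \<open>The Frobenius inner product and norm\<close>

lemma mat_mult_index:
  fixes A :: "real mat"
  assumes "i < dim_row A" "j < dim_col B" "dim_col A = dim_row B"
  shows "(A * B) $$ (i, j) = (\<Sum>k<dim_row B. A $$ (i, k) * B $$ (k, j))"
  using assms by (simp add: scalar_prod_def atLeast0LessThan)

text \<open>The trace of \<open>A\<^sup>T * B\<close>. The sums are bounded by the dimensions of
  \<open>A\<close> alone, so even symmetry has to assume equal dimensions.\<close>

definition finner :: "real mat \<Rightarrow> real mat \<Rightarrow> real" where
  "finner A B = (\<Sum>i<dim_row A. \<Sum>j<dim_col A. A $$ (i, j) * B $$ (i, j))"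

definition frob_sq :: "real mat \<Rightarrow> real" where
  "frob_sq A = (\<Sum>i<dim_row A. \<Sum>j<dim_col A. (A $$ (i, j))\<^sup>2)"

lemma frob_sq_nonneg [simp]: "0 \<le> frob_sq A"
  unfolding frob_sq_def by (intro sum_nonneg) auto

lemma frob_norm_sq: "(frob_norm A)\<^sup>2 = frob_sq A"
  unfolding frob_norm_def frob_sq_def[symmetric] by simp

lemma frob_sq_finner: "frob_sq A = finner A A"
  unfolding frob_sq_def finner_def power2_eq_square ..

lemma frob_sq_zero_iff: "frob_sq A = 0 \<longleftrightarrow> A = 0\<^sub>m (dim_row A) (dim_col A)"
proof
  assume "frob_sq A = 0"
  then have "\<forall>i\<in>{..<dim_row A}. (\<Sum>j<dim_col A. (A $$ (i, j))\<^sup>2) = 0"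
    unfolding frob_sq_def by (subst (asm) sum_nonneg_eq_0_iff) (auto intro: sum_nonneg)
  then have "A $$ (i, j) = 0" if "i < dim_row A" "j < dim_col A" for i j
    using that by (subst (asm) sum_nonneg_eq_0_iff) (auto intro: sum_nonneg)
  then show "A = 0\<^sub>m (dim_row A) (dim_col A)" by (intro eq_matI) auto
next
  assume A: "A = 0\<^sub>m (dim_row A) (dim_col A)"
  have "A $$ (i, j) = 0" if "i < dim_row A" "j < dim_col A" for i j
    using arg_cong[OF A, of "\<lambda>B. B $$ (i, j)"] that by simp
  then show "frob_sq A = 0" unfolding frob_sq_def by simp
qed

lemma frob_sq_transpose [simp]: "frob_sq (A\<^sup>T) = frob_sq A"
  unfolding frob_sq_def by (subst sum.swap) (auto intro!: sum.cong)

lemma finner_transpose: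
  "dim_row A = dim_row B \<Longrightarrow> dim_col A = dim_col B \<Longrightarrow> finner (A\<^sup>T) (B\<^sup>T) = finner A B"
  unfolding finner_def by (subst sum.swap) (auto intro!: sum.cong)

lemma finner_sym:
  "dim_row A = dim_row B \<Longrightarrow> dim_col A = dim_col B \<Longrightarrow> finner A B = finner B A"
  unfolding finner_def by (simp add: mult.commute)

lemma finner_zero [simp]: "finner A (0\<^sub>m (dim_row A) (dim_col A)) = 0" "finner (0\<^sub>m n m) A = 0"
  unfolding finner_def by auto

text \<open>Multiplication by \<open>B\<close> and by its transpose are adjoint. Together with
  \<open>finner_mult_right\<close> this is the form in which cyclicity of the trace is used.\<close>

lemma finner_mult_left:
  assumes "dim_row A = dim_row B" "dim_col B = dim_row C" "dim_col A = dim_col C"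
  shows "finner A (B * C) = finner (B\<^sup>T * A) C"
proof -
  have "finner A (B * C)
     = (\<Sum>i<dim_row A. \<Sum>j<dim_col A. \<Sum>k<dim_row C. A $$ (i, j) * B $$ (i, k) * C $$ (k, j))"
    unfolding finner_def using assms
    by (intro sum.cong refl) (auto simp: mat_mult_index sum_distrib_left mult.assoc simp del: index_mult_mat(1))
  also have "\<dots> = (\<Sum>j<dim_col A. \<Sum>i<dim_row A. \<Sum>k<dim_row C. A $$ (i, j) * B $$ (i, k) * C $$ (k, j))"
    by (rule sum.swap)
  also have "\<dots> = (\<Sum>j<dim_col A. \<Sum>k<dim_row C. \<Sum>i<dim_row A. A $$ (i, j) * B $$ (i, k) * C $$ (k, j))"
    by (intro sum.cong refl sum.swap)
  also have "\<dots> = (\<Sum>k<dim_row C. \<Sum>j<dim_col A. \<Sum>i<dim_row A. A $$ (i, j) * B $$ (i, k) * C $$ (k, j))"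
    by (rule sum.swap)
  also have "\<dots> = finner (B\<^sup>T * A) C"
    unfolding finner_def using assms
    by (intro sum.cong refl) (auto simp: mat_mult_index sum_distrib_left sum_distrib_right mult_ac
        simp del: index_mult_mat(1) intro!: sum.cong)
  finally show ?thesis .
qed

lemma finner_mult_right:
  assumes "dim_row A = dim_row B" "dim_col B = dim_row C" "dim_col A = dim_col C"
  shows "finner A (B * C) = finner (A * C\<^sup>T) B"
proof -
  have "finner A (B * C) = finner (A\<^sup>T) (C\<^sup>T * B\<^sup>T)"
    using assms by (subst finner_transpose[symmetric]) (auto simp: transpose_mult_dim)
  also have "\<dots> = finner (C * A\<^sup>T) (B\<^sup>T)"
    using assms by (subst finner_mult_left) auto
  also have "\<dots> = finner ((A * C\<^sup>T)\<^sup>T) (B\<^sup>T)"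
    using assms by (simp add: transpose_mult_dim)
  also have "\<dots> = finner (A * C\<^sup>T) B"
    using assms by (subst finner_transpose) auto
  finally show ?thesis .
qed

lemma finner_add:
  assumes "dim_row A = dim_row B" "dim_col A = dim_col B" "dim_row A = dim_row C" "dim_col A = dim_col C"
  shows "finner (A + B) C = finner A C + finner B C"
  using assms unfolding finner_def sum.distrib[symmetric]
  by (auto intro!: sum.cong simp: distrib_right)

lemma frob_sq_add:
  assumes "dim_row A = dim_row B" "dim_col A = dim_col B"
  shows "frob_sq (A + B) = frob_sq A + frob_sq B + 2 * finner A B"
  using assms unfolding frob_sq_def finner_def sum_distrib_left sum.distrib[symmetric]
  by (auto intro!: sum.cong simp: power2_sum)

lemma frob_sq_minus:
  assumes "dim_row A = dim_row B" "dim_col A = dim_col B"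
  shows "frob_sq (A - B) = frob_sq A + frob_sq B - 2 * finner A B"
  using assms unfolding frob_sq_def finner_def
  by (simp add: power2_diff sum.distrib sum_subtractf sum_distrib_left mult.assoc)

lemma frob_sq_add_le:
  assumes "dim_row A = dim_row B" "dim_col A = dim_col B"
  shows "frob_sq (A + B) \<le> 2 * frob_sq A + 2 * frob_sq B"
proof -
  have "frob_sq (A + B) + frob_sq (A - B) = 2 * frob_sq A + 2 * frob_sq B"
    using assms by (simp add: frob_sq_add frob_sq_minus)
  then show ?thesis using frob_sq_nonneg[of "A - B"] by linarith
qed

lemma frob_sq_isometry:
  assumes "Q\<^sup>T * Q = 1\<^sub>m k" "dim_col Q = dim_row X"
  shows "frob_sq (Q * X) = frob_sq X"
proof -
  have k: "k = dim_col Q" using arg_cong[OF assms(1), of dim_col] by simp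
  have "finner (Q * X) (Q * X) = finner (Q\<^sup>T * (Q * X)) X"
    using assms by (subst finner_mult_left) auto
  also have "Q\<^sup>T * (Q * X) = X"
    using assms by (intro mat_mult_cancel_left[OF assms(1)]) auto
  finally show ?thesis by (simp add: frob_sq_finner)
qed

lemma finner_Cauchy:
  assumes "dim_row A = dim_row B" "dim_col A = dim_col B"
  shows "(finner A B)\<^sup>2 \<le> frob_sq A * frob_sq B"
proof -
  let ?I = "{..<dim_row A} \<times> {..<dim_col A}"
  have "finner A B = (\<Sum>p\<in>?I. A $$ p * B $$ p)"
    unfolding finner_def by (simp add: sum.cartesian_product case_prod_unfold)
  moreover have "frob_sq A = (\<Sum>p\<in>?I. (A $$ p)\<^sup>2)"
    unfolding frob_sq_def by (simp add: sum.cartesian_product case_prod_unfold)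
  moreover have "frob_sq B = (\<Sum>p\<in>?I. (B $$ p)\<^sup>2)"
    unfolding frob_sq_def using assms by (simp add: sum.cartesian_product case_prod_unfold)
  ultimately show ?thesis using Cauchy_Schwarz_ineq_sum[of "\<lambda>p. A $$ p" "\<lambda>p. B $$ p" ?I] by simp
qed

lemma frob_sq_eq_sum_cols:
  "frob_sq A = (\<Sum>j<dim_col A. frob_sq (mat (dim_row A) 1 (\<lambda>(i, _). A $$ (i, j))))"
  unfolding frob_sq_def by (subst sum.swap) auto

text \<open>Cauchy-Schwarz for each entry of the product; the resulting double sum
  separates.\<close>

lemma frob_sq_mult_le:
  assumes "dim_col A = dim_row B" shows "frob_sq (A * B) \<le> frob_sq A * frob_sq B"
proof -
  have "frob_sq (A * B) = (\<Sum>i<dim_row A. \<Sum>j<dim_col B. (\<Sum>k<dim_row B. A $$ (i, k) * B $$ (k, j))\<^sup>2)"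
    unfolding frob_sq_def using assms by (simp add: mat_mult_index del: index_mult_mat(1))
  also have "\<dots> \<le> (\<Sum>i<dim_row A. \<Sum>j<dim_col B. (\<Sum>k<dim_row B. (A $$ (i, k))\<^sup>2) * (\<Sum>k<dim_row B. (B $$ (k, j))\<^sup>2))"
    by (intro sum_mono Cauchy_Schwarz_ineq_sum)
  also have "\<dots> = (\<Sum>i<dim_row A. \<Sum>k<dim_row B. (A $$ (i, k))\<^sup>2) * (\<Sum>j<dim_col B. \<Sum>k<dim_row B. (B $$ (k, j))\<^sup>2)"
    by (simp add: sum_product)
  also have "\<dots> = frob_sq A * frob_sq B"
    unfolding frob_sq_def using assms by (simp add: sum.swap[of _ "{..<dim_col B}"])
  finally show ?thesis .
qed

lemma frob_sq_smult: "frob_sq (c \<cdot>\<^sub>m A) = c\<^sup>2 * frob_sq A"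
  unfolding frob_sq_def by (simp add: power_mult_distrib sum_distrib_left)

lemma frob_sq_one [simp]: "frob_sq (1\<^sub>m n) = n"
proof -
  have "frob_sq (1\<^sub>m n) = (\<Sum>i<n. \<Sum>j<n. if i = j then 1 else 0 :: real)"
    unfolding frob_sq_def by (simp add: if_distrib[of "\<lambda>x. x\<^sup>2"] cong: if_cong)
  then show ?thesis by simp
qed

text \<open>The adjugate formula makes the inverse a total function whose entries are rational in
  those of \<open>A\<close>, which is what measurability needs. On singular matrices it is zero,
  because 1 / 0 = 0.\<close>

definition minv :: "real mat \<Rightarrow> real mat" where
  "minv A = (1 / mdet A) \<cdot>\<^sub>m adj_mat A"

lemma dim_minv [simp]: "dim_row (minv A) = dim_row A" "dim_col (minv A) = dim_col A"
  unfolding minv_def adj_mat_def by auto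

lemma minv_carrier [simp]: "A \<in> carrier_mat n n \<Longrightarrow> minv A \<in> carrier_mat n n"
  by auto

lemma minv_mult:
  assumes "dim_row A = n" "dim_col A = n" "mdet A \<noteq> 0"
  shows "A * minv A = 1\<^sub>m n" "minv A * A = 1\<^sub>m n"
proof -
  have A: "A \<in> carrier_mat n n" using assms by auto
  note am = adj_mat[OF A]
  have "A * minv A = (1 / mdet A) \<cdot>\<^sub>m (A * adj_mat A)"
    unfolding minv_def using A am(1) by (intro mult_smult_distrib) auto
  then show "A * minv A = 1\<^sub>m n" using am(2) assms by (auto intro!: eq_matI)
  have "minv A * A = (1 / mdet A) \<cdot>\<^sub>m (adj_mat A * A)"
    unfolding minv_def using A am(1) by (intro mult_smult_assoc_mat) auto
  then show "minv A * A = 1\<^sub>m n" using am(3) assms by (auto intro!: eq_matI)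
qed

lemma det_nz_of_left_inv:
  assumes "A \<in> carrier_mat n n" "B \<in> carrier_mat n n" "B * A = 1\<^sub>m n"
  shows "mdet A \<noteq> 0" "minv A = B"
proof -
  have "mdet B * mdet A = 1" using det_mult[OF assms(2,1)] assms(3) by simp
  then show nz: "mdet A \<noteq> 0" by auto
  have "B = B * (A * minv A)" using assms nz by (simp add: minv_mult[of A n] mult_one_dim)
  also have "\<dots> = minv A" using assms by (intro mat_mult_cancel_left[OF assms(3)]) auto
  finally show "minv A = B" by simp
qed

lemma minv_transpose:
  assumes "A \<in> carrier_mat n n" "mdet A \<noteq> 0"
  shows "(minv A)\<^sup>T = minv (A\<^sup>T)"
proof -
  have "(minv A)\<^sup>T * A\<^sup>T = (A * minv A)\<^sup>T" using assms by (simp add: transpose_mult_dim)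
  also have "\<dots> = 1\<^sub>m n" using assms by (simp add: minv_mult[of A n])
  finally show ?thesis using assms det_nz_of_left_inv[of "A\<^sup>T" n "(minv A)\<^sup>T"] by auto
qed

lemma minv_sym:
  assumes "A \<in> carrier_mat n n" "mdet A \<noteq> 0" "A\<^sup>T = A" shows "(minv A)\<^sup>T = minv A"
  using minv_transpose[OF assms(1,2)] assms(3) by simp

lemma invertible_mat_iff_det:
  assumes "A \<in> carrier_mat n n"
  shows "invertible_mat (A :: real mat) \<longleftrightarrow> mdet A \<noteq> 0"
proof
  assume "invertible_mat A"
  then obtain B where B: "A * B = 1\<^sub>m n" "B * A = 1\<^sub>m (dim_row B)"
    unfolding invertible_mat_def inverts_mat_def using assms by auto
  have "B \<in> carrier_mat n n"
    using arg_cong[OF B(1), of dim_col] arg_cong[OF B(2), of dim_col] assms by auto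
  then show "mdet A \<noteq> 0" using B assms by (intro det_nz_of_left_inv(1)[of _ n B]) auto
next
  assume "mdet A \<noteq> 0"
  then show "invertible_mat A"
    using assms minv_mult[of A n] unfolding invertible_mat_def inverts_mat_def square_mat.simps
    by (auto intro!: exI[of _ "minv A"])
qed

text \<open>The inverses in \<open>event_EF\<close> are results of Gauss-Jordan elimination; this
  replaces them by the adjugate formula.\<close>

lemma mat_inv_eq_minv:
  assumes "A \<in> carrier_mat n n" "mdet A \<noteq> 0"
  shows "mat_inv A = minv A"
proof -
  obtain B where B: "mat_inverse A = Some B"
  proof (cases "mat_inverse A")
    case None
    have "A \<in> Units (ring_mat TYPE(real) n n)"
      using assms minv_mult[of A n] unfolding Units_def ring_mat_def
      by (auto intro!: bexI[of _ "minv A"])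
    then show ?thesis using mat_inverse(1)[OF assms(1) None, of n] by auto
  qed
  from mat_inverse(2)[OF assms(1) B] show ?thesis
    using det_nz_of_left_inv(2)[of A n B] assms B by (auto simp: mat_inv_def)
qed

text \<open>Vectors are one-column matrices in what follows, so that a single product and a single
  norm suffice. This restates the kernel criterion for them.\<close>

lemma det_nz_of_kernel:
  assumes "A \<in> carrier_mat n n"
    and "\<And>v. v \<in> carrier_mat n 1 \<Longrightarrow> A * v = 0\<^sub>m n 1 \<Longrightarrow> v = 0\<^sub>m n 1"
  shows "mdet A \<noteq> 0"
proof
  assume "mdet A = 0"
  then obtain v where v: "v \<in> carrier_vec n" "v \<noteq> 0\<^sub>v n" "A *\<^sub>v v = 0\<^sub>v n"
    using det_0_iff_vec_prod_zero[OF assms(1)] by auto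
  define w where "w = mat n 1 (\<lambda>(i, _). v $ i)"
  have w: "w \<in> carrier_mat n 1" by (auto simp: w_def)
  have "A * w = 0\<^sub>m n 1"
  proof (rule eq_matI)
    fix i j assume "i < dim_row (0\<^sub>m n 1 :: real mat)" "j < dim_col (0\<^sub>m n 1 :: real mat)"
    then have ij: "i < n" "j = 0" by auto
    have "(A * w) $$ (i, j) = (A *\<^sub>v v) $ i"
      using ij assms(1) v(1) by (auto simp: w_def scalar_prod_def)
    then show "(A * w) $$ (i, j) = 0\<^sub>m n 1 $$ (i, j)" using v ij by auto
  qed (use assms w in auto)
  from assms(2)[OF w this] have w0: "w = 0\<^sub>m n 1" .
  have "v $ i = 0" if "i < n" for i
  proof -
    have "v $ i = w $$ (i, 0)" using that by (simp add: w_def)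
    also have "\<dots> = 0" unfolding w0 using that by simp
    finally show ?thesis .
  qed
  then have "v = 0\<^sub>v n" using v(1) by (intro eq_vecI) auto
  then show False using v(2) by simp
qed

text \<open>The squared norm of \<open>A * v\<close> is the inner product of
  \<open>A\<^sup>T * A * v\<close> with \<open>v\<close>, so the Gram matrix kills nothing that
  \<open>A\<close> does not kill.\<close>

lemma gram_zero:
  fixes A v :: "real mat"
  assumes "A\<^sup>T * A * v = 0\<^sub>m (dim_col A) (dim_col v)" "dim_row v = dim_col A"
  shows "A * v = 0\<^sub>m (dim_row A) (dim_col v)"
proof -
  have "frob_sq (A * v) = finner (A\<^sup>T * (A * v)) v"
    unfolding frob_sq_finner using assms by (subst finner_mult_left) auto
  also have "\<dots> = 0" using assms by (simp add: mult_assoc_dim)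
  finally show ?thesis using frob_sq_zero_iff[of "A * v"] by simp
qed

section \<open>Uniqueness and closed forms of the pseudoinverse\<close>

lemma is_pinv_unique:
  assumes X: "is_pinv A X" and Y: "is_pinv A Y"
  shows "X = Y"
proof -
  have d: "dim_row X = dim_col A" "dim_col X = dim_row A" "dim_row Y = dim_col A" "dim_col Y = dim_row A"
    using X Y unfolding is_pinv_def by auto
  have x: "A * X * A = A" "X * A * X = X" "(A * X)\<^sup>T = A * X" "(X * A)\<^sup>T = X * A"
    and y: "A * Y * A = A" "Y * A * Y = Y" "(A * Y)\<^sup>T = A * Y" "(Y * A)\<^sup>T = Y * A"
    using X Y unfolding is_pinv_def by auto
  \<comment> \<open>\<open>A * X\<close> and \<open>A * Y\<close> are symmetric, and each absorbs
    the other because both fix \<open>A\<close>; transposing the product therefore identifies them.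
    The same argument on the other side gives \<open>X * A = Y * A\<close>.\<close>
  have "A * X = (A * Y * A) * X" using y by simp
  also have "\<dots> = (A * Y) * (A * X)" using d by (simp add: mult_assoc_dim)
  also have "\<dots> = (A * Y)\<^sup>T * (A * X)\<^sup>T" using x y by simp
  also have "\<dots> = ((A * X * A) * Y)\<^sup>T" using d by (simp add: mat_ring)
  also have "\<dots> = A * Y" using x y by simp
  finally have AX: "A * X = A * Y" .
  have "X * A = X * (A * Y * A)" using y by simp
  also have "\<dots> = (X * A) * (Y * A)" using d by (simp add: mult_assoc_dim)
  also have "\<dots> = (X * A)\<^sup>T * (Y * A)\<^sup>T" using x y by simp
  also have "\<dots> = (Y * (A * X * A))\<^sup>T" using d by (simp add: mat_ring)
  also have "\<dots> = Y * A" using x y by simp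
  finally have XA: "X * A = Y * A" .
  have "X = X * A * X" using x by simp
  also have "\<dots> = Y * (A * X)" using XA d by (simp add: mult_assoc_dim)
  also have "\<dots> = Y * A * Y" using AX d by (simp add: mult_assoc_dim)
  finally show ?thesis using y by simp
qed

lemma pinv_eqI: "is_pinv A X \<Longrightarrow> pinv A = X"
  unfolding pinv_def using is_pinv_unique by blast

text \<open>The pseudoinverse of a full-rank factorisation with orthonormal columns in the left
  factor. With \<open>Q\<close> the identity it gives the formula for full row rank; with
  \<open>Q\<close> a basis of the range it gives existence for every matrix
  (\<open>pinv_exists\<close>).\<close>

lemma is_pinv_factor:
  assumes Q: "Q \<in> carrier_mat n r" "Q\<^sup>T * Q = 1\<^sub>m r" and R: "R \<in> carrier_mat r c" "mdet (R * R\<^sup>T) \<noteq> 0"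
  shows "is_pinv (Q * R) (R\<^sup>T * minv (R * R\<^sup>T) * Q\<^sup>T)"
proof -
  let ?W = "R * R\<^sup>T" and ?M = "minv (R * R\<^sup>T)"
  have W: "?W \<in> carrier_mat r r" "?W\<^sup>T = ?W" using R by (auto simp: transpose_mult_dim)
  have wm: "?W * ?M = 1\<^sub>m r" "?M * ?W = 1\<^sub>m r" using minv_mult[of ?W r] W R by auto
  have M: "?M\<^sup>T = ?M" using minv_sym[of ?W r] W R by auto
  have d: "dim_row Q = n" "dim_col Q = r" "dim_row R = r" "dim_col R = c" using Q R by auto
  \<comment> \<open>Products are associated to the right, so each cancellation is stated with an
    arbitrary tail \<open>Z\<close>; the four Penrose conditions then follow by rewriting.\<close>
  have c1: "Q\<^sup>T * (Q * Z) = Z" if "dim_row Z = r" for Z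
    using that Q d by (intro mat_mult_cancel_left[OF Q(2)]) auto
  have c2: "R * (R\<^sup>T * (?M * Z)) = Z" if "dim_row Z = r" for Z
    using that d mat_mult_cancel_left[OF wm(1), of Z] by (simp add: mult_assoc_dim)
  have c3: "?M * (R * (R\<^sup>T * Z)) = Z" if "dim_row Z = r" for Z
    using that d mat_mult_cancel_left[OF wm(2), of Z] by (simp add: mult_assoc_dim)
  show ?thesis unfolding is_pinv_def
    using d M by (auto simp: mat_ring c1 c2 c3)
qed

lemma pinv_full_row_rank:
  assumes "R \<in> carrier_mat r c" "mdet (R * R\<^sup>T) \<noteq> 0"
  shows "pinv R = R\<^sup>T * minv (R * R\<^sup>T)"
  using is_pinv_factor[of "1\<^sub>m r" r r R c] assms by (intro pinv_eqI) (auto simp: mat_ring)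

lemma is_pinv_transpose: "is_pinv A X \<Longrightarrow> is_pinv (A\<^sup>T) (X\<^sup>T)"
  unfolding is_pinv_def
proof (elim conjE, intro conjI)
  assume X: "X \<in> carrier_mat (dim_col A) (dim_row A)" and
    x: "A * X * A = A" "X * A * X = X" "(A * X)\<^sup>T = A * X" "(X * A)\<^sup>T = X * A"
  have d: "dim_row X = dim_col A" "dim_col X = dim_row A" using X by auto
  show "X\<^sup>T \<in> carrier_mat (dim_col A\<^sup>T) (dim_row A\<^sup>T)" using X by auto
  show "A\<^sup>T * X\<^sup>T * A\<^sup>T = A\<^sup>T" using arg_cong[OF x(1), of transpose_mat] d by (simp add: mat_ring)
  show "X\<^sup>T * A\<^sup>T * X\<^sup>T = X\<^sup>T" using arg_cong[OF x(2), of transpose_mat] d by (simp add: mat_ring)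
  show "(A\<^sup>T * X\<^sup>T)\<^sup>T = A\<^sup>T * X\<^sup>T" using x(4) d by (simp add: transpose_mult_dim)
  show "(X\<^sup>T * A\<^sup>T)\<^sup>T = X\<^sup>T * A\<^sup>T" using x(3) d by (simp add: transpose_mult_dim)
qed

lemma pinv_full_col_rank:
  assumes "R \<in> carrier_mat r c" "mdet (R\<^sup>T * R) \<noteq> 0"
  shows "pinv R = minv (R\<^sup>T * R) * R\<^sup>T"
proof -
  have "is_pinv (R\<^sup>T) (R * minv (R\<^sup>T * R))"
    using is_pinv_factor[of "1\<^sub>m c" c c "R\<^sup>T" r] assms by (auto simp: mat_ring)
  from is_pinv_transpose[OF this] show ?thesis
    using assms minv_sym[of "R\<^sup>T * R" c] by (intro pinv_eqI) (auto simp: transpose_mult_dim)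
qed

section \<open>Gaussian matrices\<close>

lemma space_mat_borel [simp]: "space (mat_borel r c) = carrier_mat r c"
  unfolding mat_borel_def by simp

lemma measurable_mat_entries:
  "(\<lambda>A. \<lambda>p\<in>{..<r} \<times> {..<c}. A $$ p) \<in> measurable (mat_borel r c) (PiM ({..<r} \<times> {..<c}) (\<lambda>_. borel))"
  unfolding mat_borel_def by (rule measurable_vimage_algebra1) (auto simp: space_PiM)

lemma measurable_mat_entry:
  assumes "i < r" "j < c"
  shows "(\<lambda>A. A $$ (i, j)) \<in> borel_measurable (mat_borel r c)"
proof -
  have "(\<lambda>A. (\<lambda>p\<in>{..<r} \<times> {..<c}. A $$ p) (i, j)) \<in> borel_measurable (mat_borel r c)"
    using assms by (intro measurable_compose[OF measurable_mat_entries measurable_component_singleton]) auto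
  then show ?thesis using assms by simp
qed

lemma mat_borelI:
  assumes "\<And>\<omega>. \<omega> \<in> space N \<Longrightarrow> X \<omega> \<in> carrier_mat r c"
    and "\<And>i j. i < r \<Longrightarrow> j < c \<Longrightarrow> (\<lambda>\<omega>. X \<omega> $$ (i, j)) \<in> borel_measurable N"
  shows "X \<in> measurable N (mat_borel r c)"
  unfolding mat_borel_def
  by (intro measurable_vimage_algebra2 measurable_restrict) (use assms in auto)

lemma mat_borel_carrier: "X \<in> measurable N (mat_borel r c) \<Longrightarrow> \<omega> \<in> space N \<Longrightarrow> X \<omega> \<in> carrier_mat r c"
  using measurable_space[of X N "mat_borel r c"] by auto

lemma mat_borel_dims:
  assumes "X \<in> measurable N (mat_borel r c)" "\<omega> \<in> space N"
  shows "dim_row (X \<omega>) = r" "dim_col (X \<omega>) = c"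
  using mat_borel_carrier[OF assms] by auto

lemma mat_borel_entry:
  "X \<in> measurable N (mat_borel r c) \<Longrightarrow> i < r \<Longrightarrow> j < c \<Longrightarrow> (\<lambda>\<omega>. X \<omega> $$ (i, j)) \<in> borel_measurable N"
  by (rule measurable_compose[OF _ measurable_mat_entry])

lemma mat_borel_mult:
  assumes X: "X \<in> measurable N (mat_borel r k)" and Y: "Y \<in> measurable N (mat_borel k c)"
  shows "(\<lambda>\<omega>. X \<omega> * Y \<omega>) \<in> measurable N (mat_borel r c)"
proof (rule mat_borelI)
  fix i j assume ij: "i < r" "j < c"
  have "(\<lambda>\<omega>. \<Sum>k'<k. X \<omega> $$ (i, k') * Y \<omega> $$ (k', j)) \<in> borel_measurable N"
    using ij mat_borel_entry[OF X] mat_borel_entry[OF Y]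
    by (intro borel_measurable_sum borel_measurable_times) auto
  also have "?this \<longleftrightarrow> (\<lambda>\<omega>. (X \<omega> * Y \<omega>) $$ (i, j)) \<in> borel_measurable N"
    using ij by (intro measurable_cong) (simp add: mat_borel_dims[OF X] mat_borel_dims[OF Y] mat_mult_index del: index_mult_mat(1))
  finally show "(\<lambda>\<omega>. (X \<omega> * Y \<omega>) $$ (i, j)) \<in> borel_measurable N" .
qed (intro carrier_matI; simp add: mat_borel_dims[OF X] mat_borel_dims[OF Y])

lemma mat_borel_add:
  assumes X: "X \<in> measurable N (mat_borel r c)" and Y: "Y \<in> measurable N (mat_borel r c)"
  shows "(\<lambda>\<omega>. X \<omega> + Y \<omega>) \<in> measurable N (mat_borel r c)"
proof (rule mat_borelI)
  fix i j assume ij: "i < r" "j < c"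
  have "(\<lambda>\<omega>. X \<omega> $$ (i, j) + Y \<omega> $$ (i, j)) \<in> borel_measurable N"
    using ij mat_borel_entry[OF X] mat_borel_entry[OF Y] by (intro borel_measurable_add) auto
  also have "?this \<longleftrightarrow> (\<lambda>\<omega>. (X \<omega> + Y \<omega>) $$ (i, j)) \<in> borel_measurable N"
    using ij by (intro measurable_cong) (simp add: mat_borel_dims[OF X] mat_borel_dims[OF Y])
  finally show "(\<lambda>\<omega>. (X \<omega> + Y \<omega>) $$ (i, j)) \<in> borel_measurable N" .
qed (intro carrier_matI; simp add: mat_borel_dims[OF X] mat_borel_dims[OF Y])

lemma mat_borel_minus:
  assumes X: "X \<in> measurable N (mat_borel r c)" and Y: "Y \<in> measurable N (mat_borel r c)"
  shows "(\<lambda>\<omega>. X \<omega> - Y \<omega>) \<in> measurable N (mat_borel r c)"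
proof (rule mat_borelI)
  fix i j assume ij: "i < r" "j < c"
  have "(\<lambda>\<omega>. X \<omega> $$ (i, j) - Y \<omega> $$ (i, j)) \<in> borel_measurable N"
    using ij mat_borel_entry[OF X] mat_borel_entry[OF Y] by (intro borel_measurable_diff) auto
  also have "?this \<longleftrightarrow> (\<lambda>\<omega>. (X \<omega> - Y \<omega>) $$ (i, j)) \<in> borel_measurable N"
    using ij by (intro measurable_cong) (simp add: mat_borel_dims[OF X] mat_borel_dims[OF Y])
  finally show "(\<lambda>\<omega>. (X \<omega> - Y \<omega>) $$ (i, j)) \<in> borel_measurable N" .
qed (intro carrier_matI; simp add: mat_borel_dims[OF X] mat_borel_dims[OF Y])

lemma mat_borel_transpose:
  assumes X: "X \<in> measurable N (mat_borel r c)"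
  shows "(\<lambda>\<omega>. (X \<omega>)\<^sup>T) \<in> measurable N (mat_borel c r)"
proof (rule mat_borelI)
  fix i j assume ij: "i < c" "j < r"
  show "(\<lambda>\<omega>. (X \<omega>)\<^sup>T $$ (i, j)) \<in> borel_measurable N"
    using mat_borel_entry[OF X ij(2,1)] ij
    by (subst measurable_cong[where g = "\<lambda>\<omega>. X \<omega> $$ (j, i)"]) (simp_all add: mat_borel_dims[OF X])
qed (intro carrier_matI; simp add: mat_borel_dims[OF X])

lemma mat_borel_const: "A \<in> carrier_mat r c \<Longrightarrow> (\<lambda>_. A) \<in> measurable N (mat_borel r c)"
  by simp

text \<open>By the Leibniz formula the determinant is a polynomial in the entries.\<close>

lemma mat_borel_det:
  assumes X: "X \<in> measurable N (mat_borel n n)"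
  shows "(\<lambda>\<omega>. mdet (X \<omega>)) \<in> borel_measurable N"
proof -
  have "(\<lambda>\<omega>. \<Sum>p\<in>{p. p permutes {0..<n}}. signof p * (\<Prod>i = 0..<n. X \<omega> $$ (i, p i))) \<in> borel_measurable N"
    by (intro borel_measurable_sum borel_measurable_times borel_measurable_const
        borel_measurable_prod mat_borel_entry[OF X]) (simp_all add: permutes_in_image[of _ "{0..<n}", simplified])
  also have "?this \<longleftrightarrow> ?thesis"
    by (intro measurable_cong) (simp add: det_def'[OF mat_borel_carrier[OF X]])
  finally show ?thesis .
qed

text \<open>Each entry is a cofactor divided by the determinant. Division of reals is total and
  measurable, so singular matrices need no separate treatment.\<close>

lemma mat_borel_minv:
  assumes X: "X \<in> measurable N (mat_borel n n)"
  shows "(\<lambda>\<omega>. minv (X \<omega>)) \<in> measurable N (mat_borel n n)"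
proof (rule mat_borelI)
  fix i j assume ij: "i < n" "j < n"
  have "(\<lambda>\<omega>. mat_delete (X \<omega>) j i) \<in> measurable N (mat_borel (n - 1) (n - 1))"
  proof (rule mat_borelI)
    fix a b assume ab: "a < n - 1" "b < n - 1"
    have "(\<lambda>\<omega>. X \<omega> $$ (if a < j then a else Suc a, if b < i then b else Suc b)) \<in> borel_measurable N"
      using ab by (intro mat_borel_entry[OF X]) auto
    also have "?this \<longleftrightarrow> (\<lambda>\<omega>. mat_delete (X \<omega>) j i $$ (a, b)) \<in> borel_measurable N"
      using ab unfolding mat_delete_def by (intro measurable_cong) (simp add: mat_borel_dims[OF X])
    finally show "(\<lambda>\<omega>. mat_delete (X \<omega>) j i $$ (a, b)) \<in> borel_measurable N" .
  qed (intro carrier_matI; simp add: mat_borel_dims[OF X])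
  from mat_borel_det[OF this]
  have "(\<lambda>\<omega>. 1 / mdet (X \<omega>) * ((-1) ^ (j + i) * mdet (mat_delete (X \<omega>) j i))) \<in> borel_measurable N"
    using mat_borel_det[OF X] by (intro borel_measurable_times borel_measurable_divide) auto
  also have "?this \<longleftrightarrow> (\<lambda>\<omega>. minv (X \<omega>) $$ (i, j)) \<in> borel_measurable N"
    using ij by (intro measurable_cong)
      (simp add: minv_def adj_mat_def cofactor_def mat_borel_dims[OF X])
  finally show "(\<lambda>\<omega>. minv (X \<omega>) $$ (i, j)) \<in> borel_measurable N" .
qed (intro carrier_matI; simp add: mat_borel_dims[OF X])

lemma mat_borel_frob_sq:
  assumes X: "X \<in> measurable N (mat_borel r c)"
  shows "(\<lambda>\<omega>. frob_sq (X \<omega>)) \<in> borel_measurable N"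
proof -
  have "(\<lambda>\<omega>. \<Sum>i<r. \<Sum>j<c. (X \<omega> $$ (i, j))\<^sup>2) \<in> borel_measurable N"
    by (intro borel_measurable_sum borel_measurable_power mat_borel_entry[OF X]) auto
  also have "?this \<longleftrightarrow> ?thesis"
    unfolding frob_sq_def by (intro measurable_cong) (simp add: mat_borel_dims[OF X])
  finally show ?thesis .
qed

section \<open>Vertical stacking of matrices\<close>

definition vcat :: "real mat \<Rightarrow> real mat \<Rightarrow> real mat" where
  "vcat X Y = mat (dim_row X + dim_row Y) (dim_col X)
     (\<lambda>(i, j). if i < dim_row X then X $$ (i, j) else Y $$ (i - dim_row X, j))"

lemma vcat_carrier [simp]:
  "dim_row (vcat X Y) = dim_row X + dim_row Y" "dim_col (vcat X Y) = dim_col X"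
  by (auto simp: vcat_def)

lemma vcat_index:
  "i < dim_row X + dim_row Y \<Longrightarrow> j < dim_col X \<Longrightarrow>
    vcat X Y $$ (i, j) = (if i < dim_row X then X $$ (i, j) else Y $$ (i - dim_row X, j))"
  by (simp add: vcat_def)

lemma mat_borel_vcat:
  assumes X: "X \<in> measurable N (mat_borel r1 c)" and Y: "Y \<in> measurable N (mat_borel r2 c)"
  shows "(\<lambda>\<omega>. vcat (X \<omega>) (Y \<omega>)) \<in> measurable N (mat_borel (r1 + r2) c)"
proof (rule mat_borelI)
  fix i j assume ij: "i < r1 + r2" "j < c"
  have "(\<lambda>\<omega>. if i < r1 then X \<omega> $$ (i, j) else Y \<omega> $$ (i - r1, j)) \<in> borel_measurable N"
    using ij mat_borel_entry[OF X] mat_borel_entry[OF Y] by (cases "i < r1") auto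
  also have "?this \<longleftrightarrow> (\<lambda>\<omega>. vcat (X \<omega>) (Y \<omega>) $$ (i, j)) \<in> borel_measurable N"
    using ij by (intro measurable_cong) (simp add: mat_borel_dims[OF X] mat_borel_dims[OF Y] vcat_index)
  finally show "(\<lambda>\<omega>. vcat (X \<omega>) (Y \<omega>) $$ (i, j)) \<in> borel_measurable N" .
qed (intro carrier_matI; simp add: mat_borel_dims[OF X] mat_borel_dims[OF Y])

section \<open>The Gaussian law on matrices and its behaviour under transposition and
  stacking\<close>

interpretation std_normal: prob_space std_normal_distribution
  by (rule prob_space_normal_density) simp

interpretation normal_prod: product_sigma_finite "\<lambda>_. std_normal_distribution"
  by unfold_locales

text \<open>The law of a standard Gaussian matrix, as the image of a product measure. All moments
  are computed for these laws, independently of the probability space on which the random matrices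
  live.\<close>

definition gauss_mat :: "nat \<Rightarrow> nat \<Rightarrow> real mat measure" where
  "gauss_mat r c = distr (PiM ({..<r} \<times> {..<c}) (\<lambda>_. std_normal_distribution)) (mat_borel r c) (mat r c)"

lemma measurable_mat [measurable]:
  "mat r c \<in> measurable (PiM ({..<r} \<times> {..<c}) (\<lambda>_. std_normal_distribution)) (mat_borel r c)"
proof (rule mat_borelI)
  fix i j assume "i < r" "j < c"
  then show "(\<lambda>\<omega>. mat r c \<omega> $$ (i, j))
      \<in> borel_measurable (PiM ({..<r} \<times> {..<c}) (\<lambda>_. std_normal_distribution))"
    using measurable_component_singleton[of "(i, j)" "{..<r} \<times> {..<c}" "\<lambda>_. std_normal_distribution"]
    by (simp add: measurable_cong_sets[OF refl, of std_normal_distribution borel])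
qed auto

lemma sets_gauss_mat [measurable_cong, simp]: "sets (gauss_mat r c) = sets (mat_borel r c)"
  and space_gauss_mat [simp]: "space (gauss_mat r c) = carrier_mat r c"
  unfolding gauss_mat_def by auto

lemma measurable_ident_gauss_mat: "(\<lambda>X. X) \<in> measurable (gauss_mat r c) (mat_borel r c)"
  by (simp add: measurable_ident_sets)

lemma prob_space_gauss_mat: "prob_space (gauss_mat r c)"
  unfolding gauss_mat_def
  by (intro prob_space.prob_space_distr prob_space_PiM measurable_mat std_normal.prob_space_axioms)

lemma nn_integral_gauss_mat:
  "f \<in> borel_measurable (mat_borel r c) \<Longrightarrow>
   (\<integral>\<^sup>+X. f X \<partial>gauss_mat r c) = (\<integral>\<^sup>+x. f (mat r c x) \<partial>PiM ({..<r} \<times> {..<c}) (\<lambda>_. std_normal_distribution))"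
  unfolding gauss_mat_def by (rule nn_integral_distr[OF measurable_mat]) simp

lemma emeasure_PiM_normal:
  "finite I \<Longrightarrow> (\<And>i. i \<in> I \<Longrightarrow> A i \<in> sets borel) \<Longrightarrow>
    emeasure (PiM I (\<lambda>_. std_normal_distribution)) (Pi\<^sub>E I A) = (\<Prod>i\<in>I. emeasure std_normal_distribution (A i))"
  by (rule normal_prod.emeasure_PiM) auto

lemma sets_mat_box:
  assumes "\<And>p. A p \<in> sets borel"
  shows "{X \<in> carrier_mat r c. \<forall>p\<in>{..<r} \<times> {..<c}. X $$ p \<in> A p} \<in> sets (mat_borel r c)"
proof -
  have "{X \<in> carrier_mat r c. \<forall>p\<in>{..<r} \<times> {..<c}. X $$ p \<in> A p}
     = (\<lambda>A. \<lambda>p\<in>{..<r} \<times> {..<c}. A $$ p) -` Pi\<^sub>E ({..<r} \<times> {..<c}) A \<inter> space (mat_borel r c)"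
    by (rule Set.set_eqI) (simp add: PiE_iff, blast)
  also have "\<dots> \<in> sets (mat_borel r c)"
    using assms by (intro measurable_sets[OF measurable_mat_entries] sets_PiM_I_finite) auto
  finally show ?thesis .
qed

lemma gauss_mat_box:
  assumes "\<And>p. A p \<in> sets borel"
  shows "emeasure (gauss_mat r c) {X \<in> carrier_mat r c. \<forall>p\<in>{..<r} \<times> {..<c}. X $$ p \<in> A p}
    = (\<Prod>p\<in>{..<r} \<times> {..<c}. emeasure std_normal_distribution (A p))"
proof -
  have "mat r c -` {X \<in> carrier_mat r c. \<forall>p\<in>{..<r} \<times> {..<c}. X $$ p \<in> A p}
      \<inter> space (PiM ({..<r} \<times> {..<c}) (\<lambda>_. std_normal_distribution)) = Pi\<^sub>E ({..<r} \<times> {..<c}) A"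
    by (auto simp: space_PiM PiE_iff)
  then show ?thesis
    unfolding gauss_mat_def using assms sets_mat_box[of A r c]
    by (subst emeasure_distr[OF measurable_mat]) (auto intro!: emeasure_PiM_normal)
qed

text \<open>Reading off the entries and assembling them again is the identity on matrices, so a law
  on matrices is determined by the joint law of the entries.\<close>

lemma distr_entries_mat:
  assumes sets: "sets P = sets (mat_borel r c)"
  shows "P = distr (distr P (PiM ({..<r} \<times> {..<c}) (\<lambda>_. std_normal_distribution))
        (\<lambda>X. \<lambda>p\<in>{..<r} \<times> {..<c}. X $$ p)) (mat_borel r c) (mat r c)"
proof -
  have m: "(\<lambda>X. \<lambda>p\<in>{..<r} \<times> {..<c}. X $$ p) \<in> measurable P (PiM ({..<r} \<times> {..<c}) (\<lambda>_. std_normal_distribution))"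
    using measurable_mat_entries[of r c]
      measurable_cong_sets[OF sets sets_PiM_cong[OF refl, of _ "\<lambda>_. std_normal_distribution" "\<lambda>_. borel"]] by auto
  have sp: "space P = carrier_mat r c" using sets_eq_imp_space_eq[OF sets] by simp
  have "distr (distr P (PiM ({..<r} \<times> {..<c}) (\<lambda>_. std_normal_distribution))
        (\<lambda>X. \<lambda>p\<in>{..<r} \<times> {..<c}. X $$ p)) (mat_borel r c) (mat r c)
     = distr P (mat_borel r c) (mat r c \<circ> (\<lambda>X. \<lambda>p\<in>{..<r} \<times> {..<c}. X $$ p))"
    by (rule distr_distr[OF measurable_mat m])
  also have "\<dots> = distr P P (\<lambda>X. X)"
    using sets by (intro distr_cong) (auto simp: sp)
  finally show ?thesis by (simp add: distr_id2)
qed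

text \<open>Boxes are stable under intersection and generate the sigma-algebra. Every identification
  of a Gaussian law by its entries goes through this criterion.\<close>

lemma gauss_mat_eqI:
  assumes sets: "sets P = sets (mat_borel r c)"
    and box: "\<And>A. (\<And>p. A p \<in> sets borel) \<Longrightarrow>
      emeasure P {X \<in> carrier_mat r c. \<forall>p\<in>{..<r} \<times> {..<c}. X $$ p \<in> A p}
      = (\<Prod>p\<in>{..<r} \<times> {..<c}. emeasure std_normal_distribution (A p))"
  shows "P = gauss_mat r c"
proof -
  let ?I = "{..<r} \<times> {..<c}"
  let ?e = "\<lambda>X. \<lambda>p\<in>?I. X $$ p"
  have m: "?e \<in> measurable P (PiM ?I (\<lambda>_. std_normal_distribution))"
    using measurable_mat_entries[of r c]
      measurable_cong_sets[OF sets sets_PiM_cong[OF refl, of _ "\<lambda>_. std_normal_distribution" "\<lambda>_. borel"]] by auto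
  have sp: "space P = carrier_mat r c" using sets_eq_imp_space_eq[OF sets] by simp
  have "distr P (PiM ?I (\<lambda>_. std_normal_distribution)) ?e = PiM ?I (\<lambda>_. std_normal_distribution)"
  proof (rule normal_prod.PiM_eqI)
    fix A assume A: "\<And>i. i \<in> ?I \<Longrightarrow> A i \<in> sets std_normal_distribution"
    \<comment> \<open>The hypothesis \<open>box\<close> wants Borel sets at every index, while
      \<open>A\<close> is only known to be Borel on the index set; outside it is replaced by the
      empty set.\<close>
    define A' where "A' = (\<lambda>p. if p \<in> ?I then A p else {})"
    have A': "A' p \<in> sets borel" for p using A by (auto simp: A'_def)
    have "emeasure (distr P (PiM ?I (\<lambda>_. std_normal_distribution)) ?e) (Pi\<^sub>E ?I A)
      = emeasure P (?e -` Pi\<^sub>E ?I A \<inter> space P)"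
      using A by (intro emeasure_distr[OF m] sets_PiM_I_finite) auto
    also have "?e -` Pi\<^sub>E ?I A \<inter> space P = {X \<in> carrier_mat r c. \<forall>p\<in>?I. X $$ p \<in> A' p}"
      by (rule Set.set_eqI) (auto simp add: sp PiE_iff A'_def)
    also have "emeasure P \<dots> = (\<Prod>p\<in>?I. emeasure std_normal_distribution (A' p))"
      by (rule box[OF A'])
    also have "\<dots> = (\<Prod>p\<in>?I. emeasure std_normal_distribution (A p))"
      by (intro prod.cong) (auto simp: A'_def)
    finally show "emeasure (distr P (PiM ?I (\<lambda>_. std_normal_distribution)) ?e) (Pi\<^sub>E ?I A)
      = (\<Prod>p\<in>?I. emeasure std_normal_distribution (A p))" .
  qed auto
  then show ?thesis using distr_entries_mat[OF sets] unfolding gauss_mat_def by simp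
qed

lemma distr_std_gaussian_mat:
  assumes "prob_space M" "std_gaussian_mat M r c X" "0 < r" "0 < c"
  shows "distr M (mat_borel r c) X = gauss_mat r c"
proof -
  interpret prob_space M by fact
  let ?I = "{..<r} \<times> {..<c}"
  have X: "X \<in> measurable M (mat_borel r c)"
    and ind: "indep_vars (\<lambda>_. borel) (\<lambda>p \<omega>. X \<omega> $$ p) ?I"
    and dist: "\<And>p. p \<in> ?I \<Longrightarrow> distributed M lborel (\<lambda>\<omega>. X \<omega> $$ p) (\<lambda>x. ennreal (std_normal_density x))"
    using assms(2) unfolding std_gaussian_mat_def by auto
  have d: "distr M borel (\<lambda>\<omega>. X \<omega> $$ p) = std_normal_distribution" if "p \<in> ?I" for p
    using distributed_distr_eq_density[OF dist[OF that]]
      distr_cong[OF refl sets_lborel refl, of M "\<lambda>\<omega>. X \<omega> $$ p"] by simp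
  show ?thesis
  proof (rule gauss_mat_eqI)
    fix A :: "nat \<times> nat \<Rightarrow> real set" assume A: "\<And>p. A p \<in> sets borel"
    have "emeasure (distr M (mat_borel r c) X) {X \<in> carrier_mat r c. \<forall>p\<in>?I. X $$ p \<in> A p}
      = emeasure M (X -` {X \<in> carrier_mat r c. \<forall>p\<in>?I. X $$ p \<in> A p} \<inter> space M)"
      by (intro emeasure_distr X sets_mat_box A)
    also have "X -` {X \<in> carrier_mat r c. \<forall>p\<in>?I. X $$ p \<in> A p} \<inter> space M
      = (\<Inter>p\<in>?I. (\<lambda>\<omega>. X \<omega> $$ p) -` A p \<inter> space M)"
      (is "?L = ?R")
    proof (intro Set.set_eqI iffI)
      fix \<omega> assume "\<omega> \<in> ?L" then show "\<omega> \<in> ?R" by auto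
    next
      fix \<omega> assume R: "\<omega> \<in> ?R"
      \<comment> \<open>Membership in \<open>space M\<close> is read off one factor of the
        intersection. For an empty index set the intersection would be the whole type, hence the
        positive dimensions.\<close>
      have "\<omega> \<in> space M" using INT_D[OF R, of "(0, 0)"] assms(3,4) by simp
      moreover have "X \<omega> $$ p \<in> A p" if "p \<in> ?I" for p using INT_D[OF R that] by simp
      ultimately show "\<omega> \<in> ?L" using mat_borel_carrier[OF X] by simp
    qed
    also have "emeasure M \<dots> = ennreal (\<Prod>p\<in>?I. prob ((\<lambda>\<omega>. X \<omega> $$ p) -` A p \<inter> space M))"
      unfolding emeasure_eq_measure
      using assms(3,4) A by (subst indep_varsD[OF ind, of ?I A]) auto
    also have "\<dots> = (\<Prod>p\<in>?I. emeasure M ((\<lambda>\<omega>. X \<omega> $$ p) -` A p \<inter> space M))"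
      by (simp add: prod_ennreal emeasure_eq_measure)
    also have "\<dots> = (\<Prod>p\<in>?I. emeasure (distr M borel (\<lambda>\<omega>. X \<omega> $$ p)) (A p))"
      using A X by (intro prod.cong refl emeasure_distr[symmetric]) (auto intro: mat_borel_entry)
    also have "\<dots> = (\<Prod>p\<in>?I. emeasure std_normal_distribution (A p))"
      by (intro prod.cong refl) (simp add: d)
    finally show "emeasure (distr M (mat_borel r c) X) {X \<in> carrier_mat r c. \<forall>p\<in>?I. X $$ p \<in> A p}
      = (\<Prod>p\<in>?I. emeasure std_normal_distribution (A p))" .
  qed auto
qed

lemma distr_gauss_mat_transpose: "distr (gauss_mat c r) (mat_borel r c) transpose_mat = gauss_mat r c"
proof (rule gauss_mat_eqI)
  fix A :: "nat \<times> nat \<Rightarrow> real set" assume A: "\<And>p. A p \<in> sets borel"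
  have m: "transpose_mat \<in> measurable (gauss_mat c r) (mat_borel r c)"
    using mat_borel_transpose[OF measurable_ident_gauss_mat] .
  have "emeasure (distr (gauss_mat c r) (mat_borel r c) transpose_mat) {X \<in> carrier_mat r c. \<forall>p\<in>{..<r} \<times> {..<c}. X $$ p \<in> A p}
    = emeasure (gauss_mat c r) (transpose_mat -` {X \<in> carrier_mat r c. \<forall>p\<in>{..<r} \<times> {..<c}. X $$ p \<in> A p} \<inter> space (gauss_mat c r))"
    by (intro emeasure_distr m sets_mat_box A)
  also have "transpose_mat -` {X \<in> carrier_mat r c. \<forall>p\<in>{..<r} \<times> {..<c}. X $$ p \<in> A p} \<inter> space (gauss_mat c r)
     = {X \<in> carrier_mat c r. \<forall>p\<in>{..<c} \<times> {..<r}. X $$ p \<in> A (prod.swap p)}"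
    by auto
  also have "emeasure (gauss_mat c r) \<dots> = (\<Prod>p\<in>{..<c} \<times> {..<r}. emeasure std_normal_distribution (A (prod.swap p)))"
    by (rule gauss_mat_box) (rule A)
  also have "\<dots> = (\<Prod>p\<in>{..<r} \<times> {..<c}. emeasure std_normal_distribution (A p))"
    by (rule prod.reindex_bij_witness[of _ prod.swap prod.swap]) auto
  finally show "emeasure (distr (gauss_mat c r) (mat_borel r c) transpose_mat) {X \<in> carrier_mat r c. \<forall>p\<in>{..<r} \<times> {..<c}. X $$ p \<in> A p}
    = (\<Prod>p\<in>{..<r} \<times> {..<c}. emeasure std_normal_distribution (A p))" .
qed simp

text \<open>Stacking splits rows and rotation acts from the left; transposing makes both available
  for columns.\<close>

lemma nn_integral_gauss_mat_transpose:
  assumes "f \<in> borel_measurable (mat_borel r c)"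
  shows "(\<integral>\<^sup>+X. f (X\<^sup>T) \<partial>gauss_mat c r) = (\<integral>\<^sup>+X. f X \<partial>gauss_mat r c)"
proof -
  have m: "transpose_mat \<in> measurable (gauss_mat c r) (mat_borel r c)"
    using mat_borel_transpose[OF measurable_ident_gauss_mat] .
  show ?thesis
    by (subst distr_gauss_mat_transpose[symmetric], subst nn_integral_distr[OF m]) (use assms in auto)
qed

text \<open>A box of stacked matrices is the product of two boxes, the row indices of the second
  shifted by \<open>r1\<close>, and the product over all entries splits accordingly.\<close>

lemma distr_gauss_mat_vcat:
  "distr (gauss_mat r1 c \<Otimes>\<^sub>M gauss_mat r2 c) (mat_borel (r1 + r2) c) (\<lambda>(X, Y). vcat X Y) = gauss_mat (r1 + r2) c"
proof (rule gauss_mat_eqI)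
  fix A :: "nat \<times> nat \<Rightarrow> real set" assume A: "\<And>p. A p \<in> sets borel"
  interpret G2: prob_space "gauss_mat r2 c" by (rule prob_space_gauss_mat)
  let ?P = "gauss_mat r1 c \<Otimes>\<^sub>M gauss_mat r2 c"
  let ?A2 = "\<lambda>p. A (fst p + r1, snd p)"
  have m: "(\<lambda>(X, Y). vcat X Y) \<in> measurable ?P (mat_borel (r1 + r2) c)"
    unfolding case_prod_unfold by (rule mat_borel_vcat) (auto intro: measurable_fst'' measurable_snd'')
  have "emeasure (distr ?P (mat_borel (r1 + r2) c) (\<lambda>(X, Y). vcat X Y))
      {X \<in> carrier_mat (r1 + r2) c. \<forall>p\<in>{..<r1 + r2} \<times> {..<c}. X $$ p \<in> A p}
    = emeasure ?P ((\<lambda>(X, Y). vcat X Y) -` {X \<in> carrier_mat (r1 + r2) c. \<forall>p\<in>{..<r1 + r2} \<times> {..<c}. X $$ p \<in> A p} \<inter> space ?P)"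
    by (intro emeasure_distr m sets_mat_box A)
  also have "(\<lambda>(X, Y). vcat X Y) -` {X \<in> carrier_mat (r1 + r2) c. \<forall>p\<in>{..<r1 + r2} \<times> {..<c}. X $$ p \<in> A p} \<inter> space ?P
     = {X \<in> carrier_mat r1 c. \<forall>p\<in>{..<r1} \<times> {..<c}. X $$ p \<in> A p} \<times>
       {X \<in> carrier_mat r2 c. \<forall>p\<in>{..<r2} \<times> {..<c}. X $$ p \<in> ?A2 p}" (is "?L = ?R")
  proof (intro Set.set_eqI iffI)
    fix z assume z: "z \<in> ?L"
    then obtain X Y where zz: "z = (X, Y)" "X \<in> carrier_mat r1 c" "Y \<in> carrier_mat r2 c"
      and v: "\<And>i j. i < r1 + r2 \<Longrightarrow> j < c \<Longrightarrow> vcat X Y $$ (i, j) \<in> A (i, j)"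
      by (auto simp: space_pair_measure)
    have "X $$ (i, j) \<in> A (i, j)" if "i < r1" "j < c" for i j
      using v[of i j] that zz by (auto simp: vcat_index)
    moreover have "Y $$ (i, j) \<in> A (i + r1, j)" if "i < r2" "j < c" for i j
      using v[of "i + r1" j] that zz by (auto simp: vcat_index)
    ultimately show "z \<in> ?R" using zz by auto
  next
    fix z assume z: "z \<in> ?R"
    then obtain X Y where zz: "z = (X, Y)" "X \<in> carrier_mat r1 c" "Y \<in> carrier_mat r2 c"
      and v: "\<And>i j. i < r1 \<Longrightarrow> j < c \<Longrightarrow> X $$ (i, j) \<in> A (i, j)"
        "\<And>i j. i < r2 \<Longrightarrow> j < c \<Longrightarrow> Y $$ (i, j) \<in> A (i + r1, j)"
      by auto
    have "vcat X Y $$ (i, j) \<in> A (i, j)" if "i < r1 + r2" "j < c" for i j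
      using v(1)[of i j] v(2)[of "i - r1" j] that zz by (auto simp: vcat_index)
    then show "z \<in> ?L" using zz by (auto simp: space_pair_measure)
  qed
  also have "emeasure ?P \<dots> = (\<Prod>p\<in>{..<r1} \<times> {..<c}. emeasure std_normal_distribution (A p)) *
      (\<Prod>p\<in>{..<r2} \<times> {..<c}. emeasure std_normal_distribution (?A2 p))"
    by (subst G2.emeasure_pair_measure_Times)
      (use A in \<open>simp_all only: sets_gauss_mat sets_mat_box gauss_mat_box\<close>)
  also have "(\<Prod>p\<in>{..<r2} \<times> {..<c}. emeasure std_normal_distribution (?A2 p))
     = (\<Prod>p\<in>{r1..<r1 + r2} \<times> {..<c}. emeasure std_normal_distribution (A p))"
    by (rule prod.reindex_bij_witness[of _ "\<lambda>p. (fst p - r1, snd p)" "\<lambda>p. (fst p + r1, snd p)"]) auto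
  also have "(\<Prod>p\<in>{..<r1} \<times> {..<c}. emeasure std_normal_distribution (A p)) * \<dots>
     = (\<Prod>p\<in>{..<r1} \<times> {..<c} \<union> {r1..<r1 + r2} \<times> {..<c}. emeasure std_normal_distribution (A p))"
    by (intro prod.union_disjoint[symmetric]) auto
  also have "{..<r1} \<times> {..<c} \<union> {r1..<r1 + r2} \<times> {..<c} = {..<r1 + r2} \<times> {..<c}" by auto
  finally show "emeasure (distr ?P (mat_borel (r1 + r2) c) (\<lambda>(X, Y). vcat X Y))
      {X \<in> carrier_mat (r1 + r2) c. \<forall>p\<in>{..<r1 + r2} \<times> {..<c}. X $$ p \<in> A p}
    = (\<Prod>p\<in>{..<r1 + r2} \<times> {..<c}. emeasure std_normal_distribution (A p))" .
qed simp

text \<open>This takes the place of conditional expectation: the upper rows are held fixed while the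
  lower ones are averaged.\<close>

lemma nn_integral_gauss_mat_vcat:
  assumes f: "f \<in> borel_measurable (mat_borel (r1 + r2) c)"
  shows "(\<integral>\<^sup>+X. f X \<partial>gauss_mat (r1 + r2) c) = (\<integral>\<^sup>+X. \<integral>\<^sup>+Y. f (vcat X Y) \<partial>gauss_mat r2 c \<partial>gauss_mat r1 c)"
proof -
  interpret G2: prob_space "gauss_mat r2 c" by (rule prob_space_gauss_mat)
  let ?P = "gauss_mat r1 c \<Otimes>\<^sub>M gauss_mat r2 c"
  have m: "(\<lambda>(X, Y). vcat X Y) \<in> measurable ?P (mat_borel (r1 + r2) c)"
    unfolding case_prod_unfold by (rule mat_borel_vcat) (auto intro: measurable_fst'' measurable_snd'')
  have "(\<integral>\<^sup>+X. f X \<partial>gauss_mat (r1 + r2) c) = (\<integral>\<^sup>+z. f ((\<lambda>(X, Y). vcat X Y) z) \<partial>?P)"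
    by (subst distr_gauss_mat_vcat[symmetric], subst nn_integral_distr[OF m]) (use f in auto)
  also have "\<dots> = (\<integral>\<^sup>+X. \<integral>\<^sup>+Y. f (vcat X Y) \<partial>gauss_mat r2 c \<partial>gauss_mat r1 c)"
    using measurable_compose[OF m f] by (subst G2.nn_integral_fst[symmetric]) auto
  finally show ?thesis .
qed

section \<open>Rotation invariance\<close>

lemma nn_integral_std_normal:
  "f \<in> borel_measurable borel \<Longrightarrow>
   (\<integral>\<^sup>+x. f x \<partial>std_normal_distribution) = (\<integral>\<^sup>+x. ennreal (std_normal_density x) * f x \<partial>lborel)"
  by (subst nn_integral_density) auto

lemma nn_integral_std_normal2:
  assumes [measurable]: "F \<in> borel_measurable (borel \<Otimes>\<^sub>M borel)"
  shows "(\<integral>\<^sup>+x. \<integral>\<^sup>+y. F (x, y) \<partial>std_normal_distribution \<partial>std_normal_distribution)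
    = (\<integral>\<^sup>+x. \<integral>\<^sup>+y. ennreal (std_normal_density x * std_normal_density y) * F (x, y) \<partial>lborel \<partial>lborel)"
proof -
  have m: "(\<lambda>x. \<integral>\<^sup>+y. F (x, y) \<partial>std_normal_distribution) \<in> borel_measurable borel"
    by (intro std_normal.borel_measurable_nn_integral) (simp cong: measurable_cong_sets sets_pair_measure_cong)
  have "(\<integral>\<^sup>+x. \<integral>\<^sup>+y. F (x, y) \<partial>std_normal_distribution \<partial>std_normal_distribution)
    = (\<integral>\<^sup>+x. ennreal (std_normal_density x) * (\<integral>\<^sup>+y. F (x, y) \<partial>std_normal_distribution) \<partial>lborel)"
    by (rule nn_integral_std_normal[OF m])
  also have "\<dots> = (\<integral>\<^sup>+x. ennreal (std_normal_density x) * (\<integral>\<^sup>+y. ennreal (std_normal_density y) * F (x, y) \<partial>lborel) \<partial>lborel)"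
    by (subst nn_integral_std_normal) auto
  also have "\<dots> = (\<integral>\<^sup>+x. \<integral>\<^sup>+y. ennreal (std_normal_density x * std_normal_density y) * F (x, y) \<partial>lborel \<partial>lborel)"
    by (subst nn_integral_cmult[symmetric]) (auto simp: ennreal_mult' mult.assoc)
  finally show ?thesis .
qed

lemma std_normal_density_rotate:
  fixes a b :: real
  assumes "a\<^sup>2 + b\<^sup>2 = 1"
  shows "std_normal_density (a * u + b * v) * std_normal_density (a * v - b * u)
    = std_normal_density u * std_normal_density v"
proof -
  have "(a * u + b * v)\<^sup>2 + (a * v - b * u)\<^sup>2 = (a\<^sup>2 + b\<^sup>2) * (u\<^sup>2 + v\<^sup>2)"
    by (simp add: power2_eq_square algebra_simps)
  then have "(a * u + b * v)\<^sup>2 + (a * v - b * u)\<^sup>2 = u\<^sup>2 + v\<^sup>2" using assms by simp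
  then have "exp (- (a * u + b * v)\<^sup>2 / 2) * exp (- (a * v - b * u)\<^sup>2 / 2) = exp (- u\<^sup>2 / 2) * exp (- v\<^sup>2 / 2)"
    unfolding mult_exp_exp by (simp add: field_simps)
  then show ?thesis by (simp add: std_normal_density_def)
qed

text \<open>A plane rotation as two one-dimensional affine substitutions: for fixed y the variable x
  is replaced by u = a x - b y, then for fixed u the variable y by v with y = - b u + a v. The
  Jacobians 1 / |a| and |a| cancel, and the product of densities depends on x^2 + y^2 only.\<close>

lemma nn_integral_std_normal_rotate:
  fixes a b :: real
  assumes [measurable]: "F \<in> borel_measurable (borel \<Otimes>\<^sub>M borel)" and ab: "a\<^sup>2 + b\<^sup>2 = 1"
  shows "(\<integral>\<^sup>+x. \<integral>\<^sup>+y. F (a * x - b * y, b * x + a * y) \<partial>std_normal_distribution \<partial>std_normal_distribution)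
    = (\<integral>\<^sup>+x. \<integral>\<^sup>+y. F (x, y) \<partial>std_normal_distribution \<partial>std_normal_distribution)"
proof -
  let ?p = std_normal_density
  have "(\<integral>\<^sup>+x. \<integral>\<^sup>+y. F (a * x - b * y, b * x + a * y) \<partial>std_normal_distribution \<partial>std_normal_distribution)
     = (\<integral>\<^sup>+x. \<integral>\<^sup>+y. ennreal (?p x * ?p y) * F (a * x - b * y, b * x + a * y) \<partial>lborel \<partial>lborel)"
    by (subst nn_integral_std_normal2[of "\<lambda>z. F (a * fst z - b * snd z, b * fst z + a * snd z)", simplified]) auto
  also have "\<dots> = (\<integral>\<^sup>+u. \<integral>\<^sup>+v. ennreal (?p u * ?p v) * F (u, v) \<partial>lborel \<partial>lborel)"
  proof (cases "a = 0")
    case False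
    have "(\<integral>\<^sup>+x. \<integral>\<^sup>+y. ennreal (?p x * ?p y) * F (a * x - b * y, b * x + a * y) \<partial>lborel \<partial>lborel)
       = (\<integral>\<^sup>+y. \<integral>\<^sup>+x. ennreal (?p x * ?p y) * F (a * x - b * y, b * x + a * y) \<partial>lborel \<partial>lborel)"
      by (rule lborel_pair.Fubini') measurable
    also have "\<dots> = (\<integral>\<^sup>+y. ennreal \<bar>1/a\<bar> * \<integral>\<^sup>+u. ennreal (?p (b * y / a + 1/a * u) * ?p y) * F (u, (b * u + y) / a) \<partial>lborel \<partial>lborel)"
    proof (rule nn_integral_cong)
      fix y
      have 1: "b * (b * y / a + 1/a * u) + a * y = (b * u + y) / a" for u
      proof -
        have "b * (b * y / a + 1/a * u) + a * y = (b * u + (a\<^sup>2 + b\<^sup>2) * y) / a"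
          using False by (simp add: field_simps power2_eq_square)
        then show ?thesis using ab by simp
      qed
      show "(\<integral>\<^sup>+x. ennreal (?p x * ?p y) * F (a * x - b * y, b * x + a * y) \<partial>lborel)
         = ennreal \<bar>1/a\<bar> * \<integral>\<^sup>+u. ennreal (?p (b * y / a + 1/a * u) * ?p y) * F (u, (b * u + y) / a) \<partial>lborel"
        using False
        by (subst nn_integral_real_affine[where c = "1/a" and t = "b * y / a"])
          (auto simp only: 1, measurable, simp_all add: distrib_left)
    qed
    also have "\<dots> = ennreal \<bar>1/a\<bar> * (\<integral>\<^sup>+y. \<integral>\<^sup>+u. ennreal (?p (b * y / a + 1/a * u) * ?p y) * F (u, (b * u + y) / a) \<partial>lborel \<partial>lborel)"
      by (rule nn_integral_cmult) measurable
    also have "\<dots> = ennreal \<bar>1/a\<bar> * (\<integral>\<^sup>+u. \<integral>\<^sup>+y. ennreal (?p (b * y / a + 1/a * u) * ?p y) * F (u, (b * u + y) / a) \<partial>lborel \<partial>lborel)"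
      by (subst lborel_pair.Fubini') (auto simp: case_prod_unfold)
    also have "\<dots> = ennreal \<bar>1/a\<bar> * (\<integral>\<^sup>+u. ennreal \<bar>a\<bar> * \<integral>\<^sup>+v. ennreal (?p u * ?p v) * F (u, v) \<partial>lborel \<partial>lborel)"
    proof (intro arg_cong2[where f = "(*)"] refl nn_integral_cong)
      fix u
      have 1: "b * (- b * u + a * v) / a + 1/a * u = a * u + b * v" for v
      proof -
        have "b * (- b * u + a * v) / a + 1/a * u = ((a\<^sup>2 + b\<^sup>2) * u - b\<^sup>2 * u) / a + b * v"
          using False ab by (simp add: field_simps power2_eq_square)
        then show ?thesis using False by (simp add: field_simps power2_eq_square)
      qed
      have 2: "(b * u + (- b * u + a * v)) / a = v" for v using False by simp
      have 3: "?p (a * u + b * v) * ?p (- b * u + a * v) = ?p u * ?p v" for v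
        using std_normal_density_rotate[OF ab, of u v] by (simp add: algebra_simps)
      show "(\<integral>\<^sup>+y. ennreal (?p (b * y / a + 1/a * u) * ?p y) * F (u, (b * u + y) / a) \<partial>lborel)
         = ennreal \<bar>a\<bar> * \<integral>\<^sup>+v. ennreal (?p u * ?p v) * F (u, v) \<partial>lborel"
        using False
        by (subst nn_integral_real_affine[where c = a and t = "- b * u"])
          (simp_all only: 1 2 3, measurable)
    qed
    also have "\<dots> = ennreal \<bar>1/a\<bar> * (ennreal \<bar>a\<bar> * (\<integral>\<^sup>+u. \<integral>\<^sup>+v. ennreal (?p u * ?p v) * F (u, v) \<partial>lborel \<partial>lborel))"
      by (subst nn_integral_cmult) auto
    also have "\<dots> = (\<integral>\<^sup>+u. \<integral>\<^sup>+v. ennreal (?p u * ?p v) * F (u, v) \<partial>lborel \<partial>lborel)"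
      unfolding mult.assoc[symmetric] using False by (simp add: ennreal_mult'[symmetric] abs_mult[symmetric])
    finally show ?thesis .
  next
    \<comment> \<open>Here b is 1 or -1, and the rotation exchanges the coordinates up to sign; the
      substitution above would divide by a = 0.\<close>
    case True
    with ab have "b\<^sup>2 = 1" by simp
    then have b: "b * b = 1" "\<bar>b\<bar> = 1" "b \<noteq> 0"
      using abs_square_eq_1[of b] by (auto simp: power2_eq_square)
    have p: "?p (b * v) = ?p v" "?p (- b * v) = ?p v" for v
      using b by (auto simp: std_normal_density_def power2_eq_square mult_ac)
    have "(\<integral>\<^sup>+x. \<integral>\<^sup>+y. ennreal (?p x * ?p y) * F (a * x - b * y, b * x + a * y) \<partial>lborel \<partial>lborel)
       = (\<integral>\<^sup>+x. \<integral>\<^sup>+u. ennreal (?p x * ?p u) * F (u, b * x) \<partial>lborel \<partial>lborel)"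
    proof (rule nn_integral_cong)
      fix x
      have 1: "a * x - b * (0 + - b * u) = u" "b * x + a * (0 + - b * u) = b * x" for u
        using True b(1) by (simp_all add: mult.assoc[symmetric])
      show "(\<integral>\<^sup>+y. ennreal (?p x * ?p y) * F (a * x - b * y, b * x + a * y) \<partial>lborel)
          = (\<integral>\<^sup>+u. ennreal (?p x * ?p u) * F (u, b * x) \<partial>lborel)"
        using b by (subst nn_integral_real_affine[where c = "- b" and t = 0])
          (simp_all only: 1, measurable, simp_all add: p[simplified])
    qed
    also have "\<dots> = (\<integral>\<^sup>+v. \<integral>\<^sup>+u. ennreal (?p v * ?p u) * F (u, v) \<partial>lborel \<partial>lborel)"
    proof -
      have 1: "b * (0 + b * v) = v" for v using b(1) by (simp add: mult.assoc[symmetric])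
      show ?thesis
        using b by (subst nn_integral_real_affine[where c = b and t = 0])
          (simp_all only: 1, measurable, simp_all add: p[simplified])
    qed
    also have "\<dots> = (\<integral>\<^sup>+u. \<integral>\<^sup>+v. ennreal (?p v * ?p u) * F (u, v) \<partial>lborel \<partial>lborel)"
      by (rule lborel_pair.Fubini') measurable
    finally show ?thesis by (simp add: mult.commute)
  qed
  also have "\<dots> = (\<integral>\<^sup>+x. \<integral>\<^sup>+y. F (x, y) \<partial>std_normal_distribution \<partial>std_normal_distribution)"
    by (rule nn_integral_std_normal2[symmetric]) measurable
  finally show ?thesis .
qed

lemma nn_integral_std_normal_uminus:
  assumes [measurable]: "f \<in> borel_measurable borel"
  shows "(\<integral>\<^sup>+x. f (- x) \<partial>std_normal_distribution) = (\<integral>\<^sup>+x. f x \<partial>std_normal_distribution)"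
proof -
  have "(\<integral>\<^sup>+x. f x \<partial>std_normal_distribution) = (\<integral>\<^sup>+x. ennreal (std_normal_density x) * f x \<partial>lborel)"
    by (rule nn_integral_std_normal) measurable
  also have "\<dots> = (\<integral>\<^sup>+x. ennreal (std_normal_density x) * f (- x) \<partial>lborel)"
    by (subst nn_integral_real_affine[where c = "-1" and t = 0]) (auto simp: std_normal_density_def)
  also have "\<dots> = (\<integral>\<^sup>+x. f (- x) \<partial>std_normal_distribution)"
    by (rule nn_integral_std_normal[symmetric]) measurable
  finally show ?thesis by simp
qed

section \<open>Coordinate maps preserving the product normal law\<close>

abbreviation "normal_PiM I \<equiv> PiM I (\<lambda>_. std_normal_distribution)"

text \<open>Preservation is formulated for families of reals rather than matrices, because an
  elementary rotation is then a function update of two coordinates.\<close>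

definition normal_pres :: "'i set \<Rightarrow> (('i \<Rightarrow> real) \<Rightarrow> 'i \<Rightarrow> real) \<Rightarrow> bool" where
  "normal_pres I g \<longleftrightarrow> g \<in> measurable (normal_PiM I) (normal_PiM I) \<and>
     distr (normal_PiM I) (normal_PiM I) g = normal_PiM I"

lemma normal_presI:
  assumes g: "g \<in> measurable (normal_PiM I) (normal_PiM I)"
    and eq: "\<And>f. f \<in> borel_measurable (normal_PiM I) \<Longrightarrow>
      (\<integral>\<^sup>+x. f (g x) \<partial>normal_PiM I) = (\<integral>\<^sup>+x. f x \<partial>normal_PiM I)"
  shows "normal_pres I g"
  unfolding normal_pres_def
proof (intro conjI g measure_eqI)
  fix A assume "A \<in> sets (distr (normal_PiM I) (normal_PiM I) g)"
  then have A: "A \<in> sets (normal_PiM I)" by simp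
  have "emeasure (distr (normal_PiM I) (normal_PiM I) g) A = (\<integral>\<^sup>+x. indicator A x \<partial>distr (normal_PiM I) (normal_PiM I) g)"
    using A by simp
  also have "\<dots> = (\<integral>\<^sup>+x. indicator A (g x) \<partial>normal_PiM I)"
    using A by (intro nn_integral_distr[OF g]) auto
  also have "\<dots> = (\<integral>\<^sup>+x. indicator A x \<partial>normal_PiM I)" using A by (intro eq) auto
  finally show "emeasure (distr (normal_PiM I) (normal_PiM I) g) A = emeasure (normal_PiM I) A"
    using A by simp
qed simp

lemma normal_pres_comp:
  assumes "normal_pres I g" "normal_pres I h"
  shows "normal_pres I (\<lambda>x. g (h x))"
  using assms distr_distr[of g "normal_PiM I" "normal_PiM I" h "normal_PiM I"]
    measurable_compose[of h "normal_PiM I" "normal_PiM I" g "normal_PiM I"]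
  unfolding normal_pres_def by (simp add: comp_def)

lemma normal_pres_id: "normal_pres I (\<lambda>x. x)"
  unfolding normal_pres_def by (simp add: distr_id)

text \<open>The two coordinates involved are integrated innermost, with all others fixed; the claim
  becomes the planar one.\<close>

lemma normal_pres_rotate:
  fixes a b :: real and I :: "'a set"
  assumes I: "finite I" "p \<in> I" "q \<in> I" "p \<noteq> q" and ab: "a\<^sup>2 + b\<^sup>2 = 1"
  shows "normal_pres I (\<lambda>x. x(p := a * x p - b * x q, q := b * x p + a * x q))"
proof (rule normal_presI)
  let ?g = "\<lambda>x :: _ \<Rightarrow> real. x(p := a * x p - b * x q, q := b * x p + a * x q)"
  have cm: "(\<lambda>x. x i) \<in> borel_measurable (normal_PiM I)" if "i \<in> I" for i
    using measurable_component_singleton[OF that, of "\<lambda>_. std_normal_distribution"] by (simp cong: measurable_cong_sets)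
  have sm: "f \<in> measurable N std_normal_distribution" if "f \<in> borel_measurable N" for f :: "_ \<Rightarrow> real" and N :: "('a \<Rightarrow> real) measure"
    using that by (simp cong: measurable_cong_sets)
  show g: "?g \<in> measurable (normal_PiM I) (normal_PiM I)"
    by (rule measurable_fun_upd[where J = I], use I in force, rule measurable_fun_upd[where J = I], use I in force)
      (auto intro!: sm borel_measurable_diff borel_measurable_add borel_measurable_times cm I)
  fix f :: "('a \<Rightarrow> real) \<Rightarrow> ennreal" assume f: "f \<in> borel_measurable (normal_PiM I)"
  define J where "J = I - {p, q}"
  have J: "finite J" "p \<notin> insert q J" "q \<notin> J" "I = insert p (insert q J)" using I by (auto simp: J_def)
  have fg: "(\<lambda>x. f (?g x)) \<in> borel_measurable (normal_PiM I)" using measurable_compose[OF g f] .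
  have split: "(\<integral>\<^sup>+x. h x \<partial>normal_PiM I)
     = (\<integral>\<^sup>+x. \<integral>\<^sup>+v. \<integral>\<^sup>+u. h (x(q := v, p := u)) \<partial>std_normal_distribution \<partial>std_normal_distribution \<partial>normal_PiM J)"
    if h: "h \<in> borel_measurable (normal_PiM I)" for h :: "_ \<Rightarrow> ennreal"
  proof -
    have h': "h \<in> borel_measurable (normal_PiM (insert p (insert q J)))" using h J by simp
    have "(\<lambda>w. h ((fst w)(p := snd w))) \<in> borel_measurable (normal_PiM (insert q J) \<Otimes>\<^sub>M std_normal_distribution)"
      using measurable_compose[OF measurable_add_dim h'] by (simp add: case_prod_unfold)
    then have m: "(\<lambda>x. \<integral>\<^sup>+u. h (x(p := u)) \<partial>std_normal_distribution) \<in> borel_measurable (normal_PiM (insert q J))"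
      by (intro std_normal.borel_measurable_nn_integral) (simp add: case_prod_unfold)
    have "(\<integral>\<^sup>+x. h x \<partial>normal_PiM I) = (\<integral>\<^sup>+x. \<integral>\<^sup>+u. h (x(p := u)) \<partial>std_normal_distribution \<partial>normal_PiM (insert q J))"
      using J normal_prod.product_nn_integral_insert[OF _ _ h'] by simp
    also have "\<dots> = (\<integral>\<^sup>+x. \<integral>\<^sup>+v. \<integral>\<^sup>+u. h (x(q := v, p := u)) \<partial>std_normal_distribution \<partial>std_normal_distribution \<partial>normal_PiM J)"
      using J by (subst normal_prod.product_nn_integral_insert[OF _ _ m]) auto
    finally show ?thesis .
  qed
  show "(\<integral>\<^sup>+x. f (?g x) \<partial>normal_PiM I) = (\<integral>\<^sup>+x. f x \<partial>normal_PiM I)"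
    unfolding split[OF fg] split[OF f]
  proof (rule nn_integral_cong)
    fix x assume x: "x \<in> space (normal_PiM J)"
    define F where "F = (\<lambda>z. f (x(q := fst z, p := snd z)))"
    have F: "F \<in> borel_measurable (borel \<Otimes>\<^sub>M borel)"
    proof -
      have "(\<lambda>z. x(q := fst z, p := snd z)) \<in> measurable (borel \<Otimes>\<^sub>M borel) (normal_PiM I)"
      proof (rule measurable_fun_upd[where J = "insert q J"])
        show "(\<lambda>z. x(q := fst z)) \<in> measurable (borel \<Otimes>\<^sub>M borel) (normal_PiM (insert q J))"
          using x by (intro measurable_fun_upd[where J = J]) (auto simp: J cong: measurable_cong_sets)
      qed (use J in \<open>auto cong: measurable_cong_sets\<close>)
      from measurable_compose[OF this f] show ?thesis by (simp add: F_def)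
    qed
    \<comment> \<open>\<open>F\<close> lists the coordinates in the order q, p, so the rotation
      appears with \<open>- b\<close> in place of \<open>b\<close>.\<close>
    have "(\<integral>\<^sup>+v. \<integral>\<^sup>+u. f (?g (x(q := v, p := u))) \<partial>std_normal_distribution \<partial>std_normal_distribution)
      = (\<integral>\<^sup>+v. \<integral>\<^sup>+u. F (a * v - (- b) * u, (- b) * v + a * u) \<partial>std_normal_distribution \<partial>std_normal_distribution)"
      using J I by (intro nn_integral_cong) (auto simp: F_def fun_upd_twist intro!: arg_cong[of _ _ f])
    also have "\<dots> = (\<integral>\<^sup>+v. \<integral>\<^sup>+u. F (v, u) \<partial>std_normal_distribution \<partial>std_normal_distribution)"
      using ab by (intro nn_integral_std_normal_rotate[OF F]) simp
    finally show "(\<integral>\<^sup>+v. \<integral>\<^sup>+u. f (?g (x(q := v, p := u))) \<partial>std_normal_distribution \<partial>std_normal_distribution)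
      = (\<integral>\<^sup>+v. \<integral>\<^sup>+u. f (x(q := v, p := u)) \<partial>std_normal_distribution \<partial>std_normal_distribution)"
      by (simp add: F_def)
  qed
qed

lemma normal_pres_flip:
  fixes I :: "'a set"
  assumes I: "finite I" "p \<in> I"
  shows "normal_pres I (\<lambda>x. x(p := - x p))"
proof (rule normal_presI)
  let ?g = "\<lambda>x :: _ \<Rightarrow> real. x(p := - x p)"
  have cm: "(\<lambda>x. x i) \<in> borel_measurable (normal_PiM I)" if "i \<in> I" for i
    using measurable_component_singleton[OF that, of "\<lambda>_. std_normal_distribution"] by (simp cong: measurable_cong_sets)
  have sm: "f \<in> measurable N std_normal_distribution" if "f \<in> borel_measurable N" for f :: "_ \<Rightarrow> real" and N :: "('a \<Rightarrow> real) measure"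
    using that by (simp cong: measurable_cong_sets)
  show g: "?g \<in> measurable (normal_PiM I) (normal_PiM I)"
    by (rule measurable_fun_upd[where J = I], use I in force)
      (auto intro!: sm borel_measurable_uminus cm I)
  fix f :: "('a \<Rightarrow> real) \<Rightarrow> ennreal" assume f: "f \<in> borel_measurable (normal_PiM I)"
  define J where "J = I - {p}"
  have J: "finite J" "p \<notin> J" "I = insert p J" using I by (auto simp: J_def)
  have fg: "(\<lambda>x. f (?g x)) \<in> borel_measurable (normal_PiM I)" using measurable_compose[OF g f] .
  have split: "(\<integral>\<^sup>+x. h x \<partial>normal_PiM I) = (\<integral>\<^sup>+x. \<integral>\<^sup>+u. h (x(p := u)) \<partial>std_normal_distribution \<partial>normal_PiM J)"
    if h: "h \<in> borel_measurable (normal_PiM I)" for h :: "_ \<Rightarrow> ennreal"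
    using h J normal_prod.product_nn_integral_insert[of J p h] by simp
  show "(\<integral>\<^sup>+x. f (?g x) \<partial>normal_PiM I) = (\<integral>\<^sup>+x. f x \<partial>normal_PiM I)"
    unfolding split[OF fg] split[OF f]
  proof (rule nn_integral_cong)
    fix x assume x: "x \<in> space (normal_PiM J)"
    have "(\<lambda>z. x(p := z)) \<in> measurable borel (normal_PiM I)"
      using x J by (intro measurable_fun_upd[where J = J]) (auto cong: measurable_cong_sets)
    from measurable_compose[OF this f] have F: "(\<lambda>z. f (x(p := z))) \<in> borel_measurable borel" .
    show "(\<integral>\<^sup>+u. f (?g (x(p := u))) \<partial>std_normal_distribution) = (\<integral>\<^sup>+u. f (x(p := u)) \<partial>std_normal_distribution)"
      using nn_integral_std_normal_uminus[OF F] by simp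
  qed
qed

text \<open>Multiplication from the left acts on all columns of a matrix at once; it is obtained by
  letting \<open>g k\<close> act on column \<open>k\<close> for each \<open>k\<close> in
  turn.\<close>

primrec iter_maps :: "(nat \<Rightarrow> 'a \<Rightarrow> 'a) \<Rightarrow> nat \<Rightarrow> 'a \<Rightarrow> 'a" where
  "iter_maps g 0 x = x"
| "iter_maps g (Suc m) x = g m (iter_maps g m x)"

lemma normal_pres_iter:
  "(\<And>k. k < m \<Longrightarrow> normal_pres I (g k)) \<Longrightarrow> normal_pres I (iter_maps g m)"
proof (induction m)
  case 0
  have "iter_maps g 0 = (\<lambda>x. x)" by (rule ext) simp
  then show ?case by (simp add: normal_pres_id)
next
  case (Suc m)
  have "iter_maps g (Suc m) = (\<lambda>x. g m (iter_maps g m x))" by (rule ext) simp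
  then show ?case using normal_pres_comp[of I "g m" "iter_maps g m"] Suc by simp
qed

text \<open>Orthogonal matrices that preserve the Gaussian law for every number of columns. In fact
  every orthogonal matrix does (\<open>orthogonal_rot_inv\<close>); the set is named because this is
  proved by first generating enough members from plane rotations and sign changes.\<close>

definition rot_inv :: "nat \<Rightarrow> real mat set" where
  "rot_inv r = {U. U \<in> carrier_mat r r \<and> U\<^sup>T * U = 1\<^sub>m r \<and> U * U\<^sup>T = 1\<^sub>m r \<and>
     (\<forall>c. distr (gauss_mat r c) (mat_borel r c) (\<lambda>X. U * X) = gauss_mat r c)}"

lemma measurable_mult_left:
  "U \<in> carrier_mat r k \<Longrightarrow> (\<lambda>X. U * X) \<in> measurable (gauss_mat k c) (mat_borel r c)"
  by (rule mat_borel_mult[OF mat_borel_const measurable_ident_gauss_mat])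

lemma distr_gauss_mat_of_pres:
  assumes U: "U \<in> carrier_mat r r" and h: "normal_pres ({..<r} \<times> {..<c}) h"
    and eq: "\<And>x i j. i < r \<Longrightarrow> j < c \<Longrightarrow> (U * mat r c x) $$ (i, j) = h x (i, j)"
  shows "distr (gauss_mat r c) (mat_borel r c) (\<lambda>X. U * X) = gauss_mat r c"
proof -
  let ?N = "normal_PiM ({..<r} \<times> {..<c})"
  have hm: "h \<in> measurable ?N ?N" and hd: "distr ?N ?N h = ?N" using h by (auto simp: normal_pres_def)
  have m: "(\<lambda>X. U * X) \<in> measurable (mat_borel r c) (mat_borel r c)"
    using measurable_mult_left[OF U, of c] by (simp cong: measurable_cong_sets)
  have "distr (gauss_mat r c) (mat_borel r c) (\<lambda>X. U * X) = distr ?N (mat_borel r c) ((\<lambda>X. U * X) \<circ> mat r c)"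
    unfolding gauss_mat_def by (rule distr_distr[OF m measurable_mat])
  also have "(\<lambda>X. U * X) \<circ> mat r c = mat r c \<circ> h"
  proof
    fix x show "((\<lambda>X. U * X) \<circ> mat r c) x = (mat r c \<circ> h) x"
      unfolding comp_def by (rule eq_matI) (use U eq in \<open>auto simp del: index_mult_mat(1)\<close>)
  qed
  also have "distr ?N (mat_borel r c) (mat r c \<circ> h) = distr (distr ?N ?N h) (mat_borel r c) (mat r c)"
    by (rule distr_distr[OF measurable_mat hm, symmetric])
  finally show ?thesis unfolding hd gauss_mat_def .
qed

lemma rot_inv_mult:
  assumes "O1 \<in> rot_inv r" "O2 \<in> rot_inv r"
  shows "O1 * O2 \<in> rot_inv r"
proof -
  have c: "O1 \<in> carrier_mat r r" "O2 \<in> carrier_mat r r" using assms by (auto simp: rot_inv_def)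
  then have d: "dim_row O1 = r" "dim_col O1 = r" "dim_row O2 = r" "dim_col O2 = r" by auto
  have o: "O1\<^sup>T * O1 = 1\<^sub>m r" "O1 * O1\<^sup>T = 1\<^sub>m r" "O2\<^sup>T * O2 = 1\<^sub>m r" "O2 * O2\<^sup>T = 1\<^sub>m r"
    using assms by (auto simp: rot_inv_def)
  have "distr (gauss_mat r k) (mat_borel r k) (\<lambda>X. O1 * O2 * X) = gauss_mat r k" for k
  proof -
    have m: "(\<lambda>X. O1 * X) \<in> measurable (mat_borel r k) (mat_borel r k)"
      "(\<lambda>X. O2 * X) \<in> measurable (gauss_mat r k) (mat_borel r k)"
      using measurable_mult_left[OF c(1), of k] measurable_mult_left[OF c(2), of k] by (simp_all cong: measurable_cong_sets)
    have "distr (gauss_mat r k) (mat_borel r k) (\<lambda>X. O1 * O2 * X)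
        = distr (gauss_mat r k) (mat_borel r k) ((\<lambda>X. O1 * X) \<circ> (\<lambda>X. O2 * X))"
      using d by (intro distr_cong) (auto simp: mult_assoc_dim)
    also have "\<dots> = distr (distr (gauss_mat r k) (mat_borel r k) (\<lambda>X. O2 * X)) (mat_borel r k) (\<lambda>X. O1 * X)"
      by (rule distr_distr[OF m, symmetric])
    also have "\<dots> = gauss_mat r k" using assms by (simp add: rot_inv_def)
    finally show ?thesis .
  qed
  moreover have "(O1 * O2)\<^sup>T * (O1 * O2) = 1\<^sub>m r" "(O1 * O2) * (O1 * O2)\<^sup>T = 1\<^sub>m r"
    using d o mat_mult_cancel_left[OF o(1), of O2] mat_mult_cancel_left[OF o(4), of "O1\<^sup>T"] by (simp_all add: mat_ring)
  ultimately show ?thesis using c by (auto simp: rot_inv_def)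
qed

lemma rot_inv_transpose:
  assumes "U \<in> rot_inv r"
  shows "U\<^sup>T \<in> rot_inv r"
proof -
  have c: "U \<in> carrier_mat r r" and o: "U\<^sup>T * U = 1\<^sub>m r" "U * U\<^sup>T = 1\<^sub>m r" using assms by (auto simp: rot_inv_def)
  have "distr (gauss_mat r k) (mat_borel r k) (\<lambda>X. U\<^sup>T * X) = gauss_mat r k" for k
  proof -
    have m: "(\<lambda>X. U\<^sup>T * X) \<in> measurable (mat_borel r k) (mat_borel r k)"
      "(\<lambda>X. U * X) \<in> measurable (gauss_mat r k) (mat_borel r k)"
      using measurable_mult_left[of "U\<^sup>T" r r k] measurable_mult_left[OF c, of k] c by (simp_all cong: measurable_cong_sets)
    have "distr (gauss_mat r k) (mat_borel r k) (\<lambda>X. U\<^sup>T * X)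
       = distr (distr (gauss_mat r k) (mat_borel r k) (\<lambda>X. U * X)) (mat_borel r k) (\<lambda>X. U\<^sup>T * X)"
      using assms by (simp add: rot_inv_def)
    also have "\<dots> = distr (gauss_mat r k) (mat_borel r k) ((\<lambda>X. U\<^sup>T * X) \<circ> (\<lambda>X. U * X))"
      by (rule distr_distr[OF m])
    also have "\<dots> = distr (gauss_mat r k) (gauss_mat r k) (\<lambda>X. X)"
      using c by (intro distr_cong) (auto intro!: mat_mult_cancel_left[OF o(1)])
    finally show ?thesis by (simp add: distr_id2)
  qed
  then show ?thesis using c o by (auto simp: rot_inv_def)
qed

lemma rot_inv_one: "1\<^sub>m r \<in> rot_inv r"
proof -
  have "distr (gauss_mat r c) (mat_borel r c) (\<lambda>X. 1\<^sub>m r * X) = distr (gauss_mat r c) (gauss_mat r c) (\<lambda>X. X)" for c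
    by (intro distr_cong) auto
  then show ?thesis by (auto simp: rot_inv_def distr_id2)
qed

definition givens :: "nat \<Rightarrow> nat \<Rightarrow> nat \<Rightarrow> real \<Rightarrow> real \<Rightarrow> real mat" where
  "givens r p q a b = mat r r (\<lambda>(i, j). if i = p then (if j = p then a else if j = q then - b else 0)
     else if i = q then (if j = p then b else if j = q then a else 0)
     else if i = j then 1 else 0)"

lemma givens_mult:
  assumes "p < r" "q < r" "p \<noteq> q" "dim_row X = r" "i < r" "j < dim_col X"
  shows "(givens r p q a b * X) $$ (i, j) =
    (if i = p then a * X $$ (p, j) - b * X $$ (q, j)
     else if i = q then b * X $$ (p, j) + a * X $$ (q, j) else X $$ (i, j))"
proof -
  have "(givens r p q a b * X) $$ (i, j) = (\<Sum>k<r. givens r p q a b $$ (i, k) * X $$ (k, j))"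
    using assms by (subst mat_mult_index) (auto simp: givens_def)
  also have "\<dots> = (\<Sum>k<r. (if k = p then (if i = p then a else if i = q then b else 0) * X $$ (p, j) else 0)
     + (if k = q then (if i = p then - b else if i = q then a else 0) * X $$ (q, j) else 0)
     + (if k = i then (if i = p \<or> i = q then 0 else 1) * X $$ (i, j) else 0))"
    using assms by (intro sum.cong refl) (auto simp: givens_def)
  also have "\<dots> = (if i = p then a * X $$ (p, j) - b * X $$ (q, j)
     else if i = q then b * X $$ (p, j) + a * X $$ (q, j) else X $$ (i, j))"
    unfolding sum.distrib using assms by (auto simp: sum.delta')
  finally show ?thesis .
qed

lemma orthogonalI:
  assumes U: "U \<in> carrier_mat r r" "U\<^sup>T * U = 1\<^sub>m r"
  shows "U * (U\<^sup>T) = (1\<^sub>m r :: real mat)"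
  using mat_mult_left_right_inverse[of "U\<^sup>T" r U] U by auto

text \<open>In each column the matrix rotates the coordinates \<open>(p, k)\<close> and
  \<open>(q, k)\<close> and leaves the others alone, so its action is a composition of n planar
  rotations.\<close>

lemma givens_rot_inv:
  assumes "p < r" "q < r" "p \<noteq> q" "a\<^sup>2 + b\<^sup>2 = 1"
  shows "givens r p q a b \<in> rot_inv r"
proof -
  let ?G = "givens r p q a b"
  have c: "?G \<in> carrier_mat r r" by (simp add: givens_def)
  have o: "?G * ?G\<^sup>T = 1\<^sub>m r"
  proof (rule eq_matI)
    fix i j assume ij: "i < dim_row (1\<^sub>m r :: real mat)" "j < dim_col (1\<^sub>m r :: real mat)"
    have ab: "a * a + b * b = 1" "b * b + a * a = 1" using assms(4) by (auto simp: power2_eq_square)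
    have "(?G * ?G\<^sup>T) $$ (i, j) =
      (if i = p then a * ?G\<^sup>T $$ (p, j) - b * ?G\<^sup>T $$ (q, j)
       else if i = q then b * ?G\<^sup>T $$ (p, j) + a * ?G\<^sup>T $$ (q, j) else ?G\<^sup>T $$ (i, j))"
      using ij assms by (intro givens_mult) (auto simp: givens_def)
    also have "\<dots> = 1\<^sub>m r $$ (i, j)"
      using ij assms(1-3) ab by (auto simp: givens_def)
    finally show "(?G * ?G\<^sup>T) $$ (i, j) = 1\<^sub>m r $$ (i, j)" .
  qed (use c in auto)
  have o2: "?G\<^sup>T * ?G = 1\<^sub>m r" using mat_mult_left_right_inverse[of ?G r "?G\<^sup>T"] c o by auto
  have "distr (gauss_mat r n) (mat_borel r n) (\<lambda>X. ?G * X) = gauss_mat r n" for n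
  proof (rule distr_gauss_mat_of_pres[OF c])
    define g where "g = (\<lambda>k x. x((p, k) := a * x (p, k) - b * x (q, k), (q, k) := b * x (p, k) + a * x (q, k)) :: nat \<times> nat \<Rightarrow> real)"
    show "normal_pres ({..<r} \<times> {..<n}) (iter_maps g n)"
    proof (rule normal_pres_iter)
      fix k assume "k < n"
      then show "normal_pres ({..<r} \<times> {..<n}) (g k)"
        unfolding g_def using assms by (intro normal_pres_rotate) auto
    qed
    fix x i j assume ij: "i < r" "j < n"
    \<comment> \<open>The induction needs the intermediate states: after m maps exactly the columns
      below m are rotated.\<close>
    have it: "iter_maps g m x (i, j) = (if j < m then (if i = p then a * x (p, j) - b * x (q, j)
       else if i = q then b * x (p, j) + a * x (q, j) else x (i, j)) else x (i, j))" for m i j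
      by (induction m arbitrary: i j) (use assms(3) in \<open>auto simp: g_def less_Suc_eq\<close>)
    show "(?G * mat r n x) $$ (i, j) = iter_maps g n x (i, j)"
      using ij assms by (subst givens_mult) (auto simp: it)
  qed
  then show ?thesis using c o o2 by (auto simp: rot_inv_def)
qed

definition flip :: "nat \<Rightarrow> nat \<Rightarrow> real mat" where
  "flip r p = mat_diag r (\<lambda>i. if i = p then -1 else 1)"

lemma flip_mult:
  assumes "dim_row X = r" "i < r" "j < dim_col X"
  shows "(flip r p * X) $$ (i, j) = (if i = p then - X $$ (i, j) else X $$ (i, j))"
  using assms unfolding flip_def by (subst mat_diag_mult_left[of _ r "dim_col X"]) auto

lemma flip_rot_inv: "p < r \<Longrightarrow> flip r p \<in> rot_inv r"
proof -
  assume p: "p < r"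
  let ?G = "flip r p"
  have c: "?G \<in> carrier_mat r r" by (simp add: flip_def mat_diag_def)
  have s: "?G\<^sup>T = ?G" by (rule eq_matI) (auto simp: flip_def mat_diag_def)
  have o: "?G * ?G = 1\<^sub>m r"
    by (rule eq_matI) (use c in \<open>auto simp: flip_mult simp del: index_mult_mat(1)\<close>, auto simp: flip_def mat_diag_def)
  have "distr (gauss_mat r n) (mat_borel r n) (\<lambda>X. ?G * X) = gauss_mat r n" for n
  proof (rule distr_gauss_mat_of_pres[OF c])
    define g where "g = (\<lambda>k x. x((p, k) := - x (p, k)) :: nat \<times> nat \<Rightarrow> real)"
    show "normal_pres ({..<r} \<times> {..<n}) (iter_maps g n)"
    proof (rule normal_pres_iter)
      fix k assume "k < n"
      then show "normal_pres ({..<r} \<times> {..<n}) (g k)"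
        unfolding g_def using p by (intro normal_pres_flip) auto
    qed
    fix x i j assume ij: "i < r" "j < n"
    have it: "iter_maps g m x (i, j) = (if j < m \<and> i = p then - x (i, j) else x (i, j))" for m i j
      by (induction m arbitrary: i j) (auto simp: g_def less_Suc_eq)
    show "(?G * mat r n x) $$ (i, j) = iter_maps g n x (i, j)"
      using ij by (subst flip_mult) (auto simp: it)
  qed
  then show ?thesis using c o s by (auto simp: rot_inv_def)
qed

lemma nn_integral_gauss_mat_rotate:
  assumes U: "U \<in> rot_inv r" and f: "f \<in> borel_measurable (mat_borel r c)"
  shows "(\<integral>\<^sup>+X. f (U * X) \<partial>gauss_mat r c) = (\<integral>\<^sup>+X. f X \<partial>gauss_mat r c)"
proof -
  have "distr (gauss_mat r c) (mat_borel r c) (\<lambda>X. U * X) = gauss_mat r c" "U \<in> carrier_mat r r"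
    using U by (auto simp: rot_inv_def)
  then show ?thesis
    using nn_integral_distr[OF measurable_mult_left, of U r r f c] f by simp
qed

lemma nn_integral_gauss_mat_rotate_right:
  assumes U: "U \<in> rot_inv c" and f: "f \<in> borel_measurable (mat_borel r c)"
  shows "(\<integral>\<^sup>+X. f (X * U) \<partial>gauss_mat r c) = (\<integral>\<^sup>+X. f X \<partial>gauss_mat r c)"
proof -
  have c: "U \<in> carrier_mat c c" using U by (auto simp: rot_inv_def)
  have m: "(\<lambda>X. f (X * U)) \<in> borel_measurable (mat_borel r c)"
    by (rule measurable_compose[OF mat_borel_mult[OF _ mat_borel_const[OF c]] f]) simp
  have m2: "(\<lambda>X. f (X\<^sup>T)) \<in> borel_measurable (mat_borel c r)"
    by (rule measurable_compose[OF mat_borel_transpose f]) simp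
  have "(\<integral>\<^sup>+X. f (X * U) \<partial>gauss_mat r c) = (\<integral>\<^sup>+X. f (X\<^sup>T * U) \<partial>gauss_mat c r)"
    by (rule nn_integral_gauss_mat_transpose[OF m, symmetric])
  also have "\<dots> = (\<integral>\<^sup>+X. f ((U\<^sup>T * X)\<^sup>T) \<partial>gauss_mat c r)"
    using c by (intro nn_integral_cong) (auto simp: transpose_mult_dim)
  also have "\<dots> = (\<integral>\<^sup>+X. f (X\<^sup>T) \<partial>gauss_mat c r)"
    by (rule nn_integral_gauss_mat_rotate[OF rot_inv_transpose[OF U] m2])
  also have "\<dots> = (\<integral>\<^sup>+X. f X \<partial>gauss_mat r c)"
    by (rule nn_integral_gauss_mat_transpose[OF f])
  finally show ?thesis .
qed

text \<open>One elimination step of a QR decomposition, carried out within \<open>rot_inv\<close>.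
  Vectors supported on the first k coordinates are fixed, so columns reduced earlier are not
  disturbed; the sign condition later pins down the pivot.\<close>

lemma rot_inv_reduce:
  assumes v: "v \<in> carrier_mat r 1" and k: "k < r"
  shows "\<exists>U\<in>rot_inv r.
    (\<forall>w\<in>carrier_mat r 1. (\<forall>i. k \<le> i \<longrightarrow> i < r \<longrightarrow> w $$ (i, 0) = 0) \<longrightarrow> U * w = w) \<and>
    (\<forall>i. k < i \<longrightarrow> i < r \<longrightarrow> (U * v) $$ (i, 0) = 0) \<and> 0 \<le> (U * v) $$ (k, 0)"
proof -
  \<comment> \<open>Induction on the number of entries already eliminated below position k. The base
    case only repairs the sign of the pivot.\<close>
  have step: "m < r - k \<Longrightarrow> \<exists>U\<in>rot_inv r.
    (\<forall>w\<in>carrier_mat r 1. (\<forall>i. k \<le> i \<longrightarrow> i < r \<longrightarrow> w $$ (i, 0) = 0) \<longrightarrow> U * w = w) \<and>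
    (\<forall>i. k < i \<longrightarrow> i \<le> k + m \<longrightarrow> (U * v) $$ (i, 0) = 0) \<and> 0 \<le> (U * v) $$ (k, 0)" for m
  proof (induction m)
    case 0
    show ?case
    proof (cases "0 \<le> v $$ (k, 0)")
      case True
      then show ?thesis using v rot_inv_one[of r] by (intro bexI[of _ "1\<^sub>m r"]) auto
    next
      case False
      have c: "flip r k \<in> carrier_mat r r" using flip_rot_inv[OF k] by (auto simp: rot_inv_def)
      have "flip r k * w = w" if w: "w \<in> carrier_mat r 1" "\<forall>i. k \<le> i \<longrightarrow> i < r \<longrightarrow> w $$ (i, 0) = 0" for w
        by (rule eq_matI) (use w c k in \<open>auto simp: flip_mult simp del: index_mult_mat(1)\<close>)
      then show ?thesis using flip_rot_inv[OF k] False v k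
        by (intro bexI[of _ "flip r k"]) (auto simp: flip_mult simp del: index_mult_mat(1))
    qed
  next
    case (Suc m)
    then obtain U where U: "U \<in> rot_inv r"
      and fx: "\<And>w. w \<in> carrier_mat r 1 \<Longrightarrow> (\<forall>i. k \<le> i \<longrightarrow> i < r \<longrightarrow> w $$ (i, 0) = 0) \<Longrightarrow> U * w = w"
      and z: "\<And>i. k < i \<Longrightarrow> i \<le> k + m \<Longrightarrow> (U * v) $$ (i, 0) = 0" and pos: "0 \<le> (U * v) $$ (k, 0)" by auto
    have c: "U \<in> carrier_mat r r" using U by (auto simp: rot_inv_def)
    define u where "u = U * v"
    define q where "q = k + Suc m"
    \<comment> \<open>The length of the pair formed by the pivot and the next entry. The rotation
      with a = u_k / t and b = - u_q / t takes the pair to (t, 0), and the new pivot t is again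
      nonnegative.\<close>
    define t where "t = sqrt ((u $$ (k, 0))\<^sup>2 + (u $$ (q, 0))\<^sup>2)"
    have u: "dim_row u = r" "dim_col u = 1" using c v by (auto simp: u_def)
    have q: "q < r" "k \<noteq> q" using Suc.prems by (auto simp: q_def)
    show ?case
    proof (cases "t = 0")
      case True
      then have "u $$ (q, 0) = 0" unfolding t_def by (auto simp: add_nonneg_eq_0_iff)
      then have "\<forall>i. k < i \<longrightarrow> i \<le> k + Suc m \<longrightarrow> (U * v) $$ (i, 0) = 0"
        using z by (auto simp: u_def q_def le_Suc_eq)
      then show ?thesis using U fx pos by (intro bexI[of _ U]) auto
    next
      case False
      have tt: "t * t = (u $$ (k, 0))\<^sup>2 + (u $$ (q, 0))\<^sup>2" "t \<ge> 0" by (auto simp: t_def)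
      let ?a = "u $$ (k, 0) / t" and ?b = "- u $$ (q, 0) / t"
      let ?G = "givens r k q ?a ?b"
      have ab: "?a\<^sup>2 + ?b\<^sup>2 = 1"
      proof -
        have "?a\<^sup>2 + ?b\<^sup>2 = ((u $$ (k, 0))\<^sup>2 + (u $$ (q, 0))\<^sup>2) / (t * t)"
          by (simp add: power_divide add_divide_distrib power2_eq_square)
        also have "\<dots> = 1" unfolding tt(1)[symmetric] using False by simp
        finally show ?thesis .
      qed
      have G: "?G \<in> rot_inv r" using givens_rot_inv[OF k q ab] .
      have Gc: "?G \<in> carrier_mat r r" by (simp add: givens_def)
      have as: "(?G * U) * v = ?G * u" using Gc c v by (simp add: u_def mult_assoc_dim)
      have gi: "(?G * u) $$ (i, 0) = (if i = k then ?a * u $$ (k, 0) - ?b * u $$ (q, 0)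
        else if i = q then ?b * u $$ (k, 0) + ?a * u $$ (q, 0) else u $$ (i, 0))" if "i < r" for i
        using givens_mult[OF k q u(1) that, of 0] u by simp
      have gk: "(?G * u) $$ (k, 0) = t"
      proof -
        have "(?G * u) $$ (k, 0) = (t * t) / t"
          unfolding gi[OF k] tt(1) by (simp add: add_divide_distrib power2_eq_square)
        then show ?thesis using False by simp
      qed
      have gq: "(?G * u) $$ (q, 0) = 0" using gi[OF q(1)] q by simp
      have gz: "(?G * u) $$ (i, 0) = 0" if "k < i" "i \<le> k + Suc m" for i
      proof (cases "i = q")
        case True then show ?thesis using gq by simp
      next
        case False
        then have "i \<le> k + m" "i < r" using that q by (auto simp: q_def)
        then show ?thesis using gi[of i] z[of i] that False by (simp add: u_def)
      qed
      have gf: "?G * w = w" if w: "w \<in> carrier_mat r 1" "\<forall>i. k \<le> i \<longrightarrow> i < r \<longrightarrow> w $$ (i, 0) = 0" for w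
      proof (rule eq_matI)
        fix i j assume ij: "i < dim_row w" "j < dim_col w"
        have w0: "w $$ (k, 0) = 0" "w $$ (q, 0) = 0" using w k q by (auto simp: q_def)
        have "(?G * w) $$ (i, 0) = w $$ (i, 0)"
          using w(1) w0 k q ij by (subst givens_mult) auto
        then show "(?G * w) $$ (i, j) = w $$ (i, j)" using ij w(1) by simp
      qed (use w Gc in auto)
      have "\<forall>w\<in>carrier_mat r 1. (\<forall>i. k \<le> i \<longrightarrow> i < r \<longrightarrow> w $$ (i, 0) = 0) \<longrightarrow> (?G * U) * w = w"
      proof (intro ballI impI)
        fix w :: "real mat" assume w: "w \<in> carrier_mat r 1" "\<forall>i. k \<le> i \<longrightarrow> i < r \<longrightarrow> w $$ (i, 0) = 0"
        have "?G * U * w = ?G * (U * w)" using w(1) Gc c by (simp add: mult_assoc_dim)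
        then show "?G * U * w = w" unfolding fx[OF w] gf[OF w] .
      qed
      then show ?thesis unfolding Bex_def
        using rot_inv_mult[OF G U] gz gk tt(2) as by (intro exI[of _ "?G * U"]) (auto simp del: index_mult_mat(1))
    qed
  qed
  have lt: "r - k - 1 < r - k" using k by simp
  from step[OF lt] obtain U where U: "U \<in> rot_inv r"
    and 1: "\<forall>w\<in>carrier_mat r 1. (\<forall>i. k \<le> i \<longrightarrow> i < r \<longrightarrow> w $$ (i, 0) = 0) \<longrightarrow> U * w = w"
    and 2: "\<forall>i. k < i \<longrightarrow> i \<le> k + (r - k - 1) \<longrightarrow> (U * v) $$ (i, 0) = 0" and 3: "0 \<le> (U * v) $$ (k, 0)"
    by blast
  have "\<forall>i. k < i \<longrightarrow> i < r \<longrightarrow> (U * v) $$ (i, 0) = 0" using 2 by auto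
  then show ?thesis using U 1 3 by blast
qed

section \<open>Moving orthonormal systems to coordinate axes\<close>

definition colm :: "real mat \<Rightarrow> nat \<Rightarrow> real mat" where
  "colm B j = mat (dim_row B) 1 (\<lambda>(i, _). B $$ (i, j))"

lemma colm_dim [simp]: "dim_row (colm B j) = dim_row B" "dim_col (colm B j) = 1"
  by (auto simp: colm_def)

lemma colm_index [simp]: "i < dim_row B \<Longrightarrow> colm B j $$ (i, 0) = B $$ (i, j)"
  by (auto simp: colm_def)

lemma mult_colm:
  assumes "dim_col H = dim_row B" "i < dim_row H" "j < dim_col B"
  shows "(H * B) $$ (i, j) = (H * colm B j) $$ (i, 0)"
  using assms by (simp add: mat_mult_index del: index_mult_mat(1))

text \<open>Triangularising a matrix with orthonormal columns yields the identity pattern: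
  elimination clears column m below the diagonal, orthogonality to the earlier columns clears it
  above, and the unit length together with the sign of the pivot makes the diagonal entry 1.\<close>

lemma rot_inv_orthonormal:
  assumes Q: "Q \<in> carrier_mat n s" "Q\<^sup>T * Q = 1\<^sub>m s" and sn: "s \<le> n"
  shows "\<exists>U\<in>rot_inv n. U * Q = mat n s (\<lambda>(i, j). if i = j then 1 else 0)"
proof -
  have "m \<le> s \<Longrightarrow> \<exists>U\<in>rot_inv n. \<forall>i<n. \<forall>j<m. (U * Q) $$ (i, j) = (if i = j then 1 else 0)" for m
  proof (induction m)
    case 0 show ?case using rot_inv_one by (intro bexI[of _ "1\<^sub>m n"]) auto
  next
    case (Suc m)
    then obtain U where U: "U \<in> rot_inv n"
      and e: "\<And>i j. i < n \<Longrightarrow> j < m \<Longrightarrow> (U * Q) $$ (i, j) = (if i = j then 1 else 0)" by auto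
    have c: "U \<in> carrier_mat n n" using U by (auto simp: rot_inv_def)
    let ?B = "U * Q"
    have B: "dim_row ?B = n" "dim_col ?B = s" using c Q by auto
    have mn: "m < n" "m < s" using Suc.prems sn by auto
    have cB: "colm ?B m \<in> carrier_mat n 1" using B by (intro carrier_matI) simp_all
    obtain H where H: "H \<in> rot_inv n"
      and fx: "\<And>w. w \<in> carrier_mat n 1 \<Longrightarrow> (\<forall>i. m \<le> i \<longrightarrow> i < n \<longrightarrow> w $$ (i, 0) = 0) \<Longrightarrow> H * w = w"
      and z: "\<And>i. m < i \<Longrightarrow> i < n \<Longrightarrow> (H * colm ?B m) $$ (i, 0) = 0" and pos: "0 \<le> (H * colm ?B m) $$ (m, 0)"
      using rot_inv_reduce[OF cB mn(1)] by blast
    have hc: "H \<in> carrier_mat n n" using H by (auto simp: rot_inv_def)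
    have HO: "H * U \<in> rot_inv n" using rot_inv_mult[OF H U] .
    let ?C = "H * U * Q"
    have CB: "?C = H * ?B" using hc c Q by (simp add: mult_assoc_dim)
    have C: "dim_row ?C = n" "dim_col ?C = s" using hc c Q by auto
    have e': "?C $$ (i, j) = (if i = j then 1 else 0)" if ij: "i < n" "j < m" for i j
    proof -
      have "?C $$ (i, j) = (H * colm ?B j) $$ (i, 0)"
        unfolding CB using ij mn B hc by (intro mult_colm) auto
      also have "H * colm ?B j = colm ?B j"
        using e ij B by (intro fx carrier_matI) (auto simp del: index_mult_mat(1))
      finally show ?thesis using e ij B by (simp del: index_mult_mat(1))
    qed
    have orth: "?C\<^sup>T * ?C = 1\<^sub>m s"
    proof -
      have "(H * U)\<^sup>T * (H * U) = 1\<^sub>m n" using HO by (auto simp: rot_inv_def)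
      then have "(H * U)\<^sup>T * ((H * U) * Q) = Q" using hc c Q by (intro mat_mult_cancel_left) auto
      then show ?thesis using hc c Q by (simp add: mat_ring)
    qed
    have g: "(\<Sum>l<n. ?C $$ (l, i) * ?C $$ (l, j)) = (if i = j then 1 else 0)" if "i < s" "j < s" for i j
    proof -
      have "(?C\<^sup>T * ?C) $$ (i, j) = (\<Sum>l<n. ?C $$ (l, i) * ?C $$ (l, j))"
        using that C by (subst mat_mult_index) (auto simp del: index_mult_mat(1) intro!: sum.cong)
      then show ?thesis using that unfolding orth by simp
    qed
    \<comment> \<open>Column i is already the i-th unit vector, so its inner product with column m
      is the entry at position i.\<close>
    have lo: "?C $$ (i, m) = 0" if "i < m" for i
    proof -
      have "(\<Sum>l<n. ?C $$ (l, i) * ?C $$ (l, m)) = (\<Sum>l<n. if l = i then ?C $$ (l, m) else 0)"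
        using that e' by (intro sum.cong refl) (simp del: index_mult_mat(1))
      then show ?thesis using g[of i m] that mn by (simp del: index_mult_mat(1))
    qed
    have Cm: "?C $$ (i, m) = (H * colm ?B m) $$ (i, 0)" if "i < n" for i
      unfolding CB using that mn B hc by (intro mult_colm) auto
    have hi: "?C $$ (i, m) = 0" if "m < i" "i < n" for i using z that Cm by metis
    have "(\<Sum>l<n. ?C $$ (l, m) * ?C $$ (l, m)) = (\<Sum>l<n. if l = m then ?C $$ (m, m) * ?C $$ (m, m) else 0)"
    proof (intro sum.cong refl)
      fix l assume l: "l \<in> {..<n}"
      show "?C $$ (l, m) * ?C $$ (l, m) = (if l = m then ?C $$ (m, m) * ?C $$ (m, m) else 0)"
        using lo[of l] hi[of l] l by (cases l m rule: linorder_cases) (auto simp del: index_mult_mat(1))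
    qed
    then have "?C $$ (m, m) * ?C $$ (m, m) = 1" using g[of m m] mn by (simp del: index_mult_mat(1))
    moreover have "0 \<le> ?C $$ (m, m)" using Cm pos mn by metis
    ultimately have "?C $$ (m, m) = 1"
      using square_eq_1_iff[of "?C $$ (m, m)"] by (auto simp del: index_mult_mat(1))
    then have "?C $$ (i, m) = (if i = m then 1 else 0)" if "i < n" for i
      using lo[of i] hi[of i] that by (cases i m rule: linorder_cases) (auto simp del: index_mult_mat(1))
    then have "\<forall>i<n. \<forall>j<Suc m. ?C $$ (i, j) = (if i = j then 1 else 0)"
      using e' by (auto simp: less_Suc_eq simp del: index_mult_mat(1))
    then show ?case using HO by blast
  qed
  from this[of s] obtain U where U: "U \<in> rot_inv n"
    and e: "\<forall>i<n. \<forall>j<s. (U * Q) $$ (i, j) = (if i = j then 1 else 0)" by auto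
  have "U * Q = mat n s (\<lambda>(i, j). if i = j then 1 else 0)"
    by (rule eq_matI) (use e U Q in \<open>auto simp: rot_inv_def simp del: index_mult_mat(1)\<close>)
  then show ?thesis using U by blast
qed

text \<open>Some member of \<open>rot_inv\<close> reduces \<open>V\<close> to the identity, so
  \<open>V\<close> is the transpose of that member.\<close>

lemma orthogonal_rot_inv:
  assumes V: "V \<in> carrier_mat n n" "V\<^sup>T * V = 1\<^sub>m n"
  shows "V \<in> rot_inv n"
proof -
  obtain U where U: "U \<in> rot_inv n" and e: "U * V = mat n n (\<lambda>(i, j). if i = j then 1 else 0)"
    using rot_inv_orthonormal[OF V] by auto
  have c: "U \<in> carrier_mat n n" and o: "U\<^sup>T * U = 1\<^sub>m n" using U by (auto simp: rot_inv_def)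
  have "U * V = 1\<^sub>m n" unfolding e one_mat_def by (rule eq_matI) auto
  then have "U\<^sup>T * (U * V) = U\<^sup>T" using c by (simp add: mat_ring)
  then have "V = U\<^sup>T" using mat_mult_cancel_left[OF o, of V] c V by simp
  then show ?thesis using rot_inv_transpose[OF U] by simp
qed

lemma rot_inv_map_vec:
  assumes v: "v \<in> carrier_mat r 1" and k: "k < r"
  shows "\<exists>U\<in>rot_inv r. U * v = mat r 1 (\<lambda>(i, _). if i = k then sqrt (frob_sq v) else 0)"
proof -
  have first: "\<exists>U\<in>rot_inv r. U * w = mat r 1 (\<lambda>(i, _). if i = 0 then sqrt (frob_sq w) else 0)"
    if w: "w \<in> carrier_mat r 1" for w
  proof -
    obtain U where U: "U \<in> rot_inv r" and z: "\<And>i. 0 < i \<Longrightarrow> i < r \<Longrightarrow> (U * w) $$ (i, 0) = 0"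
      and pos: "0 \<le> (U * w) $$ (0, 0)"
      using rot_inv_reduce[OF w, of 0] k by (auto simp del: index_mult_mat(1))
    have c: "U \<in> carrier_mat r r" and o: "U\<^sup>T * U = 1\<^sub>m r" using U by (auto simp: rot_inv_def)
    have "frob_sq w = frob_sq (U * w)" using frob_sq_isometry[OF o, of w] c w by auto
    also have "\<dots> = (\<Sum>i<r. ((U * w) $$ (i, 0))\<^sup>2)" unfolding frob_sq_def using c w by (auto simp del: index_mult_mat(1))
    also have "\<dots> = (\<Sum>i<r. if i = 0 then ((U * w) $$ (0, 0))\<^sup>2 else 0)"
      using z by (intro sum.cong refl) (auto simp del: index_mult_mat(1))
    also have "\<dots> = ((U * w) $$ (0, 0))\<^sup>2" using k by simp
    finally have "(U * w) $$ (0, 0) = sqrt (frob_sq w)" using pos by simp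
    then have "U * w = mat r 1 (\<lambda>(i, _). if i = 0 then sqrt (frob_sq w) else 0)"
      using z c w by (intro eq_matI) (auto simp del: index_mult_mat(1))
    then show ?thesis using U by blast
  qed
  \<comment> \<open>Only rotation to the first axis is available at this point. The target
    \<open>w\<close> is rotated there too, and composing one rotation with the transpose of the
    other takes \<open>v\<close> to \<open>w\<close>.\<close>
  define w where "w = mat r 1 (\<lambda>(i, _). if i = k then sqrt (frob_sq v) else 0)"
  have w: "w \<in> carrier_mat r 1" by (simp add: w_def)
  have fw: "frob_sq w = frob_sq v"
  proof -
    have "frob_sq w = (\<Sum>i<r. if i = k then frob_sq v else 0)"
      unfolding frob_sq_def[of w] by (simp add: w_def if_distrib[of "\<lambda>x. x\<^sup>2"] cong: if_cong)
    then show ?thesis using k by simp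
  qed
  obtain O1 where O1: "O1 \<in> rot_inv r" "O1 * v = mat r 1 (\<lambda>(i, _). if i = 0 then sqrt (frob_sq v) else 0)"
    using first[OF v] by auto
  obtain O2 where O2: "O2 \<in> rot_inv r" "O2 * w = mat r 1 (\<lambda>(i, _). if i = 0 then sqrt (frob_sq v) else 0)"
    using first[OF w] unfolding fw by blast
  have d: "O1 \<in> carrier_mat r r" "O2 \<in> carrier_mat r r" "O2\<^sup>T * O2 = 1\<^sub>m r"
    using O1 O2 by (auto simp: rot_inv_def)
  have "(O2\<^sup>T * O1) * v = O2\<^sup>T * (O2 * w)" using O1(2) O2(2) d v by (simp add: mult_assoc_dim)
  also have "\<dots> = w" using d w by (intro mat_mult_cancel_left[OF d(3)]) auto
  finally show ?thesis using rot_inv_mult[OF rot_inv_transpose[OF O2(1)] O1(1)] unfolding w_def by blast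
qed

section \<open>Moments\<close>

lemma gauss_mat_prod_moment:
  fixes e :: "nat \<times> nat \<Rightarrow> nat"
  shows "has_bochner_integral (gauss_mat r c) (\<lambda>X. \<Prod>p\<in>{..<r} \<times> {..<c}. (X $$ p) ^ e p)
    (\<Prod>p\<in>{..<r} \<times> {..<c}. LINT x|std_normal_distribution. x ^ e p)"
proof -
  let ?I = "{..<r} \<times> {..<c}"
  have i: "integrable (normal_PiM ?I) (\<lambda>x. \<Prod>p\<in>?I. x p ^ e p)"
    "(LINT x|normal_PiM ?I. (\<Prod>p\<in>?I. x p ^ e p)) = (\<Prod>p\<in>?I. (LINT x|std_normal_distribution. x ^ e p))"
    using normal_prod.product_integrable_prod[of ?I "\<lambda>p x. x ^ e p"]
      normal_prod.product_integral_prod[of ?I "\<lambda>p x. x ^ e p"] integrable_std_normal_distribution_moment by auto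
  have "has_bochner_integral (normal_PiM ?I) (\<lambda>x. \<Prod>p\<in>?I. (mat r c x $$ p) ^ e p)
      (\<Prod>p\<in>?I. LINT x|std_normal_distribution. x ^ e p)"
    using has_bochner_integral_integrable[OF i(1)] unfolding i(2)
    by (rule has_bochner_integral_cong[THEN iffD1, rotated -1]) (auto intro!: prod.cong)
  moreover have "(\<lambda>X. \<Prod>p\<in>?I. (X $$ p) ^ e p) \<in> borel_measurable (mat_borel r c)"
    by (intro borel_measurable_prod borel_measurable_power) (auto intro: measurable_mat_entry)
  ultimately show ?thesis
    unfolding gauss_mat_def by (intro has_bochner_integral_distr measurable_mat)
qed

lemma std_normal_moments:
  "(LINT x|std_normal_distribution. x ^ 0) = 1" "(LINT x|std_normal_distribution. x ^ 1) = 0"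
  "(LINT x|std_normal_distribution. x ^ 2) = 1" "(LINT x|std_normal_distribution. x ^ 3) = 0"
  "(LINT x|std_normal_distribution. x ^ 4) = 3"
proof -
  show "(LINT x|std_normal_distribution. x ^ 0) = 1"
    using std_normal_distribution_even_moments(1)[of 0] by simp
  show "(LINT x|std_normal_distribution. x ^ 1) = 0" "(LINT x|std_normal_distribution. x ^ 3) = 0"
    by (rule integral_std_normal_distribution_moment_odd, simp)+
  show "(LINT x|std_normal_distribution. x ^ 2) = 1"
    using std_normal_distribution_even_moments(1)[of 1] by (simp add: fact_numeral)
  show "(LINT x|std_normal_distribution. x ^ 4) = 3"
    using std_normal_distribution_even_moments(1)[of 2] by (simp add: fact_numeral)
qed

text \<open>Wick's formula for four entries, obtained by reading off the exponent of each entry.\<close>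

lemma gauss_mat_moment4:
  assumes "p \<in> {..<r} \<times> {..<c}" "q \<in> {..<r} \<times> {..<c}" "u \<in> {..<r} \<times> {..<c}" "v \<in> {..<r} \<times> {..<c}"
  shows "has_bochner_integral (gauss_mat r c) (\<lambda>X. X $$ p * X $$ q * X $$ u * X $$ v)
    (of_bool (p = q) * of_bool (u = v) + of_bool (p = u) * of_bool (q = v) + of_bool (p = v) * of_bool (q = u))"
proof -
  let ?I = "{..<r} \<times> {..<c}"
  define e :: "nat \<times> nat \<Rightarrow> nat" where
    "e = (\<lambda>i. of_bool (i = p) + of_bool (i = q) + of_bool (i = u) + of_bool (i = v))"
  have one: "(\<Prod>i\<in>?I. f i ^ of_bool (i = a)) = f a" if "a \<in> ?I" for f :: "nat \<times> nat \<Rightarrow> real" and a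
  proof -
    have "(\<Prod>i\<in>?I. f i ^ of_bool (i = a)) = (\<Prod>i\<in>?I. if i = a then f a else 1)"
      by (intro prod.cong) auto
    then show ?thesis using that by simp
  qed
  have 1: "(\<lambda>X :: real mat. \<Prod>i\<in>?I. (X $$ i) ^ e i) = (\<lambda>X. X $$ p * X $$ q * X $$ u * X $$ v)"
    unfolding e_def power_add prod.distrib one[OF assms(1)] one[OF assms(2)] one[OF assms(3)] one[OF assms(4)] ..
  have "(\<Prod>i\<in>?I. LINT x|std_normal_distribution. x ^ e i)
      = (\<Prod>i\<in>{p, q, u, v}. LINT x|std_normal_distribution. x ^ e i)"
    using assms std_normal_moments(1)
    by (intro prod.mono_neutral_right) (auto simp: e_def)
  also have "\<dots> = of_bool (p = q) * of_bool (u = v) + of_bool (p = u) * of_bool (q = v) + of_bool (p = v) * of_bool (q = u)"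
    using std_normal_moments
    by (cases "p = q"; cases "p = u"; cases "p = v"; cases "q = u"; cases "q = v"; cases "u = v")
      (simp_all add: e_def insert_commute numeral_eq_Suc)
  finally show ?thesis using gauss_mat_prod_moment[of r c e] 1 by simp
qed

lemma gauss_mat_moment2:
  assumes "p \<in> {..<r} \<times> {..<c}" "q \<in> {..<r} \<times> {..<c}"
  shows "has_bochner_integral (gauss_mat r c) (\<lambda>X. X $$ p * X $$ q) (of_bool (p = q))"
proof -
  let ?I = "{..<r} \<times> {..<c}"
  define e :: "nat \<times> nat \<Rightarrow> nat" where "e = (\<lambda>i. of_bool (i = p) + of_bool (i = q))"
  have one: "(\<Prod>i\<in>?I. f i ^ of_bool (i = a)) = f a" if "a \<in> ?I" for f :: "nat \<times> nat \<Rightarrow> real" and a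
  proof -
    have "(\<Prod>i\<in>?I. f i ^ of_bool (i = a)) = (\<Prod>i\<in>?I. if i = a then f a else 1)"
      by (intro prod.cong) auto
    then show ?thesis using that by simp
  qed
  have 1: "(\<lambda>X :: real mat. \<Prod>i\<in>?I. (X $$ i) ^ e i) = (\<lambda>X. X $$ p * X $$ q)"
    unfolding e_def power_add prod.distrib one[OF assms(1)] one[OF assms(2)] ..
  have "(\<Prod>i\<in>?I. LINT x|std_normal_distribution. x ^ e i)
      = (\<Prod>i\<in>{p, q}. LINT x|std_normal_distribution. x ^ e i)"
    using assms std_normal_moments(1)
    by (intro prod.mono_neutral_right) (auto simp: e_def)
  also have "\<dots> = of_bool (p = q)"
    using std_normal_moments by (cases "p = q") (simp_all add: e_def numeral_eq_Suc)
  finally show ?thesis using gauss_mat_prod_moment[of r c e] 1 by simp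
qed

lemma nn_integral_of_has_bochner:
  assumes "has_bochner_integral M f x" "\<And>\<omega>. 0 \<le> f \<omega>"
  shows "(\<integral>\<^sup>+\<omega>. ennreal (f \<omega>) \<partial>M) = ennreal x"
proof -
  have "integrable M f" "integral\<^sup>L M f = x" using assms(1) by (auto simp: has_bochner_integral_iff)
  then show ?thesis using nn_integral_eq_integral[of M f] assms(2) by simp
qed

lemma has_bochner_integral_frob_sq:
  assumes "\<And>\<omega>. \<omega> \<in> space M \<Longrightarrow> X \<omega> \<in> carrier_mat a b"
    and "\<And>i j. i < a \<Longrightarrow> j < b \<Longrightarrow> has_bochner_integral M (\<lambda>\<omega>. (X \<omega> $$ (i, j))\<^sup>2) (v i j)"
  shows "has_bochner_integral M (\<lambda>\<omega>. frob_sq (X \<omega>)) (\<Sum>i<a. \<Sum>j<b. v i j)"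
proof -
  have "has_bochner_integral M (\<lambda>\<omega>. \<Sum>i<a. \<Sum>j<b. (X \<omega> $$ (i, j))\<^sup>2) (\<Sum>i<a. \<Sum>j<b. v i j)"
    using assms(2) by (intro has_bochner_integral_sum) auto
  also have "?this \<longleftrightarrow> ?thesis"
  proof (intro has_bochner_integral_cong refl)
    fix \<omega> assume "\<omega> \<in> space M"
    then have "dim_row (X \<omega>) = a" "dim_col (X \<omega>) = b" using assms(1) by auto
    then show "(\<Sum>i<a. \<Sum>j<b. (X \<omega> $$ (i, j))\<^sup>2) = frob_sq (X \<omega>)" by (simp add: frob_sq_def)
  qed
  finally show ?thesis .
qed

text \<open>Each entry of \<open>B * X * C\<close> is a linear form in independent entries of unit
  variance, so its second moment is the sum of the squared coefficients, and these are
  products.\<close>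

lemma nn_integral_frob_sq_mult:
  assumes B: "B \<in> carrier_mat a r" and C: "C \<in> carrier_mat c b"
  shows "(\<integral>\<^sup>+X. ennreal (frob_sq (B * X * C)) \<partial>gauss_mat r c) = ennreal (frob_sq B * frob_sq C)"
proof -
  let ?I = "{..<r} \<times> {..<c}"
  have "has_bochner_integral (gauss_mat r c) (\<lambda>X. ((B * X * C) $$ (i, j))\<^sup>2)
      (\<Sum>k<r. \<Sum>l<c. (B $$ (i, k))\<^sup>2 * (C $$ (l, j))\<^sup>2)"
    if ij: "i < a" "j < b" for i j
  proof -
    let ?w = "\<lambda>p. B $$ (i, fst p) * C $$ (snd p, j)"
    have "has_bochner_integral (gauss_mat r c)
       (\<lambda>X. \<Sum>p\<in>?I. \<Sum>q\<in>?I. (?w p * ?w q) * (X $$ p * X $$ q)) (\<Sum>p\<in>?I. \<Sum>q\<in>?I. (?w p * ?w q) * of_bool (p = q))"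
      by (intro has_bochner_integral_sum has_bochner_integral_mult_right gauss_mat_moment2)
    also have "(\<Sum>p\<in>?I. \<Sum>q\<in>?I. (?w p * ?w q) * of_bool (p = q)) = (\<Sum>p\<in>?I. ?w p * ?w p)"
      by (intro sum.cong refl) (simp add: of_bool_def if_distrib[of "\<lambda>x. _ * x"] cong: if_cong)
    also have "\<dots> = (\<Sum>k<r. \<Sum>l<c. (B $$ (i, k))\<^sup>2 * (C $$ (l, j))\<^sup>2)"
      by (simp add: sum.cartesian_product case_prod_unfold power2_eq_square mult_ac)
    also have "has_bochner_integral (gauss_mat r c)
       (\<lambda>X. \<Sum>p\<in>?I. \<Sum>q\<in>?I. (?w p * ?w q) * (X $$ p * X $$ q)) \<dots> \<longleftrightarrow>
       has_bochner_integral (gauss_mat r c) (\<lambda>X. ((B * X * C) $$ (i, j))\<^sup>2) \<dots>"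
    proof (intro has_bochner_integral_cong refl)
      fix X assume "X \<in> space (gauss_mat r c)"
      then have X: "X \<in> carrier_mat r c" by simp
      have "(B * X * C) $$ (i, j) = (\<Sum>l<c. (\<Sum>k<r. B $$ (i, k) * X $$ (k, l)) * C $$ (l, j))"
        using X B C ij by (subst mat_mult_index) (auto simp: mat_mult_index simp del: index_mult_mat(1))
      also have "\<dots> = (\<Sum>k<r. \<Sum>l<c. ?w (k, l) * X $$ (k, l))"
        unfolding sum_distrib_right by (subst sum.swap) (simp add: mult_ac)
      also have "\<dots> = (\<Sum>p\<in>?I. ?w p * X $$ p)"
        by (simp add: sum.cartesian_product case_prod_unfold)
      finally show "(\<Sum>p\<in>?I. \<Sum>q\<in>?I. (?w p * ?w q) * (X $$ p * X $$ q)) = ((B * X * C) $$ (i, j))\<^sup>2"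
        by (simp add: power2_eq_square sum_product mult_ac)
    qed
    finally show ?thesis .
  qed
  moreover have "B * X * C \<in> carrier_mat a b" if "X \<in> space (gauss_mat r c)" for X
    using B C by (intro carrier_matI) simp_all
  ultimately
  have "has_bochner_integral (gauss_mat r c) (\<lambda>X. frob_sq (B * X * C))
      (\<Sum>i<a. \<Sum>j<b. \<Sum>k<r. \<Sum>l<c. (B $$ (i, k))\<^sup>2 * (C $$ (l, j))\<^sup>2)"
    by (intro has_bochner_integral_frob_sq)
  also have "(\<Sum>i<a. \<Sum>j<b. \<Sum>k<r. \<Sum>l<c. (B $$ (i, k))\<^sup>2 * (C $$ (l, j))\<^sup>2)
     = (\<Sum>i<a. \<Sum>k<r. \<Sum>l<c. \<Sum>j<b. (B $$ (i, k))\<^sup>2 * (C $$ (l, j))\<^sup>2)"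
    by (rule sum.cong[OF refl], rule trans[OF sum.swap], rule sum.cong[OF refl], rule sum.swap)
  also have "\<dots> = frob_sq B * frob_sq C"
    unfolding frob_sq_def using B C by (simp add: sum_distrib_left[symmetric] sum_distrib_right[symmetric])
  finally show ?thesis by (rule nn_integral_of_has_bochner) simp
qed

lemma sum_product4:
  fixes f g h k :: "_ \<Rightarrow> real"
  shows "(\<Sum>a\<in>A. \<Sum>b\<in>B. \<Sum>e\<in>E. \<Sum>d\<in>D. f a * g b * (h e * k d)) = (sum f A * sum g B) * (sum h E * sum k D)"
  by (simp add: sum_distrib_left[symmetric] sum_distrib_right[symmetric])

lemma sum_if_const: "(\<Sum>x\<in>A. if P then f x else (0::real)) = (if P then \<Sum>x\<in>A. f x else 0)"
  by simp

text \<open>The squared bilinear form is a double sum over columns c and d. The Wick pairing within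
  each column contributes the square of the inner product of u and k for all l^2 pairs; the two
  pairings across columns survive only for c = d and contribute that square once more and the
  product of the squared norms.\<close>

lemma gauss_mat_quartic:
  fixes u k :: "nat \<Rightarrow> real"
  shows "has_bochner_integral (gauss_mat p l)
    (\<lambda>X. (\<Sum>c<l. (\<Sum>a<p. u a * X $$ (a, c)) * (\<Sum>b<p. k b * X $$ (b, c)))\<^sup>2)
    (((real l)\<^sup>2 + real l) * (\<Sum>a<p. u a * k a)\<^sup>2 + real l * ((\<Sum>a<p. (u a)\<^sup>2) * (\<Sum>a<p. (k a)\<^sup>2)))"
proof -
  have inner: "has_bochner_integral (gauss_mat p l)
     (\<lambda>X. ((\<Sum>a<p. u a * X $$ (a, c)) * (\<Sum>b<p. k b * X $$ (b, c))) *
         ((\<Sum>a<p. u a * X $$ (a, d)) * (\<Sum>b<p. k b * X $$ (b, d))))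
     ((\<Sum>a<p. u a * k a)\<^sup>2 + of_bool (c = d) * ((\<Sum>a<p. (u a)\<^sup>2) * (\<Sum>a<p. (k a)\<^sup>2) + (\<Sum>a<p. u a * k a)\<^sup>2))"
    if cd: "c < l" "d < l" for c d
  proof -
    let ?m = "\<lambda>a b e f. of_bool ((a, c) = (b, c)) * of_bool ((e, d) = (f, d)) +
       of_bool ((a, c) = (e, d)) * of_bool ((b, c) = (f, d)) + of_bool ((a, c) = (f, d)) * of_bool ((b, c) = (e, d)) :: real"
    have "has_bochner_integral (gauss_mat p l)
      (\<lambda>X. \<Sum>a<p. \<Sum>b<p. \<Sum>e<p. \<Sum>f<p. (u a * k b * (u e * k f)) * (X $$ (a, c) * X $$ (b, c) * X $$ (e, d) * X $$ (f, d)))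
      (\<Sum>a<p. \<Sum>b<p. \<Sum>e<p. \<Sum>f<p. (u a * k b * (u e * k f)) * ?m a b e f)"
      using cd by (intro has_bochner_integral_sum has_bochner_integral_mult_right gauss_mat_moment4) auto
    also have "(\<lambda>X. \<Sum>a<p. \<Sum>b<p. \<Sum>e<p. \<Sum>f<p. (u a * k b * (u e * k f)) * (X $$ (a, c) * X $$ (b, c) * X $$ (e, d) * X $$ (f, d)))
       = (\<lambda>X. ((\<Sum>a<p. u a * X $$ (a, c)) * (\<Sum>b<p. k b * X $$ (b, c))) *
         ((\<Sum>a<p. u a * X $$ (a, d)) * (\<Sum>b<p. k b * X $$ (b, d))))"
      unfolding sum_product4[symmetric] by (intro ext sum.cong refl) (simp only: mult_ac)
    also have "(\<Sum>a<p. \<Sum>b<p. \<Sum>e<p. \<Sum>f<p. (u a * k b * (u e * k f)) * ?m a b e f)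
       = (\<Sum>a<p. \<Sum>b<p. \<Sum>e<p. \<Sum>f<p. if a = b then if e = f then u a * k b * (u e * k f) else 0 else 0)
       + of_bool (c = d) * ((\<Sum>a<p. \<Sum>b<p. \<Sum>e<p. \<Sum>f<p. if b = f then if a = e then u a * k b * (u e * k f) else 0 else 0)
       + (\<Sum>a<p. \<Sum>b<p. \<Sum>e<p. \<Sum>f<p. if a = f then if b = e then u a * k b * (u e * k f) else 0 else 0))"
      unfolding sum_distrib_left sum.distrib[symmetric]
      by (intro sum.cong refl) auto
    also have "\<dots> = (\<Sum>a<p. \<Sum>e<p. u a * k a * (u e * k e))
       + of_bool (c = d) * ((\<Sum>a<p. \<Sum>b<p. u a * k b * (u a * k b)) + (\<Sum>a<p. \<Sum>b<p. u a * k b * (u b * k a)))"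
      by (simp add: sum_if_const sum.delta sum.delta' cong: if_cong)
    also have "(\<Sum>a<p. \<Sum>e<p. u a * k a * (u e * k e)) = (\<Sum>a<p. u a * k a)\<^sup>2"
      unfolding power2_eq_square sum_product ..
    also have "(\<Sum>a<p. \<Sum>b<p. u a * k b * (u a * k b)) = (\<Sum>a<p. (u a)\<^sup>2) * (\<Sum>a<p. (k a)\<^sup>2)"
      unfolding power2_eq_square sum_product by (intro sum.cong refl) (simp add: mult_ac)
    also have "(\<Sum>a<p. \<Sum>b<p. u a * k b * (u b * k a)) = (\<Sum>a<p. u a * k a)\<^sup>2"
      unfolding power2_eq_square sum_product by (intro sum.cong refl) (simp add: mult_ac)
    finally show ?thesis .
  qed
  have diag: "(\<Sum>c<l. \<Sum>d<l. (S + of_bool (c = d) * (T + S))) = ((real l)\<^sup>2 + real l) * S + real l * T" for S T :: real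
  proof -
    have "(\<Sum>d<l. (S + of_bool (c = d) * (T + S))) = real l * S + (T + S)" if "c < l" for c
    proof -
      have "(\<Sum>d<l. of_bool (c = d) * (T + S)) = (\<Sum>d<l. if c = d then T + S else 0)"
        by (intro sum.cong) auto
      then show ?thesis using that by (simp add: sum.distrib)
    qed
    then have "(\<Sum>c<l. \<Sum>d<l. (S + of_bool (c = d) * (T + S))) = (\<Sum>c<l. real l * S + (T + S))"
      by (intro sum.cong) auto
    then show ?thesis by (simp add: algebra_simps power2_eq_square)
  qed
  have "has_bochner_integral (gauss_mat p l)
     (\<lambda>X. \<Sum>c<l. \<Sum>d<l. ((\<Sum>a<p. u a * X $$ (a, c)) * (\<Sum>b<p. k b * X $$ (b, c))) *
         ((\<Sum>a<p. u a * X $$ (a, d)) * (\<Sum>b<p. k b * X $$ (b, d))))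
     (\<Sum>c<l. \<Sum>d<l. ((\<Sum>a<p. u a * k a)\<^sup>2 + of_bool (c = d) * ((\<Sum>a<p. (u a)\<^sup>2) * (\<Sum>a<p. (k a)\<^sup>2) + (\<Sum>a<p. u a * k a)\<^sup>2)))"
    by (intro has_bochner_integral_sum inner) auto
  also have "(\<lambda>X. \<Sum>c<l. \<Sum>d<l. ((\<Sum>a<p. u a * X $$ (a, c)) * (\<Sum>b<p. k b * X $$ (b, c))) *
         ((\<Sum>a<p. u a * X $$ (a, d)) * (\<Sum>b<p. k b * X $$ (b, d))))
    = (\<lambda>X. (\<Sum>c<l. (\<Sum>a<p. u a * X $$ (a, c)) * (\<Sum>b<p. k b * X $$ (b, c)))\<^sup>2)"
    by (simp only: power2_eq_square sum_product[of _ "{..<l}"])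
  also have "(\<Sum>c<l. \<Sum>d<l. ((\<Sum>a<p. u a * k a)\<^sup>2 + of_bool (c = d) * ((\<Sum>a<p. (u a)\<^sup>2) * (\<Sum>a<p. (k a)\<^sup>2) + (\<Sum>a<p. u a * k a)\<^sup>2)))
     = ((real l)\<^sup>2 + real l) * (\<Sum>a<p. u a * k a)\<^sup>2 + real l * ((\<Sum>a<p. (u a)\<^sup>2) * (\<Sum>a<p. (k a)\<^sup>2))"
    by (rule diag)
  finally show ?thesis .
qed

text \<open>The entry at (i, j) is the quartic form of row i of \<open>B\<close> and column j of
  \<open>K\<close>. This is the fourth moment applied to \<Phi>_2, and the source of the factors in
  l next to the sixth and fourth powers of the singular values.\<close>

lemma nn_integral_frob_sq_gram_mult:
  assumes B: "B \<in> carrier_mat a p" and K: "K \<in> carrier_mat p b"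
  shows "(\<integral>\<^sup>+X. ennreal (frob_sq (B * X * X\<^sup>T * K)) \<partial>gauss_mat p l)
    = ennreal (((real l)\<^sup>2 + real l) * frob_sq (B * K) + real l * (frob_sq B * frob_sq K))"
proof -
  have "has_bochner_integral (gauss_mat p l) (\<lambda>X. ((B * X * X\<^sup>T * K) $$ (i, j))\<^sup>2)
      (((real l)\<^sup>2 + real l) * ((B * K) $$ (i, j))\<^sup>2
       + real l * ((\<Sum>k<p. (B $$ (i, k))\<^sup>2) * (\<Sum>k<p. (K $$ (k, j))\<^sup>2)))"
    if ij: "i < a" "j < b" for i j
  proof -
    have BK: "(B * K) $$ (i, j) = (\<Sum>k<p. B $$ (i, k) * K $$ (k, j))"
      using B K ij by (subst mat_mult_index) auto
    have "(B * X * X\<^sup>T * K) $$ (i, j) = (\<Sum>c<l. (\<Sum>k<p. B $$ (i, k) * X $$ (k, c)) * (\<Sum>k<p. K $$ (k, j) * X $$ (k, c)))"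
      if X: "X \<in> carrier_mat p l" for X
    proof -
      have "B * X * X\<^sup>T * K = (B * X) * (X\<^sup>T * K)" using X B K by (simp add: mult_assoc_dim)
      then have "(B * X * X\<^sup>T * K) $$ (i, j) = (\<Sum>c<l. (B * X) $$ (i, c) * (X\<^sup>T * K) $$ (c, j))"
        using X B K ij by (simp add: mat_mult_index del: index_mult_mat(1))
      also have "\<dots> = (\<Sum>c<l. (\<Sum>k<p. B $$ (i, k) * X $$ (k, c)) * (\<Sum>k<p. K $$ (k, j) * X $$ (k, c)))"
        using X B K ij by (intro sum.cong refl arg_cong2[where f = "(*)"])
          (auto simp: mat_mult_index mult.commute simp del: index_mult_mat(1))
      finally show ?thesis .
    qed
    then show ?thesis
      unfolding BK using gauss_mat_quartic[of p l "\<lambda>k. B $$ (i, k)" "\<lambda>k. K $$ (k, j)"]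
      by (subst has_bochner_integral_cong[OF refl _ refl]) auto
  qed
  moreover have "B * X * X\<^sup>T * K \<in> carrier_mat a b" if "X \<in> space (gauss_mat p l)" for X
    using B K by (intro carrier_matI) simp_all
  ultimately
  have "has_bochner_integral (gauss_mat p l) (\<lambda>X. frob_sq (B * X * X\<^sup>T * K))
      (\<Sum>i<a. \<Sum>j<b. (((real l)\<^sup>2 + real l) * ((B * K) $$ (i, j))\<^sup>2
       + real l * ((\<Sum>k<p. (B $$ (i, k))\<^sup>2) * (\<Sum>k<p. (K $$ (k, j))\<^sup>2))))"
    by (intro has_bochner_integral_frob_sq)
  also have "(\<Sum>i<a. \<Sum>j<b. (((real l)\<^sup>2 + real l) * ((B * K) $$ (i, j))\<^sup>2
       + real l * ((\<Sum>k<p. (B $$ (i, k))\<^sup>2) * (\<Sum>k<p. (K $$ (k, j))\<^sup>2))))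
     = ((real l)\<^sup>2 + real l) * (\<Sum>i<a. \<Sum>j<b. ((B * K) $$ (i, j))\<^sup>2)
       + real l * ((\<Sum>i<a. \<Sum>k<p. (B $$ (i, k))\<^sup>2) * (\<Sum>j<b. \<Sum>k<p. (K $$ (k, j))\<^sup>2))"
    by (simp only: sum.distrib sum_distrib_left[symmetric] sum_product)
  also have "\<dots> = ((real l)\<^sup>2 + real l) * frob_sq (B * K) + real l * (frob_sq B * frob_sq K)"
    unfolding frob_sq_def using B K sum.swap[of "\<lambda>j k. (K $$ (k, j))\<^sup>2" "{..<p}" "{..<b}"] by (simp del: index_mult_mat(1))
  finally show ?thesis by (rule nn_integral_of_has_bochner) simp
qed

section \<open>Inverse moments of the squared Frobenius norm\<close>

lemma AE_gauss_mat_nonzero: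
  assumes "0 < r" "0 < c"
  shows "AE X in gauss_mat r c. frob_sq X \<noteq> 0"
proof (rule AE_I)
  let ?I = "{..<r} \<times> {..<c}"
  let ?N = "{X \<in> carrier_mat r c. \<forall>p\<in>?I. X $$ p \<in> {0}}"
  show "?N \<in> sets (gauss_mat r c)" using sets_mat_box[of "\<lambda>_. {0}" r c] by simp
  show "{X \<in> space (gauss_mat r c). \<not> frob_sq X \<noteq> 0} \<subseteq> ?N"
  proof
    fix X assume "X \<in> {X \<in> space (gauss_mat r c). \<not> frob_sq X \<noteq> 0}"
    then have X: "X \<in> carrier_mat r c" "frob_sq X = 0" by auto
    have "X = 0\<^sub>m r c" using X frob_sq_zero_iff[of X] by auto
    then show "X \<in> ?N" by auto
  qed
  have "emeasure std_normal_distribution {0} = 0"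
    using AE_lborel_singleton[of 0] by (simp add: emeasure_density)
  then show "emeasure (gauss_mat r c) ?N = 0"
    using gauss_mat_box[of "\<lambda>_. {0}" r c] assms by (auto simp: prod_zero_iff lessThan_empty_iff)
qed

text \<open>The product of the two exponentials is a multiple of the normal density with variance 1
  / (1 + 2 t).\<close>

lemma nn_integral_std_normal_exp_sq:
  assumes t: "0 \<le> t"
  shows "(\<integral>\<^sup>+x. ennreal (exp (- t * x\<^sup>2)) \<partial>std_normal_distribution) = ennreal (1 / sqrt (1 + 2 * t))"
proof -
  let ?s = "1 / sqrt (1 + 2 * t)"
  have s: "0 < ?s" using t by simp
  have eq: "std_normal_density x * exp (- t * x\<^sup>2) = ?s * normal_density 0 ?s x" for x
  proof -
    have 1: "?s\<^sup>2 = 1 / (1 + 2 * t)" using t by (simp add: power_divide)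
    have "std_normal_density x * exp (- t * x\<^sup>2) = 1 / sqrt (2 * pi) * (exp (- x\<^sup>2 / 2) * exp (- t * x\<^sup>2))"
      by (simp add: std_normal_density_def)
    also have "exp (- x\<^sup>2 / 2) * exp (- t * x\<^sup>2) = exp (- x\<^sup>2 / (2 * ?s\<^sup>2))"
      unfolding 1 mult_exp_exp using t by (simp add: field_simps)
    also have "1 / sqrt (2 * pi) = ?s * (1 / sqrt (2 * pi * ?s\<^sup>2))"
      using s by (simp add: real_sqrt_mult real_sqrt_abs)
    finally show ?thesis by (simp add: normal_density_def)
  qed
  have "(\<integral>\<^sup>+x. ennreal (exp (- t * x\<^sup>2)) \<partial>std_normal_distribution)
    = (\<integral>\<^sup>+x. ennreal (std_normal_density x) * ennreal (exp (- t * x\<^sup>2)) \<partial>lborel)"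
    by (rule nn_integral_std_normal) simp
  also have "\<dots> = (\<integral>\<^sup>+x. ennreal ?s * ennreal (normal_density 0 ?s x) \<partial>lborel)"
    using s by (simp only: ennreal_mult'[symmetric] normal_density_nonneg eq less_imp_le)
  also have "\<dots> = ennreal ?s * (\<integral>\<^sup>+x. ennreal (normal_density 0 ?s x) \<partial>lborel)"
    by (rule nn_integral_cmult) simp
  also have "(\<integral>\<^sup>+x. ennreal (normal_density 0 ?s x) \<partial>lborel) = 1"
    using prob_space.emeasure_space_1[OF prob_space_normal_density[OF s, of 0]] by (simp add: emeasure_density)
  finally show ?thesis by simp
qed

lemma nn_integral_gauss_mat_exp_frob_sq:
  assumes t: "0 \<le> t"
  shows "(\<integral>\<^sup>+Y. ennreal (exp (- t * frob_sq Y)) \<partial>gauss_mat n 1) = ennreal ((1 / sqrt (1 + 2 * t)) ^ n)"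
proof -
  let ?I = "{..<n} \<times> {..<1::nat}"
  have m: "(\<lambda>Y. ennreal (exp (- t * frob_sq Y))) \<in> borel_measurable (mat_borel n 1)"
    using mat_borel_frob_sq[of "\<lambda>x. x" "mat_borel n 1" n 1] by simp
  have "(\<integral>\<^sup>+Y. ennreal (exp (- t * frob_sq Y)) \<partial>gauss_mat n 1)
     = (\<integral>\<^sup>+x. ennreal (exp (- t * frob_sq (mat n 1 x))) \<partial>normal_PiM ?I)"
    by (rule nn_integral_gauss_mat[OF m])
  also have "\<dots> = (\<integral>\<^sup>+x. (\<Prod>p\<in>?I. ennreal (exp (- t * (x p)\<^sup>2))) \<partial>normal_PiM ?I)"
  proof (intro nn_integral_cong)
    fix x
    have "frob_sq (mat n 1 x) = (\<Sum>p\<in>?I. (x p)\<^sup>2)"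
    proof -
      have "(\<Sum>p\<in>?I. (x p)\<^sup>2) = (\<Sum>i<n. \<Sum>j<1. (x (i, j))\<^sup>2)"
        by (simp only: sum.cartesian_product case_prod_unfold prod.collapse)
      then show ?thesis unfolding frob_sq_def by simp
    qed
    then have "exp (- t * frob_sq (mat n 1 x)) = (\<Prod>p\<in>?I. exp (- t * (x p)\<^sup>2))"
      by (simp add: exp_sum[symmetric] sum_distrib_left sum_negf)
    then show "ennreal (exp (- t * frob_sq (mat n 1 x))) = (\<Prod>p\<in>?I. ennreal (exp (- t * (x p)\<^sup>2)))"
      by (simp add: prod_ennreal)
  qed
  also have "\<dots> = (\<Prod>p\<in>?I. \<integral>\<^sup>+x. ennreal (exp (- t * x\<^sup>2)) \<partial>std_normal_distribution)"
    by (rule normal_prod.product_nn_integral_prod) auto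
  also have "\<dots> = (\<Prod>p\<in>?I. ennreal (1 / sqrt (1 + 2 * t)))"
    by (simp only: nn_integral_std_normal_exp_sq[OF t])
  also have "\<dots> = ennreal ((1 / sqrt (1 + 2 * t)) ^ n)"
    using t by (simp add: ennreal_power card_cartesian_product)
  finally show ?thesis .
qed

text \<open>A negative power of a positive number as a superposition of exponentials, which reduces
  negative moments of \<open>frob_sq\<close> to its Laplace transform.\<close>

lemma inverse_power_Laplace:
  assumes s: "0 \<le> (s :: real)"
  shows "ennreal (1 / s ^ Suc k) \<le> (\<integral>\<^sup>+t. ennreal (t ^ k / fact k) * indicator {0..} t * ennreal (exp (- t * s)) \<partial>lborel)"
\<comment> \<open>At s = 0 the left side is 0, because 1 / 0 = 0, whereas the integral diverges; for
  this reason the lemma is an inequality.\<close>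
proof (cases "s = 0")
  case False
  then have s: "0 < s" using assms by simp
  \<comment> \<open>The Erlang density with rate s has total mass one; dividing by s^(k + 1) gives
    the Gamma integral.\<close>
  have "1 = (\<integral>\<^sup>+t. ennreal (erlang_density k s t) \<partial>lborel)"
    using prob_space.emeasure_space_1[OF prob_space_erlang_density[OF s, of k]] by (simp add: emeasure_density)
  also have "\<dots> = (\<integral>\<^sup>+t. ennreal (s ^ Suc k) * (ennreal (t ^ k / fact k) * indicator {0..} t * ennreal (exp (- t * s))) \<partial>lborel)"
  proof (intro nn_integral_cong)
    fix t
    show "ennreal (erlang_density k s t) = ennreal (s ^ Suc k) * (ennreal (t ^ k / fact k) * indicator {0..} t * ennreal (exp (- t * s)))"
      using s by (auto simp: erlang_density_def ennreal_mult'[symmetric] mult_ac indicator_def)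
  qed
  also have "\<dots> = ennreal (s ^ Suc k) * (\<integral>\<^sup>+t. ennreal (t ^ k / fact k) * indicator {0..} t * ennreal (exp (- t * s)) \<partial>lborel)"
    by (rule nn_integral_cmult) simp
  finally have 1: "1 = ennreal (s ^ Suc k) * (\<integral>\<^sup>+t. ennreal (t ^ k / fact k) * indicator {0..} t * ennreal (exp (- t * s)) \<partial>lborel)" .
  have "ennreal (1 / s ^ Suc k) = ennreal (1 / s ^ Suc k) * 1" by simp
  also have "\<dots> = (ennreal (1 / s ^ Suc k) * ennreal (s ^ Suc k)) *
      (\<integral>\<^sup>+t. ennreal (t ^ k / fact k) * indicator {0..} t * ennreal (exp (- t * s)) \<partial>lborel)"
    by (subst 1) (simp only: mult.assoc)
  also have "ennreal (1 / s ^ Suc k) * ennreal (s ^ Suc k) = 1"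
    using s by (simp add: ennreal_mult'[symmetric])
  finally show ?thesis by simp
qed simp

text \<open>The squared norm of n standard normals has Laplace transform (1 + 2 t)^(- n / 2).
  Exchanging the two integrals reduces a negative moment to a one-dimensional integral.\<close>

lemma nn_integral_inverse_frob_sq_power:
  "(\<integral>\<^sup>+Y. ennreal (1 / frob_sq Y ^ Suc k) \<partial>gauss_mat n 1)
    \<le> (\<integral>\<^sup>+t. ennreal (t ^ k / fact k * (1 + 2 * t) powr (- real n / 2)) * indicator {0..} t \<partial>lborel)"
proof -
  interpret G: prob_space "gauss_mat n 1" by (rule prob_space_gauss_mat)
  interpret P: pair_sigma_finite "gauss_mat n 1" lborel by unfold_locales
  have m: "frob_sq \<in> borel_measurable (gauss_mat n 1)"
    using mat_borel_frob_sq[OF measurable_ident_gauss_mat[of n 1]] .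
  have "(\<integral>\<^sup>+Y. ennreal (1 / frob_sq Y ^ Suc k) \<partial>gauss_mat n 1)
     \<le> (\<integral>\<^sup>+Y. \<integral>\<^sup>+t. ennreal (t ^ k / fact k) * indicator {0..} t * ennreal (exp (- t * frob_sq Y)) \<partial>lborel \<partial>gauss_mat n 1)"
    by (intro nn_integral_mono inverse_power_Laplace) simp
  also have "\<dots> = (\<integral>\<^sup>+t. \<integral>\<^sup>+Y. ennreal (t ^ k / fact k) * indicator {0..} t * ennreal (exp (- t * frob_sq Y)) \<partial>gauss_mat n 1 \<partial>lborel)"
  proof (rule P.Fubini'[symmetric])
    have [measurable]: "frob_sq \<in> borel_measurable (gauss_mat n 1)" by (rule m)
    show "(\<lambda>(Y, t). ennreal (t ^ k / fact k) * indicator {0..} t * ennreal (exp (- t * frob_sq Y)))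
        \<in> borel_measurable (gauss_mat n 1 \<Otimes>\<^sub>M lborel)"
      by measurable
  qed
  also have "\<dots> = (\<integral>\<^sup>+t. ennreal (t ^ k / fact k) * indicator {0..} t * (\<integral>\<^sup>+Y. ennreal (exp (- t * frob_sq Y)) \<partial>gauss_mat n 1) \<partial>lborel)"
    using m by (intro nn_integral_cong nn_integral_cmult) simp
  also have "\<dots> = (\<integral>\<^sup>+t. ennreal (t ^ k / fact k * (1 + 2 * t) powr (- real n / 2)) * indicator {0..} t \<partial>lborel)"
  proof (intro nn_integral_cong)
    fix t :: real
    show "ennreal (t ^ k / fact k) * indicator {0..} t * (\<integral>\<^sup>+Y. ennreal (exp (- t * frob_sq Y)) \<partial>gauss_mat n 1)
       = ennreal (t ^ k / fact k * (1 + 2 * t) powr (- real n / 2)) * indicator {0..} t"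
    proof (cases "0 \<le> t")
      case True
      have "(1 / sqrt (1 + 2 * t)) ^ n = (1 + 2 * t) powr (- real n / 2)"
      proof -
        have "1 / sqrt (1 + 2 * t) = (1 + 2 * t) powr (- 1 / 2)"
          using True by (simp add: powr_half_sqrt[symmetric] powr_minus_divide)
        then have "(1 / sqrt (1 + 2 * t)) ^ n = ((1 + 2 * t) powr (- 1 / 2)) powr real n"
          using True by (simp add: powr_realpow)
        then show ?thesis by (simp add: powr_powr)
      qed
      then show ?thesis using True
        by (subst nn_integral_gauss_mat_exp_frob_sq[OF True]) (simp add: ennreal_mult'[symmetric])
    qed simp
  qed
  finally show ?thesis .
qed

lemma powr_neg_tendsto_0: "s < 0 \<Longrightarrow> ((\<lambda>t. (1 + 2 * t) powr s) \<longlongrightarrow> (0 :: real)) at_top"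
proof (rule tendsto_neg_powr)
  show "filterlim (\<lambda>t. 1 + 2 * t :: real) at_top at_top"
    by (intro filterlim_tendsto_add_at_top[OF tendsto_const] filterlim_tendsto_pos_mult_at_top[OF tendsto_const] filterlim_ident) auto
qed

lemma mult_two_cancel: "x < 0 \<Longrightarrow> (x * z * 2) / (2 * x) = (z :: real)"
  by simp

text \<open>The mean of an inverse chi-square variable with n degrees of freedom. From n = 3 on the
  antiderivative has a negative exponent and vanishes at infinity.\<close>

lemma nn_integral_inverse_frob_sq:
  assumes n: "3 \<le> n"
  shows "(\<integral>\<^sup>+Y. ennreal (1 / frob_sq Y) \<partial>gauss_mat n 1) \<le> ennreal (1 / (real n - 2))"
proof -
  let ?a = "- real n / 2 + 1"
  let ?F = "\<lambda>t. (1 + 2 * t) powr ?a / (2 * ?a)"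
  have a: "?a < 0" using n by simp
  have "(\<integral>\<^sup>+Y. ennreal (1 / frob_sq Y) \<partial>gauss_mat n 1)
     \<le> (\<integral>\<^sup>+t. ennreal ((1 + 2 * t) powr (- real n / 2)) * indicator {0..} t \<partial>lborel)"
    using nn_integral_inverse_frob_sq_power[where k = 0 and n = n] by simp
  also have "\<dots> = ennreal (0 - ?F 0)"
  proof (rule nn_integral_FTC_atLeast)
    fix t :: real assume t: "0 \<le> t"
    have "DERIV ?F t :> (?a * (1 + 2 * t) powr (?a - 1) * 2) / (2 * ?a)"
      using t n by (auto intro!: derivative_eq_intros)
    also have "(?a * (1 + 2 * t) powr (?a - 1) * 2) / (2 * ?a) = (1 + 2 * t) powr (- real n / 2)"
      unfolding mult_two_cancel[OF a] by simp
    finally show "DERIV ?F t :> (1 + 2 * t) powr (- real n / 2)" .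
  next
    have "(?F \<longlongrightarrow> 0 / (2 * ?a)) at_top"
      using a by (intro tendsto_divide powr_neg_tendsto_0 tendsto_const) auto
    then show "(?F \<longlongrightarrow> 0) at_top" by simp
  qed auto
  also have "0 - ?F 0 = 1 / (real n - 2)" using n by (simp add: field_simps)
  finally show ?thesis .
qed

lemma nn_integral_inverse_frob_sq_sq:
  assumes n: "5 \<le> n"
  shows "(\<integral>\<^sup>+Y. ennreal (1 / (frob_sq Y)\<^sup>2) \<partial>gauss_mat n 1) \<le> ennreal (1 / ((real n - 2) * (real n - 4)))"
proof -
  let ?a = "- real n / 2 + 1" and ?b = "- real n / 2 + 2"
  \<comment> \<open>Writing t = ((1 + 2 t) - 1) / 2 splits the integrand into two pure powers of 1 +
    2 t. Both antiderivatives vanish at infinity once n exceeds 4.\<close>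
  let ?F = "\<lambda>t. ((1 + 2 * t) powr ?b / (2 * ?b) - (1 + 2 * t) powr ?a / (2 * ?a)) / 2"
  have a: "?a < 0" "?b < 0" using n by simp_all
  have "(\<integral>\<^sup>+Y. ennreal (1 / (frob_sq Y)\<^sup>2) \<partial>gauss_mat n 1)
     \<le> (\<integral>\<^sup>+t. ennreal (t * (1 + 2 * t) powr (- real n / 2)) * indicator {0..} t \<partial>lborel)"
    using nn_integral_inverse_frob_sq_power[where k = 1 and n = n] by (simp add: power2_eq_square)
  also have "\<dots> = ennreal (0 - ?F 0)"
  proof (rule nn_integral_FTC_atLeast)
    fix t :: real assume t: "0 \<le> t"
    have "DERIV ?F t :> ((?b * (1 + 2 * t) powr (?b - 1) * 2) / (2 * ?b) - (?a * (1 + 2 * t) powr (?a - 1) * 2) / (2 * ?a)) / 2"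
      using t n by (auto intro!: derivative_eq_intros)
    also have "((?b * (1 + 2 * t) powr (?b - 1) * 2) / (2 * ?b) - (?a * (1 + 2 * t) powr (?a - 1) * 2) / (2 * ?a)) / 2
      = ((1 + 2 * t) powr (1 + (- real n / 2)) - (1 + 2 * t) powr (- real n / 2)) / 2"
      unfolding mult_two_cancel[OF a(1)] mult_two_cancel[OF a(2)] by simp
    also have "\<dots> = t * (1 + 2 * t) powr (- real n / 2)"
      using t by (subst powr_add) (simp add: algebra_simps)
    finally show "DERIV ?F t :> t * (1 + 2 * t) powr (- real n / 2)" .
  next
    have "(?F \<longlongrightarrow> (0 / (2 * ?b) - 0 / (2 * ?a)) / 2) at_top"
      using a by (intro tendsto_divide tendsto_diff powr_neg_tendsto_0 tendsto_const) auto
    then show "(?F \<longlongrightarrow> 0) at_top" by simp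
  qed auto
  also have "0 - ?F 0 = 1 / ((real n - 2) * (real n - 4))"
  proof -
    define x where "x = real n"
    have "x \<noteq> 2" "x \<noteq> 4" using n by (auto simp: x_def)
    then have "- ((1 / (2 * (- x / 2 + 2)) - 1 / (2 * (- x / 2 + 1))) / 2) = 1 / ((x - 2) * (x - 4))"
      by (simp add: divide_simps) (simp add: algebra_simps)
    then show ?thesis by (simp add: x_def)
  qed
  finally show ?thesis .
qed

section \<open>Orthonormal bases and bordered inverses\<close>

lemma sum_lessThan_add: "(\<Sum>k<a + b. f k) = (\<Sum>k<a. f k) + (\<Sum>k<b. f (a + k) :: real)" for a b :: nat
  by (induction b) (auto simp: add.assoc)

lemma vcat_mult:
  assumes "dim_col R = dim_row N" "dim_col Z = dim_row N"
  shows "vcat R Z * N = vcat (R * N) (Z * N)"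
  by (rule eq_matI) (use assms in \<open>auto simp: mat_mult_index vcat_index simp del: index_mult_mat(1)\<close>)

lemma transpose_vcat_mult:
  assumes "dim_row R = dim_row u" "dim_row Z = dim_row v" "dim_col R = dim_col Z" "dim_col u = dim_col v"
  shows "(vcat R Z)\<^sup>T * vcat u v = R\<^sup>T * u + Z\<^sup>T * v"
  by (rule eq_matI) (use assms in \<open>auto simp: mat_mult_index vcat_index sum_lessThan_add simp del: index_mult_mat(1)\<close>)

lemma frob_sq_vcat:
  assumes "dim_col u = dim_col v" shows "frob_sq (vcat u v) = frob_sq u + frob_sq v"
  unfolding frob_sq_def using assms by (simp add: vcat_index sum_lessThan_add)

lemma vcat_split:
  assumes "v \<in> carrier_mat (a + b) k"
  shows "v = vcat (mat a k (\<lambda>(i, j). v $$ (i, j))) (mat b k (\<lambda>(i, j). v $$ (a + i, j)))"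
  by (rule eq_matI) (use assms in \<open>auto simp: vcat_index\<close>)

lemma vcat_zero_iff:
  assumes "u \<in> carrier_mat a k" "v \<in> carrier_mat b k"
  shows "vcat u v = 0\<^sub>m (a + b) k \<longleftrightarrow> u = 0\<^sub>m a k \<and> v = 0\<^sub>m b k"
proof -
  have "vcat u v = 0\<^sub>m (a + b) k \<longleftrightarrow> frob_sq (vcat u v) = 0"
    using assms frob_sq_zero_iff[of "vcat u v"] by auto
  also have "\<dots> \<longleftrightarrow> frob_sq u = 0 \<and> frob_sq v = 0"
    using assms by (subst frob_sq_vcat) (auto simp: add_nonneg_eq_0_iff)
  finally show ?thesis using assms frob_sq_zero_iff[of u] frob_sq_zero_iff[of v] by auto
qed

lemma transpose_add_dim:
  "dim_row A = dim_row B \<Longrightarrow> dim_col A = dim_col B \<Longrightarrow> (A + B)\<^sup>T = A\<^sup>T + (B\<^sup>T :: real mat)"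
  by (rule eq_matI) auto

lemma transpose_smult_mat: "(x \<cdot>\<^sub>m A)\<^sup>T = x \<cdot>\<^sub>m (A\<^sup>T :: real mat)"
  by (rule eq_matI) auto

lemma add_zero_dim: "dim_row A = n \<Longrightarrow> dim_col A = m \<Longrightarrow> A + 0\<^sub>m n m = (A :: real mat)"
  by (rule eq_matI) auto

lemma mult_smult_dim: "dim_col A = dim_row B \<Longrightarrow> A * (x \<cdot>\<^sub>m B) = x \<cdot>\<^sub>m (A * B :: real mat)"
  by (rule mult_smult_distrib[of _ "dim_row A" "dim_col A" _ "dim_col B"]) auto

lemma minus_self_dim: "(A :: real mat) - A = 0\<^sub>m (dim_row A) (dim_col A)"
  by (rule eq_matI) auto

lemma mult_transpose_row:
  assumes "w \<in> carrier_mat 1 n" shows "w * w\<^sup>T = frob_sq w \<cdot>\<^sub>m 1\<^sub>m 1"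
  by (rule eq_matI) (use assms in \<open>auto simp: mat_mult_index frob_sq_def power2_eq_square simp del: index_mult_mat(1)\<close>)

lemma gram_det_nz:
  assumes L: "L \<in> carrier_mat a n" and "\<And>v. v \<in> carrier_mat n 1 \<Longrightarrow> L * v = 0\<^sub>m a 1 \<Longrightarrow> v = 0\<^sub>m n 1"
  shows "mdet (L\<^sup>T * L) \<noteq> 0"
proof (rule det_nz_of_kernel)
  show "L\<^sup>T * L \<in> carrier_mat n n" using L by auto
  fix v :: "real mat" assume v: "v \<in> carrier_mat n 1" "L\<^sup>T * L * v = 0\<^sub>m n 1"
  then show "v = 0\<^sub>m n 1" using gram_zero[of L v] L by (intro assms(2)) auto
qed

lemma gram_kernel:
  assumes L: "L \<in> carrier_mat a n" "mdet (L\<^sup>T * L) \<noteq> 0" and v: "v \<in> carrier_mat n k" "L * v = 0\<^sub>m a k"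
  shows "v = 0\<^sub>m n k"
proof -
  have "v = minv (L\<^sup>T * L) * ((L\<^sup>T * L) * v)"
    using L v by (intro mat_mult_cancel_left[OF minv_mult(2), symmetric]) auto
  also have "(L\<^sup>T * L) * v = L\<^sup>T * (L * v)" using L v by (simp add: mult_assoc_dim)
  also have "minv (L\<^sup>T * L) * (L\<^sup>T * (L * v)) = 0\<^sub>m n k"
    unfolding v(2) using L by (simp add: right_mult_zero_mat[of _ n a] right_mult_zero_mat[of _ n n])
  finally show ?thesis .
qed

text \<open>Gram-Schmidt on the rows of \<open>B\<close>, keeping only those that enlarge the span.
  The rows of \<open>P\<close> span the row space, and the coordinates \<open>B * P\<^sup>T\<close>
  have full column rank, so \<open>B\<close> gets a full-rank factorisation without a separate
  notion of rank.\<close>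

lemma orthonormal_row_basis:
  "B \<in> carrier_mat c n \<Longrightarrow> \<exists>r P. r \<le> c \<and> r \<le> n \<and> P \<in> carrier_mat r n \<and> P * P\<^sup>T = 1\<^sub>m r \<and>
     B * (P\<^sup>T * P) = B \<and> mdet ((B * P\<^sup>T)\<^sup>T * (B * P\<^sup>T)) \<noteq> 0"
proof (induction c arbitrary: B)
  case 0
  have P: "0\<^sub>m 0 n * (0\<^sub>m 0 n)\<^sup>T = (1\<^sub>m 0 :: real mat)" by (rule eq_matI) auto
  have d: "mdet ((B * (0\<^sub>m 0 n)\<^sup>T)\<^sup>T * (B * (0\<^sub>m 0 n)\<^sup>T)) \<noteq> 0"
    using 0 by (intro gram_det_nz[of _ 0 0]) auto
  have "B * ((0\<^sub>m 0 n)\<^sup>T * 0\<^sub>m 0 n) = B" by (rule eq_matI) (use 0 in auto)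
  then show ?case using P d by (intro exI[of _ 0] exI[of _ "0\<^sub>m 0 n"]) auto
next
  case (Suc c)
  define B' where "B' = mat c n (\<lambda>(i, j). B $$ (i, j))"
  define b where "b = mat 1 n (\<lambda>(i, j). B $$ (c + i, j))"
  have Bv: "B = vcat B' b" using vcat_split[of B c 1 n] Suc.prems by (simp add: B'_def b_def)
  have B': "B' \<in> carrier_mat c n" and b: "b \<in> carrier_mat 1 n" by (auto simp: B'_def b_def)
  obtain r P where rc: "r \<le> c" "r \<le> n" and P: "P \<in> carrier_mat r n" and PP: "P * P\<^sup>T = 1\<^sub>m r"
    and BP: "B' * (P\<^sup>T * P) = B'" and det: "mdet ((B' * P\<^sup>T)\<^sup>T * (B' * P\<^sup>T)) \<noteq> 0"
    using Suc.IH[OF B'] by blast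
  have d: "dim_row B' = c" "dim_col B' = n" "dim_row b = 1" "dim_col b = n" "dim_row P = r" "dim_col P = n"
    using B' b P by auto
  have BPc: "B' * P\<^sup>T \<in> carrier_mat c r" using d by (intro carrier_matI) auto
  \<comment> \<open>The part of the new row orthogonal to the basis so far. If it vanishes the basis
    is kept; otherwise it is normalised and appended.\<close>
  define w where "w = b - b * (P\<^sup>T * P)"
  have w: "w \<in> carrier_mat 1 n" "dim_row w = 1" "dim_col w = n" using d by (auto simp: w_def)
  have Pw: "P * w\<^sup>T = 0\<^sub>m r 1"
  proof -
    have "w * P\<^sup>T = b * P\<^sup>T - b * (P\<^sup>T * (P * P\<^sup>T))" using d by (simp add: w_def mat_ring)
    also have "\<dots> = 0\<^sub>m 1 r" unfolding PP using d by (simp add: mult_one_dim minus_self_dim)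
    finally have "(w * P\<^sup>T)\<^sup>T = (0\<^sub>m 1 r)\<^sup>T" by simp
    then show ?thesis using d w by (simp add: transpose_mult_dim)
  qed
  show ?case
  proof (cases "frob_sq w = 0")
    case True
    then have w0: "w = 0\<^sub>m 1 n" using frob_sq_zero_iff[of w] w by auto
    have bP: "b * (P\<^sup>T * P) = b"
    proof (rule eq_matI)
      fix i j assume ij: "i < dim_row b" "j < dim_col b"
      have "w $$ (i, j) = b $$ (i, j) - (b * (P\<^sup>T * P)) $$ (i, j)"
        using ij d unfolding w_def by (simp del: index_mult_mat(1))
      then show "(b * (P\<^sup>T * P)) $$ (i, j) = b $$ (i, j)" using w0 ij d by (simp del: index_mult_mat(1))
    qed (use d in auto)
    have "B * (P\<^sup>T * P) = B" unfolding Bv using d by (subst vcat_mult) (simp_all add: BP bP)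
    moreover have "mdet ((B * P\<^sup>T)\<^sup>T * (B * P\<^sup>T)) \<noteq> 0"
    proof (rule gram_det_nz)
      show "B * P\<^sup>T \<in> carrier_mat (c + 1) r" using d by (auto simp: Bv)
      fix v :: "real mat" assume v: "v \<in> carrier_mat r 1" "B * P\<^sup>T * v = 0\<^sub>m (c + 1) 1"
      have "B * P\<^sup>T * v = vcat (B' * P\<^sup>T * v) (b * P\<^sup>T * v)"
        unfolding Bv using d v(1) by (simp add: vcat_mult)
      moreover have "B' * P\<^sup>T * v \<in> carrier_mat c 1" "b * P\<^sup>T * v \<in> carrier_mat 1 1"
        using d v(1) by (auto intro!: carrier_matI)
      ultimately have "B' * P\<^sup>T * v = 0\<^sub>m c 1"
        using v(2) vcat_zero_iff[of "B' * P\<^sup>T * v" c 1 "b * P\<^sup>T * v" 1] by simp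
      then show "v = 0\<^sub>m r 1" using gram_kernel[OF BPc det v(1)] by auto
    qed
    ultimately show ?thesis using rc P PP by (intro exI[of _ r] exI[of _ P]) auto
  next
    case False
    define \<nu> where "\<nu> = sqrt (frob_sq w)"
    have \<nu>: "\<nu> > 0" "\<nu> * \<nu> = frob_sq w" using False by (auto simp: \<nu>_def less_le)
    define u where "u = (1 / \<nu>) \<cdot>\<^sub>m w"
    have u: "dim_row u = 1" "dim_col u = n" "u \<in> carrier_mat 1 n" using w by (auto simp: u_def)
    have wu: "w = \<nu> \<cdot>\<^sub>m u" using \<nu> by (intro eq_matI) (auto simp: u_def)
    have Pu: "P * u\<^sup>T = 0\<^sub>m r 1"
    proof -
      have "u\<^sup>T = (1 / \<nu>) \<cdot>\<^sub>m w\<^sup>T" by (rule eq_matI) (auto simp: u_def)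
      then have "P * u\<^sup>T = (1 / \<nu>) \<cdot>\<^sub>m (P * w\<^sup>T)" using d w by (simp add: mult_smult_dim)
      also have "\<dots> = 0\<^sub>m r 1" unfolding Pw by (rule eq_matI) auto
      finally show ?thesis .
    qed
    have uP: "u * P\<^sup>T = 0\<^sub>m 1 r" using arg_cong[OF Pu, of transpose_mat] u d by (simp add: transpose_mult_dim)
    have uu: "u * u\<^sup>T = 1\<^sub>m 1"
    proof -
      have "frob_sq u = 1" using \<nu> False by (simp add: u_def frob_sq_smult power_divide power2_eq_square)
      then show ?thesis using mult_transpose_row[OF u(3)] by auto
    qed
    \<comment> \<open>If r were n, the square matrix \<open>P\<close> would be orthogonal and no
      residual could remain.\<close>
    have rn: "r < n"
    proof (rule ccontr)
      assume "\<not> r < n"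
      then have "r = n" using rc by simp
      then have "P\<^sup>T * P = 1\<^sub>m n" using mat_mult_left_right_inverse[of P n "P\<^sup>T"] P PP by auto
      then have "w = 0\<^sub>m 1 n" using d by (simp add: w_def mat_ring minus_self_dim)
      then show False using False frob_sq_zero_iff[of w] w by auto
    qed
    define P2 where "P2 = vcat P u"
    have P2: "P2 \<in> carrier_mat (r + 1) n" "dim_row P2 = r + 1" "dim_col P2 = n" using d u by (auto simp: P2_def)
    have PP2: "P2 * P2\<^sup>T = 1\<^sub>m (r + 1)"
    proof -
      have "P * P2\<^sup>T = (vcat (P * P\<^sup>T) (u * P\<^sup>T))\<^sup>T"
      proof -
        have "P * P2\<^sup>T = (P2 * P\<^sup>T)\<^sup>T" using d P2 by (simp add: transpose_mult_dim)
        then show ?thesis unfolding P2_def using d u by (simp add: vcat_mult)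
      qed
      moreover have "u * P2\<^sup>T = (vcat (P * u\<^sup>T) (u * u\<^sup>T))\<^sup>T"
      proof -
        have "u * P2\<^sup>T = (P2 * u\<^sup>T)\<^sup>T" using u P2 by (simp add: transpose_mult_dim)
        then show ?thesis unfolding P2_def using d u by (simp add: vcat_mult)
      qed
      ultimately have "P2 * P2\<^sup>T = vcat ((vcat (1\<^sub>m r) (0\<^sub>m 1 r))\<^sup>T) ((vcat (0\<^sub>m r 1) (1\<^sub>m 1))\<^sup>T)"
        using P2 d u by (subst P2_def, subst vcat_mult) (auto simp: PP uP Pu uu)
      also have "\<dots> = 1\<^sub>m (r + 1)" by (rule eq_matI) (auto simp: vcat_index)
      finally show ?thesis .
    qed
    have gram2: "P2\<^sup>T * P2 = P\<^sup>T * P + u\<^sup>T * u"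
      unfolding P2_def using d u by (intro transpose_vcat_mult) auto
    have Bu: "B' * u\<^sup>T = 0\<^sub>m c 1"
    proof -
      have "B' * u\<^sup>T = B' * P\<^sup>T * (P * u\<^sup>T)" using arg_cong[OF BP, of "\<lambda>M. M * u\<^sup>T"] d u by (simp add: mat_ring)
      then show ?thesis unfolding Pu using d by (simp add: right_mult_zero_mat[of _ c r])
    qed
    have bdec: "b = b * (P\<^sup>T * P) + w" by (rule eq_matI) (use d in \<open>auto simp: w_def\<close>)
    have bu: "b * u\<^sup>T = \<nu> \<cdot>\<^sub>m 1\<^sub>m 1"
    proof -
      have "b * u\<^sup>T = b * P\<^sup>T * (P * u\<^sup>T) + w * u\<^sup>T"
        using arg_cong[OF bdec, of "\<lambda>M. M * u\<^sup>T"] d u w by (simp add: mat_ring)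
      also have "b * P\<^sup>T * (P * u\<^sup>T) = 0\<^sub>m 1 1" unfolding Pu using d by (simp add: right_mult_zero_mat[of _ 1 r])
      also have "w * u\<^sup>T = \<nu> \<cdot>\<^sub>m (u * u\<^sup>T)" unfolding wu using u by (simp add: mult_smult_assoc_mat[of _ 1 n _ 1])
      finally show ?thesis unfolding uu by simp
    qed
    have BB2: "B * (P2\<^sup>T * P2) = B"
    proof -
      have "B' * (P2\<^sup>T * P2) = B' * (P\<^sup>T * P) + (B' * u\<^sup>T) * u"
        unfolding gram2 using d u by (simp add: mat_ring)
      also have "\<dots> = B'" unfolding BP Bu using B' u by (simp add: left_mult_zero_mat[of _ 1 n])
      finally have 1: "B' * (P2\<^sup>T * P2) = B'" .
      have "b * (P2\<^sup>T * P2) = b * (P\<^sup>T * P) + (b * u\<^sup>T) * u"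
        unfolding gram2 using d u by (simp add: mat_ring)
      also have "(b * u\<^sup>T) * u = w" unfolding bu wu using u by (simp add: mult_smult_assoc_mat[of _ 1 1 _ n] one_mult_dim)
      finally have 2: "b * (P2\<^sup>T * P2) = b" using bdec by simp
      show ?thesis unfolding Bv using d P2 by (subst vcat_mult) (simp_all add: 1 2)
    qed
    have "mdet ((B * P2\<^sup>T)\<^sup>T * (B * P2\<^sup>T)) \<noteq> 0"
    proof (rule gram_det_nz)
      show "B * P2\<^sup>T \<in> carrier_mat (c + 1) (r + 1)" using d P2 by (auto simp: Bv)
      fix v :: "real mat" assume v: "v \<in> carrier_mat (r + 1) 1" "B * P2\<^sup>T * v = 0\<^sub>m (c + 1) 1"
      define v1 where "v1 = mat r 1 (\<lambda>(i, j). v $$ (i, j))"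
      define v2 where "v2 = mat 1 1 (\<lambda>(i, j). v $$ (r + i, j))"
      have vv: "v = vcat v1 v2" using vcat_split[OF v(1)] by (simp add: v1_def v2_def)
      have vd: "v1 \<in> carrier_mat r 1" "v2 \<in> carrier_mat 1 1" by (auto simp: v1_def v2_def)
      have x: "P2\<^sup>T * v = P\<^sup>T * v1 + u\<^sup>T * v2"
        unfolding P2_def vv using d u vd by (intro transpose_vcat_mult) auto
      have "B * P2\<^sup>T * v = vcat (B' * (P2\<^sup>T * v)) (b * (P2\<^sup>T * v))"
        unfolding Bv using d v(1) P2 by (simp add: vcat_mult mult_assoc_dim)
      moreover have "B' * (P2\<^sup>T * v) \<in> carrier_mat c 1" "b * (P2\<^sup>T * v) \<in> carrier_mat 1 1"
        using d v(1) by (auto intro!: carrier_matI)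
      ultimately have z: "B' * (P2\<^sup>T * v) = 0\<^sub>m c 1" "b * (P2\<^sup>T * v) = 0\<^sub>m 1 1"
        using v(2) vcat_zero_iff[of "B' * (P2\<^sup>T * v)" c 1 "b * (P2\<^sup>T * v)" 1] by simp_all
      have "B' * (P2\<^sup>T * v) = B' * P\<^sup>T * v1 + (B' * u\<^sup>T) * v2" unfolding x using d u vd by (simp add: mat_ring)
      also have "\<dots> = B' * P\<^sup>T * v1" unfolding Bu using d vd
        by (simp add: left_mult_zero_mat[of _ 1 1] add_zero_dim mult_assoc_dim)
      finally have v1: "v1 = 0\<^sub>m r 1" using gram_kernel[OF BPc det vd(1)] z by auto
      have "b * (P2\<^sup>T * v) = (b * u\<^sup>T) * v2"
        unfolding x v1 using d u vd by (simp add: mat_ring right_mult_zero_mat[of _ n r])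
      also have "\<dots> = \<nu> \<cdot>\<^sub>m v2" unfolding bu using vd by (simp add: mult_smult_assoc_mat[of _ 1 1 _ 1] one_mult_dim)
      finally have "\<nu> \<cdot>\<^sub>m v2 = 0\<^sub>m 1 1" using z by simp
      then have "(\<nu> \<cdot>\<^sub>m v2) $$ (0, 0) = 0" by simp
      then have "v2 $$ (0, 0) = 0" using \<nu> vd by simp
      then have "v2 = 0\<^sub>m 1 1" using vd by (intro eq_matI) auto
      then show "v = 0\<^sub>m (r + 1) 1" unfolding vv v1 using vcat_zero_iff[of "0\<^sub>m r 1" r 1 "0\<^sub>m 1 1" 1] by simp
    qed
    then show ?thesis using rc rn P2 PP2 BB2 by (intro exI[of _ "r + 1"] exI[of _ P2]) auto
  qed
qed

text \<open>Applied to the transpose, the row basis becomes an orthonormal basis of the range of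
  \<open>A\<close>. Then \<open>A = P\<^sup>T * (P * A)\<close>, and \<open>P * A\<close> has full
  row rank.\<close>

lemma pinv_exists: "\<exists>X. is_pinv A X"
proof -
  have "A\<^sup>T \<in> carrier_mat (dim_col A) (dim_row A)" by simp
  from orthonormal_row_basis[OF this] obtain r P where P: "P \<in> carrier_mat r (dim_row A)" "P * P\<^sup>T = 1\<^sub>m r"
    and AP: "A\<^sup>T * (P\<^sup>T * P) = A\<^sup>T" and det: "mdet ((A\<^sup>T * P\<^sup>T)\<^sup>T * (A\<^sup>T * P\<^sup>T)) \<noteq> 0" by blast
  have "A = (A\<^sup>T * (P\<^sup>T * P))\<^sup>T" unfolding AP by simp
  also have "\<dots> = P\<^sup>T * (P * A)" using P by (simp add: mat_ring)
  finally have A: "A = P\<^sup>T * (P * A)" .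
  have "is_pinv (P\<^sup>T * (P * A)) ((P * A)\<^sup>T * minv ((P * A) * (P * A)\<^sup>T) * P\<^sup>T\<^sup>T)"
    using P det by (intro is_pinv_factor[of _ "dim_row A" r _ "dim_col A"]) (auto simp: transpose_mult_dim)
  then show ?thesis using A by auto
qed

lemma pinv_is_pinv: "is_pinv A (pinv A)"
  using pinv_exists[of A] pinv_eqI by metis

text \<open>\<open>k\<close> holds the regression coefficients of \<open>y\<close> on the rows of
  \<open>R\<close> and \<open>p\<close> is the residual, whose squared length is the Schur
  complement of the bordered Gram matrix. If it is nonzero the Gram matrix is invertible, and block
  inversion gives the last column of the inverse as (-k, 1) divided by that squared length.\<close>

lemma bordered_inverse:
  assumes R: "R \<in> carrier_mat r c" "mdet (R * R\<^sup>T) \<noteq> 0" and y: "y \<in> carrier_mat c 1"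
  defines "k \<equiv> minv (R * R\<^sup>T) * R * y"
  defines "p \<equiv> y - R\<^sup>T * k"
  defines "X \<equiv> vcat R (y\<^sup>T)"
  assumes p0: "frob_sq p \<noteq> 0"
  shows "mdet (X * X\<^sup>T) \<noteq> 0"
    and "minv (X * X\<^sup>T) * vcat (0\<^sub>m r 1) (1\<^sub>m 1)
      = vcat ((- 1 / frob_sq p) \<cdot>\<^sub>m k) ((1 / frob_sq p) \<cdot>\<^sub>m 1\<^sub>m 1)"
proof -
  let ?S = "R * R\<^sup>T"
  have d: "dim_row R = r" "dim_col R = c" "dim_row y = c" "dim_col y = 1" using R y by auto
  have kd: "dim_row k = r" "dim_col k = 1" using d by (auto simp: k_def)
  have pd: "dim_row p = c" "dim_col p = 1" using d kd by (auto simp: p_def)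
  have Xd: "dim_row X = r + 1" "dim_col X = c" using d by (auto simp: X_def)
  have Rp: "R * p = 0\<^sub>m r 1"
  proof -
    have "?S * k = R * y"
      unfolding k_def using d R minv_mult(1)[of ?S r]
      by (simp add: mult_assoc_dim[of "minv ?S"] mat_mult_cancel_left del: mult_assoc_dim)
    then have "R * p = R * y - R * y" using d kd by (simp add: p_def mat_ring)
    then show ?thesis using d by (simp add: minus_self_dim)
  qed
  have yp: "y\<^sup>T * p = frob_sq p \<cdot>\<^sub>m 1\<^sub>m 1"
  proof -
    have y': "y = p + R\<^sup>T * k" using d kd by (intro eq_matI) (auto simp: p_def)
    have "y\<^sup>T * p = p\<^sup>T * p + k\<^sup>T * (R * p)"
      by (subst y') (use d kd pd in \<open>simp add: mat_ring transpose_add_dim\<close>)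
    also have "k\<^sup>T * (R * p) = 0\<^sub>m 1 1" unfolding Rp using kd by (simp add: right_mult_zero_mat[of _ 1 r])
    also have "p\<^sup>T * p = frob_sq p \<cdot>\<^sub>m 1\<^sub>m 1" using mult_transpose_row[of "p\<^sup>T" c] pd by auto
    finally show ?thesis by simp
  qed
  show det: "mdet (X * X\<^sup>T) \<noteq> 0"
  proof -
    have "mdet ((X\<^sup>T)\<^sup>T * X\<^sup>T) \<noteq> 0"
    proof (rule gram_det_nz)
      show "X\<^sup>T \<in> carrier_mat c (r + 1)" using Xd by auto
      fix v :: "real mat" assume v: "v \<in> carrier_mat (r + 1) 1" "X\<^sup>T * v = 0\<^sub>m c 1"
      define v1 where "v1 = mat r 1 (\<lambda>(i, j). v $$ (i, j))"
      define v2 where "v2 = mat 1 1 (\<lambda>(i, j). v $$ (r + i, j))"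
      have vv: "v = vcat v1 v2" using vcat_split[OF v(1)] by (simp add: v1_def v2_def)
      have vd: "v1 \<in> carrier_mat r 1" "v2 \<in> carrier_mat 1 1" by (auto simp: v1_def v2_def)
      have x: "X\<^sup>T * v = R\<^sup>T * v1 + y * v2"
        unfolding X_def vv using d vd by (subst transpose_vcat_mult) auto
      have "p\<^sup>T * (X\<^sup>T * v) = (R * p)\<^sup>T * v1 + (y\<^sup>T * p)\<^sup>T * v2"
        unfolding x using d vd pd by (simp add: mat_ring)
      also have "\<dots> = frob_sq p \<cdot>\<^sub>m v2" unfolding Rp yp using vd
        by (simp add: left_mult_zero_mat[of _ r 1] transpose_smult_mat mult_smult_assoc_mat[of _ 1 1 _ 1] one_mult_dim)
      finally have "frob_sq p \<cdot>\<^sub>m v2 = 0\<^sub>m 1 1" unfolding v(2) using pd by (simp add: right_mult_zero_mat[of _ 1 c])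
      then have "(frob_sq p \<cdot>\<^sub>m v2) $$ (0, 0) = 0" by simp
      then have "v2 $$ (0, 0) = 0" using p0 vd by simp
      then have v2: "v2 = 0\<^sub>m 1 1" using vd by (intro eq_matI) auto
      have "R\<^sup>T * v1 = 0\<^sub>m c 1" using x v(2) v2 d vd by (simp add: right_mult_zero_mat[of _ c 1] add_zero_dim)
      then have v1: "v1 = 0\<^sub>m r 1" using gram_kernel[of "R\<^sup>T" c r v1 1] R vd by auto
      show "v = 0\<^sub>m (r + 1) 1" unfolding vv v1 v2 using vcat_zero_iff[of "0\<^sub>m r 1" r 1 "0\<^sub>m 1 1" 1] by simp
    qed
    then show ?thesis by simp
  qed
  \<comment> \<open>The transpose of \<open>X\<close> sends this vector to \<open>p\<close> divided
    by its squared length. As \<open>p\<close> is orthogonal to the rows of \<open>R\<close> and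
    \<open>y\<^sup>T * p\<close> is that squared length, \<open>X\<close> takes the result to the
    last unit vector.\<close>
  let ?w = "vcat ((- 1 / frob_sq p) \<cdot>\<^sub>m k) ((1 / frob_sq p) \<cdot>\<^sub>m 1\<^sub>m 1)"
  have "X\<^sup>T * ?w = R\<^sup>T * ((- 1 / frob_sq p) \<cdot>\<^sub>m k) + y * ((1 / frob_sq p) \<cdot>\<^sub>m 1\<^sub>m 1)"
    unfolding X_def using d kd by (subst transpose_vcat_mult) auto
  also have "\<dots> = (- 1 / frob_sq p) \<cdot>\<^sub>m (R\<^sup>T * k) + (1 / frob_sq p) \<cdot>\<^sub>m (y * 1\<^sub>m 1)"
    using d kd by (simp add: mult_smult_dim)
  also have "\<dots> = (1 / frob_sq p) \<cdot>\<^sub>m p"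
    using d kd by (intro eq_matI) (auto simp: p_def mult_one_dim diff_divide_distrib simp del: index_mult_mat(1))
  finally have "X * (X\<^sup>T * ?w) = (1 / frob_sq p) \<cdot>\<^sub>m (X * p)"
    using Xd pd by (simp add: mult_smult_dim)
  also have "X * p = vcat (0\<^sub>m r 1) (frob_sq p \<cdot>\<^sub>m 1\<^sub>m 1)"
    unfolding X_def using d pd by (simp add: vcat_mult Rp yp)
  also have "(1 / frob_sq p) \<cdot>\<^sub>m \<dots> = vcat (0\<^sub>m r 1) (1\<^sub>m 1)"
    using p0 by (intro eq_matI) (auto simp: vcat_index)
  finally have Ww: "(X * X\<^sup>T) * ?w = vcat (0\<^sub>m r 1) (1\<^sub>m 1)" using Xd kd by (simp add: mult_assoc_dim)
  show "minv (X * X\<^sup>T) * vcat (0\<^sub>m r 1) (1\<^sub>m 1) = ?w"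
    unfolding Ww[symmetric] using Xd kd det by (intro mat_mult_cancel_left[OF minv_mult(2)]) auto
qed

section \<open>Inverse Wishart moments\<close>

lemma mat_borel_ident: "(\<lambda>X. X) \<in> measurable (mat_borel r c) (mat_borel r c)"
  by simp

lemma nn_integral_eq_0_cong:
  assumes "AE x in M. f x = (0 :: ennreal)"
  shows "(\<integral>\<^sup>+x. f x \<partial>M) = 0"
  using nn_integral_cong_AE[OF assms] by simp

text \<open>An orthonormal basis of the row space of \<open>R\<close> has at most r vectors. Once
  they are moved to the first axes, all coordinates from r on are orthogonal to the rows of
  \<open>R\<close>.\<close>

lemma trapezoid_rotation:
  assumes R: "R \<in> carrier_mat r c"
  shows "\<exists>U\<in>rot_inv c. \<forall>i j. r \<le> i \<longrightarrow> i < c \<longrightarrow> j < r \<longrightarrow> (U * R\<^sup>T) $$ (i, j) = 0"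
proof -
  obtain s P where s: "s \<le> r" "s \<le> c" and P: "P \<in> carrier_mat s c" "P * P\<^sup>T = 1\<^sub>m s" and RP: "R * (P\<^sup>T * P) = R"
    using orthonormal_row_basis[OF R] by blast
  obtain U where U: "U \<in> rot_inv c" and UP: "U * P\<^sup>T = mat c s (\<lambda>(i, j). if i = j then 1 else 0)"
    using rot_inv_orthonormal[of "P\<^sup>T" c s] P s by auto
  have Uc: "U \<in> carrier_mat c c" using U by (auto simp: rot_inv_def)
  have d: "dim_row U = c" "dim_col U = c" "dim_row P = s" "dim_col P = c" "dim_row R = r" "dim_col R = c"
    using Uc P R by auto
  have "R\<^sup>T = (R * (P\<^sup>T * P))\<^sup>T" unfolding RP ..
  then have "U * R\<^sup>T = (U * P\<^sup>T) * (P * R\<^sup>T)" using d by (simp add: mat_ring)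
  then have "(U * R\<^sup>T) $$ (i, j) = 0" if "r \<le> i" "i < c" "j < r" for i j
    using that s d unfolding UP by (simp only:, subst mat_mult_index) (auto intro!: sum.neutral)
  then show ?thesis using U by blast
qed

abbreviation last_unit :: "nat \<Rightarrow> real mat" where
  "last_unit r \<equiv> vcat (0\<^sub>m r 1) (1\<^sub>m 1)"

text \<open>Rows \<open>\<phi>\<close> below \<open>R\<close> are parametrised by Gaussian vectors \<open>x\<close> and \<open>y\<close>, where \<open>y\<close> carries the
  component of \<open>\<phi>\<close> orthogonal to the rows of \<open>R\<close>.\<close>

definition row_param :: "real mat \<Rightarrow> nat \<Rightarrow> nat \<Rightarrow> real mat \<Rightarrow> (real mat \<Rightarrow> real mat \<Rightarrow> real mat) \<Rightarrow> bool" where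
  "row_param R r m K T \<longleftrightarrow>
    K \<in> carrier_mat r r \<and> frob_sq K \<le> frob_sq (R\<^sup>T * minv (R * R\<^sup>T)) \<and>
    (\<forall>f \<in> borel_measurable (mat_borel 1 (r + m)).
      (\<integral>\<^sup>+\<phi>. f \<phi> \<partial>gauss_mat 1 (r + m)) = (\<integral>\<^sup>+x. \<integral>\<^sup>+y. f (T x y) \<partial>gauss_mat m 1 \<partial>gauss_mat r 1 :: ennreal)) \<and>
    (\<forall>x \<in> carrier_mat r 1. \<forall>y \<in> carrier_mat m 1. frob_sq y \<noteq> 0 \<longrightarrow> (\<forall>X. X = vcat R (T x y) \<longrightarrow>
      mdet (X * X\<^sup>T) \<noteq> 0 \<and> (minv (X * X\<^sup>T) * last_unit r) $$ (r, 0) \<le> 1 / frob_sq y \<and>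
      frob_sq (minv (X * X\<^sup>T) * last_unit r) \<le> (1 + frob_sq (K * x)) * (1 / (frob_sq y)\<^sup>2)))"

lemma row_param_exists:
  assumes R: "R \<in> carrier_mat r (r + m)" "mdet (R * R\<^sup>T) \<noteq> 0"
  shows "\<exists>K T. row_param R r m K T"
proof -
  let ?c = "r + m"
  let ?M = "minv (R * R\<^sup>T)"
  obtain U where U: "U \<in> rot_inv ?c" and z: "\<And>i j. r \<le> i \<Longrightarrow> i < ?c \<Longrightarrow> j < r \<Longrightarrow> (U * R\<^sup>T) $$ (i, j) = 0"
    using trapezoid_rotation[OF R(1)] by blast
  have Uc: "U \<in> carrier_mat ?c ?c" and UU: "U\<^sup>T * U = 1\<^sub>m ?c" "U * U\<^sup>T = 1\<^sub>m ?c" using U by (auto simp: rot_inv_def)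
  have d: "dim_row U = ?c" "dim_col U = ?c" "dim_row R = r" "dim_col R = ?c" using Uc R by auto
  have Ms: "?M\<^sup>T = ?M" using R d by (intro minv_sym[of _ r]) (auto simp: transpose_mult_dim)
  \<comment> \<open>In rotated coordinates the regression coefficients are \<open>N\<close> applied
    to \<open>x\<close> stacked on \<open>y\<close>. The columns of \<open>N\<close> beyond r
    vanish, so the coefficients are \<open>K * x\<close> and do not involve \<open>y\<close>: this
    is the independence of coefficients and residual.\<close>
  define N where "N = ?M * (U * R\<^sup>T)\<^sup>T"
  have N: "dim_row N = r" "dim_col N = ?c" using d by (auto simp: N_def)
  have Nz: "N $$ (i, j) = 0" if "i < r" "r \<le> j" "j < ?c" for i j
    unfolding N_def using that d z by (subst mat_mult_index) (auto intro!: sum.neutral simp del: index_mult_mat(1))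
  define K where "K = mat r r (\<lambda>(i, j). N $$ (i, j))"
  have fN: "frob_sq N = frob_sq (R\<^sup>T * ?M)"
  proof -
    have "N\<^sup>T = U * (R\<^sup>T * ?M)" using d Ms by (simp add: N_def mat_ring)
    then have "frob_sq N = frob_sq (U * (R\<^sup>T * ?M))" using frob_sq_transpose[of N] by simp
    then show ?thesis using frob_sq_isometry[OF UU(1)] d by simp
  qed
  have fK: "frob_sq K \<le> frob_sq N"
    unfolding frob_sq_def using N by (simp add: K_def sum_lessThan_add sum_nonneg sum_mono)
  \<comment> \<open>The transposed row is a rotation of the stacked standard Gaussian vector, hence
    again standard Gaussian.\<close>
  define T where "T = (\<lambda>x y. (U\<^sup>T * vcat x y)\<^sup>T)"
  have "row_param R r m K T"
    unfolding row_param_def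
  proof (intro conjI ballI impI allI)
    show "K \<in> carrier_mat r r" by (simp add: K_def)
    show "frob_sq K \<le> frob_sq (R\<^sup>T * ?M)" using fK fN by simp
  next
    fix f :: "real mat \<Rightarrow> ennreal" assume f: "f \<in> borel_measurable (mat_borel 1 ?c)"
    have m1: "(\<lambda>X. f (X\<^sup>T)) \<in> borel_measurable (mat_borel ?c 1)"
      by (rule measurable_compose[OF mat_borel_transpose f]) simp
    have m2: "(\<lambda>X. f ((U\<^sup>T * X)\<^sup>T)) \<in> borel_measurable (mat_borel ?c 1)"
      by (rule measurable_compose[OF mat_borel_mult[OF mat_borel_const] m1]) (use Uc in auto)
    have "(\<integral>\<^sup>+\<phi>. f \<phi> \<partial>gauss_mat 1 ?c) = (\<integral>\<^sup>+X. f (X\<^sup>T) \<partial>gauss_mat ?c 1)"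
      by (rule nn_integral_gauss_mat_transpose[OF f, symmetric])
    also have "\<dots> = (\<integral>\<^sup>+X. f ((U\<^sup>T * X)\<^sup>T) \<partial>gauss_mat ?c 1)"
      by (rule nn_integral_gauss_mat_rotate[OF rot_inv_transpose[OF U] m1, symmetric])
    also have "\<dots> = (\<integral>\<^sup>+x. \<integral>\<^sup>+y. f (T x y) \<partial>gauss_mat m 1 \<partial>gauss_mat r 1)"
      unfolding T_def by (rule nn_integral_gauss_mat_vcat[OF m2])
    finally show "(\<integral>\<^sup>+\<phi>. f \<phi> \<partial>gauss_mat 1 ?c) = (\<integral>\<^sup>+x. \<integral>\<^sup>+y. f (T x y) \<partial>gauss_mat m 1 \<partial>gauss_mat r 1)" .
  next
    fix x y X assume x: "x \<in> carrier_mat r 1" and y: "y \<in> carrier_mat m 1" and y0: "frob_sq y \<noteq> 0"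
      and X: "X = vcat R (T x y)"
    define \<eta> where "\<eta> = U\<^sup>T * vcat x y"
    have xy: "dim_row x = r" "dim_col x = 1" "dim_row y = m" "dim_col y = 1" using x y by auto
    have \<eta>: "\<eta> \<in> carrier_mat ?c 1" "dim_row \<eta> = ?c" "dim_col \<eta> = 1" using d xy by (auto simp: \<eta>_def)
    define k where "k = ?M * R * \<eta>"
    define p where "p = \<eta> - R\<^sup>T * k"
    have kd: "dim_row k = r" "dim_col k = 1" using d \<eta> by (auto simp: k_def)
    have pd: "dim_row p = ?c" "dim_col p = 1" using d \<eta> kd by (auto simp: p_def)
    have "k = N * vcat x y" unfolding k_def N_def \<eta>_def using d xy by (simp add: mat_ring)
    also have "\<dots> = K * x"
    proof (rule eq_matI)
      fix i j assume "i < dim_row (K * x)" "j < dim_col (K * x)"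
      then have ij: "i < r" "j = 0" using xy by (auto simp: K_def)
      have "(N * vcat x y) $$ (i, j) = (\<Sum>l<r. N $$ (i, l) * x $$ (l, 0)) + (\<Sum>l<m. N $$ (i, r + l) * y $$ (l, 0))"
        using ij N xy by (subst mat_mult_index) (auto simp: sum_lessThan_add vcat_index)
      also have "(\<Sum>l<m. N $$ (i, r + l) * y $$ (l, 0)) = 0" using ij Nz by (intro sum.neutral) auto
      also have "(\<Sum>l<r. N $$ (i, l) * x $$ (l, 0)) = (K * x) $$ (i, j)"
        using ij xy by (subst mat_mult_index) (auto simp: K_def)
      finally show "(N * vcat x y) $$ (i, j) = (K * x) $$ (i, j)" by simp
    qed (use N xy in \<open>auto simp: K_def\<close>)
    finally have kK: "k = K * x" .
    \<comment> \<open>Subtracting the projection onto the rows of \<open>R\<close> changes only the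
      first r rotated coordinates, so the lower block of \<open>U * p\<close> is \<open>y\<close>
      itself.\<close>
    have q: "frob_sq y \<le> frob_sq p"
    proof -
      have "U * \<eta> = vcat x y" unfolding \<eta>_def using d xy by (intro mat_mult_cancel_left[OF UU(2)]) auto
      then have Up: "U * p = vcat x y - U * R\<^sup>T * k" using d \<eta> kd by (simp add: p_def mat_ring)
      define a where "a = mat r 1 (\<lambda>(i, j). (U * p) $$ (i, j))"
      define b where "b = mat m 1 (\<lambda>(i, j). (U * p) $$ (r + i, j))"
      have "U * p \<in> carrier_mat ?c 1" using d pd by (intro carrier_matI) auto
      from vcat_split[OF this] have v: "U * p = vcat a b" by (simp add: a_def b_def)
      have "b = y"
      proof (rule eq_matI)
        fix i j assume "i < dim_row y" "j < dim_col y"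
        then have ij: "i < m" "j = 0" using xy by auto
        have "(U * R\<^sup>T * k) $$ (r + i, 0) = 0"
          using ij d kd z by (subst mat_mult_index) (auto intro!: sum.neutral simp del: index_mult_mat(1))
        then show "b $$ (i, j) = y $$ (i, j)"
          using ij d kd xy unfolding b_def Up by (simp add: vcat_index del: index_mult_mat(1))
      qed (use xy in \<open>auto simp: b_def\<close>)
      have "frob_sq p = frob_sq (U * p)" using frob_sq_isometry[OF UU(1), of p] d pd by simp
      also have "\<dots> = frob_sq a + frob_sq y"
        unfolding v \<open>b = y\<close>[symmetric] by (rule frob_sq_vcat) (simp add: a_def b_def)
      finally show ?thesis using frob_sq_nonneg[of a] by linarith
    qed
    have y1: "0 < frob_sq y" using y0 by (simp add: less_le)
    have p0: "frob_sq p \<noteq> 0" using q y1 by linarith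
    have Xe: "X = vcat R (\<eta>\<^sup>T)" by (simp add: X T_def \<eta>_def)
    note bi = bordered_inverse[OF R \<eta>(1), folded k_def, folded p_def, OF p0, folded Xe]
    show "mdet (X * X\<^sup>T) \<noteq> 0" by (rule bi(1))
    show "(minv (X * X\<^sup>T) * last_unit r) $$ (r, 0) \<le> 1 / frob_sq y"
      unfolding bi(2) using kd q y1 by (simp add: vcat_index frac_le)
    show "frob_sq (minv (X * X\<^sup>T) * last_unit r) \<le> (1 + frob_sq (K * x)) * (1 / (frob_sq y)\<^sup>2)"
      unfolding bi(2)
    proof -
      have "frob_sq (vcat ((- 1 / frob_sq p) \<cdot>\<^sub>m k) ((1 / frob_sq p) \<cdot>\<^sub>m 1\<^sub>m 1))
         = (1 + frob_sq (K * x)) * (1 / (frob_sq p)\<^sup>2)"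
        using kd kK by (subst frob_sq_vcat) (simp_all add: frob_sq_smult power_divide algebra_simps add_divide_distrib)
      also have "\<dots> \<le> (1 + frob_sq (K * x)) * (1 / (frob_sq y)\<^sup>2)"
        using q y1 by (intro mult_left_mono divide_left_mono power_mono mult_pos_pos) (auto simp: add_nonneg_nonneg)
      finally show "frob_sq (vcat ((- 1 / frob_sq p) \<cdot>\<^sub>m k) ((1 / frob_sq p) \<cdot>\<^sub>m 1\<^sub>m 1))
        \<le> (1 + frob_sq (K * x)) * (1 / (frob_sq y)\<^sup>2)" .
    qed
  qed
  then show ?thesis by blast
qed

lemma row_paramD:
  assumes "row_param R r m K T"
  shows "K \<in> carrier_mat r r" "frob_sq K \<le> frob_sq (R\<^sup>T * minv (R * R\<^sup>T))"
    and "f \<in> borel_measurable (mat_borel 1 (r + m)) \<Longrightarrow>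
      (\<integral>\<^sup>+\<phi>. f \<phi> \<partial>gauss_mat 1 (r + m)) = (\<integral>\<^sup>+x. \<integral>\<^sup>+y. f (T x y) \<partial>gauss_mat m 1 \<partial>gauss_mat r 1 :: ennreal)"
    and "x \<in> carrier_mat r 1 \<Longrightarrow> y \<in> carrier_mat m 1 \<Longrightarrow> frob_sq y \<noteq> 0 \<Longrightarrow> X = vcat R (T x y) \<Longrightarrow>
      mdet (X * X\<^sup>T) \<noteq> 0 \<and> (minv (X * X\<^sup>T) * last_unit r) $$ (r, 0) \<le> 1 / frob_sq y \<and>
      frob_sq (minv (X * X\<^sup>T) * last_unit r) \<le> (1 + frob_sq (K * x)) * (1 / (frob_sq y)\<^sup>2)"
  using assms unfolding row_param_def by blast+

lemma mat_borel_gram: "X \<in> measurable N (mat_borel r c) \<Longrightarrow> (\<lambda>\<omega>. X \<omega> * (X \<omega>)\<^sup>T) \<in> measurable N (mat_borel r r)"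
  by (intro mat_borel_mult mat_borel_transpose)

lemma measurable_vcat_right:
  assumes "R \<in> carrier_mat r c"
  shows "vcat R \<in> measurable (mat_borel k c) (mat_borel (r + k) c)"
  using mat_borel_vcat[OF mat_borel_const[OF assms], of "\<lambda>x. x" "mat_borel k c" k] by simp

text \<open>Induction on the number of rows. While there are fewer rows than columns, the next row
  almost surely has a nonzero component orthogonal to the previous ones, and the bordered Gram
  matrix stays invertible.\<close>

lemma AE_gauss_mat_gram_det:
  "r \<le> c \<Longrightarrow> AE X in gauss_mat r c. mdet (X * X\<^sup>T) \<noteq> 0"
proof (induction r)
  case 0
  have "mdet (X * X\<^sup>T) \<noteq> 0" if "X \<in> carrier_mat 0 c" for X
    using that by (intro det_nz_of_kernel[of _ 0]) auto
  then show ?case by (intro AE_I2) simp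
next
  case (Suc r)
  define m where "m = c - r"
  have c: "c = r + m" "0 < m" using Suc.prems by (auto simp: m_def)
  \<comment> \<open>The null set is expressed as a vanishing integral of an indicator, so that it
    can be treated row by row with \<open>nn_integral_gauss_mat_vcat\<close>.\<close>
  define f :: "real mat \<Rightarrow> ennreal" where "f = (\<lambda>X. indicator {0} (mdet (X * X\<^sup>T)))"
  have f: "f \<in> borel_measurable (mat_borel k c)" for k
    unfolding f_def
    by (rule measurable_compose[OF mat_borel_det[OF mat_borel_gram[OF mat_borel_ident]]]) simp
  have "(\<integral>\<^sup>+X. f X \<partial>gauss_mat (r + 1) c) = (\<integral>\<^sup>+R. \<integral>\<^sup>+\<phi>. f (vcat R \<phi>) \<partial>gauss_mat 1 c \<partial>gauss_mat r c)"
    by (rule nn_integral_gauss_mat_vcat[OF f])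
  also have "\<dots> = 0"
  proof (rule nn_integral_eq_0_cong, rule AE_mp[OF Suc.IH AE_I2])
    fix R assume "R \<in> space (gauss_mat r c)"
    then have R: "R \<in> carrier_mat r (r + m)" using c by simp
    show "mdet (R * R\<^sup>T) \<noteq> 0 \<longrightarrow> (\<integral>\<^sup>+\<phi>. f (vcat R \<phi>) \<partial>gauss_mat 1 c) = 0"
    proof
      assume det: "mdet (R * R\<^sup>T) \<noteq> 0"
      obtain K T where KT: "row_param R r m K T" using row_param_exists[OF R det] by blast
      note int = row_paramD(3)[OF KT] and T = row_paramD(4)[OF KT]
      have "(\<integral>\<^sup>+\<phi>. f (vcat R \<phi>) \<partial>gauss_mat 1 c) = (\<integral>\<^sup>+x. \<integral>\<^sup>+y. f (vcat R (T x y)) \<partial>gauss_mat m 1 \<partial>gauss_mat r 1)"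
        unfolding c(1) by (rule int, rule measurable_compose[OF measurable_vcat_right[OF R] f[unfolded c(1)]])
      also have "\<dots> = (\<integral>\<^sup>+x. 0 \<partial>gauss_mat r 1)"
      proof (rule nn_integral_cong, rule nn_integral_eq_0_cong)
        fix x assume x: "x \<in> space (gauss_mat r 1)"
        show "AE y in gauss_mat m 1. f (vcat R (T x y)) = 0"
        proof (rule AE_mp[OF AE_gauss_mat_nonzero[OF c(2), of 1] AE_I2], simp, rule impI)
          fix y assume "y \<in> space (gauss_mat m 1)" "frob_sq y \<noteq> 0"
          then show "f (vcat R (T x y)) = 0" using T[OF _ _ _ refl, of x y] x by (simp add: f_def)
        qed
      qed
      finally show "(\<integral>\<^sup>+\<phi>. f (vcat R \<phi>) \<partial>gauss_mat 1 c) = 0" by simp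
    qed
  qed (use Suc.prems in simp)
  finally have "AE X in gauss_mat (r + 1) c. f X = 0"
    using f by (subst (asm) nn_integral_0_iff_AE) auto
  then show ?case unfolding Suc_eq_plus1 by (rule AE_mp) (auto simp: f_def indicator_def intro!: AE_I2)
qed

lemma minv_gram_rotate:
  assumes U: "U \<in> rot_inv r" and X: "X \<in> carrier_mat r c" "mdet (X * X\<^sup>T) \<noteq> 0"
  shows "minv ((U * X) * (U * X)\<^sup>T) = U * minv (X * X\<^sup>T) * U\<^sup>T"
proof -
  have Uc: "U \<in> carrier_mat r r" and UU: "U\<^sup>T * U = 1\<^sub>m r" "U * U\<^sup>T = 1\<^sub>m r" using U by (auto simp: rot_inv_def)
  have d: "dim_row U = r" "dim_col U = r" "dim_row X = r" "dim_col X = c" using Uc X by auto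
  have m: "minv (X * X\<^sup>T) * (X * X\<^sup>T) = 1\<^sub>m r" using X d by (intro minv_mult) auto
  have "(U * minv (X * X\<^sup>T) * U\<^sup>T) * ((U * X) * (U * X)\<^sup>T)
     = U * (minv (X * X\<^sup>T) * (U\<^sup>T * (U * (X * (X\<^sup>T * U\<^sup>T)))))"
    using d by (simp add: mat_ring)
  also have "U\<^sup>T * (U * (X * (X\<^sup>T * U\<^sup>T))) = (X * X\<^sup>T) * U\<^sup>T"
    using d by (subst mat_mult_cancel_left[OF UU(1)]) (auto simp: mat_ring)
  also have "minv (X * X\<^sup>T) * ((X * X\<^sup>T) * U\<^sup>T) = U\<^sup>T"
    using d by (intro mat_mult_cancel_left[OF m]) auto
  finally show ?thesis using UU d by (intro det_nz_of_left_inv(2)[of _ r]) (auto intro!: carrier_matI)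
qed

lemma rot_inv_to_last:
  assumes v: "v \<in> carrier_mat (Suc r) 1"
  shows "\<exists>U\<in>rot_inv (Suc r). U * v = sqrt (frob_sq v) \<cdot>\<^sub>m last_unit r"
proof -
  obtain U where U: "U \<in> rot_inv (Suc r)" "U * v = mat (Suc r) 1 (\<lambda>(i, _). if i = r then sqrt (frob_sq v) else 0)"
    using rot_inv_map_vec[OF v, of r] by auto
  have "mat (Suc r) 1 (\<lambda>(i, _). if i = r then sqrt (frob_sq v) else 0) = sqrt (frob_sq v) \<cdot>\<^sub>m last_unit r"
    by (rule eq_matI) (auto simp: vcat_index)
  then show ?thesis using U by auto
qed

lemma last_unit_dim: "dim_row (last_unit r) = Suc r" "dim_col (last_unit r) = 1" "last_unit r \<in> carrier_mat (Suc r) 1"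
  by auto

lemma finner_last_unit:
  assumes "B \<in> carrier_mat (Suc r) 1" shows "finner (last_unit r) B = B $$ (r, 0)"
  using assms by (simp add: finner_def vcat_index)

text \<open>The last diagonal entry of the inverse Gram matrix is the reciprocal of the squared
  distance of the last row from the span of the others. This is at most 1 / |y|^2, and |y|^2 is
  chi-square with m degrees of freedom.\<close>

lemma nn_integral_inv_wishart_last:
  assumes m: "3 \<le> m"
  shows "(\<integral>\<^sup>+X. ennreal ((minv (X * X\<^sup>T) * last_unit r) $$ (r, 0)) \<partial>gauss_mat (Suc r) (r + m)) \<le> ennreal (1 / (real m - 2))"
proof -
  let ?f = "\<lambda>X. ennreal ((minv (X * X\<^sup>T) * last_unit r) $$ (r, 0))"
  have f: "?f \<in> borel_measurable (mat_borel (r + 1) (r + m))"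
    by (intro measurable_compose[OF mat_borel_entry[OF mat_borel_mult[OF mat_borel_minv[OF mat_borel_gram[OF mat_borel_ident]] mat_borel_const]] measurable_ennreal])
      auto
  have "(\<integral>\<^sup>+X. ?f X \<partial>gauss_mat (r + 1) (r + m)) = (\<integral>\<^sup>+R. \<integral>\<^sup>+\<phi>. ?f (vcat R \<phi>) \<partial>gauss_mat 1 (r + m) \<partial>gauss_mat r (r + m))"
    by (rule nn_integral_gauss_mat_vcat[OF f])
  also have "\<dots> \<le> (\<integral>\<^sup>+R. ennreal (1 / (real m - 2)) \<partial>gauss_mat r (r + m))"
  proof (rule nn_integral_mono_AE, rule AE_mp[OF AE_gauss_mat_gram_det AE_I2])
    fix R assume "R \<in> space (gauss_mat r (r + m))"
    then have R: "R \<in> carrier_mat r (r + m)" by simp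
    show "mdet (R * R\<^sup>T) \<noteq> 0 \<longrightarrow> (\<integral>\<^sup>+\<phi>. ?f (vcat R \<phi>) \<partial>gauss_mat 1 (r + m)) \<le> ennreal (1 / (real m - 2))"
    proof
      assume det: "mdet (R * R\<^sup>T) \<noteq> 0"
      obtain K T where KT: "row_param R r m K T" using row_param_exists[OF R det] by blast
      note int = row_paramD(3)[OF KT] and T = row_paramD(4)[OF KT]
      have "(\<integral>\<^sup>+\<phi>. ?f (vcat R \<phi>) \<partial>gauss_mat 1 (r + m)) = (\<integral>\<^sup>+x. \<integral>\<^sup>+y. ?f (vcat R (T x y)) \<partial>gauss_mat m 1 \<partial>gauss_mat r 1)"
        by (rule int, rule measurable_compose[OF measurable_vcat_right[OF R] f])
      also have "\<dots> \<le> (\<integral>\<^sup>+x. ennreal (1 / (real m - 2)) \<partial>gauss_mat r 1)"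
      proof (rule nn_integral_mono)
        fix x assume x: "x \<in> space (gauss_mat r 1)"
        have "(\<integral>\<^sup>+y. ?f (vcat R (T x y)) \<partial>gauss_mat m 1) \<le> (\<integral>\<^sup>+y. ennreal (1 / frob_sq y) \<partial>gauss_mat m 1)"
        proof (rule nn_integral_mono_AE, rule AE_mp[OF AE_gauss_mat_nonzero[of m 1] AE_I2])
          fix y assume "y \<in> space (gauss_mat m 1)"
          then show "frob_sq y \<noteq> 0 \<longrightarrow> ?f (vcat R (T x y)) \<le> ennreal (1 / frob_sq y)"
            using T[OF _ _ _ refl, of x y] x by (auto intro!: ennreal_leI simp del: index_mult_mat(1))
        qed (use m in auto)
        also have "\<dots> \<le> ennreal (1 / (real m - 2))" by (rule nn_integral_inverse_frob_sq[OF m])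
        finally show "(\<integral>\<^sup>+y. ?f (vcat R (T x y)) \<partial>gauss_mat m 1) \<le> ennreal (1 / (real m - 2))" .
      qed
      also have "\<dots> = ennreal (1 / (real m - 2))"
        using prob_space.emeasure_space_1[OF prob_space_gauss_mat[of r 1]] by simp
      finally show "(\<integral>\<^sup>+\<phi>. ?f (vcat R \<phi>) \<partial>gauss_mat 1 (r + m)) \<le> ennreal (1 / (real m - 2))" .
    qed
  qed simp
  also have "\<dots> = ennreal (1 / (real m - 2))"
    using prob_space.emeasure_space_1[OF prob_space_gauss_mat[of r "r + m"]] by simp
  finally show ?thesis by simp
qed

lemma frob_sq_pinv_mult:
  assumes X: "X \<in> carrier_mat r c" "mdet (X * X\<^sup>T) \<noteq> 0" and v: "v \<in> carrier_mat r k"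
  shows "frob_sq (X\<^sup>T * minv (X * X\<^sup>T) * v) = finner v (minv (X * X\<^sup>T) * v)"
proof -
  let ?M = "minv (X * X\<^sup>T)"
  have d: "dim_row X = r" "dim_col X = c" "dim_row v = r" "dim_col v = k" using X v by auto
  have m: "(X * X\<^sup>T) * ?M = 1\<^sub>m r" using X d by (intro minv_mult) auto
  have "frob_sq (X\<^sup>T * ?M * v) = finner (X\<^sup>T * (?M * v)) (X\<^sup>T * (?M * v))"
    unfolding frob_sq_finner using d by (simp add: mult_assoc_dim)
  also have "\<dots> = finner (X * (X\<^sup>T * (?M * v))) (?M * v)" using d by (subst finner_mult_left) auto
  also have "X * (X\<^sup>T * (?M * v)) = v" using d mat_mult_cancel_left[OF m, of v] by (simp add: mult_assoc_dim)
  finally show ?thesis .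
qed

text \<open>The squared norm is the quadratic form of the inverse Gram matrix at \<open>v\<close>. A
  rotation of the rows of \<open>X\<close>, which preserves its law, takes \<open>v\<close> to a
  multiple of the last axis, where the form is a diagonal entry.\<close>

lemma nn_integral_pinv_col:
  assumes v: "v \<in> carrier_mat (Suc r) 1" and m: "3 \<le> m"
  shows "(\<integral>\<^sup>+X. ennreal (frob_sq (X\<^sup>T * minv (X * X\<^sup>T) * v)) \<partial>gauss_mat (Suc r) (r + m)) \<le> ennreal (frob_sq v / (real m - 2))"
proof -
  let ?r = "Suc r" and ?c = "r + m"
  obtain U where U: "U \<in> rot_inv ?r" "U * v = sqrt (frob_sq v) \<cdot>\<^sub>m last_unit r" using rot_inv_to_last[OF v] by auto
  have Uc: "U \<in> carrier_mat ?r ?r" and UU: "U\<^sup>T * U = 1\<^sub>m ?r" "U * U\<^sup>T = 1\<^sub>m ?r" using U by (auto simp: rot_inv_def)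
  have d: "dim_row U = ?r" "dim_col U = ?r" "dim_row v = ?r" "dim_col v = 1" using Uc v by auto
  have Uv: "U * v \<in> carrier_mat ?r 1" using Uc v by simp
  let ?h = "\<lambda>v X. ennreal (frob_sq (X\<^sup>T * minv (X * X\<^sup>T) * v))"
  have hm: "?h w \<in> borel_measurable (mat_borel ?r ?c)" if "w \<in> carrier_mat ?r 1" for w
    by (intro measurable_compose[OF mat_borel_frob_sq[OF mat_borel_mult[OF mat_borel_mult[OF mat_borel_transpose[OF mat_borel_ident]
       mat_borel_minv[OF mat_borel_gram[OF mat_borel_ident]]] mat_borel_const[OF that]]] measurable_ennreal])
  have AEd: "AE X in gauss_mat ?r ?c. mdet (X * X\<^sup>T) \<noteq> 0" using m by (intro AE_gauss_mat_gram_det) simp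
  have "(\<integral>\<^sup>+X. ?h v X \<partial>gauss_mat ?r ?c) = (\<integral>\<^sup>+X. ?h (U * v) (U * X) \<partial>gauss_mat ?r ?c)"
  proof (rule nn_integral_cong_AE, rule AE_mp[OF AEd AE_I2], rule impI)
    fix X assume "X \<in> space (gauss_mat ?r ?c)" and det: "mdet (X * X\<^sup>T) \<noteq> 0"
    then have X: "X \<in> carrier_mat ?r ?c" "dim_row X = ?r" "dim_col X = ?c" by auto
    have "(U * X)\<^sup>T * minv ((U * X) * (U * X)\<^sup>T) * (U * v)
      = X\<^sup>T * (U\<^sup>T * (U * (minv (X * X\<^sup>T) * (U\<^sup>T * (U * v)))))"
      unfolding minv_gram_rotate[OF U(1) X(1) det] using d X by (simp add: mat_ring)
    also have "U\<^sup>T * (U * v) = v" using d by (intro mat_mult_cancel_left[OF UU(1)]) auto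
    also have "U\<^sup>T * (U * (minv (X * X\<^sup>T) * v)) = minv (X * X\<^sup>T) * v" using d X by (intro mat_mult_cancel_left[OF UU(1)]) auto
    finally show "?h v X = ?h (U * v) (U * X)" using d X by (simp add: mult_assoc_dim)
  qed
  also have "\<dots> = (\<integral>\<^sup>+X. ?h (U * v) X \<partial>gauss_mat ?r ?c)"
    by (rule nn_integral_gauss_mat_rotate[OF U(1) hm[OF Uv]])
  also have "\<dots> = (\<integral>\<^sup>+X. ennreal (frob_sq v) * ennreal ((minv (X * X\<^sup>T) * last_unit r) $$ (r, 0)) \<partial>gauss_mat ?r ?c)"
  proof (rule nn_integral_cong_AE, rule AE_mp[OF AEd AE_I2], rule impI)
    fix X assume "X \<in> space (gauss_mat ?r ?c)" and det: "mdet (X * X\<^sup>T) \<noteq> 0"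
    then have X: "X \<in> carrier_mat ?r ?c" "dim_row X = ?r" "dim_col X = ?c" by auto
    have "X\<^sup>T * minv (X * X\<^sup>T) * (U * v) = sqrt (frob_sq v) \<cdot>\<^sub>m (X\<^sup>T * minv (X * X\<^sup>T) * last_unit r)"
      unfolding U(2) using X by (simp add: mult_smult_dim)
    then have "frob_sq (X\<^sup>T * minv (X * X\<^sup>T) * (U * v)) = frob_sq v * frob_sq (X\<^sup>T * minv (X * X\<^sup>T) * last_unit r)"
      by (simp add: frob_sq_smult)
    also have "frob_sq (X\<^sup>T * minv (X * X\<^sup>T) * last_unit r) = (minv (X * X\<^sup>T) * last_unit r) $$ (r, 0)"
      using X by (subst frob_sq_pinv_mult[OF X(1) det last_unit_dim(3)], subst finner_last_unit) (auto intro!: carrier_matI)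
    finally show "?h (U * v) X = ennreal (frob_sq v) * ennreal ((minv (X * X\<^sup>T) * last_unit r) $$ (r, 0))"
      by (simp add: ennreal_mult')
  qed
  also have "\<dots> = ennreal (frob_sq v) * (\<integral>\<^sup>+X. ennreal ((minv (X * X\<^sup>T) * last_unit r) $$ (r, 0)) \<partial>gauss_mat ?r ?c)"
    by (intro nn_integral_cmult measurable_compose[OF mat_borel_entry[OF mat_borel_mult[OF mat_borel_minv[OF mat_borel_gram[OF measurable_ident_gauss_mat]] mat_borel_const]] measurable_ennreal]) auto
  also have "\<dots> \<le> ennreal (frob_sq v) * ennreal (1 / (real m - 2))"
    by (intro mult_left_mono nn_integral_inv_wishart_last m) simp
  also have "\<dots> = ennreal (frob_sq v / (real m - 2))" using m by (simp add: ennreal_mult'[symmetric])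
  finally show ?thesis .
qed

lemma frob_sq_mult_cols:
  assumes "dim_col A = dim_row N"
  shows "frob_sq (A * N) = (\<Sum>j<dim_col N. frob_sq (A * colm N j))"
proof -
  have "colm (A * N) j = A * colm N j" if "j < dim_col N" for j
    by (rule eq_matI) (use assms that mult_colm[of A N _ j] in \<open>auto simp del: index_mult_mat(1)\<close>)
  then show ?thesis unfolding frob_sq_eq_sum_cols[of "A * N"] colm_def[symmetric] by simp
qed

lemma nn_integral_pinv_mult:
  assumes N: "N \<in> carrier_mat r k" and r: "0 < r" "r + 2 \<le> c"
  shows "(\<integral>\<^sup>+X. ennreal (frob_sq (X\<^sup>T * minv (X * X\<^sup>T) * N)) \<partial>gauss_mat r c) \<le> ennreal (frob_sq N / (real c - real r - 1))"
proof -
  obtain r' where r': "r = Suc r'" using r by (cases r) auto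
  \<comment> \<open>The last of the r rows has r - 1 predecessors, so there are c - r + 1 degrees of
    freedom, and m - 2 is c - r - 1.\<close>
  define m where "m = c - r'"
  have c: "c = r' + m" "3 \<le> m" using r r' by (auto simp: m_def)
  have mc: "real m - 2 = real c - real r - 1" using c r' by simp
  have meas: "(\<lambda>X. ennreal (frob_sq (X\<^sup>T * minv (X * X\<^sup>T) * colm N j))) \<in> borel_measurable (gauss_mat r c)" for j
    by (intro measurable_compose[OF mat_borel_frob_sq[OF mat_borel_mult[OF mat_borel_mult[OF mat_borel_transpose[OF measurable_ident_gauss_mat]
       mat_borel_minv[OF mat_borel_gram[OF measurable_ident_gauss_mat]]] mat_borel_const]] measurable_ennreal]) (use N in auto)
  have "(\<integral>\<^sup>+X. ennreal (frob_sq (X\<^sup>T * minv (X * X\<^sup>T) * N)) \<partial>gauss_mat r c)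
     = (\<integral>\<^sup>+X. (\<Sum>j<k. ennreal (frob_sq (X\<^sup>T * minv (X * X\<^sup>T) * colm N j))) \<partial>gauss_mat r c)"
  proof (intro nn_integral_cong)
    fix X assume "X \<in> space (gauss_mat r c)"
    then show "ennreal (frob_sq (X\<^sup>T * minv (X * X\<^sup>T) * N)) = (\<Sum>j<k. ennreal (frob_sq (X\<^sup>T * minv (X * X\<^sup>T) * colm N j)))"
      using N by (subst frob_sq_mult_cols) (auto simp: sum_ennreal)
  qed
  also have "\<dots> = (\<Sum>j<k. \<integral>\<^sup>+X. ennreal (frob_sq (X\<^sup>T * minv (X * X\<^sup>T) * colm N j)) \<partial>gauss_mat r c)"
    by (intro nn_integral_sum meas)
  also have "\<dots> \<le> (\<Sum>j<k. ennreal (frob_sq (colm N j) / (real m - 2)))"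
    unfolding r' c(1) using N r' by (intro sum_mono nn_integral_pinv_col c(2)) (auto intro!: carrier_matI)
  also have "\<dots> = ennreal (\<Sum>j<k. frob_sq (colm N j) / (real m - 2))"
    using c(2) by (intro sum_ennreal) auto
  also have "(\<Sum>j<k. frob_sq (colm N j) / (real m - 2)) = frob_sq N / (real m - 2)"
    using N by (simp add: sum_divide_distrib[symmetric] frob_sq_eq_sum_cols[of N] colm_def)
  finally show ?thesis unfolding mc .
qed

text \<open>The squared length of the last column is at most (1 + |K x|^2) / |y|^4 with x and y
  independent. The two factors are averaged separately: x gives |K|^2, which is bounded by the
  squared norm of the pseudoinverse of the first r rows and has mean at most r / (m - 1), and y
  gives the second inverse chi-square moment.\<close>

lemma nn_integral_inv_wishart_sq_last:
  assumes m: "5 \<le> m"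
  shows "(\<integral>\<^sup>+X. ennreal (frob_sq (minv (X * X\<^sup>T) * last_unit r)) \<partial>gauss_mat (Suc r) (r + m))
    \<le> ennreal ((1 + real r / (real m - 1)) * (1 / ((real m - 2) * (real m - 4))))"
proof -
  let ?f = "\<lambda>X. ennreal (frob_sq (minv (X * X\<^sup>T) * last_unit r))"
  let ?I = "1 / ((real m - 2) * (real m - 4))"
  have I0: "0 \<le> ?I" using m by simp
  have f: "?f \<in> borel_measurable (mat_borel (r + 1) (r + m))"
    by (intro measurable_compose[OF mat_borel_frob_sq[OF mat_borel_mult[OF mat_borel_minv[OF mat_borel_gram[OF mat_borel_ident]] mat_borel_const]] measurable_ennreal])
      auto
  have fR: "(\<lambda>R. ennreal (frob_sq (R\<^sup>T * minv (R * R\<^sup>T)))) \<in> borel_measurable (gauss_mat r (r + m))"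
    by (intro measurable_compose[OF mat_borel_frob_sq[OF mat_borel_mult[OF mat_borel_transpose[OF measurable_ident_gauss_mat]
       mat_borel_minv[OF mat_borel_gram[OF measurable_ident_gauss_mat]]]] measurable_ennreal])
  have ER: "(\<integral>\<^sup>+R. ennreal (frob_sq (R\<^sup>T * minv (R * R\<^sup>T))) \<partial>gauss_mat r (r + m)) \<le> ennreal (real r / (real m - 1))"
  proof (cases "r = 0")
    case True
    have "(\<integral>\<^sup>+R. ennreal (frob_sq (R\<^sup>T * minv (R * R\<^sup>T))) \<partial>gauss_mat r (r + m)) = (\<integral>\<^sup>+R. 0 \<partial>gauss_mat r (r + m))"
      using True by (intro nn_integral_cong) (auto simp: frob_sq_def)
    then show ?thesis by simp
  next
    case False
    have "(\<integral>\<^sup>+R. ennreal (frob_sq (R\<^sup>T * minv (R * R\<^sup>T))) \<partial>gauss_mat r (r + m))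
      = (\<integral>\<^sup>+R. ennreal (frob_sq (R\<^sup>T * minv (R * R\<^sup>T) * 1\<^sub>m r)) \<partial>gauss_mat r (r + m))"
      by (intro nn_integral_cong) (auto simp: mult_one_dim)
    also have "\<dots> \<le> ennreal (frob_sq (1\<^sub>m r) / (real (r + m) - real r - 1))"
      using m False by (intro nn_integral_pinv_mult) auto
    finally show ?thesis by simp
  qed
  have "(\<integral>\<^sup>+X. ?f X \<partial>gauss_mat (r + 1) (r + m)) = (\<integral>\<^sup>+R. \<integral>\<^sup>+\<phi>. ?f (vcat R \<phi>) \<partial>gauss_mat 1 (r + m) \<partial>gauss_mat r (r + m))"
    by (rule nn_integral_gauss_mat_vcat[OF f])
  also have "\<dots> \<le> (\<integral>\<^sup>+R. (1 + ennreal (frob_sq (R\<^sup>T * minv (R * R\<^sup>T)))) * ennreal ?I \<partial>gauss_mat r (r + m))"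
  proof (rule nn_integral_mono_AE, rule AE_mp[OF AE_gauss_mat_gram_det AE_I2])
    fix R assume "R \<in> space (gauss_mat r (r + m))"
    then have R: "R \<in> carrier_mat r (r + m)" by simp
    show "mdet (R * R\<^sup>T) \<noteq> 0 \<longrightarrow> (\<integral>\<^sup>+\<phi>. ?f (vcat R \<phi>) \<partial>gauss_mat 1 (r + m))
        \<le> (1 + ennreal (frob_sq (R\<^sup>T * minv (R * R\<^sup>T)))) * ennreal ?I"
    proof
      assume det: "mdet (R * R\<^sup>T) \<noteq> 0"
      obtain K T where KT: "row_param R r m K T" using row_param_exists[OF R det] by blast
      note K = row_paramD(1,2)[OF KT] and int = row_paramD(3)[OF KT] and T = row_paramD(4)[OF KT]
      have "(\<integral>\<^sup>+\<phi>. ?f (vcat R \<phi>) \<partial>gauss_mat 1 (r + m)) = (\<integral>\<^sup>+x. \<integral>\<^sup>+y. ?f (vcat R (T x y)) \<partial>gauss_mat m 1 \<partial>gauss_mat r 1)"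
        by (rule int, rule measurable_compose[OF measurable_vcat_right[OF R] f])
      also have "\<dots> \<le> (\<integral>\<^sup>+x. (1 + ennreal (frob_sq (K * x))) * ennreal ?I \<partial>gauss_mat r 1)"
      proof (rule nn_integral_mono)
        fix x assume x: "x \<in> space (gauss_mat r 1)"
        have my: "(\<lambda>y. ennreal (1 / (frob_sq y)\<^sup>2)) \<in> borel_measurable (gauss_mat m 1)"
          using mat_borel_frob_sq[OF measurable_ident_gauss_mat[of m 1]] by simp
        have "(\<integral>\<^sup>+y. ?f (vcat R (T x y)) \<partial>gauss_mat m 1) \<le> (\<integral>\<^sup>+y. (1 + ennreal (frob_sq (K * x))) * ennreal (1 / (frob_sq y)\<^sup>2) \<partial>gauss_mat m 1)"
        proof (rule nn_integral_mono_AE, rule AE_mp[OF AE_gauss_mat_nonzero[of m 1] AE_I2])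
          fix y assume y: "y \<in> space (gauss_mat m 1)"
          show "frob_sq y \<noteq> 0 \<longrightarrow> ?f (vcat R (T x y)) \<le> (1 + ennreal (frob_sq (K * x))) * ennreal (1 / (frob_sq y)\<^sup>2)"
          proof
            assume "frob_sq y \<noteq> 0"
            then have "?f (vcat R (T x y)) \<le> ennreal ((1 + frob_sq (K * x)) * (1 / (frob_sq y)\<^sup>2))"
              using T[OF _ _ _ refl, of x y] x y by (intro ennreal_leI) auto
            also have "\<dots> = (1 + ennreal (frob_sq (K * x))) * ennreal (1 / (frob_sq y)\<^sup>2)"
              by (subst ennreal_mult) (auto simp: add_nonneg_nonneg)
            finally show "?f (vcat R (T x y)) \<le> (1 + ennreal (frob_sq (K * x))) * ennreal (1 / (frob_sq y)\<^sup>2)" .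
          qed
        qed (use m in auto)
        also have "\<dots> = (1 + ennreal (frob_sq (K * x))) * (\<integral>\<^sup>+y. ennreal (1 / (frob_sq y)\<^sup>2) \<partial>gauss_mat m 1)"
          by (rule nn_integral_cmult[OF my])
        also have "\<dots> \<le> (1 + ennreal (frob_sq (K * x))) * ennreal ?I"
          by (intro mult_left_mono nn_integral_inverse_frob_sq_sq m) simp
        finally show "(\<integral>\<^sup>+y. ?f (vcat R (T x y)) \<partial>gauss_mat m 1) \<le> (1 + ennreal (frob_sq (K * x))) * ennreal ?I" .
      qed
      also have "\<dots> = (1 + ennreal (frob_sq K)) * ennreal ?I"
      proof -
        have mx: "(\<lambda>x. ennreal (frob_sq (K * x))) \<in> borel_measurable (gauss_mat r 1)"
          by (intro measurable_compose[OF mat_borel_frob_sq[OF mat_borel_mult[OF mat_borel_const[OF K(1)] measurable_ident_gauss_mat]] measurable_ennreal])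
        have "(\<integral>\<^sup>+x. ennreal (frob_sq (K * x)) \<partial>gauss_mat r 1) = (\<integral>\<^sup>+x. ennreal (frob_sq (K * x * 1\<^sub>m 1)) \<partial>gauss_mat r 1)"
          using K(1) by (intro nn_integral_cong) (auto simp: mult_one_dim)
        also have "\<dots> = ennreal (frob_sq K)"
          using nn_integral_frob_sq_mult[OF K(1), of "1\<^sub>m 1" 1 1] by simp
        finally have 1: "(\<integral>\<^sup>+x. ennreal (frob_sq (K * x)) \<partial>gauss_mat r 1) = ennreal (frob_sq K)" .
        have "(\<integral>\<^sup>+x. (1 + ennreal (frob_sq (K * x))) * ennreal ?I \<partial>gauss_mat r 1)
          = (\<integral>\<^sup>+x. 1 + ennreal (frob_sq (K * x)) \<partial>gauss_mat r 1) * ennreal ?I"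
          using mx by (intro nn_integral_multc) simp
        also have "(\<integral>\<^sup>+x. 1 + ennreal (frob_sq (K * x)) \<partial>gauss_mat r 1) = 1 + ennreal (frob_sq K)"
          using mx prob_space.emeasure_space_1[OF prob_space_gauss_mat[of r 1]] by (subst nn_integral_add) (auto simp: 1[simplified])
        finally show ?thesis .
      qed
      also have "\<dots> \<le> (1 + ennreal (frob_sq (R\<^sup>T * minv (R * R\<^sup>T)))) * ennreal ?I"
        using K(2) by (intro mult_right_mono add_mono ennreal_leI) auto
      finally show "(\<integral>\<^sup>+\<phi>. ?f (vcat R \<phi>) \<partial>gauss_mat 1 (r + m)) \<le> (1 + ennreal (frob_sq (R\<^sup>T * minv (R * R\<^sup>T)))) * ennreal ?I" .
    qed
  qed simp
  also have "\<dots> = (\<integral>\<^sup>+R. 1 + ennreal (frob_sq (R\<^sup>T * minv (R * R\<^sup>T))) \<partial>gauss_mat r (r + m)) * ennreal ?I"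
    using fR by (intro nn_integral_multc) simp
  also have "(\<integral>\<^sup>+R. 1 + ennreal (frob_sq (R\<^sup>T * minv (R * R\<^sup>T))) \<partial>gauss_mat r (r + m))
      = 1 + (\<integral>\<^sup>+R. ennreal (frob_sq (R\<^sup>T * minv (R * R\<^sup>T))) \<partial>gauss_mat r (r + m))"
    using fR prob_space.emeasure_space_1[OF prob_space_gauss_mat[of r "r + m"]] by (subst nn_integral_add) auto
  also have "(1 + (\<integral>\<^sup>+R. ennreal (frob_sq (R\<^sup>T * minv (R * R\<^sup>T))) \<partial>gauss_mat r (r + m))) * ennreal ?I
      \<le> (1 + ennreal (real r / (real m - 1))) * ennreal ?I"
    by (intro mult_right_mono add_mono ER) auto
  also have "\<dots> = ennreal ((1 + real r / (real m - 1)) * ?I)"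
    using m I0 by (subst ennreal_mult) auto
  finally show ?thesis by simp
qed

text \<open>All r columns of the inverse have the same law up to rotation, so the bound for the last
  one is multiplied by r.\<close>

lemma nn_integral_inv_wishart_sq:
  assumes r: "0 < r" "r + 4 \<le> c"
  shows "(\<integral>\<^sup>+X. ennreal (frob_sq (minv (X * X\<^sup>T))) \<partial>gauss_mat r c)
    \<le> ennreal (real r * (real c - 1) / ((real c - real r) * (real c - real r - 1) * (real c - real r - 3)))"
proof -
  obtain r' where r': "r = Suc r'" using r by (cases r) auto
  define m where "m = c - r'"
  have c: "c = r' + m" "5 \<le> m" using r r' by (auto simp: m_def)
  let ?e = "\<lambda>j. colm (1\<^sub>m r) j"
  let ?B = "(1 + real r' / (real m - 1)) * (1 / ((real m - 2) * (real m - 4)))"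
  let ?h = "\<lambda>v X. ennreal (frob_sq (minv (X * X\<^sup>T) * v))"
  have hm: "?h w \<in> borel_measurable (mat_borel r c)" if "w \<in> carrier_mat r 1" for w
    by (intro measurable_compose[OF mat_borel_frob_sq[OF mat_borel_mult[OF mat_borel_minv[OF mat_borel_gram[OF mat_borel_ident]] mat_borel_const[OF that]]] measurable_ennreal])
  have AEd: "AE X in gauss_mat r c. mdet (X * X\<^sup>T) \<noteq> 0" using r by (intro AE_gauss_mat_gram_det) simp
  have col: "(\<integral>\<^sup>+X. ?h (?e j) X \<partial>gauss_mat r c) \<le> ennreal ?B" if j: "j < r" for j
  proof -
    have e: "?e j \<in> carrier_mat r 1" by (intro carrier_matI) auto
    have "frob_sq (?e j) = (\<Sum>i<r. if i = j then 1 else 0)"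
      unfolding frob_sq_def using j by (simp add: colm_def if_distrib[of "\<lambda>x. x\<^sup>2"] cong: if_cong)
    then have e1: "frob_sq (?e j) = 1" using j by simp
    obtain U where U: "U \<in> rot_inv r" "U * ?e j = 1 \<cdot>\<^sub>m last_unit r'"
      using rot_inv_to_last[OF e[unfolded r']] e1 unfolding r' by auto
    have U2: "U * ?e j = last_unit r'" unfolding U(2) by (rule eq_matI) auto
    have Uc: "U \<in> carrier_mat r r" and UU: "U\<^sup>T * U = 1\<^sub>m r" using U by (auto simp: rot_inv_def)
    have d: "dim_row U = r" "dim_col U = r" using Uc by auto
    have "(\<integral>\<^sup>+X. ?h (?e j) X \<partial>gauss_mat r c) = (\<integral>\<^sup>+X. ?h (U * ?e j) (U * X) \<partial>gauss_mat r c)"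
    proof (rule nn_integral_cong_AE, rule AE_mp[OF AEd AE_I2], rule impI)
      fix X assume "X \<in> space (gauss_mat r c)" and det: "mdet (X * X\<^sup>T) \<noteq> 0"
      then have X: "X \<in> carrier_mat r c" "dim_row X = r" "dim_col X = c" by auto
      have "minv ((U * X) * (U * X)\<^sup>T) * (U * ?e j) = U * (minv (X * X\<^sup>T) * (U\<^sup>T * (U * ?e j)))"
        unfolding minv_gram_rotate[OF U(1) X(1) det] using d X by (simp add: mult_assoc_dim)
      also have "U\<^sup>T * (U * ?e j) = ?e j" using d by (intro mat_mult_cancel_left[OF UU]) auto
      finally show "?h (?e j) X = ?h (U * ?e j) (U * X)"
        using d X frob_sq_isometry[OF UU, of "minv (X * X\<^sup>T) * ?e j"] by simp
    qed
    also have "\<dots> = (\<integral>\<^sup>+X. ?h (U * ?e j) X \<partial>gauss_mat r c)"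
      by (rule nn_integral_gauss_mat_rotate[OF U(1) hm]) (use Uc e in auto)
    also have "\<dots> \<le> ennreal ?B"
      unfolding U2 unfolding r' c(1) by (rule nn_integral_inv_wishart_sq_last[OF c(2)])
    finally show ?thesis .
  qed
  have "(\<integral>\<^sup>+X. ennreal (frob_sq (minv (X * X\<^sup>T))) \<partial>gauss_mat r c)
     = (\<integral>\<^sup>+X. (\<Sum>j<r. ?h (?e j) X) \<partial>gauss_mat r c)"
  proof (intro nn_integral_cong)
    fix X assume "X \<in> space (gauss_mat r c)"
    then have "dim_row X = r" by auto
    then have "frob_sq (minv (X * X\<^sup>T)) = (\<Sum>j<r. frob_sq (minv (X * X\<^sup>T) * ?e j))"
      using frob_sq_mult_cols[of "minv (X * X\<^sup>T)" "1\<^sub>m r"] by (simp add: mult_one_dim)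
    then show "ennreal (frob_sq (minv (X * X\<^sup>T))) = (\<Sum>j<r. ?h (?e j) X)" by (simp add: sum_ennreal)
  qed
  also have "\<dots> = (\<Sum>j<r. \<integral>\<^sup>+X. ?h (?e j) X \<partial>gauss_mat r c)"
  proof (rule nn_integral_sum)
    fix j
    have "?e j \<in> carrier_mat r 1" by (intro carrier_matI) auto
    from hm[OF this] show "?h (?e j) \<in> borel_measurable (gauss_mat r c)" by (simp cong: measurable_cong_sets)
  qed
  also have "\<dots> \<le> (\<Sum>j<r. ennreal ?B)" by (intro sum_mono col) auto
  also have "\<dots> = ennreal (real r * ?B)" using c by (simp add: ennreal_of_nat_eq_real_of_nat ennreal_mult'[symmetric])
  \<comment> \<open>With m = c - r + 1 the first factor of \<open>?B\<close> is 1 + (r - 1) / (c -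
    r) = (c - 1) / (c - r).\<close>
  also have "real r * ?B = real r * (real c - 1) / ((real c - real r) * (real c - real r - 1) * (real c - real r - 3))"
  proof -
    have 1: "real r' = real r - 1" "real m = real c - real r + 1" using r' c by auto
    have "real c - real r \<noteq> 0" using r by auto
    then show ?thesis unfolding 1 by (simp add: field_simps)
  qed
  finally show ?thesis .
qed

section \<open>Measurability of pseudoinverse and spectral norm\<close>

lemma smult_mult_dim: "dim_col A = dim_row B \<Longrightarrow> (x \<cdot>\<^sub>m A) * B = x \<cdot>\<^sub>m (A * B :: real mat)"
  by (rule mult_smult_assoc_mat[of _ "dim_row A" "dim_col A" _ "dim_col B"]) auto

lemma frob_sq_minus_le:
  assumes "dim_row A = dim_row B" "dim_col A = dim_col B"
  shows "frob_sq (A - B) \<le> 2 * frob_sq A + 2 * frob_sq B"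
proof -
  have "frob_sq (A + B) + frob_sq (A - B) = 2 * frob_sq A + 2 * frob_sq B"
    using assms by (simp add: frob_sq_add frob_sq_minus)
  then show ?thesis using frob_sq_nonneg[of "A + B"] by linarith
qed

lemma abs_entry_le_frob:
  assumes "i < dim_row A" "j < dim_col A"
  shows "\<bar>A $$ (i, j)\<bar> \<le> sqrt (frob_sq A)"
proof -
  have "(A $$ (i, j))\<^sup>2 \<le> (\<Sum>j<dim_col A. (A $$ (i, j))\<^sup>2)"
    using assms by (intro member_le_sum) auto
  also have "\<dots> \<le> frob_sq A"
    unfolding frob_sq_def using assms
    by (intro member_le_sum[of i _ "\<lambda>i. \<Sum>j<dim_col A. (A $$ (i, j))\<^sup>2"]) (auto intro: sum_nonneg)
  finally show ?thesis using real_sqrt_le_mono by fastforce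
qed

text \<open>The pseudoinverse is discontinuous; its measurability comes from the limit of Tikhonov regularisations.\<close>

definition tikhonov :: "real mat \<Rightarrow> real \<Rightarrow> real mat" where
  "tikhonov A t = minv (A\<^sup>T * A + t \<cdot>\<^sub>m 1\<^sub>m (dim_col A)) * A\<^sup>T"

text \<open>\<open>D\<close> is at least t times the identity: pairing \<open>D * V\<close> with
  \<open>V\<close> gives at least t |V|^2, and Cauchy-Schwarz turns this into a lower bound for |D
  V|. It yields both the invertibility of \<open>D\<close> and the bound 1 / t for its
  inverse.\<close>

lemma tikhonov_resolvent:
  fixes A V :: "real mat"
  assumes t: "0 < t" and V: "dim_row V = dim_col A"
  defines "D \<equiv> A\<^sup>T * A + t \<cdot>\<^sub>m 1\<^sub>m (dim_col A)"
  shows "t\<^sup>2 * frob_sq V \<le> frob_sq (D * V)"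
proof -
  have DV: "D * V = A\<^sup>T * (A * V) + t \<cdot>\<^sub>m V"
    unfolding D_def using V by (simp add: mat_ring smult_mult_dim one_mult_dim)
  have 1: "finner V (D * V) = frob_sq (A * V) + t * frob_sq V"
  proof -
    have "finner V (D * V) = finner (D * V) V" using V by (intro finner_sym) (auto simp: D_def)
    also have "\<dots> = finner (A\<^sup>T * (A * V)) V + finner (t \<cdot>\<^sub>m V) V" unfolding DV using V by (intro finner_add) auto
    also have "finner (A\<^sup>T * (A * V)) V = frob_sq (A * V)" unfolding frob_sq_finner using V finner_mult_left[of "A * V" A V] by simp
    also have "finner (t \<cdot>\<^sub>m V) V = t * frob_sq V"
      unfolding frob_sq_finner finner_def by (simp add: sum_distrib_left mult.assoc)
    finally show ?thesis .
  qed
  have "(t * frob_sq V)\<^sup>2 \<le> (finner V (D * V))\<^sup>2" unfolding 1 using t by (intro power_mono) auto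
  also have "\<dots> \<le> frob_sq V * frob_sq (D * V)" using V by (intro finner_Cauchy) (auto simp: D_def)
  finally have "frob_sq V * (t\<^sup>2 * frob_sq V) \<le> frob_sq V * frob_sq (D * V)"
    by (simp add: power2_eq_square mult_ac)
  then show ?thesis
  proof (cases "frob_sq V = 0")
    case False
    then have "0 < frob_sq V" by (simp add: less_le)
    then show ?thesis using \<open>frob_sq V * (t\<^sup>2 * frob_sq V) \<le> _\<close> by simp
  qed simp
qed

text \<open>Expanding twice, the difference is t K - t^2 D^(-1) K. The resolvent bound gives |t
  D^(-1) K| <= |K|, so both terms are of order t with a constant depending on the matrix only, which
  is enough for pointwise convergence.\<close>

lemma tikhonov_pinv:
  fixes A :: "real mat"
  assumes t: "0 < t"
  shows "frob_sq (pinv A - tikhonov A t) \<le> 4 * t\<^sup>2 * frob_sq (pinv A * (pinv A)\<^sup>T * pinv A)"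
proof -
  let ?n = "dim_col A" and ?P = "pinv A"
  let ?D = "A\<^sup>T * A + t \<cdot>\<^sub>m 1\<^sub>m ?n"
  have Dc: "?D \<in> carrier_mat ?n ?n" by auto
  have det: "mdet ?D \<noteq> 0"
  proof (rule det_nz_of_kernel[OF Dc])
    fix v :: "real mat" assume v: "v \<in> carrier_mat ?n 1" "?D * v = 0\<^sub>m ?n 1"
    have "t\<^sup>2 * frob_sq v \<le> frob_sq (?D * v)" using v(1) by (intro tikhonov_resolvent t) auto
    also have "\<dots> = 0" unfolding v(2) by (simp add: frob_sq_def)
    finally have "t\<^sup>2 * frob_sq v \<le> 0" .
    then have "frob_sq v = 0" using t frob_sq_nonneg[of v] by (auto simp: mult_le_0_iff)
    then show "v = 0\<^sub>m ?n 1" using frob_sq_zero_iff[of v] v(1) by auto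
  qed
  note Dm = minv_mult[of ?D ?n, OF _ _ det, simplified]
  have P: "?P \<in> carrier_mat ?n (dim_row A)" and p: "A * ?P * A = A" "?P * A * ?P = ?P" "(A * ?P)\<^sup>T = A * ?P" "(?P * A)\<^sup>T = ?P * A"
    using pinv_is_pinv[of A] by (auto simp: is_pinv_def)
  have d: "dim_row ?P = ?n" "dim_col ?P = dim_row A" using P by auto
  \<comment> \<open>A preimage of the pseudoinverse under \<open>A\<^sup>T * A\<close>; it supplies
    the second expansion step.\<close>
  define K where "K = ?P * ?P\<^sup>T * ?P"
  have K: "dim_row K = ?n" "dim_col K = dim_row A" using d by (auto simp: K_def)
  have AT: "A\<^sup>T = A\<^sup>T * A * ?P"
  proof -
    have "A\<^sup>T = (A * ?P * A)\<^sup>T" unfolding p(1) ..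
    also have "\<dots> = A\<^sup>T * (A * ?P)\<^sup>T" using d by (simp add: transpose_mult_dim)
    finally show ?thesis unfolding p(3) using d by (simp add: mult_assoc_dim)
  qed
  have PK: "?P = A\<^sup>T * A * K"
  proof -
    have "?P = (?P * A)\<^sup>T * ?P" unfolding p(4) p(2) ..
    also have "\<dots> = A\<^sup>T * (?P\<^sup>T * ?P)" using d by (simp add: mat_ring)
    also have "\<dots> = (A\<^sup>T * A * ?P) * (?P\<^sup>T * ?P)" using AT by simp
    also have "\<dots> = A\<^sup>T * A * K" using d by (simp add: K_def mat_ring)
    finally show ?thesis .
  qed
  have DP: "?D * ?P = A\<^sup>T + t \<cdot>\<^sub>m ?P"
    using d AT by (simp add: add_mult_dim smult_mult_dim one_mult_dim)
  have DK: "?D * K = ?P + t \<cdot>\<^sub>m K"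
    using K PK by (simp add: add_mult_dim smult_mult_dim one_mult_dim)
  have diff: "?P - tikhonov A t = t \<cdot>\<^sub>m K - t \<cdot>\<^sub>m (t \<cdot>\<^sub>m (minv ?D * K))"
  proof -
    have "?P = minv ?D * (?D * ?P)" using d by (intro mat_mult_cancel_left[OF Dm(2), symmetric]) auto
    also have "\<dots> = tikhonov A t + t \<cdot>\<^sub>m (minv ?D * ?P)"
      unfolding DP tikhonov_def using d by (simp add: mult_add_dim mult_smult_dim)
    finally have 1: "?P = tikhonov A t + t \<cdot>\<^sub>m (minv ?D * ?P)" .
    have "K = minv ?D * (?D * K)" using K by (intro mat_mult_cancel_left[OF Dm(2), symmetric]) auto
    also have "\<dots> = minv ?D * ?P + t \<cdot>\<^sub>m (minv ?D * K)"
      unfolding DK using d K by (simp add: mult_add_dim mult_smult_dim)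
    finally have 2: "K = minv ?D * ?P + t \<cdot>\<^sub>m (minv ?D * K)" .
    show ?thesis
    proof (rule eq_matI)
      fix i j assume "i < dim_row (t \<cdot>\<^sub>m K - t \<cdot>\<^sub>m (t \<cdot>\<^sub>m (minv ?D * K)))" "j < dim_col (t \<cdot>\<^sub>m K - t \<cdot>\<^sub>m (t \<cdot>\<^sub>m (minv ?D * K)))"
      then have ij: "i < ?n" "j < dim_row A" using K by auto
      have td: "dim_row (tikhonov A t) = ?n" "dim_col (tikhonov A t) = dim_row A" by (auto simp: tikhonov_def)
      have "?P $$ (i, j) = tikhonov A t $$ (i, j) + t * (minv ?D * ?P) $$ (i, j)"
        using arg_cong[OF 1, of "\<lambda>M. M $$ (i, j)"] ij td d by (simp del: index_mult_mat(1))
      moreover have "K $$ (i, j) = (minv ?D * ?P) $$ (i, j) + t * (minv ?D * K) $$ (i, j)"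
        using arg_cong[OF 2, of "\<lambda>M. M $$ (i, j)"] ij K d by (simp del: index_mult_mat(1))
      ultimately show "(?P - tikhonov A t) $$ (i, j) = (t \<cdot>\<^sub>m K - t \<cdot>\<^sub>m (t \<cdot>\<^sub>m (minv ?D * K))) $$ (i, j)"
        using ij d K td by (simp add: algebra_simps del: index_mult_mat(1))
    qed (use d K in \<open>auto simp: tikhonov_def\<close>)
  qed
  have "t\<^sup>2 * frob_sq (minv ?D * K) \<le> frob_sq (?D * (minv ?D * K))"
    using K by (intro tikhonov_resolvent t) auto
  also have "?D * (minv ?D * K) = K" using K by (intro mat_mult_cancel_left[OF Dm(1)]) auto
  finally have V: "frob_sq (t \<cdot>\<^sub>m (minv ?D * K)) \<le> frob_sq K" by (simp add: frob_sq_smult)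
  have "frob_sq (?P - tikhonov A t) \<le> 2 * frob_sq (t \<cdot>\<^sub>m K) + 2 * frob_sq (t \<cdot>\<^sub>m (t \<cdot>\<^sub>m (minv ?D * K)))"
    unfolding diff using K by (intro frob_sq_minus_le) auto
  also have "\<dots> \<le> 2 * (t\<^sup>2 * frob_sq K) + 2 * (t\<^sup>2 * frob_sq K)"
    unfolding frob_sq_smult[of t K] frob_sq_smult[of t "t \<cdot>\<^sub>m _"] using V by (intro add_mono mult_left_mono) auto
  finally show ?thesis by (simp add: K_def)
qed

lemma tikhonov_tendsto_pinv:
  assumes "i < dim_col A" "j < dim_row A"
  shows "(\<lambda>k. tikhonov A (1 / real (Suc k)) $$ (i, j)) \<longlonglongrightarrow> pinv A $$ (i, j)"
proof -
  let ?K = "pinv A * (pinv A)\<^sup>T * pinv A"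
  have P: "pinv A \<in> carrier_mat (dim_col A) (dim_row A)" using pinv_is_pinv[of A] by (auto simp: is_pinv_def)
  have td: "dim_row (tikhonov A t) = dim_col A" "dim_col (tikhonov A t) = dim_row A" for t by (auto simp: tikhonov_def)
  have bd: "norm (tikhonov A (1 / real (Suc k)) $$ (i, j) - pinv A $$ (i, j)) \<le> 2 * sqrt (frob_sq ?K) * (1 / real (Suc k))" for k
  proof -
    let ?t = "1 / real (Suc k)"
    have "\<bar>(pinv A - tikhonov A ?t) $$ (i, j)\<bar> \<le> sqrt (frob_sq (pinv A - tikhonov A ?t))"
      using assms P td by (intro abs_entry_le_frob) auto
    also have "\<dots> \<le> sqrt (4 * ?t\<^sup>2 * frob_sq ?K)" by (intro real_sqrt_le_mono tikhonov_pinv) simp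
    also have "\<dots> = sqrt 4 * ?t * sqrt (frob_sq ?K)" unfolding real_sqrt_mult by (simp only: real_sqrt_abs) simp
    also have "sqrt 4 = 2" by (rule real_sqrt_unique) auto
    also have "2 * ?t * sqrt (frob_sq ?K) = 2 * sqrt (frob_sq ?K) * ?t" by simp
    also have "(pinv A - tikhonov A ?t) $$ (i, j) = pinv A $$ (i, j) - tikhonov A ?t $$ (i, j)"
      using assms td by simp
    finally show ?thesis unfolding real_norm_def by (subst abs_minus_commute)
  qed
  have lim: "(\<lambda>k. 2 * sqrt (frob_sq ?K) * (1 / real (Suc k))) \<longlonglongrightarrow> 0"
    using tendsto_mult_left[OF LIMSEQ_inverse_real_of_nat, of "2 * sqrt (frob_sq ?K)"] by (simp add: inverse_eq_divide)
  have "(\<lambda>k. tikhonov A (1 / real (Suc k)) $$ (i, j) - pinv A $$ (i, j)) \<longlonglongrightarrow> 0"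
    by (rule Lim_null_comparison[OF always_eventually[OF allI[OF bd]] lim])
  then show ?thesis by (simp add: LIM_zero_iff)
qed

lemma pinv_dims: "dim_row (pinv A) = dim_col A" "dim_col (pinv A) = dim_row A"
  using pinv_is_pinv[of A] by (auto simp: is_pinv_def)

lemma mat_borel_pinv:
  assumes X: "X \<in> measurable N (mat_borel r c)"
  shows "(\<lambda>\<omega>. pinv (X \<omega>)) \<in> measurable N (mat_borel c r)"
proof (rule mat_borelI)
  fix i j assume ij: "i < c" "j < r"
  show "(\<lambda>\<omega>. pinv (X \<omega>) $$ (i, j)) \<in> borel_measurable N"
  proof (rule borel_measurable_LIMSEQ_real)
    fix k :: nat
    let ?t = "1 / real (Suc k)"
    have "(\<lambda>\<omega>. minv ((X \<omega>)\<^sup>T * X \<omega> + ?t \<cdot>\<^sub>m 1\<^sub>m c) * (X \<omega>)\<^sup>T) \<in> measurable N (mat_borel c r)"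
      by (intro mat_borel_mult[of _ _ _ c] mat_borel_minv mat_borel_add mat_borel_const mat_borel_mult[of _ _ _ r] mat_borel_transpose X) auto
    also have "?this \<longleftrightarrow> (\<lambda>\<omega>. tikhonov (X \<omega>) ?t) \<in> measurable N (mat_borel c r)"
      by (intro measurable_cong) (simp add: tikhonov_def mat_borel_dims[OF X])
    finally show "(\<lambda>\<omega>. tikhonov (X \<omega>) ?t $$ (i, j)) \<in> borel_measurable N"
      using ij by (rule mat_borel_entry)
  next
    fix \<omega> assume "\<omega> \<in> space N"
    then show "(\<lambda>k. tikhonov (X \<omega>) (1 / real (Suc k)) $$ (i, j)) \<longlonglongrightarrow> pinv (X \<omega>) $$ (i, j)"
      using ij by (intro tikhonov_tendsto_pinv) (simp_all add: mat_borel_dims[OF X])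
  qed
qed (intro carrier_matI; simp add: pinv_dims mat_borel_dims[OF X])

section \<open>The spectral norm: product bound and measurability\<close>

definition mcol :: "real vec \<Rightarrow> real mat" where
  "mcol x = mat (dim_vec x) 1 (\<lambda>(i, _). x $ i)"

lemma mcol_dim [simp]: "dim_row (mcol x) = dim_vec x" "dim_col (mcol x) = 1"
  by (auto simp: mcol_def)

lemma vec2_norm_mcol: "vec2_norm x = sqrt (frob_sq (mcol x))"
  by (simp add: vec2_norm_def frob_sq_def mcol_def scalar_prod_def power2_eq_square atLeast0LessThan)

lemma mcol_mult: "dim_col C = dim_vec x \<Longrightarrow> mcol (C *\<^sub>v x) = C * mcol x"
  by (rule eq_matI) (auto simp: mcol_def scalar_prod_def)

lemma spec_norm_bdd:
  "bdd_above ((\<lambda>x. vec2_norm (C *\<^sub>v x)) ` {x \<in> carrier_vec (dim_col C). vec2_norm x = 1})"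
proof (rule bdd_aboveI2)
  fix x assume x: "x \<in> {x \<in> carrier_vec (dim_col C). vec2_norm x = 1}"
  then have "vec2_norm (C *\<^sub>v x) = sqrt (frob_sq (C * mcol x))" by (auto simp: vec2_norm_mcol mcol_mult)
  also have "\<dots> \<le> sqrt (frob_sq C * frob_sq (mcol x))"
    using x by (intro real_sqrt_le_mono frob_sq_mult_le) auto
  also have "\<dots> = sqrt (frob_sq C)" using x by (simp add: vec2_norm_mcol real_sqrt_mult)
  finally show "vec2_norm (C *\<^sub>v x) \<le> sqrt (frob_sq C)" .
qed

lemma spec_norm_bound:
  assumes v: "v \<in> carrier_mat (dim_col C) 1"
  shows "sqrt (frob_sq (C * v)) \<le> spec_norm C * sqrt (frob_sq v)"
proof (cases "frob_sq v = 0")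
  case True
  then have "v = 0\<^sub>m (dim_col C) 1" using frob_sq_zero_iff[of v] v by auto
  then have "C * v = 0\<^sub>m (dim_row C) 1" by (simp add: right_mult_zero_mat[of _ "dim_row C" "dim_col C"])
  then show ?thesis using True by (simp add: frob_sq_def)
next
  case False
  then have s: "0 < sqrt (frob_sq v)" by (simp add: less_le)
  define x where "x = vec (dim_col C) (\<lambda>i. v $$ (i, 0) / sqrt (frob_sq v))"
  have mx: "mcol x = (1 / sqrt (frob_sq v)) \<cdot>\<^sub>m v" using v by (intro eq_matI) (auto simp: mcol_def x_def)
  have x: "x \<in> carrier_vec (dim_col C)" by (simp add: x_def)
  have nx: "vec2_norm x = 1" unfolding vec2_norm_mcol mx frob_sq_smult using False by (simp add: power_divide)
  have "vec2_norm (C *\<^sub>v x) \<le> spec_norm C"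
    unfolding spec_norm_def using x nx by (intro cSUP_upper spec_norm_bdd) auto
  also have "vec2_norm (C *\<^sub>v x) = sqrt (frob_sq (C * v)) / sqrt (frob_sq v)"
    using x v by (simp add: vec2_norm_mcol mcol_mult mx mult_smult_dim frob_sq_smult real_sqrt_mult real_sqrt_divide power_divide)
  finally show ?thesis using s by (simp add: divide_le_eq)
qed

text \<open>Without columns the unit sphere is empty and nothing is known about the supremum, hence
  the hypothesis.\<close>

lemma spec_norm_nonneg:
  assumes "0 < dim_col C" shows "0 \<le> spec_norm C"
proof -
  have "sqrt (frob_sq (C * colm (1\<^sub>m (dim_col C)) 0)) \<le> spec_norm C * sqrt (frob_sq (colm (1\<^sub>m (dim_col C)) 0))"
    by (rule spec_norm_bound) (auto intro!: carrier_matI)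
  also have "frob_sq (colm (1\<^sub>m (dim_col C)) 0) = 1"
    unfolding frob_sq_def using assms by (simp add: colm_def if_distrib[of "\<lambda>x. x\<^sup>2"] cong: if_cong)
  finally have "sqrt (frob_sq (C * colm (1\<^sub>m (dim_col C)) 0)) \<le> spec_norm C" by simp
  moreover have "0 \<le> sqrt (frob_sq (C * colm (1\<^sub>m (dim_col C)) 0))" by simp
  ultimately show ?thesis by linarith
qed

text \<open>Row by row this is |C^T b| <= |C| |b|. It follows from |C^T b|^2 = <C C^T b, b> and
  Cauchy-Schwarz, which avoids comparing the spectral norms of \<open>C\<close> and its transpose.
  It is used with the inverse of T as \<open>C\<close>.\<close>

lemma frob_sq_mult_spec_norm:
  assumes "dim_col B = dim_row C" "0 < dim_col C"
  shows "frob_sq (B * C) \<le> frob_sq B * (spec_norm C)\<^sup>2"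
proof -
  let ?s = "spec_norm C"
  have col: "frob_sq (C\<^sup>T * b) \<le> ?s\<^sup>2 * frob_sq b" if b: "b \<in> carrier_mat (dim_row C) 1" for b
  proof -
    let ?y = "C\<^sup>T * b"
    have y: "?y \<in> carrier_mat (dim_col C) 1" using b by auto
    have "frob_sq ?y = finner ?y (C\<^sup>T * b)" by (simp add: frob_sq_finner)
    also have "\<dots> = finner (C * ?y) b" using b by (subst finner_mult_left) auto
    finally have "(frob_sq ?y)\<^sup>2 = (finner (C * ?y) b)\<^sup>2" by simp
    also have "\<dots> \<le> frob_sq (C * ?y) * frob_sq b" using b by (intro finner_Cauchy) auto
    also have "frob_sq (C * ?y) \<le> ?s\<^sup>2 * frob_sq ?y"
    proof -
      have "(sqrt (frob_sq (C * ?y)))\<^sup>2 \<le> (?s * sqrt (frob_sq ?y))\<^sup>2"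
        by (intro power_mono spec_norm_bound[OF y]) simp
      then show ?thesis by (simp add: power_mult_distrib)
    qed
    finally have "frob_sq ?y * frob_sq ?y \<le> frob_sq ?y * (?s\<^sup>2 * frob_sq b)"
      by (simp add: power2_eq_square mult_ac mult_right_mono)
    then show ?thesis
    proof (cases "frob_sq ?y = 0")
      case False
      then have "0 < frob_sq ?y" by (simp add: less_le)
      then show ?thesis using \<open>frob_sq ?y * frob_sq ?y \<le> _\<close> by (simp only: mult_le_cancel_left_pos)
    qed simp
  qed
  have "frob_sq (B * C) = frob_sq (C\<^sup>T * B\<^sup>T)" using assms frob_sq_transpose[of "B * C"] by (simp add: transpose_mult_dim)
  also have "\<dots> = (\<Sum>j<dim_row B. frob_sq (C\<^sup>T * colm (B\<^sup>T) j))" using assms by (subst frob_sq_mult_cols) auto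
  also have "\<dots> \<le> (\<Sum>j<dim_row B. ?s\<^sup>2 * frob_sq (colm (B\<^sup>T) j))" using assms by (intro sum_mono col) (auto intro!: carrier_matI)
  also have "\<dots> = ?s\<^sup>2 * frob_sq (B\<^sup>T)" using frob_sq_eq_sum_cols[of "B\<^sup>T"] by (simp add: sum_distrib_left colm_def)
  finally show ?thesis by (simp add: mult.commute)
qed

text \<open>Countably many test vectors make sublevel sets of the norm measurable. The homogeneous,
  squared inequality allows rational vectors of any length, whereas rational points of the unit
  sphere would be awkward.\<close>

lemma spec_norm_le_iff_rational:
  assumes c: "0 < dim_col A" and b: "0 \<le> b"
  shows "spec_norm A \<le> b \<longleftrightarrow> (\<forall>f \<in> {..<dim_col A} \<rightarrow>\<^sub>E \<rat>. frob_sq (A * mat (dim_col A) 1 (\<lambda>(i, _). f i)) \<le> b\<^sup>2 * frob_sq (mat (dim_col A) 1 (\<lambda>(i, _). f i)))"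
    (is "_ \<longleftrightarrow> (\<forall>f\<in>?F. ?Q f)")
proof
  assume s: "spec_norm A \<le> b"
  show "\<forall>f\<in>?F. ?Q f"
  proof
    fix f assume "f \<in> ?F"
    let ?v = "mat (dim_col A) 1 (\<lambda>(i, _). f i)"
    have "sqrt (frob_sq (A * ?v)) \<le> spec_norm A * sqrt (frob_sq ?v)" by (rule spec_norm_bound) simp
    also have "\<dots> \<le> b * sqrt (frob_sq ?v)" using s by (intro mult_right_mono) auto
    finally have "(sqrt (frob_sq (A * ?v)))\<^sup>2 \<le> (b * sqrt (frob_sq ?v))\<^sup>2" by (intro power_mono) auto
    then show "?Q f" by (simp add: power_mult_distrib)
  qed
next
  assume F: "\<forall>f\<in>?F. ?Q f"
  have bound: "frob_sq (A * v) \<le> b\<^sup>2 * frob_sq v" if v: "v \<in> carrier_mat (dim_col A) 1" for v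
  proof -
    \<comment> \<open>Rounding down to multiples of 1 / (k + 1) approximates \<open>v\<close> by
      rational vectors; the value \<open>undefined\<close> outside the index range puts
      \<open>f k\<close> into the extensional function space.\<close>
    define f where "f = (\<lambda>k i. if i < dim_col A then real_of_int \<lfloor>real (Suc k) * v $$ (i, 0)\<rfloor> / real (Suc k) else undefined)"
    let ?w = "\<lambda>k. mat (dim_col A) 1 (\<lambda>(i, _). f k i)"
    have lim: "(\<lambda>k. f k i) \<longlonglongrightarrow> v $$ (i, 0)" if "i < dim_col A" for i
    proof -
      have bd: "norm (f k i - v $$ (i, 0)) \<le> 1 / real (Suc k)" for k
      proof -
        let ?x = "real (Suc k) * v $$ (i, 0)"
        have "f k i - v $$ (i, 0) = (real_of_int \<lfloor>?x\<rfloor> - ?x) / real (Suc k)"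
          using that by (simp add: f_def diff_divide_distrib)
        moreover have "\<bar>real_of_int \<lfloor>?x\<rfloor> - ?x\<bar> \<le> 1" by linarith
        ultimately show ?thesis by (simp add: divide_right_mono)
      qed
      have "(\<lambda>k. f k i - v $$ (i, 0)) \<longlonglongrightarrow> 0"
        by (rule Lim_null_comparison[OF always_eventually[OF allI[OF bd]]
              LIMSEQ_inverse_real_of_nat[unfolded inverse_eq_divide]])
      then show ?thesis by (simp add: LIM_zero_iff)
    qed
    have fF: "f k \<in> ?F" for k by (auto simp: f_def PiE_iff extensional_def)
    have 1: "(\<lambda>k. frob_sq (?w k)) \<longlonglongrightarrow> frob_sq v"
      unfolding frob_sq_def using v lim by (auto intro!: tendsto_sum tendsto_power)
    have 2: "(\<lambda>k. frob_sq (A * ?w k)) \<longlonglongrightarrow> frob_sq (A * v)"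
      unfolding frob_sq_def using v lim
      by (auto simp: mat_mult_index simp del: index_mult_mat(1) intro!: tendsto_sum tendsto_power tendsto_mult)
    show ?thesis
      by (rule LIMSEQ_le[OF 2 tendsto_mult_left[OF 1]]) (use F fF in auto)
  qed
  show "spec_norm A \<le> b"
    unfolding spec_norm_def
  proof (rule cSUP_least)
    have "vec2_norm (vec (dim_col A) (\<lambda>i. if i = 0 then 1 else 0)) = 1"
      unfolding vec2_norm_mcol mcol_def frob_sq_def using c by (simp add: if_distrib[of "\<lambda>x. x\<^sup>2"] cong: if_cong)
    then show "{x \<in> carrier_vec (dim_col A). vec2_norm x = 1} \<noteq> {}" by (auto intro!: exI[of _ "vec (dim_col A) (\<lambda>i. if i = 0 then 1 else 0)"])
    fix x assume x: "x \<in> {x \<in> carrier_vec (dim_col A). vec2_norm x = 1}"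
    have "vec2_norm (A *\<^sub>v x) = sqrt (frob_sq (A * mcol x))" using x by (auto simp: vec2_norm_mcol mcol_mult)
    also have "\<dots> \<le> sqrt (b\<^sup>2 * frob_sq (mcol x))" using x by (intro real_sqrt_le_mono bound carrier_matI) auto
    also have "\<dots> = b" using x b by (simp add: vec2_norm_mcol real_sqrt_mult)
    finally show "vec2_norm (A *\<^sub>v x) \<le> b" .
  qed
qed

lemma borel_measurable_spec_norm:
  assumes X: "X \<in> measurable N (mat_borel r c)" and c: "0 < c"
  shows "(\<lambda>\<omega>. spec_norm (X \<omega>)) \<in> borel_measurable N"
proof (rule borel_measurable_iff_le[THEN iffD2], rule allI)
  fix b :: real
  show "{\<omega> \<in> space N. spec_norm (X \<omega>) \<le> b} \<in> sets N"
  proof (cases "0 \<le> b")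
    case False
    have "0 \<le> spec_norm (X \<omega>)" if "\<omega> \<in> space N" for \<omega>
      using spec_norm_nonneg c mat_borel_dims(2)[OF X that] by simp
    then have eq: "{\<omega> \<in> space N. spec_norm (X \<omega>) \<le> b} = {}"
      using False by fastforce
    show ?thesis unfolding eq by simp
  next
    case True
    let ?F = "{..<c} \<rightarrow>\<^sub>E (\<rat> :: real set)"
    have count: "countable ?F" by (intro countable_PiE) (auto simp: countable_rat)
    have "{\<omega> \<in> space N. spec_norm (X \<omega>) \<le> b}
      = {\<omega> \<in> space N. \<forall>f\<in>?F. frob_sq (X \<omega> * mat c 1 (\<lambda>(i, _). f i)) \<le> b\<^sup>2 * frob_sq (mat c 1 (\<lambda>(i, _). f i))}"
      using c True by (intro Collect_cong conj_cong refl) (subst spec_norm_le_iff_rational, simp_all add: mat_borel_dims[OF X])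
    also have "\<dots> \<in> sets N"
    proof (rule sets.sets_Collect_countable_All'[OF _ count])
      fix f
      have [measurable]: "(\<lambda>\<omega>. frob_sq (X \<omega> * mat c 1 (\<lambda>(i, _). f i))) \<in> borel_measurable N"
        by (rule mat_borel_frob_sq[OF mat_borel_mult[OF X mat_borel_const[where c = 1]]]) simp
      show "{\<omega> \<in> space N. frob_sq (X \<omega> * mat c 1 (\<lambda>(i, _). f i)) \<le> b\<^sup>2 * frob_sq (mat c 1 (\<lambda>(i, _). f i))} \<in> sets N"
        by measurable
    qed
    finally show ?thesis .
  qed
qed

section \<open>The sketched least-squares error\<close>

lemma zero_add_dim: "dim_row A = n \<Longrightarrow> dim_col A = m \<Longrightarrow> 0\<^sub>m n m + A = (A :: real mat)"
  by (rule eq_matI) auto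

lemma residual_orthogonal:
  fixes Q :: "real mat"
  assumes Q: "Q \<in> carrier_mat m s" "Q\<^sup>T * Q = 1\<^sub>m s" and A: "A \<in> carrier_mat m n"
  shows "Q\<^sup>T * (A - Q * (Q\<^sup>T * A)) = 0\<^sub>m s n"
proof -
  have "Q\<^sup>T * (Q * (Q\<^sup>T * A)) = Q\<^sup>T * A" using Q A by (intro mat_mult_cancel_left[OF Q(2)]) auto
  then have "Q\<^sup>T * (A - Q * (Q\<^sup>T * A)) = Q\<^sup>T * A - Q\<^sup>T * A" using Q A by (simp add: mult_minus_dim)
  then show ?thesis using Q A by (simp add: minus_self_dim)
qed

text \<open>Pythagoras for a matrix whose columns are orthogonal to the range of \<open>Q\<close>
  and one with columns in that range.\<close>

lemma frob_sq_add_range: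
  fixes Q :: "real mat"
  assumes Q: "Q \<in> carrier_mat m s" "Q\<^sup>T * Q = 1\<^sub>m s" and E: "E \<in> carrier_mat m n" "Q\<^sup>T * E = 0\<^sub>m s n"
    and D: "D \<in> carrier_mat s n"
  shows "frob_sq (E - Q * D) = frob_sq E + frob_sq D"
proof -
  have "finner E (Q * D) = finner (Q\<^sup>T * E) D" using Q E D by (subst finner_mult_left) auto
  then have "finner E (Q * D) = 0" unfolding E(2) by simp
  moreover have "frob_sq (Q * D) = frob_sq D" using Q D by (intro frob_sq_isometry) auto
  ultimately show ?thesis using Q E D by (subst frob_sq_minus) auto
qed

text \<open>The two approximations differ by an element of the range of \<open>Q\<close>, to which
  the residual of the projection is orthogonal.\<close>

lemma best_approximation:
  fixes Q :: "real mat"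
  assumes Q: "Q \<in> carrier_mat m s" "Q\<^sup>T * Q = 1\<^sub>m s" and A: "A \<in> carrier_mat m n" and N: "N \<in> carrier_mat s n"
  shows "frob_sq (A - Q * (Q\<^sup>T * A)) \<le> frob_sq (A - Q * N)"
proof -
  let ?E = "A - Q * (Q\<^sup>T * A)" and ?D = "N - Q\<^sup>T * A"
  have d: "dim_row Q = m" "dim_col Q = s" "dim_row A = m" "dim_col A = n" "dim_row N = s" "dim_col N = n"
    using Q A N by auto
  have "A - Q * N = ?E - Q * ?D"
  proof (rule eq_matI)
    fix i j assume ij: "i < dim_row (?E - Q * ?D)" "j < dim_col (?E - Q * ?D)"
    have "Q * ?D = Q * N - Q * (Q\<^sup>T * A)" using d by (simp add: mult_minus_dim)
    then show "(A - Q * N) $$ (i, j) = (?E - Q * ?D) $$ (i, j)" using ij d by (simp del: index_mult_mat(1))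
  qed (use d in auto)
  then have "frob_sq (A - Q * N) = frob_sq (?E - Q * ?D)" by (rule arg_cong)
  also have "\<dots> = frob_sq ?E + frob_sq ?D"
    using residual_orthogonal[OF Q A] d by (intro frob_sq_add_range[OF Q, where n = n]) (auto intro!: carrier_matI)
  finally show ?thesis using frob_sq_nonneg[of ?D] by linarith
qed

text \<open>After a rotation, \<open>\<Psi> Q\<close> and the part of \<open>\<Psi>\<close> acting on the residual are independent Gaussian blocks.\<close>

lemma nn_integral_sketch_error:
  assumes Q: "Q \<in> carrier_mat m s" "Q\<^sup>T * Q = 1\<^sub>m s" and A: "A \<in> carrier_mat m n"
    and s: "0 < s" "s + 2 \<le> d" "s \<le> m"
  shows "(\<integral>\<^sup>+\<Psi>. ennreal (frob_sq (A - Q * (pinv (\<Psi> * Q) * (\<Psi> * A)))) \<partial>gauss_mat d m)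
    \<le> ennreal (real d / (real d - real s - 1) * frob_sq (A - Q * (Q\<^sup>T * A)))"
proof -
  define E where "E = A - Q * (Q\<^sup>T * A)"
  define k where "k = m - s"
  have m: "m = s + k" using s by (simp add: k_def)
  have dm: "dim_row Q = m" "dim_col Q = s" "dim_row A = m" "dim_col A = n" "dim_row E = m" "dim_col E = n"
    using Q A by (auto simp: E_def)
  have QE: "Q\<^sup>T * E = 0\<^sub>m s n" unfolding E_def by (rule residual_orthogonal[OF Q A])
  \<comment> \<open>In these coordinates \<open>Q\<close> occupies the first s rows and the residual
    \<open>E\<close>, being orthogonal to it, the remaining k rows.\<close>
  obtain U where U: "U \<in> rot_inv m" and UQ0: "U * Q = mat m s (\<lambda>(i, j). if i = j then 1 else 0)"
    using rot_inv_orthonormal[OF Q s(3)] by blast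
  have UQ: "U * Q = vcat (1\<^sub>m s) (0\<^sub>m k s)" unfolding UQ0 m by (rule eq_matI) (auto simp: vcat_index)
  have Uc: "U \<in> carrier_mat m m" and UU: "U\<^sup>T * U = 1\<^sub>m m" using U by (auto simp: rot_inv_def)
  have dU: "dim_row U = m" "dim_col U = m" using Uc by auto
  define E2 where "E2 = mat k n (\<lambda>(i, j). (U * E) $$ (s + i, j))"
  define E1 where "E1 = mat s n (\<lambda>(i, j). (U * E) $$ (i, j))"
  have UE0: "U * E = vcat E1 E2"
    unfolding E1_def E2_def by (rule vcat_split) (use dU dm m in \<open>auto intro!: carrier_matI\<close>)
  have dE: "dim_row E1 = s" "dim_col E1 = n" "dim_row E2 = k" "dim_col E2 = n" by (auto simp: E1_def E2_def)
  have "E1 = 0\<^sub>m s n"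
  proof -
    have "(U * Q)\<^sup>T * (U * E) = Q\<^sup>T * (U\<^sup>T * (U * E))" using dU dm by (simp add: mat_ring)
    also have "U\<^sup>T * (U * E) = E" using dU dm by (intro mat_mult_cancel_left[OF UU]) auto
    finally have "(vcat (1\<^sub>m s) (0\<^sub>m k s))\<^sup>T * vcat E1 E2 = 0\<^sub>m s n" unfolding UQ UE0 QE .
    then have "(1\<^sub>m s)\<^sup>T * E1 + (0\<^sub>m k s)\<^sup>T * E2 = 0\<^sub>m s n"
      using dE by (subst (asm) transpose_vcat_mult) auto
    then show ?thesis using dE by (simp add: one_mult_dim add_zero_dim zero_add_dim)
  qed
  then have UE: "U * E = vcat (0\<^sub>m s n) E2" using UE0 by simp
  have fE2: "frob_sq E2 = frob_sq E"
  proof -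
    have "frob_sq E = frob_sq (U * E)" using dU dm by (subst frob_sq_isometry[OF UU]) auto
    also have "\<dots> = frob_sq E2" unfolding UE using dE by (subst frob_sq_vcat) (auto simp: frob_sq_def)
    finally show ?thesis ..
  qed
  let ?f = "\<lambda>\<Psi>. ennreal (frob_sq (A - Q * (pinv (\<Psi> * Q) * (\<Psi> * A))))"
  have fm: "?f \<in> borel_measurable (mat_borel d m)"
    by (rule measurable_compose[OF mat_borel_frob_sq[OF mat_borel_minus[OF mat_borel_const[OF A]
        mat_borel_mult[OF mat_borel_const[OF Q(1)] mat_borel_mult[OF
          mat_borel_pinv[OF mat_borel_mult[OF mat_borel_ident mat_borel_const[OF Q(1)]]]
          mat_borel_mult[OF mat_borel_ident mat_borel_const[OF A]]]]]] measurable_ennreal])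
  have fm1: "(\<lambda>\<Psi>. ?f (\<Psi> * U)) \<in> borel_measurable (mat_borel d m)"
    by (rule measurable_compose[OF mat_borel_mult[OF mat_borel_ident mat_borel_const[OF Uc]] fm])
  have fm2: "(\<lambda>Y. ?f (Y\<^sup>T * U)) \<in> borel_measurable (mat_borel (s + k) d)"
    using measurable_compose[OF mat_borel_transpose[OF mat_borel_ident] fm1] unfolding m .
  have "(\<integral>\<^sup>+\<Psi>. ?f \<Psi> \<partial>gauss_mat d m) = (\<integral>\<^sup>+\<Psi>. ?f (\<Psi> * U) \<partial>gauss_mat d m)"
    by (rule nn_integral_gauss_mat_rotate_right[OF U fm, symmetric])
  also have "\<dots> = (\<integral>\<^sup>+Y. ?f (Y\<^sup>T * U) \<partial>gauss_mat (s + k) d)"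
    unfolding m by (rule nn_integral_gauss_mat_transpose[OF fm1[unfolded m], symmetric])
  also have "\<dots> = (\<integral>\<^sup>+Y1. \<integral>\<^sup>+Y2. ?f ((vcat Y1 Y2)\<^sup>T * U) \<partial>gauss_mat k d \<partial>gauss_mat s d)"
    by (rule nn_integral_gauss_mat_vcat[OF fm2])
  also have "\<dots> = (\<integral>\<^sup>+Y1. ennreal (frob_sq E) + ennreal (frob_sq E) * ennreal (frob_sq (Y1\<^sup>T * minv (Y1 * Y1\<^sup>T) * 1\<^sub>m s)) \<partial>gauss_mat s d)"
  proof (rule nn_integral_cong_AE, rule AE_mp[OF AE_gauss_mat_gram_det AE_I2])
    show "s \<le> d" using s by simp
    fix Y1 assume "Y1 \<in> space (gauss_mat s d)"
    then have Y1: "Y1 \<in> carrier_mat s d" "dim_row Y1 = s" "dim_col Y1 = d" by auto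
    show "mdet (Y1 * Y1\<^sup>T) \<noteq> 0 \<longrightarrow> (\<integral>\<^sup>+Y2. ?f ((vcat Y1 Y2)\<^sup>T * U) \<partial>gauss_mat k d)
        = ennreal (frob_sq E) + ennreal (frob_sq E) * ennreal (frob_sq (Y1\<^sup>T * minv (Y1 * Y1\<^sup>T) * 1\<^sub>m s))"
    proof
      assume det: "mdet (Y1 * Y1\<^sup>T) \<noteq> 0"
      define P where "P = minv (Y1 * Y1\<^sup>T) * Y1"
      have P: "dim_row P = s" "dim_col P = d" using Y1 by (auto simp: P_def)
      \<comment> \<open>The transposed block has full column rank, so the pseudoinverse is a left
        inverse. The part of \<open>A\<close> in the range of \<open>Q\<close> is reproduced
        exactly, and only the residual creates an error.\<close>
      have pinv: "pinv (Y1\<^sup>T) = P" using pinv_full_col_rank[of "Y1\<^sup>T" d s] Y1 det by (auto simp: P_def)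
      have PY: "P * Y1\<^sup>T = 1\<^sub>m s" using Y1 det by (simp add: P_def mult_assoc_dim minv_mult)
      have Ms: "(minv (Y1 * Y1\<^sup>T))\<^sup>T = minv (Y1 * Y1\<^sup>T)"
        using Y1 det by (intro minv_sym[of _ s]) (auto simp: transpose_mult_dim)
      have fP: "frob_sq P = frob_sq (Y1\<^sup>T * minv (Y1 * Y1\<^sup>T) * 1\<^sub>m s)"
        using frob_sq_transpose[of P] Y1 Ms by (simp add: P_def transpose_mult_dim mult_one_dim)
      have "?f ((vcat Y1 Y2)\<^sup>T * U) = ennreal (frob_sq E) + ennreal (frob_sq (E2\<^sup>T * Y2 * P\<^sup>T))"
        if "Y2 \<in> carrier_mat k d" for Y2
      proof -
        have Y2: "dim_row Y2 = k" "dim_col Y2 = d" using that by auto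
        let ?\<Psi> = "(vcat Y1 Y2)\<^sup>T * U"
        have "?\<Psi> * Q = (vcat Y1 Y2)\<^sup>T * vcat (1\<^sub>m s) (0\<^sub>m k s)"
          unfolding UQ[symmetric] using Y1 Y2 dU dm m by (simp add: mult_assoc_dim)
        also have "\<dots> = Y1\<^sup>T * 1\<^sub>m s + Y2\<^sup>T * 0\<^sub>m k s" using Y1 Y2 by (intro transpose_vcat_mult) auto
        also have "\<dots> = Y1\<^sup>T" using Y1 Y2 by (simp add: mult_one_dim add_zero_dim zero_add_dim)
        finally have PQ: "?\<Psi> * Q = Y1\<^sup>T" .
        have "?\<Psi> * E = (vcat Y1 Y2)\<^sup>T * vcat (0\<^sub>m s n) E2"
          unfolding UE[symmetric] using Y1 Y2 dU dm m by (simp add: mult_assoc_dim)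
        also have "\<dots> = Y1\<^sup>T * 0\<^sub>m s n + Y2\<^sup>T * E2" using Y1 Y2 dE by (intro transpose_vcat_mult) auto
        also have "\<dots> = Y2\<^sup>T * E2" using Y1 Y2 dE by (simp add: zero_add_dim)
        finally have PE: "?\<Psi> * E = Y2\<^sup>T * E2" .
        have "A = Q * (Q\<^sup>T * A) + E" using dm by (intro eq_matI) (auto simp: E_def)
        then have "?\<Psi> * A = ?\<Psi> * (Q * (Q\<^sup>T * A) + E)" by (rule arg_cong)
        also have "\<dots> = ?\<Psi> * (Q * (Q\<^sup>T * A)) + ?\<Psi> * E"
          using dm dU Y1 Y2 m by (intro mult_add_dim) auto
        also have "?\<Psi> * (Q * (Q\<^sup>T * A)) = (?\<Psi> * Q) * (Q\<^sup>T * A)"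
          using dm dU Y1 Y2 m by (intro mult_assoc_dim[symmetric]) auto
        finally have "P * (?\<Psi> * A) = P * (Y1\<^sup>T * (Q\<^sup>T * A)) + P * (Y2\<^sup>T * E2)"
          unfolding PQ PE using Y1 Y2 P dm dE by (simp add: mult_add_dim)
        also have "P * (Y1\<^sup>T * (Q\<^sup>T * A)) = Q\<^sup>T * A"
          using Y1 P dm by (intro mat_mult_cancel_left[OF PY]) auto
        finally have B: "P * (?\<Psi> * A) = Q\<^sup>T * A + P * (Y2\<^sup>T * E2)" .
        have "A - Q * (P * (?\<Psi> * A)) = E - Q * (P * (Y2\<^sup>T * E2))"
        proof -
          have "Q * (P * (?\<Psi> * A)) = Q * (Q\<^sup>T * A) + Q * (P * (Y2\<^sup>T * E2))"
            unfolding B using dm P Y2 dE by (simp add: mult_add_dim)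
          then show ?thesis using dm P Y2 dE by (intro eq_matI) (auto simp: E_def simp del: index_mult_mat(1))
        qed
        then have "frob_sq (A - Q * (pinv (?\<Psi> * Q) * (?\<Psi> * A))) = frob_sq (E - Q * (P * (Y2\<^sup>T * E2)))"
          unfolding PQ pinv by (rule arg_cong)
        also have "\<dots> = frob_sq E + frob_sq (P * (Y2\<^sup>T * E2))"
          using dm P Y2 dE QE by (intro frob_sq_add_range[OF Q, where n = n]) (auto intro!: carrier_matI)
        also have "P * (Y2\<^sup>T * E2) = (E2\<^sup>T * Y2 * P\<^sup>T)\<^sup>T" using P Y2 dE by (simp add: mat_ring)
        finally show ?thesis by simp
      qed
      then have "(\<integral>\<^sup>+Y2. ?f ((vcat Y1 Y2)\<^sup>T * U) \<partial>gauss_mat k d)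
          = (\<integral>\<^sup>+Y2. ennreal (frob_sq E) + ennreal (frob_sq (E2\<^sup>T * Y2 * P\<^sup>T)) \<partial>gauss_mat k d)"
        by (intro nn_integral_cong) auto
      also have "\<dots> = ennreal (frob_sq E) + (\<integral>\<^sup>+Y2. ennreal (frob_sq (E2\<^sup>T * Y2 * P\<^sup>T)) \<partial>gauss_mat k d)"
      proof -
        have "(\<lambda>Y2. ennreal (frob_sq (E2\<^sup>T * Y2 * P\<^sup>T))) \<in> borel_measurable (gauss_mat k d)"
          by (intro measurable_compose[OF mat_borel_frob_sq[OF mat_borel_mult[OF mat_borel_mult[OF mat_borel_const measurable_ident_gauss_mat] mat_borel_const]] measurable_ennreal])
            (use dE P in \<open>auto intro!: carrier_matI\<close>)
        then show ?thesis using prob_space.emeasure_space_1[OF prob_space_gauss_mat[of k d]]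
          by (subst nn_integral_add) auto
      qed
      also have "(\<integral>\<^sup>+Y2. ennreal (frob_sq (E2\<^sup>T * Y2 * P\<^sup>T)) \<partial>gauss_mat k d) = ennreal (frob_sq (E2\<^sup>T) * frob_sq (P\<^sup>T))"
        using dE P by (intro nn_integral_frob_sq_mult) (auto intro!: carrier_matI)
      also have "\<dots> = ennreal (frob_sq E) * ennreal (frob_sq (Y1\<^sup>T * minv (Y1 * Y1\<^sup>T) * 1\<^sub>m s))"
        by (simp add: fE2 fP ennreal_mult')
      finally show "(\<integral>\<^sup>+Y2. ?f ((vcat Y1 Y2)\<^sup>T * U) \<partial>gauss_mat k d)
        = ennreal (frob_sq E) + ennreal (frob_sq E) * ennreal (frob_sq (Y1\<^sup>T * minv (Y1 * Y1\<^sup>T) * 1\<^sub>m s))" .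
    qed
  qed
  also have "\<dots> = ennreal (frob_sq E) + ennreal (frob_sq E) * (\<integral>\<^sup>+Y1. ennreal (frob_sq (Y1\<^sup>T * minv (Y1 * Y1\<^sup>T) * 1\<^sub>m s)) \<partial>gauss_mat s d)"
  proof -
    have "(\<lambda>Y1. ennreal (frob_sq (Y1\<^sup>T * minv (Y1 * Y1\<^sup>T) * 1\<^sub>m s))) \<in> borel_measurable (gauss_mat s d)"
      by (intro measurable_compose[OF mat_borel_frob_sq[OF mat_borel_mult[OF mat_borel_mult[OF mat_borel_transpose[OF measurable_ident_gauss_mat]
       mat_borel_minv[OF mat_borel_gram[OF measurable_ident_gauss_mat]]] mat_borel_const]] measurable_ennreal]) auto
    then show ?thesis using prob_space.emeasure_space_1[OF prob_space_gauss_mat[of s d]]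
      by (subst nn_integral_add) (auto simp: nn_integral_cmult)
  qed
  also have "\<dots> \<le> ennreal (frob_sq E) + ennreal (frob_sq E) * ennreal (frob_sq (1\<^sub>m s) / (real d - real s - 1))"
    using s by (intro add_mono mult_left_mono nn_integral_pinv_mult) auto
  also have "\<dots> = ennreal (frob_sq E + frob_sq E * (real s / (real d - real s - 1)))"
    using s by (simp add: ennreal_mult'[symmetric])
  also have "frob_sq E + frob_sq E * (real s / (real d - real s - 1)) = (real d - 1) / (real d - real s - 1) * frob_sq E"
    using s by (simp add: field_simps)
  \<comment> \<open>The bound obtained has d - 1 in the numerator: 1 + s / (d - s - 1) = (d - 1) /
    (d - s - 1). It is weakened to d here.\<close>
  also have "ennreal \<dots> \<le> ennreal (real d / (real d - real s - 1) * frob_sq E)"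
    using s by (intro ennreal_leI mult_right_mono divide_right_mono) auto
  finally show ?thesis unfolding E_def .
qed

section \<open>From the range of the sketch to an explicit competitor\<close>

lemma range_factor:
  assumes "M \<in> carrier_mat r c" "N \<in> carrier_mat r c'"
    and sub: "vec_space.col_space r M \<subseteq> vec_space.col_space r (N :: real mat)"
  shows "\<exists>X\<in>carrier_mat c' c. M = N * X"
proof -
  have "\<exists>x\<in>carrier_vec c'. N *\<^sub>v x = col M j" if j: "j < c" for j
  proof -
    have "col M j = M *\<^sub>v unit_vec c j" using assms(1) j by (intro eq_vecI) auto
    then have "col M j \<in> vec_space.col_space r M"
      using assms(1) by (subst vec_space.col_space_eq) auto
    then have "col M j \<in> vec_space.col_space r N" using sub by auto
    then show ?thesis using assms(2) by (subst (asm) vec_space.col_space_eq) auto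
  qed
  then obtain x where x: "\<And>j. j < c \<Longrightarrow> x j \<in> carrier_vec c'" "\<And>j. j < c \<Longrightarrow> N *\<^sub>v x j = col M j" by metis
  have "M = N * mat c' c (\<lambda>(i, j). x j $ i)"
  proof (rule eq_matI)
    fix i j assume "i < dim_row (N * mat c' c (\<lambda>(i, j). x j $ i))" "j < dim_col (N * mat c' c (\<lambda>(i, j). x j $ i))"
    then have ij: "i < r" "j < c" using assms by auto
    have "M $$ (i, j) = (N *\<^sub>v x j) $ i" unfolding x(2)[OF ij(2)] using ij assms by simp
    also have "\<dots> = (N * mat c' c (\<lambda>(i, j). x j $ i)) $$ (i, j)"
      using ij assms x(1)[OF ij(2)] by (auto simp: scalar_prod_def)
    finally show "M $$ (i, j) = (N * mat c' c (\<lambda>(i, j). x j $ i)) $$ (i, j)" .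
  qed (use assms in auto)
  then show ?thesis by (intro bexI[of _ "mat c' c (\<lambda>(i, j). x j $ i)"]) auto
qed

section \<open>Deterministic low-rank error bound\<close>

text \<open>\<open>A\<close> enters through its Gram matrix and the range relation for
  \<open>Q\<close>, so left singular vectors do not appear: norms of \<open>A * (V2 * X)\<close> are
  those of \<open>L2 * X\<close>. \<open>L1\<close> and \<open>L2\<close> are abstract
  symmetric-type factors standing for \<Sigma>_1 and \<Sigma>_2, and \<open>N0\<close> records that
  the range of \<open>Q\<close> contains one power step.\<close>

lemma low_rank_error:
  fixes A V1 V2 L1 L2 \<Omega> \<Phi> Q N0 :: "real mat"
  assumes A: "A \<in> carrier_mat m n" and V: "V1 \<in> carrier_mat n \<rho>" "V2 \<in> carrier_mat n k"
    and V22: "V2\<^sup>T * V2 = 1\<^sub>m k" and V11: "V1\<^sup>T * V1 = 1\<^sub>m \<rho>" and V21: "V2\<^sup>T * V1 = 0\<^sub>m k \<rho>"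
    and VV: "V1 * V1\<^sup>T + V2 * V2\<^sup>T = 1\<^sub>m n"
    and L: "L1 \<in> carrier_mat \<rho> \<rho>" "L2 \<in> carrier_mat k k" "L2\<^sup>T = L2" "mdet L1 \<noteq> 0"
    and AA: "A\<^sup>T * A = V1 * (L1 * L1) * V1\<^sup>T + V2 * (L2 * L2) * V2\<^sup>T"
    and \<Omega>: "\<Omega> \<in> carrier_mat n s" and \<Phi>: "\<Phi> \<in> carrier_mat n l"
    and Q: "Q \<in> carrier_mat m s" "Q\<^sup>T * Q = 1\<^sub>m s"
    and N0: "N0 \<in> carrier_mat s s" "(A * \<Phi>) * ((A * \<Phi>)\<^sup>T * (A * \<Omega>)) = Q * N0"
  defines "\<Omega>1 \<equiv> V1\<^sup>T * \<Omega>" and "\<Omega>2 \<equiv> V2\<^sup>T * \<Omega>" and "\<Phi>1 \<equiv> V1\<^sup>T * \<Phi>" and "\<Phi>2 \<equiv> V2\<^sup>T * \<Phi>"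
  assumes det: "mdet (\<Omega>1 * \<Omega>1\<^sup>T) \<noteq> 0" "mdet (\<Phi>1 * \<Phi>1\<^sup>T) \<noteq> 0"
  defines "Op \<equiv> \<Omega>1\<^sup>T * minv (\<Omega>1 * \<Omega>1\<^sup>T)" and "M \<equiv> minv (\<Phi>1 * \<Phi>1\<^sup>T)"
  defines "G \<equiv> (L2 * L2) * \<Omega>2 * Op * (minv L1 * minv L1)"
  defines "T \<equiv> 1\<^sub>m \<rho> + \<Phi>1 * \<Phi>2\<^sup>T * G * M"
  assumes T: "mdet T \<noteq> 0"
  shows "frob_sq (A - Q * (Q\<^sup>T * A)) \<le> frob_sq L2 + frob_sq (L2 * \<Phi>2 * (\<Phi>1\<^sup>T + \<Phi>2\<^sup>T * G) * M * minv T)"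
proof -
  have d: "dim_row A = m" "dim_col A = n" "dim_row V1 = n" "dim_col V1 = \<rho>" "dim_row V2 = n" "dim_col V2 = k"
    "dim_row L1 = \<rho>" "dim_col L1 = \<rho>" "dim_row L2 = k" "dim_col L2 = k" "dim_row \<Omega> = n" "dim_col \<Omega> = s"
    "dim_row \<Phi> = n" "dim_col \<Phi> = l" "dim_row Q = m" "dim_col Q = s" "dim_row N0 = s" "dim_col N0 = s"
    using A V L \<Omega> \<Phi> Q N0 by auto
  have d2: "dim_row \<Omega>1 = \<rho>" "dim_col \<Omega>1 = s" "dim_row \<Omega>2 = k" "dim_col \<Omega>2 = s"
    "dim_row \<Phi>1 = \<rho>" "dim_col \<Phi>1 = l" "dim_row \<Phi>2 = k" "dim_col \<Phi>2 = l"
    using d by (auto simp: \<Omega>1_def \<Omega>2_def \<Phi>1_def \<Phi>2_def)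
  have d3: "dim_row Op = s" "dim_col Op = \<rho>" "dim_row M = \<rho>" "dim_col M = \<rho>" using d2 by (auto simp: Op_def M_def)
  have d4: "dim_row G = k" "dim_col G = \<rho>" using d d2 d3 by (auto simp: G_def)
  have d5: "dim_row T = \<rho>" "dim_col T = \<rho>" using d2 d3 d4 by (auto simp: T_def)
  define H where "H = \<Phi>1\<^sup>T + \<Phi>2\<^sup>T * G"
  have dH: "dim_row H = l" "dim_col H = \<rho>" using d2 d4 by (auto simp: H_def)
  define J where "J = \<Phi>2 * (H * (M * minv T))"
  have dJ: "dim_row J = k" "dim_col J = \<rho>" using d2 d5 dH d3 by (auto simp: J_def)
  have OO: "\<Omega>1 * Op = 1\<^sub>m \<rho>" unfolding Op_def using d2 det by (simp add: mult_assoc_dim[symmetric] minv_mult)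
  have LL: "L1 * minv L1 = 1\<^sub>m \<rho>" using d L by (intro minv_mult) auto
  have MM: "(\<Phi>1 * \<Phi>1\<^sup>T) * M = 1\<^sub>m \<rho>" unfolding M_def using d2 det by (intro minv_mult) auto
  have TT: "T * minv T = 1\<^sub>m \<rho>" using d5 T by (intro minv_mult) auto
  \<comment> \<open>In the blocks, Z^T A \<Omega> is \<Phi>_1^T L1^2 \<Omega>_1 + \<Phi>_2^T L2^2
    \<Omega>_2. Since \<open>Op\<close> is a right inverse of \<Omega>_1, the right factor turns the
    first summand into \<Phi>_1^T and the second into \<Phi>_2^T G.\<close>
  have H: "(A * \<Phi>)\<^sup>T * (A * \<Omega>) * (Op * (minv L1 * minv L1)) = H"
  proof -
    have "(A * \<Phi>)\<^sup>T * (A * \<Omega>) = \<Phi>\<^sup>T * ((A\<^sup>T * A) * \<Omega>)" using d by (simp add: mat_ring)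
    also have "\<dots> = \<Phi>\<^sup>T * (V1 * ((L1 * L1) * \<Omega>1) + V2 * ((L2 * L2) * \<Omega>2))"
      unfolding AA \<Omega>1_def \<Omega>2_def using d by (simp add: mat_ring)
    also have "\<dots> = \<Phi>1\<^sup>T * ((L1 * L1) * \<Omega>1) + \<Phi>2\<^sup>T * ((L2 * L2) * \<Omega>2)"
      unfolding \<Phi>1_def \<Phi>2_def using d d2 by (simp add: mat_ring)
    finally have "(A * \<Phi>)\<^sup>T * (A * \<Omega>) * (Op * (minv L1 * minv L1))
      = \<Phi>1\<^sup>T * (L1 * (L1 * (\<Omega>1 * (Op * (minv L1 * minv L1))))) + \<Phi>2\<^sup>T * G"
      unfolding G_def using d d2 d3 by (simp add: mat_ring)
    also have "\<Omega>1 * (Op * (minv L1 * minv L1)) = minv L1 * minv L1"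
      using d d2 d3 by (intro mat_mult_cancel_left[OF OO]) auto
    also have "L1 * (minv L1 * minv L1) = minv L1" using d by (intro mat_mult_cancel_left[OF LL]) auto
    also have "\<Phi>1\<^sup>T * (L1 * minv L1) = \<Phi>1\<^sup>T" unfolding LL using d2 by (simp add: mult_one_dim)
    finally show ?thesis by (simp add: H_def)
  qed
  \<comment> \<open>Before division by T the V_1-coefficient \<Phi>_1 H M is exactly T; this is the
    origin of T.\<close>
  have P1HM: "\<Phi>1 * (H * (M * minv T)) = 1\<^sub>m \<rho>"
  proof -
    have "\<Phi>1 * (H * M) = (\<Phi>1 * \<Phi>1\<^sup>T) * M + \<Phi>1 * \<Phi>2\<^sup>T * G * M"
      unfolding H_def using d2 d3 d4 by (simp add: mat_ring)
    then have "\<Phi>1 * (H * M) = T" unfolding MM T_def .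
    then have "\<Phi>1 * (H * M) * minv T = 1\<^sub>m \<rho>" using TT by simp
    then show ?thesis using d2 dH d3 d5 by (simp add: mult_assoc_dim)
  qed
  have \<Phi>dec: "\<Phi> = V1 * \<Phi>1 + V2 * \<Phi>2"
  proof -
    have "\<Phi> = (V1 * V1\<^sup>T + V2 * V2\<^sup>T) * \<Phi>" unfolding VV using d by (simp add: one_mult_dim)
    then show ?thesis unfolding \<Phi>1_def \<Phi>2_def using d by (simp add: mat_ring)
  qed
  define K where "K = A * V1 + A * (V2 * J)"
  have dK: "dim_row K = m" "dim_col K = \<rho>" using d dJ by (auto simp: K_def)
  have "(A * \<Phi>) * (H * (M * minv T)) = K"
  proof -
    have "(A * \<Phi>) * (H * (M * minv T)) = A * ((V1 * \<Phi>1 + V2 * \<Phi>2) * (H * (M * minv T)))"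
      unfolding \<Phi>dec[symmetric] using d dH d3 d5 by (simp add: mult_assoc_dim)
    also have "\<dots> = A * (V1 * (\<Phi>1 * (H * (M * minv T))) + V2 * (\<Phi>2 * (H * (M * minv T))))"
      using d d2 dH d3 d5 by (simp add: mat_ring)
    also have "\<dots> = K" unfolding P1HM K_def J_def[symmetric] using d dJ by (simp add: mat_ring)
    finally show ?thesis .
  qed
  moreover have "(A * \<Phi>) * (H * (M * minv T)) = Q * (N0 * (Op * (minv L1 * minv L1)) * (M * minv T))"
  proof -
    have "(A * \<Phi>) * (H * (M * minv T)) = (A * \<Phi>) * ((A * \<Phi>)\<^sup>T * (A * \<Omega>)) * (Op * (minv L1 * minv L1)) * (M * minv T)"
      unfolding H[symmetric] using d d2 d3 d5 by (simp add: mult_assoc_dim)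
    then show ?thesis unfolding N0 using d d2 d3 d5 by (simp add: mult_assoc_dim)
  qed
  ultimately have KQ: "K = Q * (N0 * (Op * (minv L1 * minv L1)) * (M * minv T))" by simp
  \<comment> \<open>The coefficients of the competitor \<open>K * V1\<^sup>T\<close> with respect to
    \<open>Q\<close>.\<close>
  define N where "N = (N0 * (Op * (minv L1 * minv L1)) * (M * minv T)) * V1\<^sup>T"
  have N: "N \<in> carrier_mat s n" using d d3 d5 by (auto simp: N_def intro!: carrier_matI)
  have QN: "Q * N = K * V1\<^sup>T" unfolding N_def KQ using d d3 d5 by (simp add: mult_assoc_dim)
  have right: "frob_sq (X * V\<^sup>T) = frob_sq X" if "V\<^sup>T * V = 1\<^sub>m r" "dim_col X = dim_col V" for X V :: "real mat" and r
    using frob_sq_isometry[OF that(1), of "X\<^sup>T"] that(2) frob_sq_transpose[of "X * V\<^sup>T"] by (simp add: transpose_mult_dim)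
  have AV: "frob_sq (A * (V2 * X)) = frob_sq (L2 * X)" if X: "dim_row X = k" for X
  proof -
    have "V1\<^sup>T * V2 = 0\<^sub>m \<rho> k" using arg_cong[OF V21, of transpose_mat] d by (simp add: transpose_mult_dim)
    then have V2A: "V2\<^sup>T * ((A\<^sup>T * A) * (V2 * X)) = (L2 * L2) * X"
    proof -
      assume V12: "V1\<^sup>T * V2 = 0\<^sub>m \<rho> k"
      have "V2\<^sup>T * ((A\<^sup>T * A) * (V2 * X)) = (V2\<^sup>T * V1) * ((L1 * L1) * ((V1\<^sup>T * V2) * X)) + (V2\<^sup>T * V2) * ((L2 * L2) * ((V2\<^sup>T * V2) * X))"
        unfolding AA using d X by (simp add: mat_ring)
      then show ?thesis unfolding V12 V21 V22 using d X by (simp add: one_mult_dim zero_add_dim)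
    qed
    have "frob_sq (A * (V2 * X)) = finner (V2\<^sup>T * (A\<^sup>T * (A * (V2 * X)))) X"
      unfolding frob_sq_finner using d X by (subst finner_mult_left, simp, simp, simp, subst finner_mult_left) auto
    also have "V2\<^sup>T * (A\<^sup>T * (A * (V2 * X))) = L2 * (L2 * X)" using V2A d X by (simp add: mult_assoc_dim)
    also have "finner (L2 * (L2 * X)) X = frob_sq (L2 * X)"
      unfolding frob_sq_finner using d X L(3) finner_mult_left[of "L2 * X" L2 X] by simp
    finally show ?thesis .
  qed
  have "frob_sq (A - Q * (Q\<^sup>T * A)) \<le> frob_sq (A - Q * N)" by (rule best_approximation[OF Q A N])
  \<comment> \<open>The competitor reproduces the V_1 part of \<open>A\<close>. What remains acts on
    orthogonal row spaces, V_2 for the tail and V_1 for the perturbation by \<open>J\<close>, so the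
    cross term vanishes.\<close>
  also have "A - Q * N = (A * V2) * V2\<^sup>T - (A * (V2 * J)) * V1\<^sup>T"
  proof (rule eq_matI)
    fix i j assume ij: "i < dim_row ((A * V2) * V2\<^sup>T - (A * (V2 * J)) * V1\<^sup>T)" "j < dim_col ((A * V2) * V2\<^sup>T - (A * (V2 * J)) * V1\<^sup>T)"
    have "A = A * (V1 * V1\<^sup>T + V2 * V2\<^sup>T)" unfolding VV using d by (simp add: mult_one_dim)
    also have "\<dots> = (A * V1) * V1\<^sup>T + (A * V2) * V2\<^sup>T" using d by (simp add: mat_ring)
    finally have 1: "A $$ (i, j) = ((A * V1) * V1\<^sup>T + (A * V2) * V2\<^sup>T) $$ (i, j)" by (rule arg_cong)
    have "Q * N = (A * V1) * V1\<^sup>T + (A * (V2 * J)) * V1\<^sup>T" unfolding QN K_def using d dJ by (simp add: mat_ring)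
    then have 2: "(Q * N) $$ (i, j) = ((A * V1) * V1\<^sup>T + (A * (V2 * J)) * V1\<^sup>T) $$ (i, j)" by (rule arg_cong)
    show "(A - Q * N) $$ (i, j) = ((A * V2) * V2\<^sup>T - (A * (V2 * J)) * V1\<^sup>T) $$ (i, j)"
      using 1 2 ij d dJ N by (simp del: index_mult_mat(1))
  qed (use d N in auto)
  also have "frob_sq \<dots> = frob_sq ((A * V2) * V2\<^sup>T) + frob_sq ((A * (V2 * J)) * V1\<^sup>T)
      - 2 * finner ((A * V2) * V2\<^sup>T) ((A * (V2 * J)) * V1\<^sup>T)"
    using d dJ by (intro frob_sq_minus) auto
  also have "finner ((A * V2) * V2\<^sup>T) ((A * (V2 * J)) * V1\<^sup>T) = finner ((A * V2) * (V2\<^sup>T * V1)) (A * (V2 * J))"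
    using d dJ by (subst finner_mult_right) (auto simp: mult_assoc_dim)
  also have "\<dots> = 0" unfolding V21 using d by (simp)
  also have "frob_sq ((A * V2) * V2\<^sup>T) + frob_sq ((A * (V2 * J)) * V1\<^sup>T) - 2 * 0 = frob_sq L2 + frob_sq (L2 * J)"
    using right[OF V22, of "A * V2"] right[OF V11, of "A * (V2 * J)"] AV[of J] AV[of "1\<^sub>m k"] d dJ
    by (simp add: mult_one_dim)
  finally have "frob_sq (A - Q * (Q\<^sup>T * A)) \<le> frob_sq L2 + frob_sq (L2 * J)" .
  then show ?thesis unfolding J_def H_def using d d2 d3 d4 d5 by (simp add: mult_assoc_dim)
qed

section \<open>Selection of row blocks\<close>

definition topE :: "nat \<Rightarrow> nat \<Rightarrow> real mat" where
  "topE a b = mat a (a + b) (\<lambda>(i, j). if i = j then 1 else 0)"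

text \<open>With \<open>topE\<close> it writes the extraction of row blocks as a matrix product, so
  the algebra and the measurability rules for products apply to the blocks of \<Omega> and
  \<Phi>.\<close>

definition botE :: "nat \<Rightarrow> nat \<Rightarrow> real mat" where
  "botE a b = mat b (a + b) (\<lambda>(i, j). if a + i = j then 1 else 0)"

lemma topE_dim [simp]: "dim_row (topE a b) = a" "dim_col (topE a b) = a + b"
  and botE_dim [simp]: "dim_row (botE a b) = b" "dim_col (botE a b) = a + b"
  by (auto simp: topE_def botE_def)

lemma topE_mult_index:
  assumes "dim_row X = a + b" "i < a" "j < dim_col X" shows "(topE a b * X) $$ (i, j) = X $$ (i, j)"
proof -
  have "(topE a b * X) $$ (i, j) = (\<Sum>k<a + b. if i = k then X $$ (k, j) else 0)"
    using assms by (subst mat_mult_index) (auto simp: topE_def mult_delta_left intro!: sum.cong)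
  then show ?thesis using assms by simp
qed

lemma botE_mult_index:
  assumes "dim_row X = a + b" "i < b" "j < dim_col X" shows "(botE a b * X) $$ (i, j) = X $$ (a + i, j)"
proof -
  have "(botE a b * X) $$ (i, j) = (\<Sum>k<a + b. if a + i = k then X $$ (k, j) else 0)"
    using assms by (subst mat_mult_index) (auto simp: botE_def mult_delta_left intro!: sum.cong)
  then show ?thesis using assms by simp
qed

lemma topE_vcat:
  assumes "X \<in> carrier_mat a c" "Y \<in> carrier_mat b c" shows "topE a b * vcat X Y = X"
  by (rule eq_matI) (use assms in \<open>auto simp: topE_mult_index vcat_index simp del: index_mult_mat(1)\<close>)

lemma botE_vcat:
  assumes "X \<in> carrier_mat a c" "Y \<in> carrier_mat b c" shows "botE a b * vcat X Y = Y"
  by (rule eq_matI) (use assms in \<open>auto simp: botE_mult_index vcat_index simp del: index_mult_mat(1)\<close>)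

text \<open>Rotation invariance removes \<open>U\<close>, and stacking separates the blocks: the
  coordinates along V_1 and V_2 become independent Gaussian matrices.\<close>

lemma nn_integral_gauss_mat_split:
  assumes U: "U \<in> rot_inv (a + b)"
    and f: "(\<lambda>X. f (topE a b * X) (botE a b * X)) \<in> borel_measurable (mat_borel (a + b) c)"
  shows "(\<integral>\<^sup>+X. f (topE a b * (U * X)) (botE a b * (U * X)) \<partial>gauss_mat (a + b) c)
    = (\<integral>\<^sup>+X. \<integral>\<^sup>+Y. f X Y \<partial>gauss_mat b c \<partial>gauss_mat a c)"
proof -
  have "(\<integral>\<^sup>+X. f (topE a b * (U * X)) (botE a b * (U * X)) \<partial>gauss_mat (a + b) c)
     = (\<integral>\<^sup>+X. f (topE a b * X) (botE a b * X) \<partial>gauss_mat (a + b) c)"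
    by (rule nn_integral_gauss_mat_rotate[OF U f])
  also have "\<dots> = (\<integral>\<^sup>+X. \<integral>\<^sup>+Y. f (topE a b * vcat X Y) (botE a b * vcat X Y) \<partial>gauss_mat b c \<partial>gauss_mat a c)"
    by (rule nn_integral_gauss_mat_vcat[OF f])
  also have "\<dots> = (\<integral>\<^sup>+X. \<integral>\<^sup>+Y. f X Y \<partial>gauss_mat b c \<partial>gauss_mat a c)"
    by (intro nn_integral_cong) (simp add: topE_vcat botE_vcat)
  finally show ?thesis .
qed

section \<open>Expectation of the tail term\<close>

text \<open>The squared norm of \<open>L2 * J\<close> with the factor T^(-1) left off, that is, what
  remains to be averaged once this factor is bounded by \<xi>. \<open>S\<close> stands for
  \<Sigma>_1^(-2), and the pseudoinverse of \<Omega>_1 is in its full-rank form.\<close>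

definition tail_error :: "real mat \<Rightarrow> real mat \<Rightarrow> real mat \<Rightarrow> real mat \<Rightarrow> real mat \<Rightarrow> real mat \<Rightarrow> real" where
  "tail_error L2 S \<Phi>1 \<Phi>2 \<Omega>1 \<Omega>2 =
    frob_sq (L2 * \<Phi>2 * (\<Phi>1\<^sup>T + \<Phi>2\<^sup>T * ((L2 * L2) * \<Omega>2 * (\<Omega>1\<^sup>T * minv (\<Omega>1 * \<Omega>1\<^sup>T)) * S)) * minv (\<Phi>1 * \<Phi>1\<^sup>T))"

text \<open>The two summands of H are separated at the cost of a factor 2, the one in
  \<open>\<epsilon>\<close>. In the second summand \<Omega>_2 is isolated between factors that do
  not contain it, ready for the second moment formula.\<close>

lemma tail_error_le:
  assumes "L2 \<in> carrier_mat k k" "S \<in> carrier_mat \<rho> \<rho>" "\<Phi>1 \<in> carrier_mat \<rho> l" "\<Phi>2 \<in> carrier_mat k l"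
    "\<Omega>1 \<in> carrier_mat \<rho> s" "\<Omega>2 \<in> carrier_mat k s"
  shows "tail_error L2 S \<Phi>1 \<Phi>2 \<Omega>1 \<Omega>2 \<le>
    2 * frob_sq (L2 * \<Phi>2 * (\<Phi>1\<^sup>T * minv (\<Phi>1 * \<Phi>1\<^sup>T))) +
    2 * frob_sq ((L2 * \<Phi>2 * \<Phi>2\<^sup>T * (L2 * L2)) * \<Omega>2 * (\<Omega>1\<^sup>T * minv (\<Omega>1 * \<Omega>1\<^sup>T) * (S * minv (\<Phi>1 * \<Phi>1\<^sup>T))))"
proof -
  have d: "dim_row L2 = k" "dim_col L2 = k" "dim_row S = \<rho>" "dim_col S = \<rho>" "dim_row \<Phi>1 = \<rho>" "dim_col \<Phi>1 = l"
    "dim_row \<Phi>2 = k" "dim_col \<Phi>2 = l" "dim_row \<Omega>1 = \<rho>" "dim_col \<Omega>1 = s" "dim_row \<Omega>2 = k" "dim_col \<Omega>2 = s"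
    using assms by auto
  have "L2 * \<Phi>2 * (\<Phi>1\<^sup>T + \<Phi>2\<^sup>T * ((L2 * L2) * \<Omega>2 * (\<Omega>1\<^sup>T * minv (\<Omega>1 * \<Omega>1\<^sup>T)) * S)) * minv (\<Phi>1 * \<Phi>1\<^sup>T)
    = L2 * \<Phi>2 * (\<Phi>1\<^sup>T * minv (\<Phi>1 * \<Phi>1\<^sup>T)) +
      (L2 * \<Phi>2 * \<Phi>2\<^sup>T * (L2 * L2)) * \<Omega>2 * (\<Omega>1\<^sup>T * minv (\<Omega>1 * \<Omega>1\<^sup>T) * (S * minv (\<Phi>1 * \<Phi>1\<^sup>T)))"
    using d by (simp add: mat_ring)
  then show ?thesis unfolding tail_error_def using d by (simp only:) (intro frob_sq_add_le; simp)
qed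

text \<open>\<Phi> is fixed. Averaging over \<Omega>_2 multiplies the squared norms of the factors
  on its two sides; the right one contains the pseudoinverse of \<Omega>_1, whose first inverse
  moment is bounded with 1 / (s - \<rho> - 1).\<close>

lemma nn_integral_tail_error_\<Omega>:
  assumes U: "U \<in> rot_inv (\<rho> + k)"
    and c: "L2 \<in> carrier_mat k k" "S \<in> carrier_mat \<rho> \<rho>" "\<Phi>1 \<in> carrier_mat \<rho> l" "\<Phi>2 \<in> carrier_mat k l"
    and s: "0 < \<rho>" "\<rho> + 2 \<le> s"
  shows "(\<integral>\<^sup>+\<Omega>. ennreal (tail_error L2 S \<Phi>1 \<Phi>2 (topE \<rho> k * (U * \<Omega>)) (botE \<rho> k * (U * \<Omega>))) \<partial>gauss_mat (\<rho> + k) s)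
    \<le> ennreal (2 * frob_sq (L2 * \<Phi>2 * (\<Phi>1\<^sup>T * minv (\<Phi>1 * \<Phi>1\<^sup>T)))) +
      ennreal (2 * frob_sq (S * minv (\<Phi>1 * \<Phi>1\<^sup>T)) / (real s - real \<rho> - 1)) * ennreal (frob_sq (L2 * \<Phi>2 * \<Phi>2\<^sup>T * (L2 * L2)))"
proof -
  let ?W = "L2 * \<Phi>2 * \<Phi>2\<^sup>T * (L2 * L2)" and ?M = "minv (\<Phi>1 * \<Phi>1\<^sup>T)"
  let ?a = "2 * frob_sq (L2 * \<Phi>2 * (\<Phi>1\<^sup>T * ?M))"
  let ?f = "\<lambda>X Y. ennreal (frob_sq (?W * Y * (X\<^sup>T * minv (X * X\<^sup>T) * (S * ?M))))"
  have Uc: "U \<in> carrier_mat (\<rho> + k) (\<rho> + k)" using U by (auto simp: rot_inv_def)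
  have W: "?W \<in> carrier_mat k k" and SM: "S * ?M \<in> carrier_mat \<rho> \<rho>" using c by (auto intro!: carrier_matI)
  have tE: "topE \<rho> k \<in> carrier_mat \<rho> (\<rho> + k)" "botE \<rho> k \<in> carrier_mat k (\<rho> + k)" by (auto intro!: carrier_matI)
  have fm: "(\<lambda>Z. ?f (topE \<rho> k * Z) (botE \<rho> k * Z)) \<in> borel_measurable (mat_borel (\<rho> + k) s)"
  proof -
    note t = mat_borel_mult[OF mat_borel_const[OF tE(1)] mat_borel_ident, of s] and b = mat_borel_mult[OF mat_borel_const[OF tE(2)] mat_borel_ident, of s]
    show ?thesis
      by (rule measurable_compose[OF mat_borel_frob_sq[OF mat_borel_mult[OF mat_borel_mult[OF mat_borel_const[OF W] b]
         mat_borel_mult[OF mat_borel_mult[OF mat_borel_transpose[OF t] mat_borel_minv[OF mat_borel_gram[OF t]]] mat_borel_const[OF SM]]]] measurable_ennreal])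
  qed
  have fmU: "(\<lambda>\<Omega>. ?f (topE \<rho> k * (U * \<Omega>)) (botE \<rho> k * (U * \<Omega>))) \<in> borel_measurable (gauss_mat (\<rho> + k) s)"
    by (rule measurable_compose[OF mat_borel_mult[OF mat_borel_const[OF Uc] measurable_ident_gauss_mat] fm])
  have "(\<integral>\<^sup>+\<Omega>. ennreal (tail_error L2 S \<Phi>1 \<Phi>2 (topE \<rho> k * (U * \<Omega>)) (botE \<rho> k * (U * \<Omega>))) \<partial>gauss_mat (\<rho> + k) s)
    \<le> (\<integral>\<^sup>+\<Omega>. ennreal ?a + 2 * ?f (topE \<rho> k * (U * \<Omega>)) (botE \<rho> k * (U * \<Omega>)) \<partial>gauss_mat (\<rho> + k) s)"
  proof (rule nn_integral_mono)
    fix \<Omega> assume "\<Omega> \<in> space (gauss_mat (\<rho> + k) s)"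
    then have \<Omega>: "\<Omega> \<in> carrier_mat (\<rho> + k) s" by simp
    have "ennreal (tail_error L2 S \<Phi>1 \<Phi>2 (topE \<rho> k * (U * \<Omega>)) (botE \<rho> k * (U * \<Omega>)))
      \<le> ennreal (?a + 2 * frob_sq (?W * (botE \<rho> k * (U * \<Omega>)) * ((topE \<rho> k * (U * \<Omega>))\<^sup>T * minv ((topE \<rho> k * (U * \<Omega>)) * (topE \<rho> k * (U * \<Omega>))\<^sup>T) * (S * ?M))))"
      using \<Omega> Uc by (intro ennreal_leI tail_error_le[OF c, of _ s]) (auto intro!: carrier_matI)
    also have "\<dots> = ennreal ?a + 2 * ?f (topE \<rho> k * (U * \<Omega>)) (botE \<rho> k * (U * \<Omega>))"
      by (subst ennreal_plus) (auto simp: ennreal_mult')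
    finally show "ennreal (tail_error L2 S \<Phi>1 \<Phi>2 (topE \<rho> k * (U * \<Omega>)) (botE \<rho> k * (U * \<Omega>)))
      \<le> ennreal ?a + 2 * ?f (topE \<rho> k * (U * \<Omega>)) (botE \<rho> k * (U * \<Omega>))" .
  qed
  also have "\<dots> = ennreal ?a + 2 * (\<integral>\<^sup>+\<Omega>. ?f (topE \<rho> k * (U * \<Omega>)) (botE \<rho> k * (U * \<Omega>)) \<partial>gauss_mat (\<rho> + k) s)"
    using fmU prob_space.emeasure_space_1[OF prob_space_gauss_mat[of "\<rho> + k" s]]
    by (subst nn_integral_add) (auto simp: nn_integral_cmult)
  also have "(\<integral>\<^sup>+\<Omega>. ?f (topE \<rho> k * (U * \<Omega>)) (botE \<rho> k * (U * \<Omega>)) \<partial>gauss_mat (\<rho> + k) s)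
     = (\<integral>\<^sup>+X. \<integral>\<^sup>+Y. ?f X Y \<partial>gauss_mat k s \<partial>gauss_mat \<rho> s)"
    by (rule nn_integral_gauss_mat_split[OF U fm])
  also have "\<dots> = (\<integral>\<^sup>+X. ennreal (frob_sq ?W) * ennreal (frob_sq (X\<^sup>T * minv (X * X\<^sup>T) * (S * ?M))) \<partial>gauss_mat \<rho> s)"
  proof (rule nn_integral_cong)
    fix X assume "X \<in> space (gauss_mat \<rho> s)"
    then have "X\<^sup>T * minv (X * X\<^sup>T) * (S * ?M) \<in> carrier_mat s \<rho>" using c by (auto intro!: carrier_matI)
    from nn_integral_frob_sq_mult[OF W this]
    show "(\<integral>\<^sup>+Y. ?f X Y \<partial>gauss_mat k s) = ennreal (frob_sq ?W) * ennreal (frob_sq (X\<^sup>T * minv (X * X\<^sup>T) * (S * ?M)))"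
      by (simp add: ennreal_mult')
  qed
  also have "\<dots> = ennreal (frob_sq ?W) * (\<integral>\<^sup>+X. ennreal (frob_sq (X\<^sup>T * minv (X * X\<^sup>T) * (S * ?M))) \<partial>gauss_mat \<rho> s)"
    by (rule nn_integral_cmult, rule measurable_compose[OF mat_borel_frob_sq[OF mat_borel_mult[OF mat_borel_mult[OF mat_borel_transpose[OF measurable_ident_gauss_mat]
       mat_borel_minv[OF mat_borel_gram[OF measurable_ident_gauss_mat]]] mat_borel_const[OF SM]]] measurable_ennreal])
  also have "ennreal ?a + 2 * \<dots> \<le> ennreal ?a + 2 * (ennreal (frob_sq ?W) * ennreal (frob_sq (S * ?M) / (real s - real \<rho> - 1)))"
    by (intro add_left_mono mult_left_mono nn_integral_pinv_mult[OF SM s]) auto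
  also have "2 * (ennreal (frob_sq ?W) * ennreal (frob_sq (S * ?M) / (real s - real \<rho> - 1)))
     = ennreal (2 * frob_sq (S * ?M) / (real s - real \<rho> - 1)) * ennreal (frob_sq ?W)"
    using s by (simp add: ennreal_mult'[symmetric] ennreal_numeral[symmetric] mult_ac del: ennreal_numeral)
  finally show ?thesis .
qed

text \<open>\<Phi>_2 is averaged next: by second moments in the first summand and fourth moments in
  the second, which produce |L2^3|^2 and |L2|^2 |L2^2|^2, the sums over sixth and fourth powers of
  the tail. \<Phi>_1 follows with the first and second inverse Wishart moments, the second one
  existing because \<rho> + 4 <= l.\<close>

lemma nn_integral_tail_error:
  assumes U: "U \<in> rot_inv (\<rho> + k)"
    and c: "L2 \<in> carrier_mat k k" "S \<in> carrier_mat \<rho> \<rho>"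
    and S: "\<And>M. M \<in> carrier_mat \<rho> \<rho> \<Longrightarrow> frob_sq (S * M) \<le> \<kappa> * frob_sq M" "0 \<le> \<kappa>"
    and s: "0 < \<rho>" "\<rho> + 2 \<le> s" and l: "\<rho> + 4 \<le> l"
  shows "(\<integral>\<^sup>+\<Phi>. \<integral>\<^sup>+\<Omega>. ennreal (tail_error L2 S (topE \<rho> k * (U * \<Phi>)) (botE \<rho> k * (U * \<Phi>)) (topE \<rho> k * (U * \<Omega>)) (botE \<rho> k * (U * \<Omega>)))
      \<partial>gauss_mat (\<rho> + k) s \<partial>gauss_mat (\<rho> + k) l)
    \<le> ennreal (2 * frob_sq L2 * (real \<rho> / (real l - real \<rho> - 1)) +
       2 * \<kappa> / (real s - real \<rho> - 1) * (((real l)\<^sup>2 + real l) * frob_sq (L2 * (L2 * L2)) + real l * (frob_sq L2 * frob_sq (L2 * L2)))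
         * (real \<rho> * (real l - 1) / ((real l - real \<rho>) * (real l - real \<rho> - 1) * (real l - real \<rho> - 3))))"
proof -
  let ?w = "real \<rho> * (real l - 1) / ((real l - real \<rho>) * (real l - real \<rho> - 1) * (real l - real \<rho> - 3))"
  let ?D = "((real l)\<^sup>2 + real l) * frob_sq (L2 * (L2 * L2)) + real l * (frob_sq L2 * frob_sq (L2 * L2))"
  let ?c = "2 * \<kappa> / (real s - real \<rho> - 1)"
  have D0: "0 \<le> ?D" by (intro add_nonneg_nonneg mult_nonneg_nonneg) auto
  have c0: "0 \<le> ?c" using S s by simp
  have w0: "0 \<le> ?w" using l by simp
  have Uc: "U \<in> carrier_mat (\<rho> + k) (\<rho> + k)" using U by (auto simp: rot_inv_def)
  have tE: "topE \<rho> k \<in> carrier_mat \<rho> (\<rho> + k)" "botE \<rho> k \<in> carrier_mat k (\<rho> + k)" by (auto intro!: carrier_matI)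
  have LL: "L2 * L2 \<in> carrier_mat k k" using c by auto
  let ?g = "\<lambda>X Y. ennreal (2 * frob_sq (L2 * Y * (X\<^sup>T * minv (X * X\<^sup>T)))) +
      ennreal (?c * frob_sq (minv (X * X\<^sup>T))) * ennreal (frob_sq (L2 * Y * Y\<^sup>T * (L2 * L2)))"
  have gm: "(\<lambda>Z. ?g (topE \<rho> k * Z) (botE \<rho> k * Z)) \<in> borel_measurable (mat_borel (\<rho> + k) l)"
  proof -
    note t = mat_borel_mult[OF mat_borel_const[OF tE(1)] mat_borel_ident, of l] and b = mat_borel_mult[OF mat_borel_const[OF tE(2)] mat_borel_ident, of l]
    have [measurable]: "(\<lambda>Z. frob_sq (L2 * (botE \<rho> k * Z) * ((topE \<rho> k * Z)\<^sup>T * minv (topE \<rho> k * Z * (topE \<rho> k * Z)\<^sup>T)))) \<in> borel_measurable (mat_borel (\<rho> + k) l)"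
      "(\<lambda>Z. frob_sq (minv (topE \<rho> k * Z * (topE \<rho> k * Z)\<^sup>T))) \<in> borel_measurable (mat_borel (\<rho> + k) l)"
      "(\<lambda>Z. frob_sq (L2 * (botE \<rho> k * Z) * (botE \<rho> k * Z)\<^sup>T * (L2 * L2))) \<in> borel_measurable (mat_borel (\<rho> + k) l)"
      by (rule mat_borel_frob_sq[OF mat_borel_mult[OF mat_borel_mult[OF mat_borel_const[OF c(1)] b] mat_borel_mult[OF mat_borel_transpose[OF t] mat_borel_minv[OF mat_borel_gram[OF t]]]]],
          rule mat_borel_frob_sq[OF mat_borel_minv[OF mat_borel_gram[OF t]]],
          rule mat_borel_frob_sq[OF mat_borel_mult[OF mat_borel_mult[OF mat_borel_mult[OF mat_borel_const[OF c(1)] b] mat_borel_transpose[OF b]] mat_borel_const[OF LL]]])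
    show ?thesis by measurable
  qed
  have "(\<integral>\<^sup>+\<Phi>. \<integral>\<^sup>+\<Omega>. ennreal (tail_error L2 S (topE \<rho> k * (U * \<Phi>)) (botE \<rho> k * (U * \<Phi>)) (topE \<rho> k * (U * \<Omega>)) (botE \<rho> k * (U * \<Omega>)))
      \<partial>gauss_mat (\<rho> + k) s \<partial>gauss_mat (\<rho> + k) l)
    \<le> (\<integral>\<^sup>+\<Phi>. ?g (topE \<rho> k * (U * \<Phi>)) (botE \<rho> k * (U * \<Phi>)) \<partial>gauss_mat (\<rho> + k) l)"
  proof (rule nn_integral_mono)
    fix \<Phi> assume "\<Phi> \<in> space (gauss_mat (\<rho> + k) l)"
    then have \<Phi>: "topE \<rho> k * (U * \<Phi>) \<in> carrier_mat \<rho> l" "botE \<rho> k * (U * \<Phi>) \<in> carrier_mat k l"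
      using Uc by (auto intro!: carrier_matI)
    let ?X = "topE \<rho> k * (U * \<Phi>)" and ?Y = "botE \<rho> k * (U * \<Phi>)"
    note nn_integral_tail_error_\<Omega>[OF U c \<Phi> s]
    also have "ennreal (2 * frob_sq (L2 * ?Y * (?X\<^sup>T * minv (?X * ?X\<^sup>T)))) +
      ennreal (2 * frob_sq (S * minv (?X * ?X\<^sup>T)) / (real s - real \<rho> - 1)) * ennreal (frob_sq (L2 * ?Y * ?Y\<^sup>T * (L2 * L2))) \<le> ?g ?X ?Y"
    proof (intro add_left_mono mult_right_mono ennreal_leI)
      have "frob_sq (S * minv (?X * ?X\<^sup>T)) \<le> \<kappa> * frob_sq (minv (?X * ?X\<^sup>T))" using \<Phi> by (intro S carrier_matI) auto
      then have "2 * frob_sq (S * minv (?X * ?X\<^sup>T)) / (real s - real \<rho> - 1) \<le> 2 * (\<kappa> * frob_sq (minv (?X * ?X\<^sup>T))) / (real s - real \<rho> - 1)"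
        using s by (intro divide_right_mono) auto
      then show "2 * frob_sq (S * minv (?X * ?X\<^sup>T)) / (real s - real \<rho> - 1) \<le> ?c * frob_sq (minv (?X * ?X\<^sup>T))" by simp
    qed simp
    finally show "(\<integral>\<^sup>+\<Omega>. ennreal (tail_error L2 S ?X ?Y (topE \<rho> k * (U * \<Omega>)) (botE \<rho> k * (U * \<Omega>))) \<partial>gauss_mat (\<rho> + k) s) \<le> ?g ?X ?Y" .
  qed
  also have "\<dots> = (\<integral>\<^sup>+X. \<integral>\<^sup>+Y. ?g X Y \<partial>gauss_mat k l \<partial>gauss_mat \<rho> l)"
    by (rule nn_integral_gauss_mat_split[OF U gm])
  also have "\<dots> = (\<integral>\<^sup>+X. ennreal (2 * frob_sq L2) * ennreal (frob_sq (X\<^sup>T * minv (X * X\<^sup>T) * 1\<^sub>m \<rho>)) + ennreal (?c * ?D) * ennreal (frob_sq (minv (X * X\<^sup>T))) \<partial>gauss_mat \<rho> l)"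
  proof (rule nn_integral_cong)
    fix X assume "X \<in> space (gauss_mat \<rho> l)"
    then have X: "X \<in> carrier_mat \<rho> l" by simp
    have C: "X\<^sup>T * minv (X * X\<^sup>T) \<in> carrier_mat l \<rho>" using X by (auto intro!: carrier_matI)
    have m1: "(\<lambda>Y. ennreal (frob_sq (L2 * Y * (X\<^sup>T * minv (X * X\<^sup>T))))) \<in> borel_measurable (gauss_mat k l)"
      by (rule measurable_compose[OF mat_borel_frob_sq[OF mat_borel_mult[OF mat_borel_mult[OF mat_borel_const[OF c(1)] measurable_ident_gauss_mat] mat_borel_const[OF C]]] measurable_ennreal])
    have m2: "(\<lambda>Y. ennreal (frob_sq (L2 * Y * Y\<^sup>T * (L2 * L2)))) \<in> borel_measurable (gauss_mat k l)"
      by (rule measurable_compose[OF mat_borel_frob_sq[OF mat_borel_mult[OF mat_borel_mult[OF mat_borel_mult[OF mat_borel_const[OF c(1)] measurable_ident_gauss_mat] mat_borel_transpose[OF measurable_ident_gauss_mat]] mat_borel_const[OF LL]]] measurable_ennreal])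
    have "(\<integral>\<^sup>+Y. ?g X Y \<partial>gauss_mat k l)
      = (\<integral>\<^sup>+Y. ennreal 2 * ennreal (frob_sq (L2 * Y * (X\<^sup>T * minv (X * X\<^sup>T)))) + ennreal (?c * frob_sq (minv (X * X\<^sup>T))) * ennreal (frob_sq (L2 * Y * Y\<^sup>T * (L2 * L2))) \<partial>gauss_mat k l)"
      by (simp only: ennreal_mult' frob_sq_nonneg)
    also have "\<dots> = ennreal 2 * (\<integral>\<^sup>+Y. ennreal (frob_sq (L2 * Y * (X\<^sup>T * minv (X * X\<^sup>T)))) \<partial>gauss_mat k l)
        + ennreal (?c * frob_sq (minv (X * X\<^sup>T))) * (\<integral>\<^sup>+Y. ennreal (frob_sq (L2 * Y * Y\<^sup>T * (L2 * L2))) \<partial>gauss_mat k l)"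
      using m1 m2 by (subst nn_integral_add) (auto simp: nn_integral_cmult)
    also have "\<dots> = ennreal 2 * ennreal (frob_sq L2 * frob_sq (X\<^sup>T * minv (X * X\<^sup>T))) + ennreal (?c * frob_sq (minv (X * X\<^sup>T))) * ennreal ?D"
      by (simp only: nn_integral_frob_sq_mult[OF c(1) C] nn_integral_frob_sq_gram_mult[OF c(1) LL])
    also have "\<dots> = ennreal (2 * frob_sq L2) * ennreal (frob_sq (X\<^sup>T * minv (X * X\<^sup>T) * 1\<^sub>m \<rho>)) + ennreal (?c * ?D) * ennreal (frob_sq (minv (X * X\<^sup>T)))"
    proof -
      have "X\<^sup>T * minv (X * X\<^sup>T) * 1\<^sub>m \<rho> = X\<^sup>T * minv (X * X\<^sup>T)" using X by (simp add: mult_one_dim)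
      then show ?thesis using c0 D0 by (simp only: ennreal_mult'[symmetric] frob_sq_nonneg mult_nonneg_nonneg) (simp only: mult_ac)
    qed
    finally show "(\<integral>\<^sup>+Y. ?g X Y \<partial>gauss_mat k l) = ennreal (2 * frob_sq L2) * ennreal (frob_sq (X\<^sup>T * minv (X * X\<^sup>T) * 1\<^sub>m \<rho>)) + ennreal (?c * ?D) * ennreal (frob_sq (minv (X * X\<^sup>T)))" .
  qed
  also have "\<dots> = ennreal (2 * frob_sq L2) * (\<integral>\<^sup>+X. ennreal (frob_sq (X\<^sup>T * minv (X * X\<^sup>T) * 1\<^sub>m \<rho>)) \<partial>gauss_mat \<rho> l)
     + ennreal (?c * ?D) * (\<integral>\<^sup>+X. ennreal (frob_sq (minv (X * X\<^sup>T))) \<partial>gauss_mat \<rho> l)"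
  proof -
    have m1: "(\<lambda>X. ennreal (frob_sq (X\<^sup>T * minv (X * X\<^sup>T) * 1\<^sub>m \<rho>))) \<in> borel_measurable (gauss_mat \<rho> l)"
      by (rule measurable_compose[OF mat_borel_frob_sq[OF mat_borel_mult[OF mat_borel_mult[OF mat_borel_transpose[OF measurable_ident_gauss_mat]
       mat_borel_minv[OF mat_borel_gram[OF measurable_ident_gauss_mat]]] mat_borel_const[OF one_carrier_mat]]] measurable_ennreal])
    have m2: "(\<lambda>X. ennreal (frob_sq (minv (X * X\<^sup>T)))) \<in> borel_measurable (gauss_mat \<rho> l)"
      by (rule measurable_compose[OF mat_borel_frob_sq[OF mat_borel_minv[OF mat_borel_gram[OF measurable_ident_gauss_mat]]] measurable_ennreal])
    show ?thesis using m1 m2 by (subst nn_integral_add) (auto simp: nn_integral_cmult)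
  qed
  also have "\<dots> \<le> ennreal (2 * frob_sq L2) * ennreal (frob_sq (1\<^sub>m \<rho>) / (real l - real \<rho> - 1)) + ennreal (?c * ?D) * ennreal ?w"
    using s l by (intro add_mono mult_left_mono nn_integral_pinv_mult nn_integral_inv_wishart_sq) auto
  also have "\<dots> = ennreal (2 * frob_sq L2 * (real \<rho> / (real l - real \<rho> - 1)) + ?c * ?D * ?w)"
  proof -
    have "0 \<le> real \<rho> / (real l - real \<rho> - 1)" using l by simp
    then show ?thesis
      using w0 c0 D0 by (simp only: frob_sq_one ennreal_mult'[symmetric] ennreal_plus[symmetric] frob_sq_nonneg mult_nonneg_nonneg)
  qed
  finally show ?thesis .
qed

section \<open>Singular value coordinates\<close>

lemma mat_diag_dims [simp]: "dim_row (mat_diag n f) = n" "dim_col (mat_diag n f) = n"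
  using mat_diag_dim[of n f] by (auto simp del: mat_diag_dim)

lemma mat_diag_index: "i < n \<Longrightarrow> j < n \<Longrightarrow> mat_diag n f $$ (i, j) = (if i = j then f j else 0)"
  by (simp add: mat_diag_def)

lemma pow_mat_2: "X \<in> carrier_mat n n \<Longrightarrow> X ^\<^sub>m 2 = X * (X :: real mat)"
  by (simp add: numeral_2_eq_2 one_mult_dim)

lemma mat_diag_transpose: "(mat_diag n f)\<^sup>T = mat_diag n (f :: nat \<Rightarrow> real)"
  by (rule eq_matI) (auto simp: mat_diag_index)

lemma frob_sq_mat_diag: "frob_sq (mat_diag n f) = (\<Sum>i<n. (f i)\<^sup>2)"
  unfolding frob_sq_def
  by (intro sum.cong) (auto simp: mat_diag_index if_distrib[of "\<lambda>x. x\<^sup>2"] cong: if_cong)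

lemma minv_mat_diag:
  assumes "\<And>i. i < n \<Longrightarrow> f i \<noteq> 0"
  shows "mdet (mat_diag n f) \<noteq> 0" "minv (mat_diag n f) = mat_diag n (\<lambda>i. 1 / f i)"
proof -
  have "mat_diag n (\<lambda>i. 1 / f i) * mat_diag n f = 1\<^sub>m n"
    by (rule eq_matI) (use assms in \<open>auto simp: mat_diag_index\<close>)
  then show "mdet (mat_diag n f) \<noteq> 0" "minv (mat_diag n f) = mat_diag n (\<lambda>i. 1 / f i)"
    using det_nz_of_left_inv[of "mat_diag n f" n "mat_diag n (\<lambda>i. 1 / f i)"] by auto
qed

lemma frob_sq_mat_diag_mult_le:
  assumes "\<And>i. i < n \<Longrightarrow> (f i)\<^sup>2 \<le> \<kappa>" "M \<in> carrier_mat n c"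
  shows "frob_sq (mat_diag n f * M) \<le> \<kappa> * frob_sq M"
proof -
  have "frob_sq (mat_diag n f * M) = (\<Sum>i<n. \<Sum>j<c. (f i)\<^sup>2 * (M $$ (i, j))\<^sup>2)"
    unfolding mat_diag_mult_left[OF assms(2)] frob_sq_def by (simp add: power_mult_distrib)
  also have "\<dots> \<le> (\<Sum>i<n. \<Sum>j<c. \<kappa> * (M $$ (i, j))\<^sup>2)"
    using assms(1) by (intro sum_mono mult_right_mono) auto
  also have "\<dots> = \<kappa> * frob_sq M" unfolding frob_sq_def using assms(2) by (simp add: sum_distrib_left)
  finally show ?thesis .
qed

text \<open>\<open>V\<close> diagonalises the Gram matrix, so its characteristic polynomial has n
  real roots, all of them squares; the sorted list of their square roots inherits length, sign and
  order.\<close>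

lemma sing_vals_props:
  assumes A: "A \<in> carrier_mat m n" and V: "right_singular_basis A V"
  shows "length (sing_vals A) = n" "\<And>i. i < n \<Longrightarrow> 0 \<le> sing_vals A ! i"
    "\<And>i j. i \<le> j \<Longrightarrow> j < n \<Longrightarrow> sing_vals A ! j \<le> sing_vals A ! i"
proof -
  have Vc: "V \<in> carrier_mat n n" and VV: "V\<^sup>T * V = 1\<^sub>m n" and AA: "A\<^sup>T * A = V * (Sigma_mat A ^\<^sub>m 2) * V\<^sup>T"
    using V A unfolding right_singular_basis_def by auto
  \<comment> \<open>The diagonal is expressed through \<open>sing_val\<close> before the length of
    the underlying list is known. There is no circularity: the polynomial shows the list to be a
    sorted arrangement of n numbers.\<close>
  define q where "q = (\<lambda>j. (sing_val A (j + 1))\<^sup>2)"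
  have S: "Sigma_mat A ^\<^sub>m 2 = mat_diag n q"
    using A by (subst pow_mat_2[of _ n]) (auto simp: Sigma_mat_def q_def power2_eq_square)
  have "similar_mat (A\<^sup>T * A) (mat_diag n q)"
    using Vc VV orthogonalI[OF Vc VV] AA A unfolding S by (intro similar_matI[of _ _ V "V\<^sup>T" n]) auto
  then have "char_poly (A\<^sup>T * A) = char_poly (mat_diag n q)" by (rule char_poly_similar)
  also have "\<dots> = (\<Prod>a\<leftarrow>diag_mat (mat_diag n q). [:- a, 1:])"
    by (rule char_poly_upper_triangular[of _ n]) (auto simp: mat_diag_def upper_triangular_def)
  also have "diag_mat (mat_diag n q) = map q [0..<n]" by (auto simp: diag_mat_def mat_diag_index)
  finally have cp: "char_poly (A\<^sup>T * A) = (\<Prod>a\<leftarrow>map q [0..<n]. [:- a, 1:])" .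
  have pr: "proots (\<Prod>a\<leftarrow>xs. [:- a, 1:]) = mset xs" for xs :: "real list"
  proof (induction xs)
    case (Cons a xs)
    have nz: "(\<Prod>a\<leftarrow>xs. [:- a, 1:]) \<noteq> 0" by (auto simp: prod_list_zero_iff)
    have "proots ([:- a, 1:] * (\<Prod>a\<leftarrow>xs. [:- a, 1:])) = proots [:- a, 1:] + proots (\<Prod>a\<leftarrow>xs. [:- a, 1:])"
      by (rule proots_mult[OF _ nz]) simp
    then show ?case using Cons by simp
  qed simp
  have sv: "sing_vals A = rev (sort (map (\<lambda>j. sqrt (q j)) [0..<n]))"
    unfolding sing_vals_def cp pr by (simp add: mset_map[symmetric] del: mset_map mset_upt) (simp add: comp_def)
  show len: "length (sing_vals A) = n" unfolding sv by simp
  show "0 \<le> sing_vals A ! i" if "i < n" for i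
  proof -
    have "sing_vals A ! i \<in> set (sing_vals A)" using that len by simp
    then show ?thesis unfolding sv by (auto simp: q_def)
  qed
  show "sing_vals A ! j \<le> sing_vals A ! i" if "i \<le> j" "j < n" for i j
  proof -
    have "sorted (rev (sing_vals A))" unfolding sv by simp
    then show ?thesis using that len sorted_rev_nth_mono[of "sing_vals A" i j] by simp
  qed
qed

lemma topE_botE_orth:
  "topE a b * (topE a b)\<^sup>T = 1\<^sub>m a" "botE a b * (botE a b)\<^sup>T = 1\<^sub>m b" "botE a b * (topE a b)\<^sup>T = 0\<^sub>m b a"
proof -
  show "topE a b * (topE a b)\<^sup>T = 1\<^sub>m a"
  proof (rule eq_matI)
    fix i j assume ij: "i < dim_row (1\<^sub>m a)" "j < dim_col (1\<^sub>m a)"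
    have "(topE a b * (topE a b)\<^sup>T) $$ (i, j) = (topE a b)\<^sup>T $$ (i, j)"
      by (rule topE_mult_index) (use ij in auto)
    then show "(topE a b * (topE a b)\<^sup>T) $$ (i, j) = 1\<^sub>m a $$ (i, j)" using ij by (auto simp: topE_def simp del: index_mult_mat(1))
  qed auto
  show "botE a b * (botE a b)\<^sup>T = 1\<^sub>m b"
  proof (rule eq_matI)
    fix i j assume ij: "i < dim_row (1\<^sub>m b)" "j < dim_col (1\<^sub>m b)"
    have "(botE a b * (botE a b)\<^sup>T) $$ (i, j) = (botE a b)\<^sup>T $$ (a + i, j)"
      by (rule botE_mult_index) (use ij in auto)
    then show "(botE a b * (botE a b)\<^sup>T) $$ (i, j) = 1\<^sub>m b $$ (i, j)" using ij by (auto simp: botE_def simp del: index_mult_mat(1))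
  qed auto
  show "botE a b * (topE a b)\<^sup>T = 0\<^sub>m b a"
  proof (rule eq_matI)
    fix i j assume ij: "i < dim_row (0\<^sub>m b a)" "j < dim_col (0\<^sub>m b a)"
    have "(botE a b * (topE a b)\<^sup>T) $$ (i, j) = (topE a b)\<^sup>T $$ (a + i, j)"
      by (rule botE_mult_index) (use ij in auto)
    then show "(botE a b * (topE a b)\<^sup>T) $$ (i, j) = 0\<^sub>m b a $$ (i, j)" using ij by (auto simp: topE_def simp del: index_mult_mat(1))
  qed auto
qed

lemma diag_topE_botE:
  "mat_diag (a + b) f = (topE a b)\<^sup>T * mat_diag a f * topE a b + (botE a b)\<^sup>T * mat_diag b (\<lambda>i. f (a + i)) * botE a b"
proof -
  have v: "vcat (topE a b) (botE a b) = 1\<^sub>m (a + b)"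
    by (rule eq_matI) (auto simp: vcat_index topE_def botE_def)
  have "mat_diag (a + b) f = mat_diag (a + b) f * vcat (topE a b) (botE a b)" unfolding v by (simp add: mult_one_dim)
  also have "\<dots> = vcat (mat_diag a f * topE a b) (mat_diag b (\<lambda>i. f (a + i)) * botE a b)"
  proof -
    have "vcat (topE a b) (botE a b) \<in> carrier_mat (a + b) (a + b)" "topE a b \<in> carrier_mat a (a + b)" "botE a b \<in> carrier_mat b (a + b)"
      by (auto intro!: carrier_matI)
    note m = this[THEN mat_diag_mult_left]
    show ?thesis unfolding m by (rule eq_matI) (auto simp: vcat_index)
  qed
  also have "\<dots> = (vcat (topE a b) (botE a b))\<^sup>T * vcat (mat_diag a f * topE a b) (mat_diag b (\<lambda>i. f (a + i)) * botE a b)"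
    unfolding v by (simp add: one_mult_dim)
  also have "\<dots> = (topE a b)\<^sup>T * (mat_diag a f * topE a b) + (botE a b)\<^sup>T * (mat_diag b (\<lambda>i. f (a + i)) * botE a b)"
    by (intro transpose_vcat_mult) auto
  finally show ?thesis by (simp add: mult_assoc_dim)
qed

text \<open>What \<open>low_rank_error\<close> asks of the two column blocks of an orthogonal
  matrix; the last equation cuts a spectral decomposition along the blocks.\<close>

lemma orthogonal_blocks:
  assumes V: "V \<in> carrier_mat (a + b) (a + b)" "V\<^sup>T * V = 1\<^sub>m (a + b)"
  defines "V1 \<equiv> V * (topE a b)\<^sup>T" and "V2 \<equiv> V * (botE a b)\<^sup>T"
  shows "V1 \<in> carrier_mat (a + b) a" "V2 \<in> carrier_mat (a + b) b"
    "V1\<^sup>T = topE a b * V\<^sup>T" "V2\<^sup>T = botE a b * V\<^sup>T"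
    "V2\<^sup>T * V2 = 1\<^sub>m b" "V1\<^sup>T * V1 = 1\<^sub>m a" "V2\<^sup>T * V1 = 0\<^sub>m b a" "V1 * V1\<^sup>T + V2 * V2\<^sup>T = 1\<^sub>m (a + b)"
    "V * mat_diag (a + b) f * V\<^sup>T = V1 * mat_diag a f * V1\<^sup>T + V2 * mat_diag b (\<lambda>i. f (a + i)) * V2\<^sup>T"
proof -
  have d: "dim_row V = a + b" "dim_col V = a + b" using V by auto
  show c: "V1 \<in> carrier_mat (a + b) a" "V2 \<in> carrier_mat (a + b) b" using d by (auto simp: V1_def V2_def intro!: carrier_matI)
  show t: "V1\<^sup>T = topE a b * V\<^sup>T" "V2\<^sup>T = botE a b * V\<^sup>T" using d by (auto simp: V1_def V2_def transpose_mult_dim)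
  have VX: "V\<^sup>T * (V * X) = X" if "dim_row X = a + b" for X using that d by (intro mat_mult_cancel_left[OF V(2)]) auto
  show "V2\<^sup>T * V2 = 1\<^sub>m b" "V1\<^sup>T * V1 = 1\<^sub>m a" "V2\<^sup>T * V1 = 0\<^sub>m b a"
    unfolding t unfolding V1_def V2_def using d by (simp_all add: mult_assoc_dim VX topE_botE_orth)
  show dec: "V * mat_diag (a + b) f * V\<^sup>T = V1 * mat_diag a f * V1\<^sup>T + V2 * mat_diag b (\<lambda>i. f (a + i)) * V2\<^sup>T" for f
    unfolding t unfolding V1_def V2_def using d by (subst diag_topE_botE) (simp add: mat_ring)
  have "V1 * V1\<^sup>T + V2 * V2\<^sup>T = V * V\<^sup>T"
    using dec[of "\<lambda>_. 1"] c d by (simp add: mult_one_dim)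
  then show "V1 * V1\<^sup>T + V2 * V2\<^sup>T = 1\<^sub>m (a + b)" using orthogonalI[OF V] by simp
qed

lemma mat_of_cols_take_drop:
  assumes V: "V \<in> carrier_mat (a + b) (a + b)"
  shows "mat_of_cols (a + b) (take a (cols V)) = V * (topE a b)\<^sup>T" "mat_of_cols (a + b) (drop a (cols V)) = V * (botE a b)\<^sup>T"
proof -
  have d: "dim_row V = a + b" "dim_col V = a + b" using V by auto
  have t: "V * (topE a b)\<^sup>T = (topE a b * V\<^sup>T)\<^sup>T" "V * (botE a b)\<^sup>T = (botE a b * V\<^sup>T)\<^sup>T" using d by (auto simp: transpose_mult_dim)
  show "mat_of_cols (a + b) (take a (cols V)) = V * (topE a b)\<^sup>T"
    unfolding t by (rule eq_matI) (use d in \<open>auto simp: topE_mult_index mat_of_cols_index simp del: index_mult_mat(1)\<close>)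
  show "mat_of_cols (a + b) (drop a (cols V)) = V * (botE a b)\<^sup>T"
    unfolding t by (rule eq_matI) (use d in \<open>auto simp: botE_mult_index mat_of_cols_index simp del: index_mult_mat(1)\<close>)
qed

text \<open>After rotation and splitting, the event concerns the upper block alone, which is
  Gaussian of size a by c.\<close>

lemma AE_gauss_mat_block_det:
  assumes U: "U \<in> rot_inv (a + b)" and ac: "a \<le> c"
  shows "AE X in gauss_mat (a + b) c. mdet ((topE a b * (U * X)) * (topE a b * (U * X))\<^sup>T) \<noteq> 0"
proof -
  define f :: "real mat \<Rightarrow> ennreal" where "f = (\<lambda>X. indicator {0} (mdet (X * X\<^sup>T)))"
  have f: "f \<in> borel_measurable (mat_borel a c)"
    unfolding f_def by (rule measurable_compose[OF mat_borel_det[OF mat_borel_gram[OF mat_borel_ident]]]) simp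
  have tE: "topE a b \<in> carrier_mat a (a + b)" by (auto intro!: carrier_matI)
  have Uc: "U \<in> carrier_mat (a + b) (a + b)" using U by (auto simp: rot_inv_def)
  have m: "(\<lambda>X. f (topE a b * X)) \<in> borel_measurable (mat_borel (a + b) c)"
    by (rule measurable_compose[OF mat_borel_mult[OF mat_borel_const[OF tE] mat_borel_ident] f])
  have mU: "(\<lambda>X. f (topE a b * (U * X))) \<in> borel_measurable (gauss_mat (a + b) c)"
    by (rule measurable_compose[OF mat_borel_mult[OF mat_borel_const[OF Uc] measurable_ident_gauss_mat] m])
  have "(\<integral>\<^sup>+X. f (topE a b * (U * X)) \<partial>gauss_mat (a + b) c) = (\<integral>\<^sup>+X. \<integral>\<^sup>+Y. f X \<partial>gauss_mat b c \<partial>gauss_mat a c)"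
    by (rule nn_integral_gauss_mat_split[OF U, of "\<lambda>X Y. f X"]) (rule m)
  also have "\<dots> = 0"
  proof (rule nn_integral_eq_0_cong, rule AE_mp[OF AE_gauss_mat_gram_det[OF ac] AE_I2], rule impI)
    fix X assume "mdet (X * X\<^sup>T) \<noteq> 0"
    then show "(\<integral>\<^sup>+Y. f X \<partial>gauss_mat b c) = 0" by (simp add: f_def)
  qed
  finally have "AE X in gauss_mat (a + b) c. f (topE a b * (U * X)) = 0"
    using mU by (subst (asm) nn_integral_0_iff_AE) auto
  then show ?thesis by (rule AE_mp) (auto simp: f_def indicator_def intro!: AE_I2)
qed

text \<open>The passage from the given probability space to iterated integrals over Gaussian laws.
  Independence identifies the joint law with a product indexed by 0, 1, 2, which is integrated one
  coordinate at a time.\<close>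

lemma nn_integral_indep_triple:
  assumes M: "prob_space M"
    and ind: "prob_space.indep_vars M ((!) [mat_borel r1 c1, mat_borel r2 c2, mat_borel r3 c3]) ((!) [X, Y, Z]) {..<3::nat}"
    and dX: "distr M (mat_borel r1 c1) X = gauss_mat r1 c1"
    and dY: "distr M (mat_borel r2 c2) Y = gauss_mat r2 c2"
    and dZ: "distr M (mat_borel r3 c3) Z = gauss_mat r3 c3"
    and mX: "X \<in> measurable M (mat_borel r1 c1)" and mY: "Y \<in> measurable M (mat_borel r2 c2)" and mZ: "Z \<in> measurable M (mat_borel r3 c3)"
    and F: "(\<lambda>(x, y, z). F x y z) \<in> borel_measurable (mat_borel r1 c1 \<Otimes>\<^sub>M (mat_borel r2 c2 \<Otimes>\<^sub>M mat_borel r3 c3))"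
  shows "(\<integral>\<^sup>+\<omega>. F (X \<omega>) (Y \<omega>) (Z \<omega>) \<partial>M) = (\<integral>\<^sup>+x. \<integral>\<^sup>+y. \<integral>\<^sup>+z. F x y z \<partial>gauss_mat r3 c3 \<partial>gauss_mat r2 c2 \<partial>gauss_mat r1 c1 :: ennreal)"
proof -
  interpret prob_space M by fact
  let ?I = "{..<3::nat}"
  let ?B = "(!) [mat_borel r1 c1, mat_borel r2 c2, mat_borel r3 c3]"
  let ?X = "(!) [X, Y, Z]"
  \<comment> \<open>The product locale requires a sigma-finite measure at every natural number, so
    indices beyond 2 repeat the last law.\<close>
  define N where "N = (\<lambda>i::nat. if i = 0 then gauss_mat r1 c1 else if i = 1 then gauss_mat r2 c2 else gauss_mat r3 c3)"
  have N: "N 0 = gauss_mat r1 c1" "N 1 = gauss_mat r2 c2" "N 2 = gauss_mat r3 c3" "N (Suc 0) = gauss_mat r2 c2" by (auto simp: N_def)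
  have I: "?I = insert 0 (insert 1 {2})" by auto
  interpret NP: product_sigma_finite N
    by (unfold product_sigma_finite_def) (auto simp: N_def intro!: prob_space_imp_sigma_finite prob_space_gauss_mat)
  have rv: "random_variable (?B i) (?X i)" if "i \<in> ?I" for i
    using that mX mY mZ unfolding I by auto
  have dist: "distr M (\<Pi>\<^sub>M i\<in>?I. ?B i) (\<lambda>x. \<lambda>i\<in>?I. ?X i x) = (\<Pi>\<^sub>M i\<in>?I. distr M (?B i) (?X i))"
    using ind by (subst (asm) indep_vars_iff_distr_eq_PiM'[OF _ rv]) (auto simp: lessThan_empty_iff)
  also have "\<dots> = PiM ?I N"
    by (rule PiM_cong) (unfold I, auto simp: dX dY dZ N)
  finally have dist: "distr M (\<Pi>\<^sub>M i\<in>?I. ?B i) (\<lambda>x. \<lambda>i\<in>?I. ?X i x) = PiM ?I N" .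
  have mv: "(\<lambda>x. \<lambda>i\<in>?I. ?X i x) \<in> measurable M (\<Pi>\<^sub>M i\<in>?I. ?B i)"
    by (rule measurable_restrict) (rule rv)
  have setsB: "sets (\<Pi>\<^sub>M i\<in>?I. ?B i) = sets (PiM ?I N)"
    by (rule sets_PiM_cong) (unfold I, auto simp: N)
  define f where "f = (\<lambda>w :: nat \<Rightarrow> real mat. F (w 0) (w 1) (w 2))"
  have comp: "(\<lambda>w. w i) \<in> measurable (PiM J N) (N i)" if "i \<in> J" for i J
    by (rule measurable_component_singleton[OF that])
  have fm: "f \<in> borel_measurable (PiM ?I N)"
  proof -
    have "(\<lambda>w. (w 0, w 1, w 2)) \<in> measurable (PiM ?I N) (mat_borel r1 c1 \<Otimes>\<^sub>M (mat_borel r2 c2 \<Otimes>\<^sub>M mat_borel r3 c3))"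
      using comp[of 0 ?I] comp[of 1 ?I] comp[of 2 ?I] unfolding N by (intro measurable_Pair) (auto cong: measurable_cong_sets)
    from measurable_compose[OF this F] show ?thesis by (simp add: f_def)
  qed
  have "(\<integral>\<^sup>+\<omega>. F (X \<omega>) (Y \<omega>) (Z \<omega>) \<partial>M) = (\<integral>\<^sup>+\<omega>. f (\<lambda>i\<in>?I. ?X i \<omega>) \<partial>M)"
    by (intro nn_integral_cong) (simp add: f_def)
  also have "\<dots> = (\<integral>\<^sup>+w. f w \<partial>distr M (\<Pi>\<^sub>M i\<in>?I. ?B i) (\<lambda>x. \<lambda>i\<in>?I. ?X i x))"
    using fm by (intro nn_integral_distr[OF mv, symmetric]) (simp add: measurable_cong_sets[OF setsB refl])
  also have "\<dots> = (\<integral>\<^sup>+w. f w \<partial>PiM (insert 0 {1, 2}) N)"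
    unfolding dist by (simp add: I insert_commute)
  also have "\<dots> = (\<integral>\<^sup>+x. \<integral>\<^sup>+w. f (w(0 := x)) \<partial>PiM {1, 2} N \<partial>N 0)"
    using fm unfolding I by (intro NP.product_nn_integral_insert_rev) auto
  also have "\<dots> = (\<integral>\<^sup>+x. \<integral>\<^sup>+y. \<integral>\<^sup>+z. F x y z \<partial>gauss_mat r3 c3 \<partial>gauss_mat r2 c2 \<partial>gauss_mat r1 c1)"
    unfolding N
  proof (rule nn_integral_cong)
    fix x assume x: "x \<in> space (gauss_mat r1 c1)"
    have Fx: "(\<lambda>(y, z). F x y z) \<in> borel_measurable (mat_borel r2 c2 \<Otimes>\<^sub>M mat_borel r3 c3)"
      using measurable_compose[OF measurable_Pair1'[of x "mat_borel r1 c1"] F] x by simp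
    have m12: "(\<lambda>w. F x (w 1) (w 2)) \<in> borel_measurable (PiM (insert 1 {2}) N)"
    proof -
      have "(\<lambda>w. (w 1, w 2)) \<in> measurable (PiM (insert 1 {2}) N) (mat_borel r2 c2 \<Otimes>\<^sub>M mat_borel r3 c3)"
        using comp[of 1 "insert 1 {2}"] comp[of 2 "insert 1 {2}"] unfolding N by (intro measurable_Pair) (auto cong: measurable_cong_sets)
      from measurable_compose[OF this Fx] show ?thesis by simp
    qed
    have "(\<integral>\<^sup>+w. f (w(0 := x)) \<partial>PiM {1, 2} N) = (\<integral>\<^sup>+w. F x (w 1) (w 2) \<partial>PiM (insert 1 {2}) N)"
      by (simp add: f_def)
    also have "\<dots> = (\<integral>\<^sup>+y. \<integral>\<^sup>+w. F x y (w 2) \<partial>PiM {2} N \<partial>N 1)"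
      using m12 by (subst NP.product_nn_integral_insert_rev) auto
    also have "\<dots> = (\<integral>\<^sup>+y. \<integral>\<^sup>+z. F x y z \<partial>gauss_mat r3 c3 \<partial>gauss_mat r2 c2)"
      unfolding N
    proof (rule nn_integral_cong)
      fix y assume y: "y \<in> space (gauss_mat r2 c2)"
      have "(\<lambda>z. F x y z) \<in> borel_measurable (mat_borel r3 c3)"
        using measurable_compose[OF measurable_Pair1'[of y "mat_borel r2 c2"] Fx] y by simp
      then show "(\<integral>\<^sup>+w. F x y (w 2) \<partial>PiM {2} N) = (\<integral>\<^sup>+z. F x y z \<partial>gauss_mat r3 c3)"
        using NP.product_nn_integral_singleton[of "F x y" 2] by (simp add: N)
    qed
    finally show "(\<integral>\<^sup>+w. f (w(0 := x)) \<partial>PiM {1, 2} N) = (\<integral>\<^sup>+y. \<integral>\<^sup>+z. F x y z \<partial>gauss_mat r3 c3 \<partial>gauss_mat r2 c2)" .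
  qed
  finally show ?thesis .
qed

section \<open>The error on the conditioning event\<close>

text \<open>The factor \<open>S\<close> stands for \<open>\<Sigma>\<^sub>1\<^sup>-\<^sup>2\<close>; taking \<open>S = 0\<close> covers the convention for singular \<open>\<Sigma>\<^sub>1\<close>.\<close>

definition spi_T :: "real mat \<Rightarrow> real mat \<Rightarrow> real mat \<Rightarrow> real mat \<Rightarrow> real mat \<Rightarrow> real mat \<Rightarrow> real mat" where
  "spi_T L2 S \<Phi>1 \<Phi>2 \<Omega>1 \<Omega>2 =
    1\<^sub>m (dim_row \<Phi>1) + \<Phi>1 * \<Phi>2\<^sup>T * ((L2 * L2) * \<Omega>2 * pinv \<Omega>1 * S) * minv (\<Phi>1 * \<Phi>1\<^sup>T)"

text \<open>The conditioning event as a predicate on the four Gaussian blocks, with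
  \<open>minv\<close> for every inverse; \<open>event_EF_iff\<close> connects it with
  \<open>event_EF\<close>.\<close>

definition well_cond :: "real mat \<Rightarrow> real mat \<Rightarrow> real \<Rightarrow> real mat \<Rightarrow> real mat \<Rightarrow> real mat \<Rightarrow> real mat \<Rightarrow> bool" where
  "well_cond L2 S \<xi> \<Phi>1 \<Phi>2 \<Omega>1 \<Omega>2 \<longleftrightarrow>
    mdet (\<Phi>1 * \<Phi>1\<^sup>T) \<noteq> 0 \<and> mdet (spi_T L2 S \<Phi>1 \<Phi>2 \<Omega>1 \<Omega>2) \<noteq> 0 \<and>
    spec_norm (minv (spi_T L2 S \<Phi>1 \<Phi>2 \<Omega>1 \<Omega>2)) < \<xi>"

definition sing_head :: "real mat \<Rightarrow> nat \<Rightarrow> real mat" where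
  "sing_head A \<rho> = mat_diag \<rho> (\<lambda>j. sing_val A (j + 1))"

definition sing_tail :: "real mat \<Rightarrow> nat \<Rightarrow> nat \<Rightarrow> real mat" where
  "sing_tail A \<rho> k = mat_diag k (\<lambda>j. sing_val A (\<rho> + j + 1))"

text \<open>The convention for singular \<Sigma>_1 is put into this single factor, so that
  \<open>spi_T\<close> needs no case distinction.\<close>

definition inv_sq :: "real mat \<Rightarrow> real mat" where
  "inv_sq L = (if mdet L = 0 then 0\<^sub>m (dim_row L) (dim_row L) else minv L * minv L)"

lemma sing_dims [simp]: "dim_row (sing_head A \<rho>) = \<rho>" "dim_col (sing_head A \<rho>) = \<rho>"
  "dim_row (sing_tail A \<rho> k) = k" "dim_col (sing_tail A \<rho> k) = k"
  "dim_row (inv_sq (sing_head A \<rho>)) = \<rho>" "dim_col (inv_sq (sing_head A \<rho>)) = \<rho>"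
  by (auto simp: sing_head_def sing_tail_def inv_sq_def)

lemma spi_T_carrier:
  assumes "\<Phi>1 \<in> carrier_mat \<rho> l"
  shows "spi_T L2 S \<Phi>1 \<Phi>2 \<Omega>1 \<Omega>2 \<in> carrier_mat \<rho> \<rho>"
  using assms by (auto simp: spi_T_def intro!: carrier_matI)

lemma event_EF_iff:
  assumes A: "A \<in> carrier_mat m (\<rho> + k)" and V: "right_singular_basis A V"
    and \<Omega>: "\<Omega> \<in> carrier_mat (\<rho> + k) s" and \<Phi>: "\<Phi> \<in> carrier_mat (\<rho> + k) l"
  shows "(\<Omega>, \<Phi>) \<in> event_EF A V \<rho> \<xi> \<longleftrightarrow>
    well_cond (sing_tail A \<rho> k) (inv_sq (sing_head A \<rho>)) \<xi> (topE \<rho> k * (V\<^sup>T * \<Phi>)) (botE \<rho> k * (V\<^sup>T * \<Phi>))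
      (topE \<rho> k * (V\<^sup>T * \<Omega>)) (botE \<rho> k * (V\<^sup>T * \<Omega>))"
proof -
  have dA: "dim_col A = \<rho> + k" using A by auto
  have Vc: "V \<in> carrier_mat (\<rho> + k) (\<rho> + k)" "V\<^sup>T * V = 1\<^sub>m (\<rho> + k)" using V dA by (auto simp: right_singular_basis_def)
  have d: "dim_row V = \<rho> + k" "dim_col V = \<rho> + k" "dim_row \<Omega> = \<rho> + k" "dim_col \<Omega> = s" "dim_row \<Phi> = \<rho> + k" "dim_col \<Phi> = l"
    using Vc \<Omega> \<Phi> by auto
  define X1 X2 Y1 Y2 where XY: "X1 = topE \<rho> k * (V\<^sup>T * \<Phi>)" "X2 = botE \<rho> k * (V\<^sup>T * \<Phi>)"
    "Y1 = topE \<rho> k * (V\<^sup>T * \<Omega>)" "Y2 = botE \<rho> k * (V\<^sup>T * \<Omega>)"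
  have dX: "dim_row X1 = \<rho>" "dim_col X1 = l" "dim_row X2 = k" "dim_col X2 = l"
    "dim_row Y1 = \<rho>" "dim_col Y1 = s" "dim_row Y2 = k" "dim_col Y2 = s" using d by (auto simp: XY)
  have bl: "(mat_of_cols (\<rho> + k) (take \<rho> (cols V)))\<^sup>T * \<Phi> = X1" "(mat_of_cols (\<rho> + k) (drop \<rho> (cols V)))\<^sup>T * \<Phi> = X2"
    "(mat_of_cols (\<rho> + k) (take \<rho> (cols V)))\<^sup>T * \<Omega> = Y1" "(mat_of_cols (\<rho> + k) (drop \<rho> (cols V)))\<^sup>T * \<Omega> = Y2"
    unfolding XY mat_of_cols_take_drop[OF Vc(1)] orthogonal_blocks(3,4)[OF Vc] using d by (auto simp: mult_assoc_dim)
  define W where "W = X1 * X1\<^sup>T"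
  have Wc: "W \<in> carrier_mat \<rho> \<rho>" using dX by (auto simp: W_def intro!: carrier_matI)
  define L1 L2 where "L1 = sing_head A \<rho>" and "L2 = sing_tail A \<rho> k"
  have L: "mat_diag \<rho> (\<lambda>j. sing_val A (j + 1)) = L1" "mat_diag k (\<lambda>j. sing_val A (\<rho> + j + 1)) = L2"
    "L1 \<in> carrier_mat \<rho> \<rho>" "L2 \<in> carrier_mat k k"
    by (auto simp: L1_def L2_def sing_head_def sing_tail_def)
  \<comment> \<open>Both branches of the conditional agree with one product, because
    \<open>inv_sq\<close> is zero in the singular case.\<close>
  have G: "(if invertible_mat L1 then (L2 ^\<^sub>m 2) * Y2 * pinv Y1 * (mat_inv L1 ^\<^sub>m 2) else 0\<^sub>m k \<rho>)
      = (L2 * L2) * Y2 * pinv Y1 * inv_sq L1"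
  proof (cases "mdet L1 = 0")
    case True
    then show ?thesis using L dX by (auto simp: invertible_mat_iff_det inv_sq_def pinv_dims)
  next
    case False
    have mc: "minv L1 \<in> carrier_mat \<rho> \<rho>" using L(3) by (auto intro!: carrier_matI)
    show ?thesis unfolding mat_inv_eq_minv[OF L(3) False] pow_mat_2[OF mc] pow_mat_2[OF L(4)]
      using L(3) False by (simp add: invertible_mat_iff_det inv_sq_def)
  qed
  define T where "T = spi_T L2 (inv_sq L1) X1 X2 Y1 Y2"
  have Tc: "T \<in> carrier_mat \<rho> \<rho>" unfolding T_def by (rule spi_T_carrier[of _ _ l]) (use dX in \<open>auto intro!: carrier_matI\<close>)
  have "(\<Omega>, \<Phi>) \<in> event_EF A V \<rho> \<xi> \<longleftrightarrow> invertible_mat W \<and>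
      invertible_mat (1\<^sub>m \<rho> + X1 * X2\<^sup>T * ((L2 * L2) * Y2 * pinv Y1 * inv_sq L1) * mat_inv W) \<and>
      spec_norm (mat_inv (1\<^sub>m \<rho> + X1 * X2\<^sup>T * ((L2 * L2) * Y2 * pinv Y1 * inv_sq L1) * mat_inv W)) < \<xi>"
    unfolding event_EF_def Let_def dA mem_Collect_eq prod.case bl W_def add_diff_cancel_left' L(1,2) G by (rule refl)
  also have "\<dots> \<longleftrightarrow> mdet W \<noteq> 0 \<and> mdet T \<noteq> 0 \<and> spec_norm (minv T) < \<xi>"
  proof (cases "mdet W = 0")
    case False
    have "1\<^sub>m \<rho> + X1 * X2\<^sup>T * ((L2 * L2) * Y2 * pinv Y1 * inv_sq L1) * mat_inv W = T"
      unfolding T_def spi_T_def mat_inv_eq_minv[OF Wc False] by (simp add: dX W_def)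
    then show ?thesis using False Wc Tc by (auto simp: invertible_mat_iff_det mat_inv_eq_minv)
  qed (use Wc in \<open>auto simp: invertible_mat_iff_det\<close>)
  finally show ?thesis unfolding well_cond_def T_def L1_def L2_def W_def XY .
qed

text \<open>The event contains a pseudoinverse and a spectral norm; this is what their measurability
  was prepared for.\<close>

lemma pred_well_cond:
  assumes "X1 \<in> measurable N (mat_borel \<rho> l)" "X2 \<in> measurable N (mat_borel k l)"
    "Y1 \<in> measurable N (mat_borel \<rho> s)" "Y2 \<in> measurable N (mat_borel k s)"
    and L: "L2 \<in> carrier_mat k k" "S \<in> carrier_mat \<rho> \<rho>" and \<rho>: "0 < \<rho>"
  shows "Measurable.pred N (\<lambda>\<omega>. well_cond L2 S \<xi> (X1 \<omega>) (X2 \<omega>) (Y1 \<omega>) (Y2 \<omega>))"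
proof -
  have W: "(\<lambda>\<omega>. X1 \<omega> * (X1 \<omega>)\<^sup>T) \<in> measurable N (mat_borel \<rho> \<rho>)" by (rule mat_borel_gram[OF assms(1)])
  have LL: "L2 * L2 \<in> carrier_mat k k" using L by auto
  have dr: "dim_row (X1 \<omega>) = \<rho>" if "\<omega> \<in> space N" for \<omega> using mat_borel_carrier[OF assms(1) that] by auto
  have "(\<lambda>\<omega>. 1\<^sub>m \<rho> + X1 \<omega> * (X2 \<omega>)\<^sup>T * ((L2 * L2) * Y2 \<omega> * pinv (Y1 \<omega>) * S) * minv (X1 \<omega> * (X1 \<omega>)\<^sup>T)) \<in> measurable N (mat_borel \<rho> \<rho>)"
    by (rule mat_borel_add[OF mat_borel_const[OF one_carrier_mat]
      mat_borel_mult[OF mat_borel_mult[OF mat_borel_mult[OF assms(1) mat_borel_transpose[OF assms(2)]]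
        mat_borel_mult[OF mat_borel_mult[OF mat_borel_mult[OF mat_borel_const[OF LL] assms(4)]
          mat_borel_pinv[OF assms(3)]] mat_borel_const[OF L(2)]]] mat_borel_minv[OF W]]])
  then have T: "(\<lambda>\<omega>. spi_T L2 S (X1 \<omega>) (X2 \<omega>) (Y1 \<omega>) (Y2 \<omega>)) \<in> measurable N (mat_borel \<rho> \<rho>)"
    unfolding spi_T_def by (rule measurable_cong[THEN iffD1, rotated]) (simp add: dr)
  note [measurable] = mat_borel_det[OF W] mat_borel_det[OF T] borel_measurable_spec_norm[OF mat_borel_minv[OF T] \<rho>]
  show ?thesis unfolding well_cond_def by measurable
qed

section \<open>The algorithm with one power step\<close>

lemma thin_qrD:
  assumes "thin_qr qr" "c \<le> r"
  shows "qr \<in> measurable (mat_borel r c) (mat_borel r c)"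
    "X \<in> carrier_mat r c \<Longrightarrow> qr X \<in> carrier_mat r c"
    "X \<in> carrier_mat r c \<Longrightarrow> (qr X)\<^sup>T * qr X = 1\<^sub>m c"
    "X \<in> carrier_mat r c \<Longrightarrow> \<exists>R\<in>carrier_mat c c. X = qr X * R"
  using assms unfolding thin_qr_def by (auto intro!: range_factor)

lemma spi_Q_1: "spi_Q qr 1 A \<Omega> \<Phi> = qr (A * \<Phi> * qr ((A * \<Phi>)\<^sup>T * (A * \<Omega>)))"
  by (simp add: spi_Q_def Let_def)

lemma mat_borel_spi_Q:
  assumes qr: "thin_qr qr" "s \<le> l" "s \<le> m" and A: "A \<in> carrier_mat m n"
    and \<Omega>: "\<Omega> \<in> measurable N (mat_borel n s)" and \<Phi>: "\<Phi> \<in> measurable N (mat_borel n l)"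
  shows "(\<lambda>\<omega>. spi_Q qr 1 A (\<Omega> \<omega>) (\<Phi> \<omega>)) \<in> measurable N (mat_borel m s)"
proof -
  have Z: "(\<lambda>\<omega>. A * \<Phi> \<omega>) \<in> measurable N (mat_borel m l)" and Y: "(\<lambda>\<omega>. A * \<Omega> \<omega>) \<in> measurable N (mat_borel m s)"
    using A \<Omega> \<Phi> by (auto intro: mat_borel_mult mat_borel_const)
  have "(\<lambda>\<omega>. qr ((A * \<Phi> \<omega>)\<^sup>T * (A * \<Omega> \<omega>))) \<in> measurable N (mat_borel l s)"
    by (rule measurable_compose[OF mat_borel_mult[OF mat_borel_transpose[OF Z] Y] thin_qrD(1)[OF qr(1,2)]])
  from measurable_compose[OF mat_borel_mult[OF Z this] thin_qrD(1)[OF qr(1,3)]]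
  show ?thesis unfolding spi_Q_1 .
qed

text \<open>With Z = A \<Phi> and Y = A \<Omega>, the two QR factorisations read Z^T Y = X R1 and Z
  X = Q R2. Hence Z Z^T Y = Q R2 R1, whatever the rank of the matrices involved.\<close>

lemma spi_Q_props:
  assumes qr: "thin_qr qr" "s \<le> l" "s \<le> m" and A: "A \<in> carrier_mat m n"
    and \<Omega>: "\<Omega> \<in> carrier_mat n s" and \<Phi>: "\<Phi> \<in> carrier_mat n l"
  defines "Q \<equiv> spi_Q qr 1 A \<Omega> \<Phi>"
  shows "Q \<in> carrier_mat m s" "Q\<^sup>T * Q = 1\<^sub>m s"
    "\<exists>N\<in>carrier_mat s s. (A * \<Phi>) * ((A * \<Phi>)\<^sup>T * (A * \<Omega>)) = Q * N"
proof -
  define Z where "Z = A * \<Phi>"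
  have Zc: "Z \<in> carrier_mat m l" and X: "Z\<^sup>T * (A * \<Omega>) \<in> carrier_mat l s" using A \<Omega> \<Phi> by (auto simp: Z_def)
  from thin_qrD(4)[OF qr(1,2) X] obtain R1 where R1: "R1 \<in> carrier_mat s s" "Z\<^sup>T * (A * \<Omega>) = qr (Z\<^sup>T * (A * \<Omega>)) * R1" by auto
  have qc: "qr (Z\<^sup>T * (A * \<Omega>)) \<in> carrier_mat l s" by (rule thin_qrD(2)[OF qr(1,2) X])
  then have X2: "Z * qr (Z\<^sup>T * (A * \<Omega>)) \<in> carrier_mat m s" using Zc by auto
  have Q: "Q = qr (Z * qr (Z\<^sup>T * (A * \<Omega>)))" unfolding Q_def Z_def spi_Q_1 ..
  from thin_qrD(4)[OF qr(1,3) X2] obtain R2 where R2: "R2 \<in> carrier_mat s s" "Z * qr (Z\<^sup>T * (A * \<Omega>)) = Q * R2" by (auto simp: Q)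
  show Qc: "Q \<in> carrier_mat m s" unfolding Q by (rule thin_qrD(2)[OF qr(1,3) X2])
  show "Q\<^sup>T * Q = 1\<^sub>m s" unfolding Q by (rule thin_qrD(3)[OF qr(1,3) X2])
  have "Z * (Z\<^sup>T * (A * \<Omega>)) = (Z * qr (Z\<^sup>T * (A * \<Omega>))) * R1"
    using qc Zc R1(1) by (subst R1(2)) (simp add: mult_assoc_dim)
  also have "\<dots> = Q * (R2 * R1)" unfolding R2(2) using Qc R1 R2 by (simp add: mult_assoc_dim)
  finally show "\<exists>N\<in>carrier_mat s s. (A * \<Phi>) * ((A * \<Phi>)\<^sup>T * (A * \<Omega>)) = Q * N"
    using R1(1) R2(1) unfolding Z_def by (intro bexI[of _ "R2 * R1"]) auto
qed

lemma gram_split: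
  assumes A: "A \<in> carrier_mat m (a + b)" and V: "right_singular_basis A V"
  defines "V1 \<equiv> V * (topE a b)\<^sup>T" and "V2 \<equiv> V * (botE a b)\<^sup>T"
  shows "A\<^sup>T * A = V1 * (sing_head A a * sing_head A a) * V1\<^sup>T + V2 * (sing_tail A a b * sing_tail A a b) * V2\<^sup>T"
proof -
  have V': "V \<in> carrier_mat (a + b) (a + b)" "V\<^sup>T * V = 1\<^sub>m (a + b)" "A\<^sup>T * A = V * (Sigma_mat A ^\<^sub>m 2) * V\<^sup>T"
    using V A unfolding right_singular_basis_def by auto
  have S: "Sigma_mat A ^\<^sub>m 2 = mat_diag (a + b) (\<lambda>j. sing_val A (j + 1) * sing_val A (j + 1))"
    using A by (subst pow_mat_2[of _ "a + b"]) (auto simp: Sigma_mat_def)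
  show ?thesis unfolding V'(3) S orthogonal_blocks(9)[OF V'(1,2)] V1_def V2_def
    by (simp add: sing_head_def sing_tail_def add.assoc)
qed

text \<open>The split point \<open>a\<close> is arbitrary here: it is \<rho> in the regular case and
  the number of nonzero singular values in the exact one.\<close>

lemma spi_Q_error:
  assumes qr: "thin_qr qr" "s \<le> l" "s \<le> m" and A: "A \<in> carrier_mat m (a + b)" and V: "right_singular_basis A V"
    and \<Omega>: "\<Omega> \<in> carrier_mat (a + b) s" and \<Phi>: "\<Phi> \<in> carrier_mat (a + b) l"
    and L1: "mdet (sing_head A a) \<noteq> 0"
  defines "Q \<equiv> spi_Q qr 1 A \<Omega> \<Phi>" and "\<Phi>1 \<equiv> topE a b * (V\<^sup>T * \<Phi>)" and "\<Phi>2 \<equiv> botE a b * (V\<^sup>T * \<Phi>)"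
    and "\<Omega>1 \<equiv> topE a b * (V\<^sup>T * \<Omega>)" and "\<Omega>2 \<equiv> botE a b * (V\<^sup>T * \<Omega>)"
  defines "T \<equiv> spi_T (sing_tail A a b) (inv_sq (sing_head A a)) \<Phi>1 \<Phi>2 \<Omega>1 \<Omega>2"
  assumes det: "mdet (\<Omega>1 * \<Omega>1\<^sup>T) \<noteq> 0" "mdet (\<Phi>1 * \<Phi>1\<^sup>T) \<noteq> 0" and T: "mdet T \<noteq> 0"
  shows "frob_sq (A - Q * (Q\<^sup>T * A)) \<le> frob_sq (sing_tail A a b) +
    frob_sq (sing_tail A a b * \<Phi>2 * (\<Phi>1\<^sup>T + \<Phi>2\<^sup>T * (sing_tail A a b * sing_tail A a b * \<Omega>2 * (\<Omega>1\<^sup>T * minv (\<Omega>1 * \<Omega>1\<^sup>T)) * inv_sq (sing_head A a)))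
      * minv (\<Phi>1 * \<Phi>1\<^sup>T) * minv T)"
proof -
  have V': "V \<in> carrier_mat (a + b) (a + b)" "V\<^sup>T * V = 1\<^sub>m (a + b)"
    using V A unfolding right_singular_basis_def by auto
  define V1 V2 where V12: "V1 = V * (topE a b)\<^sup>T" "V2 = V * (botE a b)\<^sup>T"
  note ob = orthogonal_blocks[OF V', folded V12]
  have dV: "dim_row V = a + b" "dim_col V = a + b" "dim_row \<Omega> = a + b" "dim_row \<Phi> = a + b" using V' \<Omega> \<Phi> by auto
  have bl: "\<Omega>1 = V1\<^sup>T * \<Omega>" "\<Omega>2 = V2\<^sup>T * \<Omega>" "\<Phi>1 = V1\<^sup>T * \<Phi>" "\<Phi>2 = V2\<^sup>T * \<Phi>"
    unfolding ob(3,4) \<Omega>1_def \<Omega>2_def \<Phi>1_def \<Phi>2_def using dV by (simp_all add: mult_assoc_dim)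
  note Qp = spi_Q_props[OF qr A \<Omega> \<Phi>, folded Q_def]
  from Qp(3) obtain N where N: "N \<in> carrier_mat s s" "(A * \<Phi>) * ((A * \<Phi>)\<^sup>T * (A * \<Omega>)) = Q * N" by auto
  have isq: "inv_sq (sing_head A a) = minv (sing_head A a) * minv (sing_head A a)" using L1 by (simp add: inv_sq_def)
  have p: "pinv \<Omega>1 = \<Omega>1\<^sup>T * minv (\<Omega>1 * \<Omega>1\<^sup>T)"
    by (rule pinv_full_row_rank[of _ a s]) (use det \<Omega> in \<open>auto simp: \<Omega>1_def intro!: carrier_matI\<close>)
  have dr: "dim_row \<Phi>1 = a" by (simp add: \<Phi>1_def)
  have L: "sing_head A a \<in> carrier_mat a a" "sing_tail A a b \<in> carrier_mat b b" by (auto intro!: carrier_matI)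
  have Lt: "(sing_tail A a b)\<^sup>T = sing_tail A a b" by (simp add: sing_tail_def mat_diag_transpose)
  note T' = T[unfolded T_def spi_T_def p isq dr]
  show ?thesis unfolding T_def spi_T_def p isq dr
    using low_rank_error[OF A ob(1,2,5,6,7,8) L Lt L1 gram_split[OF A V, folded V12] \<Omega> \<Phi> Qp(1,2) N, folded bl, OF det T'] .
qed

lemma borel_measurable_tail_error:
  assumes "X1 \<in> measurable N (mat_borel \<rho> l)" "X2 \<in> measurable N (mat_borel k l)"
    "Y1 \<in> measurable N (mat_borel \<rho> s)" "Y2 \<in> measurable N (mat_borel k s)"
    and L: "L2 \<in> carrier_mat k k" "S \<in> carrier_mat \<rho> \<rho>"
  shows "(\<lambda>\<omega>. tail_error L2 S (X1 \<omega>) (X2 \<omega>) (Y1 \<omega>) (Y2 \<omega>)) \<in> borel_measurable N"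
proof -
  have LL: "L2 * L2 \<in> carrier_mat k k" using L by auto
  show ?thesis unfolding tail_error_def
    by (rule mat_borel_frob_sq[OF mat_borel_mult[OF mat_borel_mult[OF mat_borel_mult[OF mat_borel_const[OF L(1)] assms(2)]
      mat_borel_add[OF mat_borel_transpose[OF assms(1)] mat_borel_mult[OF mat_borel_transpose[OF assms(2)]
        mat_borel_mult[OF mat_borel_mult[OF mat_borel_mult[OF mat_borel_const[OF LL] assms(4)]
          mat_borel_mult[OF mat_borel_transpose[OF assms(3)] mat_borel_minv[OF mat_borel_gram[OF assms(3)]]]] mat_borel_const[OF L(2)]]]]]
      mat_borel_minv[OF mat_borel_gram[OF assms(1)]]]])
qed

text \<open>The singular values decrease, so \<sigma>_\<rho> is the smallest in the head and its
  inverse fourth power bounds all squared diagonal entries of \<Sigma>_1^(-2).\<close>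

lemma inv_sq_sing_head:
  assumes A: "A \<in> carrier_mat m n" and V: "right_singular_basis A V" and \<rho>: "0 < \<rho>" "\<rho> \<le> n" and pos: "sing_val A \<rho> \<noteq> 0"
  shows "mdet (sing_head A \<rho>) \<noteq> 0"
    "M \<in> carrier_mat \<rho> c \<Longrightarrow> frob_sq (inv_sq (sing_head A \<rho>) * M) \<le> 1 / sing_val A \<rho> ^ 4 * frob_sq M"
proof -
  note sv = sing_vals_props[OF A V]
  have "0 \<le> sing_val A \<rho>" unfolding sing_val_def by (rule sv(2)) (use \<rho> in simp)
  then have p: "0 < sing_val A \<rho>" using pos by simp
  have ge: "sing_val A \<rho> \<le> sing_val A (i + 1)" if "i < \<rho>" for i
    using sv(3)[of i "\<rho> - 1"] that \<rho> by (simp add: sing_val_def)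
  have nz: "sing_val A (i + 1) \<noteq> 0" if "i < \<rho>" for i using ge[OF that] p by linarith
  show det: "mdet (sing_head A \<rho>) \<noteq> 0" unfolding sing_head_def by (rule minv_mat_diag(1)) (rule nz)
  have "inv_sq (sing_head A \<rho>) = mat_diag \<rho> (\<lambda>i. 1 / sing_val A (i + 1) * (1 / sing_val A (i + 1)))"
    using det minv_mat_diag(2)[of \<rho> "\<lambda>j. sing_val A (j + 1)", OF nz] unfolding inv_sq_def sing_head_def by simp
  moreover have "(1 / sing_val A (i + 1) * (1 / sing_val A (i + 1)))\<^sup>2 \<le> 1 / sing_val A \<rho> ^ 4" if "i < \<rho>" for i
  proof -
    have "(1 / sing_val A (i + 1) * (1 / sing_val A (i + 1)))\<^sup>2 = 1 / sing_val A (i + 1) ^ 4"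
      by (simp add: power_divide power_mult_distrib power2_eq_square numeral_eq_Suc)
    also have "\<dots> \<le> 1 / sing_val A \<rho> ^ 4" using p ge[OF that] by (intro divide_left_mono power_mono mult_pos_pos) (auto intro: less_le_trans)
    finally show ?thesis .
  qed
  ultimately show "frob_sq (inv_sq (sing_head A \<rho>) * M) \<le> 1 / sing_val A \<rho> ^ 4 * frob_sq M" if "M \<in> carrier_mat \<rho> c"
    using frob_sq_mat_diag_mult_le[of \<rho> "\<lambda>i. 1 / sing_val A (i + 1) * (1 / sing_val A (i + 1))" "1 / sing_val A \<rho> ^ 4" M c, OF _ that] by simp
qed

text \<open>The indicator is kept in front of |L2|^2, where it integrates to the probability of the
  event, and dropped from the second term, whose Gaussian average is taken over all \<Omega> and
  \<Phi>. The factor T^(-1) has been replaced by \<xi> before that.\<close>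

lemma nn_integral_range_error:
  assumes qr: "thin_qr qr" "s \<le> l" "s \<le> m" and A: "A \<in> carrier_mat m (\<rho> + k)" and V: "right_singular_basis A V"
    and \<rho>: "0 < \<rho>" "\<rho> + 2 \<le> s" "\<rho> + 4 \<le> l" and pos: "sing_val A \<rho> \<noteq> 0" and \<xi>: "0 \<le> \<xi>"
  defines "L2 \<equiv> sing_tail A \<rho> k"
  defines "wc \<equiv> \<lambda>\<Phi> \<Omega>. well_cond L2 (inv_sq (sing_head A \<rho>)) \<xi> (topE \<rho> k * (V\<^sup>T * \<Phi>)) (botE \<rho> k * (V\<^sup>T * \<Phi>))
      (topE \<rho> k * (V\<^sup>T * \<Omega>)) (botE \<rho> k * (V\<^sup>T * \<Omega>))"
  shows "(\<integral>\<^sup>+\<Phi>. \<integral>\<^sup>+\<Omega>. of_bool (wc \<Phi> \<Omega>) * ennreal (frob_sq (A - spi_Q qr 1 A \<Omega> \<Phi> * ((spi_Q qr 1 A \<Omega> \<Phi>)\<^sup>T * A)))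
      \<partial>gauss_mat (\<rho> + k) s \<partial>gauss_mat (\<rho> + k) l)
    \<le> ennreal (frob_sq L2) * (\<integral>\<^sup>+\<Phi>. \<integral>\<^sup>+\<Omega>. of_bool (wc \<Phi> \<Omega>) \<partial>gauss_mat (\<rho> + k) s \<partial>gauss_mat (\<rho> + k) l) +
      ennreal (\<xi>\<^sup>2) * ennreal (2 * frob_sq L2 * (real \<rho> / (real l - real \<rho> - 1)) +
       2 * (1 / sing_val A \<rho> ^ 4) / (real s - real \<rho> - 1) * (((real l)\<^sup>2 + real l) * frob_sq (L2 * (L2 * L2)) + real l * (frob_sq L2 * frob_sq (L2 * L2)))
         * (real \<rho> * (real l - 1) / ((real l - real \<rho>) * (real l - real \<rho> - 1) * (real l - real \<rho> - 3))))"
proof -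
  let ?S = "inv_sq (sing_head A \<rho>)" and ?n = "\<rho> + k"
  define te where "te = (\<lambda>\<Phi> \<Omega>. tail_error L2 ?S (topE \<rho> k * (V\<^sup>T * \<Phi>)) (botE \<rho> k * (V\<^sup>T * \<Phi>)) (topE \<rho> k * (V\<^sup>T * \<Omega>)) (botE \<rho> k * (V\<^sup>T * \<Omega>)))"
  have V': "V \<in> carrier_mat ?n ?n" "V\<^sup>T * V = 1\<^sub>m ?n" using V A unfolding right_singular_basis_def by auto
  have Vr: "V\<^sup>T \<in> rot_inv ?n" by (rule rot_inv_transpose[OF orthogonal_rot_inv[OF V']])
  have c: "L2 \<in> carrier_mat k k" "?S \<in> carrier_mat \<rho> \<rho>" "V\<^sup>T \<in> carrier_mat ?n ?n"
    "topE \<rho> k \<in> carrier_mat \<rho> ?n" "botE \<rho> k \<in> carrier_mat k ?n"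
    using V' unfolding L2_def by (auto intro!: carrier_matI)
  have dc: "dim_row L2 = k" "dim_col L2 = k" using c by auto
  note top = mat_borel_mult[OF mat_borel_const[OF c(4)] mat_borel_mult[OF mat_borel_const[OF c(3)]]]
    and bot = mat_borel_mult[OF mat_borel_const[OF c(5)] mat_borel_mult[OF mat_borel_const[OF c(3)]]]
  have wm: "Measurable.pred N (\<lambda>\<omega>. wc (X \<omega>) (Y \<omega>))" and tm: "(\<lambda>\<omega>. te (X \<omega>) (Y \<omega>)) \<in> borel_measurable N"
    if X: "X \<in> measurable N (mat_borel ?n l)" and Y: "Y \<in> measurable N (mat_borel ?n s)" for X Y and N :: "'z measure"
    unfolding wc_def te_def
    by (rule pred_well_cond[OF top[OF X] bot[OF X] top[OF Y] bot[OF Y] c(1,2) \<rho>(1)])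
      (rule borel_measurable_tail_error[OF top[OF X] bot[OF X] top[OF Y] bot[OF Y] c(1,2)])
  interpret G: sigma_finite_measure "gauss_mat ?n s"
    by (intro prob_space_imp_sigma_finite prob_space_gauss_mat)
  have L1: "mdet (sing_head A \<rho>) \<noteq> 0" by (rule inv_sq_sing_head(1)[OF A V \<rho>(1) _ pos]) simp
  \<comment> \<open>Full rank of \<Phi>_1 is part of \<open>wc\<close>. Full rank of \<Omega>_1 is
    not, since the event uses a pseudoinverse there, so the pointwise bound holds only for almost
    every \<Omega>.\<close>
  have point: "AE \<Omega> in gauss_mat ?n s. of_bool (wc \<Phi> \<Omega>) * ennreal (frob_sq (A - spi_Q qr 1 A \<Omega> \<Phi> * ((spi_Q qr 1 A \<Omega> \<Phi>)\<^sup>T * A)))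
      \<le> ennreal (frob_sq L2) * of_bool (wc \<Phi> \<Omega>) + ennreal (\<xi>\<^sup>2) * ennreal (te \<Phi> \<Omega>)" if \<Phi>: "\<Phi> \<in> carrier_mat ?n l" for \<Phi>
  proof (rule AE_mp[OF AE_gauss_mat_block_det[OF Vr, of s] AE_I2], goal_cases)
    case (2 \<Omega>)
    then have \<Omega>: "\<Omega> \<in> carrier_mat ?n s" by (simp add: sets_eq_imp_space_eq[OF sets_gauss_mat])
    show ?case
    proof (rule impI, cases "wc \<Phi> \<Omega>")
      assume det: "mdet (topE \<rho> k * (V\<^sup>T * \<Omega>) * (topE \<rho> k * (V\<^sup>T * \<Omega>))\<^sup>T) \<noteq> 0" and w: "wc \<Phi> \<Omega>"
      define \<Phi>1 \<Phi>2 \<Omega>1 \<Omega>2 where b: "\<Phi>1 = topE \<rho> k * (V\<^sup>T * \<Phi>)" "\<Phi>2 = botE \<rho> k * (V\<^sup>T * \<Phi>)"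
        "\<Omega>1 = topE \<rho> k * (V\<^sup>T * \<Omega>)" "\<Omega>2 = botE \<rho> k * (V\<^sup>T * \<Omega>)"
      define T where "T = spi_T L2 ?S \<Phi>1 \<Phi>2 \<Omega>1 \<Omega>2"
      have Tc: "T \<in> carrier_mat \<rho> \<rho>" unfolding T_def by (rule spi_T_carrier[of _ _ l]) (use \<Phi> in \<open>auto simp: b intro!: carrier_matI\<close>)
      have w': "mdet (\<Phi>1 * \<Phi>1\<^sup>T) \<noteq> 0" "mdet T \<noteq> 0" "spec_norm (minv T) < \<xi>"
        using w unfolding wc_def well_cond_def T_def b by auto
      let ?B = "L2 * \<Phi>2 * (\<Phi>1\<^sup>T + \<Phi>2\<^sup>T * (L2 * L2 * \<Omega>2 * (\<Omega>1\<^sup>T * minv (\<Omega>1 * \<Omega>1\<^sup>T)) * ?S)) * minv (\<Phi>1 * \<Phi>1\<^sup>T)"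
      have sn: "0 \<le> spec_norm (minv T)" by (rule spec_norm_nonneg) (use Tc \<rho> in auto)
      have te: "te \<Phi> \<Omega> = frob_sq ?B" unfolding te_def tail_error_def b ..
      have "frob_sq (A - spi_Q qr 1 A \<Omega> \<Phi> * ((spi_Q qr 1 A \<Omega> \<Phi>)\<^sup>T * A)) \<le> frob_sq L2 + frob_sq (?B * minv T)"
        using spi_Q_error[OF qr A V \<Omega> \<Phi> L1, folded L2_def b, folded T_def, OF det[folded b] w'(1,2)] by simp
      also have "frob_sq (?B * minv T) \<le> frob_sq ?B * (spec_norm (minv T))\<^sup>2"
        by (rule frob_sq_mult_spec_norm) (use Tc \<rho> in \<open>auto simp: b\<close>)
      also have "\<dots> \<le> frob_sq ?B * \<xi>\<^sup>2" using sn w'(3) by (intro mult_left_mono power_mono) auto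
      finally have "frob_sq (A - spi_Q qr 1 A \<Omega> \<Phi> * ((spi_Q qr 1 A \<Omega> \<Phi>)\<^sup>T * A)) \<le> frob_sq L2 + \<xi>\<^sup>2 * te \<Phi> \<Omega>"
        unfolding te by (simp add: mult.commute)
      then show "of_bool (wc \<Phi> \<Omega>) * ennreal (frob_sq (A - spi_Q qr 1 A \<Omega> \<Phi> * ((spi_Q qr 1 A \<Omega> \<Phi>)\<^sup>T * A)))
        \<le> ennreal (frob_sq L2) * of_bool (wc \<Phi> \<Omega>) + ennreal (\<xi>\<^sup>2) * ennreal (te \<Phi> \<Omega>)" using w by (simp add: te ennreal_mult''[symmetric] ennreal_plus[symmetric] ennreal_leI del: ennreal_plus)
    qed simp
  qed (use \<rho> in simp)
  have "(\<integral>\<^sup>+\<Phi>. \<integral>\<^sup>+\<Omega>. of_bool (wc \<Phi> \<Omega>) * ennreal (frob_sq (A - spi_Q qr 1 A \<Omega> \<Phi> * ((spi_Q qr 1 A \<Omega> \<Phi>)\<^sup>T * A)))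
      \<partial>gauss_mat ?n s \<partial>gauss_mat ?n l)
    \<le> (\<integral>\<^sup>+\<Phi>. ennreal (frob_sq L2) * (\<integral>\<^sup>+\<Omega>. of_bool (wc \<Phi> \<Omega>) \<partial>gauss_mat ?n s) + ennreal (\<xi>\<^sup>2) * (\<integral>\<^sup>+\<Omega>. ennreal (te \<Phi> \<Omega>) \<partial>gauss_mat ?n s)
      \<partial>gauss_mat ?n l)"
  proof (rule nn_integral_mono)
    fix \<Phi> assume "\<Phi> \<in> space (gauss_mat ?n l)"
    then have \<Phi>: "\<Phi> \<in> carrier_mat ?n l" by (simp add: sets_eq_imp_space_eq[OF sets_gauss_mat])
    note [measurable] = wm[OF mat_borel_const[OF \<Phi>] measurable_ident_gauss_mat] tm[OF mat_borel_const[OF \<Phi>] measurable_ident_gauss_mat]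
    have "(\<integral>\<^sup>+\<Omega>. of_bool (wc \<Phi> \<Omega>) * ennreal (frob_sq (A - spi_Q qr 1 A \<Omega> \<Phi> * ((spi_Q qr 1 A \<Omega> \<Phi>)\<^sup>T * A))) \<partial>gauss_mat ?n s)
      \<le> (\<integral>\<^sup>+\<Omega>. ennreal (frob_sq L2) * of_bool (wc \<Phi> \<Omega>) + ennreal (\<xi>\<^sup>2) * ennreal (te \<Phi> \<Omega>) \<partial>gauss_mat ?n s)"
      by (rule nn_integral_mono_AE[OF point[OF \<Phi>]])
    also have "\<dots> = ennreal (frob_sq L2) * (\<integral>\<^sup>+\<Omega>. of_bool (wc \<Phi> \<Omega>) \<partial>gauss_mat ?n s) + ennreal (\<xi>\<^sup>2) * (\<integral>\<^sup>+\<Omega>. ennreal (te \<Phi> \<Omega>) \<partial>gauss_mat ?n s)"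
      by (simp add: nn_integral_add nn_integral_cmult)
    finally show "(\<integral>\<^sup>+\<Omega>. of_bool (wc \<Phi> \<Omega>) * ennreal (frob_sq (A - spi_Q qr 1 A \<Omega> \<Phi> * ((spi_Q qr 1 A \<Omega> \<Phi>)\<^sup>T * A))) \<partial>gauss_mat ?n s)
      \<le> \<dots>" .
  qed
  also have "\<dots> = ennreal (frob_sq L2) * (\<integral>\<^sup>+\<Phi>. \<integral>\<^sup>+\<Omega>. of_bool (wc \<Phi> \<Omega>) \<partial>gauss_mat ?n s \<partial>gauss_mat ?n l) +
      ennreal (\<xi>\<^sup>2) * (\<integral>\<^sup>+\<Phi>. \<integral>\<^sup>+\<Omega>. ennreal (te \<Phi> \<Omega>) \<partial>gauss_mat ?n s \<partial>gauss_mat ?n l)"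
  proof -
    have f: "fst \<in> measurable (gauss_mat ?n l \<Otimes>\<^sub>M gauss_mat ?n s) (mat_borel ?n l)" "snd \<in> measurable (gauss_mat ?n l \<Otimes>\<^sub>M gauss_mat ?n s) (mat_borel ?n s)"
      using measurable_fst[of "gauss_mat ?n l" "gauss_mat ?n s"] measurable_snd[of "gauss_mat ?n l" "gauss_mat ?n s"]
      by (simp_all cong: measurable_cong_sets)
    note [measurable] = wm[OF f] tm[OF f]
    have "(\<lambda>\<Phi>. \<integral>\<^sup>+\<Omega>. of_bool (wc \<Phi> \<Omega>) \<partial>gauss_mat ?n s :: ennreal) \<in> borel_measurable (gauss_mat ?n l)"
      "(\<lambda>\<Phi>. \<integral>\<^sup>+\<Omega>. ennreal (te \<Phi> \<Omega>) \<partial>gauss_mat ?n s) \<in> borel_measurable (gauss_mat ?n l)"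
      by (intro G.borel_measurable_nn_integral; simp add: case_prod_beta)+
    then show ?thesis by (simp add: nn_integral_add nn_integral_cmult)
  qed
  also have "(\<integral>\<^sup>+\<Phi>. \<integral>\<^sup>+\<Omega>. ennreal (te \<Phi> \<Omega>) \<partial>gauss_mat ?n s \<partial>gauss_mat ?n l) \<le> ennreal (2 * frob_sq L2 * (real \<rho> / (real l - real \<rho> - 1)) +
       2 * (1 / sing_val A \<rho> ^ 4) / (real s - real \<rho> - 1) * (((real l)\<^sup>2 + real l) * frob_sq (L2 * (L2 * L2)) + real l * (frob_sq L2 * frob_sq (L2 * L2)))
         * (real \<rho> * (real l - 1) / ((real l - real \<rho>) * (real l - real \<rho> - 1) * (real l - real \<rho> - 3))))"
    unfolding te_def
    by (rule nn_integral_tail_error[OF Vr c(1,2) inv_sq_sing_head(2)[OF A V \<rho>(1) _ pos] _ \<rho>]) auto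
  finally show ?thesis by (simp add: add_left_mono mult_left_mono)
qed

text \<open>Splitting at the number of nonzero singular values instead of \<rho> makes \<Sigma>_1
  invertible and \<Sigma>_2 zero. The general error bound then gives zero, provided the two upper
  blocks have full rank.\<close>

lemma AE_spi_Q_exact:
  assumes qr: "thin_qr qr" "s \<le> l" "s \<le> m" and A: "A \<in> carrier_mat m n" and V: "right_singular_basis A V"
    and r: "r < s" "r < n" and 0: "sing_val A (r + 1) = 0"
  shows "AE \<Phi> in gauss_mat n l. AE \<Omega> in gauss_mat n s.
    frob_sq (A - spi_Q qr 1 A \<Omega> \<Phi> * ((spi_Q qr 1 A \<Omega> \<Phi>)\<^sup>T * A)) = 0"
proof -
  \<comment> \<open>By monotonicity all singular values from position a + 1 on vanish, and those
    before are nonzero by minimality. The value a = 0 is allowed and covers A = 0.\<close>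
  define a where "a = (LEAST i. sing_val A (i + 1) = 0)"
  define k where "k = n - a"
  have a0: "sing_val A (a + 1) = 0" and ar: "a \<le> r" unfolding a_def using 0 by (auto intro: LeastI Least_le)
  have nz: "sing_val A (i + 1) \<noteq> 0" if "i < a" for i using not_less_Least that unfolding a_def by blast
  have n: "n = a + k" using ar r by (simp add: k_def)
  note A = A[unfolded n]
  have V': "V \<in> carrier_mat (a + k) (a + k)" "V\<^sup>T * V = 1\<^sub>m (a + k)" using V A unfolding right_singular_basis_def by auto
  have Vr: "V\<^sup>T \<in> rot_inv (a + k)" by (rule rot_inv_transpose[OF orthogonal_rot_inv[OF V']])
  have L1: "mdet (sing_head A a) \<noteq> 0" unfolding sing_head_def by (rule minv_mat_diag(1)) (rule nz)
  have L2: "sing_tail A a k = 0\<^sub>m k k"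
  proof -
    have "sing_val A (a + j + 1) = 0" if "j < k" for j
      using sing_vals_props(2)[OF A V, of "a + j"] sing_vals_props(3)[OF A V, of a "a + j"] a0 that
      by (simp add: sing_val_def)
    then show ?thesis unfolding sing_tail_def by (intro eq_matI) (auto simp: mat_diag_index)
  qed
  have "frob_sq (A - spi_Q qr 1 A \<Omega> \<Phi> * ((spi_Q qr 1 A \<Omega> \<Phi>)\<^sup>T * A)) = 0"
    if \<Phi>: "\<Phi> \<in> carrier_mat (a + k) l" and \<Omega>: "\<Omega> \<in> carrier_mat (a + k) s"
      and d: "mdet (topE a k * (V\<^sup>T * \<Omega>) * (topE a k * (V\<^sup>T * \<Omega>))\<^sup>T) \<noteq> 0" "mdet (topE a k * (V\<^sup>T * \<Phi>) * (topE a k * (V\<^sup>T * \<Phi>))\<^sup>T) \<noteq> 0" for \<Phi> \<Omega>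
  proof -
    have dd: "dim_col \<Omega> = s" "dim_col \<Phi> = l" using \<Omega> \<Phi> by auto
    \<comment> \<open>The correction in T carries a factor \<open>L2\<close>, which is zero, so T is
      the identity.\<close>
    have T: "spi_T (sing_tail A a k) (inv_sq (sing_head A a)) (topE a k * (V\<^sup>T * \<Phi>)) (botE a k * (V\<^sup>T * \<Phi>))
        (topE a k * (V\<^sup>T * \<Omega>)) (botE a k * (V\<^sup>T * \<Omega>)) = 1\<^sub>m a"
      unfolding spi_T_def L2 by (simp add: pinv_dims dd add_zero_dim)
    have "mdet (1\<^sub>m a :: real mat) \<noteq> 0" by simp
    note b = spi_Q_error[OF qr A V \<Omega> \<Phi> L1 d, unfolded T, OF this]
    have "frob_sq (A - spi_Q qr 1 A \<Omega> \<Phi> * ((spi_Q qr 1 A \<Omega> \<Phi>)\<^sup>T * A)) \<le> 0"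
      by (rule order_trans[OF b]) (simp add: L2 dd frob_sq_def)
    then show ?thesis using frob_sq_nonneg[of "A - spi_Q qr 1 A \<Omega> \<Phi> * ((spi_Q qr 1 A \<Omega> \<Phi>)\<^sup>T * A)"] by linarith
  qed
  note ex = this
  have as: "a \<le> s" "a \<le> l" using ar r qr by auto
  show ?thesis unfolding n
  proof (rule AE_mp[OF AE_gauss_mat_block_det[OF Vr as(2)] AE_I2], rule impI)
    fix \<Phi> assume "\<Phi> \<in> space (gauss_mat (a + k) l)" and d: "mdet (topE a k * (V\<^sup>T * \<Phi>) * (topE a k * (V\<^sup>T * \<Phi>))\<^sup>T) \<noteq> 0"
    then have \<Phi>: "\<Phi> \<in> carrier_mat (a + k) l" by (simp add: sets_eq_imp_space_eq[OF sets_gauss_mat])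
    show "AE \<Omega> in gauss_mat (a + k) s. frob_sq (A - spi_Q qr 1 A \<Omega> \<Phi> * ((spi_Q qr 1 A \<Omega> \<Phi>)\<^sup>T * A)) = 0"
    proof (rule AE_mp[OF AE_gauss_mat_block_det[OF Vr as(1)] AE_I2], rule impI)
      fix \<Omega> assume "\<Omega> \<in> space (gauss_mat (a + k) s)" and d2: "mdet (topE a k * (V\<^sup>T * \<Omega>) * (topE a k * (V\<^sup>T * \<Omega>))\<^sup>T) \<noteq> 0"
      then have \<Omega>: "\<Omega> \<in> carrier_mat (a + k) s" by (simp add: sets_eq_imp_space_eq[OF sets_gauss_mat])
      show "frob_sq (A - spi_Q qr 1 A \<Omega> \<Phi> * ((spi_Q qr 1 A \<Omega> \<Phi>)\<^sup>T * A)) = 0" by (rule ex[OF \<Phi> \<Omega> d2 d])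
    qed
  qed
qed

text \<open>Two estimates lead from the moments to the constants: l^2 + l <= l^2 + 2 l in
  \<open>\<delta>\<close>, and 2 / (s - \<rho> - 1) <= e^2 (s + \<rho>) / (s - \<rho>)^2 in
  \<open>\<delta>\<close> and \<open>\<mu>\<close>. \<open>\<epsilon>\<close> is taken over
  unchanged.\<close>

lemma spi_constant_bound:
  fixes \<rho> s l :: nat and t S6 S4 \<kappa> :: real
  assumes n: "1 \<le> \<rho>" "\<rho> + 4 \<le> s" "s < l" and nn: "0 \<le> t" "0 \<le> S6" "0 \<le> S4" "0 \<le> \<kappa>"
  shows "2 * t * (real \<rho> / (real l - real \<rho> - 1)) +
      2 * \<kappa> / (real s - real \<rho> - 1) * (((real l)\<^sup>2 + real l) * S6 + real l * (t * S4))
         * (real \<rho> * (real l - 1) / ((real l - real \<rho>) * (real l - real \<rho> - 1) * (real l - real \<rho> - 3)))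
    \<le> 2 * real \<rho> / (real l - real \<rho> - 1) * t
      + (exp 1)\<^sup>2 * (real s + real \<rho>) * real \<rho> * (real l - 1) * ((real l)\<^sup>2 + 2 * real l) /
          ((real s - real \<rho>)\<^sup>2 * (real l - real \<rho>) * (real l - real \<rho> - 1) * (real l - real \<rho> - 3)) * (S6 * \<kappa>)
      + (exp 1)\<^sup>2 * (real s + real \<rho>) * real \<rho> * (real l - 1) * real l /
          ((real s - real \<rho>)\<^sup>2 * (real l - real \<rho>) * (real l - real \<rho> - 1) * (real l - real \<rho> - 3)) * t * (S4 * \<kappa>)"
proof -
  define w where "w = real \<rho> * (real l - 1) / ((real l - real \<rho>) * (real l - real \<rho> - 1) * (real l - real \<rho> - 3))"
  define c1 where "c1 = (exp 1)\<^sup>2 * (real s + real \<rho>) / (real s - real \<rho>)\<^sup>2"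
  have w0: "0 \<le> w" unfolding w_def using n by (intro divide_nonneg_nonneg mult_nonneg_nonneg) auto
  have c: "2 / (real s - real \<rho> - 1) \<le> c1"
  proof -
    define u where "u = real s - real \<rho>"
    have u: "4 \<le> u" and s: "u + 2 \<le> real s + real \<rho>" using n by (auto simp: u_def)
    have "2\<^sup>2 \<le> (exp (1::real))\<^sup>2" using exp_ge_add_one_self[of "1::real"] by (intro power_mono) auto
    then have "4 * (u + 2) \<le> (exp 1)\<^sup>2 * (real s + real \<rho>)" using u s by (intro mult_mono) auto
    \<comment> \<open>With u = s - \<rho>, clearing denominators asks for 2 u^2 <= e^2 (s + \<rho>)
      (u - 1). This follows from e^2 >= 4 and s + \<rho> >= u + 2.\<close>
    moreover have "2 * u\<^sup>2 \<le> 4 * (u + 2) * (u - 1)" using u by (simp add: power2_eq_square algebra_simps) (use mult_mono[of 4 u 4 u] in linarith)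
    ultimately have "2 * u\<^sup>2 \<le> (exp 1)\<^sup>2 * (real s + real \<rho>) * (u - 1)"
      using u by (meson mult_right_mono order_trans diff_ge_0_iff_ge one_le_numeral)
    then show ?thesis unfolding c1_def u_def[symmetric] using u by (simp add: field_simps)
  qed
  have d: "(exp 1)\<^sup>2 * (real s + real \<rho>) * real \<rho> * (real l - 1) * x /
          ((real s - real \<rho>)\<^sup>2 * (real l - real \<rho>) * (real l - real \<rho> - 1) * (real l - real \<rho> - 3)) = c1 * x * w" for x
    unfolding c1_def w_def by (simp add: ac_simps)
  have "2 * \<kappa> / (real s - real \<rho> - 1) * (((real l)\<^sup>2 + real l) * S6 + real l * (t * S4)) * w
      = 2 / (real s - real \<rho> - 1) * (\<kappa> * (((real l)\<^sup>2 + real l) * S6 + real l * (t * S4)) * w)" by simp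
  also have "\<dots> \<le> c1 * (\<kappa> * (((real l)\<^sup>2 + 2 * real l) * S6 + real l * (t * S4)) * w)"
    using nn w0 n by (intro mult_mono[OF c] mult_right_mono mult_left_mono add_mono mult_nonneg_nonneg add_nonneg_nonneg) (auto simp: c1_def)
  also have "\<dots> = c1 * ((real l)\<^sup>2 + 2 * real l) * w * (S6 * \<kappa>) + c1 * real l * w * t * (S4 * \<kappa>)" by (simp add: algebra_simps)
  finally have "2 * \<kappa> / (real s - real \<rho> - 1) * (((real l)\<^sup>2 + real l) * S6 + real l * (t * S4)) * w
      \<le> c1 * ((real l)\<^sup>2 + 2 * real l) * w * (S6 * \<kappa>) + c1 * real l * w * t * (S4 * \<kappa>)" .
  moreover have "2 * t * (real \<rho> / (real l - real \<rho> - 1)) = 2 * real \<rho> / (real l - real \<rho> - 1) * t" by simp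
  ultimately show ?thesis unfolding d w_def[symmetric] by (simp only: add.assoc add_left_mono)
qed

lemma frob_sq_sing_tail:
  "frob_sq (sing_tail A \<rho> k) = (\<Sum>j = \<rho> + 1..\<rho> + k. sing_val A j ^ 2)"
  "frob_sq (sing_tail A \<rho> k * sing_tail A \<rho> k) = (\<Sum>j = \<rho> + 1..\<rho> + k. sing_val A j ^ 4)"
  "frob_sq (sing_tail A \<rho> k * (sing_tail A \<rho> k * sing_tail A \<rho> k)) = (\<Sum>j = \<rho> + 1..\<rho> + k. sing_val A j ^ 6)"
proof -
  have sh: "(\<Sum>i<k. g (\<rho> + i + 1)) = (\<Sum>j = \<rho> + 1..\<rho> + k. g j)" for g :: "nat \<Rightarrow> real"
    by (induction k) auto
  show "frob_sq (sing_tail A \<rho> k) = (\<Sum>j = \<rho> + 1..\<rho> + k. sing_val A j ^ 2)"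
    unfolding sh[symmetric] by (simp add: sing_tail_def frob_sq_mat_diag)
  show "frob_sq (sing_tail A \<rho> k * sing_tail A \<rho> k) = (\<Sum>j = \<rho> + 1..\<rho> + k. sing_val A j ^ 4)"
    unfolding sh[symmetric] by (simp add: sing_tail_def frob_sq_mat_diag power2_eq_square numeral_eq_Suc mult.assoc)
  show "frob_sq (sing_tail A \<rho> k * (sing_tail A \<rho> k * sing_tail A \<rho> k)) = (\<Sum>j = \<rho> + 1..\<rho> + k. sing_val A j ^ 6)"
    unfolding sh[symmetric] by (simp add: sing_tail_def frob_sq_mat_diag power2_eq_square numeral_eq_Suc mult.assoc)
qed

lemma mat_borel_spi_residual:
  assumes qr: "thin_qr qr" "s \<le> l" "s \<le> m" and A: "A \<in> carrier_mat m n"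
    and X: "X \<in> measurable N (mat_borel n l)" and Y: "Y \<in> measurable N (mat_borel n s)" and Z: "Z \<in> measurable N (mat_borel d m)"
  shows "(\<lambda>\<omega>. A - spi_Q qr 1 A (Y \<omega>) (X \<omega>) * spi_B qr 1 A (Y \<omega>) (X \<omega>) (Z \<omega>)) \<in> measurable N (mat_borel m n)"
  unfolding spi_B_def Let_def
  by (rule mat_borel_minus[OF mat_borel_const[OF A] mat_borel_mult[OF mat_borel_spi_Q[OF qr A Y X]
    mat_borel_mult[OF mat_borel_pinv[OF mat_borel_mult[OF Z mat_borel_spi_Q[OF qr A Y X]]] mat_borel_mult[OF Z mat_borel_const[OF A]]]]])

theorem theorem3p1:
  fixes M :: "'w measure"
    and A V :: "real mat"
    and m n l s d \<rho> :: nat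
    and \<Omega> \<Phi> \<Psi> Q B :: "'w \<Rightarrow> real mat"
    and qr :: "real mat \<Rightarrow> real mat"
    and \<xi> \<xi>h \<epsilon> \<delta> \<mu> :: real
    and EF :: "'w set"
  assumes "prob_space M"
    and "A \<in> carrier_mat m n"
    and "0 < l" "l < min m n"
    and "0 < s" "s < min m n"
    and "0 < d" "d < min m n"
    and "s < min l d"
    and "1 \<le> \<rho>" "\<rho> + 4 \<le> s" "s < l" "s + 1 < d"
    and "std_gaussian_mat M n l \<Phi>"
    and "std_gaussian_mat M n s \<Omega>"
    and "std_gaussian_mat M d m \<Psi>"
    and "prob_space.indep_vars M
           ((!) [mat_borel n l, mat_borel n s, mat_borel d m]) ((!) [\<Phi>, \<Omega>, \<Psi>]) {..<3::nat}"
    and "thin_qr qr"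
    and "\<And>\<omega>. Q \<omega> = spi_Q qr 1 A (\<Omega> \<omega>) (\<Phi> \<omega>)"
    and "\<And>\<omega>. B \<omega> = spi_B qr 1 A (\<Omega> \<omega>) (\<Phi> \<omega>) (\<Psi> \<omega>)"
    and "right_singular_basis A V"
    and "1 < \<xi>"
    and "EF = {\<omega> \<in> space M. (\<Omega> \<omega>, \<Phi> \<omega>) \<in> event_EF A V \<rho> \<xi>}"
    and "measure M EF > 0"
    and "\<xi>h = \<xi> / sqrt (measure M EF)"
    and "\<epsilon> = 2 * real \<rho> / (real l - real \<rho> - 1)"
    and "\<delta> = (exp 1)\<^sup>2 * (real s + real \<rho>) * real \<rho> * (real l - 1) * ((real l)\<^sup>2 + 2 * real l) /
             ((real s - real \<rho>)\<^sup>2 * (real l - real \<rho>) * (real l - real \<rho> - 1) * (real l - real \<rho> - 3))"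
    and "\<mu> = (exp 1)\<^sup>2 * (real s + real \<rho>) * real \<rho> * (real l - 1) * real l /
             ((real s - real \<rho>)\<^sup>2 * (real l - real \<rho>) * (real l - real \<rho> - 1) * (real l - real \<rho> - 3))"
  shows "integrable (uniform_measure M EF) (\<lambda>\<omega>. (frob_norm (A - Q \<omega> * B \<omega>))\<^sup>2) \<and>
         (LINT \<omega>|uniform_measure M EF. (frob_norm (A - Q \<omega> * B \<omega>))\<^sup>2)
           \<le> real d / (real d - real s - 1) *
              ((1 + \<epsilon> * \<xi>h\<^sup>2) * tau_sq (\<rho> + 1) A
               + \<delta> * \<xi>h\<^sup>2 * ((\<Sum>j = \<rho> + 1..n. (sing_val A j) ^ 6) / (sing_val A \<rho>) ^ 4)
               + \<mu> * \<xi>h\<^sup>2 * tau_sq (\<rho> + 1) A *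
                   ((\<Sum>j = \<rho> + 1..n. (sing_val A j) ^ 4) / (sing_val A \<rho>) ^ 4))"
proof -
  interpret prob_space M by fact
  define k where "k = n - \<rho>"
  have n: "n = \<rho> + k" and qr: "thin_qr qr" "s \<le> l" "s \<le> m" and \<xi>: "0 \<le> \<xi>"
    using assms(4-6,9-13,18,22) by (auto simp: k_def)
  note A = \<open>A \<in> carrier_mat m n\<close> and V = \<open>right_singular_basis A V\<close>
  have V': "V \<in> carrier_mat n n" using V A unfolding right_singular_basis_def by auto
  have mX: "\<Phi> \<in> measurable M (mat_borel n l)" and mY: "\<Omega> \<in> measurable M (mat_borel n s)" and mZ: "\<Psi> \<in> measurable M (mat_borel d m)"
    using assms(14-16) by (auto simp: std_gaussian_mat_def)
  let ?L2 = "sing_tail A \<rho> k" and ?S = "inv_sq (sing_head A \<rho>)"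
  define wc where "wc = (\<lambda>\<Phi> \<Omega>. well_cond ?L2 ?S \<xi> (topE \<rho> k * (V\<^sup>T * \<Phi>)) (botE \<rho> k * (V\<^sup>T * \<Phi>))
      (topE \<rho> k * (V\<^sup>T * \<Omega>)) (botE \<rho> k * (V\<^sup>T * \<Omega>)))"
  define err where "err = (\<lambda>\<Phi> \<Omega>. frob_sq (A - spi_Q qr 1 A \<Omega> \<Phi> * ((spi_Q qr 1 A \<Omega> \<Phi>)\<^sup>T * A)))"
  define res where "res = (\<lambda>\<Phi> \<Omega> \<Psi>. frob_sq (A - spi_Q qr 1 A \<Omega> \<Phi> * spi_B qr 1 A \<Omega> \<Phi> \<Psi>))"
  define D where "D = real d / (real d - real s - 1)"
  define p where "p = measure M EF"
  define t where "t = tau_sq (\<rho> + 1) A"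
  define S4 where "S4 = (\<Sum>j = \<rho> + 1..n. sing_val A j ^ 4)"
  define S6 where "S6 = (\<Sum>j = \<rho> + 1..n. sing_val A j ^ 6)"
  define \<kappa> where "\<kappa> = 1 / sing_val A \<rho> ^ 4"
  \<comment> \<open>The sum of all terms that the theorem multiplies by
    \<open>\<xi>h\<^sup>2\<close>.\<close>
  define C where "C = \<epsilon> * t + \<delta> * (S6 * \<kappa>) + \<mu> * t * (S4 * \<kappa>)"
  have t: "t = frob_sq ?L2" and S4: "S4 = frob_sq (?L2 * ?L2)" and S6: "S6 = frob_sq (?L2 * (?L2 * ?L2))"
    using A n by (auto simp: t_def tau_sq_def S4_def S6_def frob_sq_sing_tail)
  have D0: "0 \<le> D" using assms(13) by (simp add: D_def)
  have nn: "0 \<le> t" "0 \<le> S6" "0 \<le> S4" "0 \<le> \<kappa>" unfolding t S4 S6 \<kappa>_def by auto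
  have p0: "0 < p" using assms(24) by (simp add: p_def)
  note cb = spi_constant_bound[OF assms(10-12) nn, folded \<open>\<epsilon> = _\<close> \<open>\<delta> = _\<close> \<open>\<mu> = _\<close>, folded C_def]
  \<comment> \<open>The left side of \<open>cb\<close> is a sum of nonnegative terms, so the sign of
    \<open>C\<close> follows without inspecting its constants.\<close>
  have C0: "0 \<le> C"
    by (rule order_trans[OF _ cb]) (use nn assms(10-12) in \<open>auto intro!: add_nonneg_nonneg mult_nonneg_nonneg divide_nonneg_nonneg\<close>)
  have tE: "topE \<rho> k \<in> carrier_mat \<rho> n" "botE \<rho> k \<in> carrier_mat k n" "V\<^sup>T \<in> carrier_mat n n"
    "?L2 \<in> carrier_mat k k" "?S \<in> carrier_mat \<rho> \<rho>"
    using n V' by (auto intro!: carrier_matI)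
  note top = mat_borel_mult[OF mat_borel_const[OF tE(1)] mat_borel_mult[OF mat_borel_const[OF tE(3)]]]
    and bot = mat_borel_mult[OF mat_borel_const[OF tE(2)] mat_borel_mult[OF mat_borel_const[OF tE(3)]]]
  have wm: "Measurable.pred N (\<lambda>\<omega>. wc (X \<omega>) (Y \<omega>))" and em: "(\<lambda>\<omega>. err (X \<omega>) (Y \<omega>)) \<in> borel_measurable N"
    if X: "X \<in> measurable N (mat_borel n l)" and Y: "Y \<in> measurable N (mat_borel n s)" for X Y and N :: "'z measure"
  proof -
    show "Measurable.pred N (\<lambda>\<omega>. wc (X \<omega>) (Y \<omega>))"
      unfolding wc_def using assms(10) by (intro pred_well_cond[OF top[OF X] bot[OF X] top[OF Y] bot[OF Y] tE(4,5)]) simp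
    note Q = mat_borel_spi_Q[OF qr A Y X]
    show "(\<lambda>\<omega>. err (X \<omega>) (Y \<omega>)) \<in> borel_measurable N" unfolding err_def
      by (rule mat_borel_frob_sq[OF mat_borel_minus[OF mat_borel_const[OF A] mat_borel_mult[OF Q mat_borel_mult[OF mat_borel_transpose[OF Q] mat_borel_const[OF A]]]]])
  qed
  have rm: "(\<lambda>\<omega>. res (X \<omega>) (Y \<omega>) (Z \<omega>)) \<in> borel_measurable N"
    if "X \<in> measurable N (mat_borel n l)" "Y \<in> measurable N (mat_borel n s)" "Z \<in> measurable N (mat_borel d m)" for X Y Z and N :: "'z measure"
    unfolding res_def by (rule mat_borel_frob_sq[OF mat_borel_spi_residual[OF qr A that]])
  have EF: "EF = {\<omega> \<in> space M. wc (\<Phi> \<omega>) (\<Omega> \<omega>)}"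
  proof -
    have "(\<Omega> \<omega>, \<Phi> \<omega>) \<in> event_EF A V \<rho> \<xi> \<longleftrightarrow> wc (\<Phi> \<omega>) (\<Omega> \<omega>)" if "\<omega> \<in> space M" for \<omega>
      unfolding wc_def using mat_borel_carrier[OF mX that] mat_borel_carrier[OF mY that] A V unfolding n by (intro event_EF_iff)
    then show ?thesis using assms(23) by auto
  qed
  have [measurable]: "EF \<in> sets M" using wm[OF mX mY] unfolding EF by (rule predE)
  have emEF: "emeasure M EF = ennreal p" by (simp add: p_def emeasure_eq_measure)
  note triple = nn_integral_indep_triple[OF \<open>prob_space M\<close> assms(17) _ _ _ mX mY mZ]
  have pos: "0 < n" "0 < l" "0 < s" "0 < d" "0 < m" using assms(3-8) by auto
  note triple = triple[OF distr_std_gaussian_mat[OF \<open>prob_space M\<close> assms(14) pos(1,2)]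
      distr_std_gaussian_mat[OF \<open>prob_space M\<close> assms(15) pos(1,3)] distr_std_gaussian_mat[OF \<open>prob_space M\<close> assms(16) pos(4,5)]]
  let ?P = "mat_borel n l \<Otimes>\<^sub>M (mat_borel n s \<Otimes>\<^sub>M mat_borel d m)"
  have pr: "fst \<in> measurable ?P (mat_borel n l)" "(\<lambda>w. fst (snd w)) \<in> measurable ?P (mat_borel n s)" "(\<lambda>w. snd (snd w)) \<in> measurable ?P (mat_borel d m)"
    by measurable
  interpret GZ: prob_space "gauss_mat d m" by (rule prob_space_gauss_mat)
  interpret GY: prob_space "gauss_mat n s" by (rule prob_space_gauss_mat)
  have GZ1: "emeasure (gauss_mat d m) (carrier_mat d m) = 1"
    using GZ.emeasure_space_1 by (simp add: sets_eq_imp_space_eq[OF sets_gauss_mat])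
  \<comment> \<open>The probability of the event as an integral over \<Phi> and \<Omega> only; the
    inner integral over \<Psi> has mass one.\<close>
  have p_int: "(\<integral>\<^sup>+\<Phi>. \<integral>\<^sup>+\<Omega>. of_bool (wc \<Phi> \<Omega>) \<partial>gauss_mat n s \<partial>gauss_mat n l) = ennreal p"
  proof -
    note [measurable] = wm[OF pr(1,2)]
    have "(\<integral>\<^sup>+\<omega>. of_bool (wc (\<Phi> \<omega>) (\<Omega> \<omega>)) \<partial>M) = (\<integral>\<^sup>+\<Phi>. \<integral>\<^sup>+\<Omega>. \<integral>\<^sup>+\<Psi>. of_bool (wc \<Phi> \<Omega>) \<partial>gauss_mat d m \<partial>gauss_mat n s \<partial>gauss_mat n l)"
      by (rule triple[of "\<lambda>\<Phi> \<Omega> \<Psi>. of_bool (wc \<Phi> \<Omega>)"]) (simp add: case_prod_beta)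
    moreover have "(\<integral>\<^sup>+\<omega>. of_bool (wc (\<Phi> \<omega>) (\<Omega> \<omega>)) \<partial>M) = (\<integral>\<^sup>+\<omega>. indicator EF \<omega> \<partial>M)"
      by (rule nn_integral_cong) (simp add: EF indicator_def)
    ultimately show ?thesis by (simp add: emEF GZ1)
  qed
  have range: "(\<integral>\<^sup>+\<Phi>. \<integral>\<^sup>+\<Omega>. of_bool (wc \<Phi> \<Omega>) * ennreal (err \<Phi> \<Omega>) \<partial>gauss_mat n s \<partial>gauss_mat n l) \<le> ennreal (t * p + \<xi>\<^sup>2 * C)"
  \<comment> \<open>If \<sigma>_\<rho> = 0, then \<open>\<kappa>\<close> is 1 / 0 = 0, in agreement
    with the convention for the quotients, and the integral on the left vanishes.\<close>
  proof (cases "sing_val A \<rho> = 0")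
    case True
    have "AE \<Phi> in gauss_mat n l. AE \<Omega> in gauss_mat n s. err \<Phi> \<Omega> = 0"
      using AE_spi_Q_exact[OF qr A V, of "\<rho> - 1"] assms(6,10,11) True by (simp add: err_def)
    then have "(\<integral>\<^sup>+\<Phi>. \<integral>\<^sup>+\<Omega>. of_bool (wc \<Phi> \<Omega>) * ennreal (err \<Phi> \<Omega>) \<partial>gauss_mat n s \<partial>gauss_mat n l) = 0"
      by (intro nn_integral_eq_0_cong) (auto elim!: eventually_mono intro!: nn_integral_eq_0_cong)
    then show ?thesis by simp
  next
    case False
    have l: "0 < \<rho>" "\<rho> + 2 \<le> s" "\<rho> + 4 \<le> l" using assms(10-12) by auto
    have "(\<integral>\<^sup>+\<Phi>. \<integral>\<^sup>+\<Omega>. of_bool (wc \<Phi> \<Omega>) * ennreal (err \<Phi> \<Omega>) \<partial>gauss_mat n s \<partial>gauss_mat n l)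
      \<le> ennreal t * (\<integral>\<^sup>+\<Phi>. \<integral>\<^sup>+\<Omega>. of_bool (wc \<Phi> \<Omega>) \<partial>gauss_mat n s \<partial>gauss_mat n l) + ennreal (\<xi>\<^sup>2) *
        ennreal (2 * t * (real \<rho> / (real l - real \<rho> - 1)) +
          2 * \<kappa> / (real s - real \<rho> - 1) * (((real l)\<^sup>2 + real l) * S6 + real l * (t * S4))
            * (real \<rho> * (real l - 1) / ((real l - real \<rho>) * (real l - real \<rho> - 1) * (real l - real \<rho> - 3))))"
      unfolding wc_def err_def by (rule nn_integral_range_error[OF qr A[unfolded n] V l False \<xi>, folded n t S4 S6 \<kappa>_def])
    also have "\<dots> \<le> ennreal t * ennreal p + ennreal (\<xi>\<^sup>2) * ennreal C"
      unfolding p_int by (rule add_left_mono[OF mult_left_mono[OF ennreal_leI[OF cb]]]) simp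
    also have "\<dots> = ennreal (t * p + \<xi>\<^sup>2 * C)"
      using nn(1) C0 p0 by (simp add: ennreal_mult ennreal_plus)
    finally show ?thesis .
  qed
  have total: "(\<integral>\<^sup>+\<omega>. of_bool (wc (\<Phi> \<omega>) (\<Omega> \<omega>)) * ennreal (res (\<Phi> \<omega>) (\<Omega> \<omega>) (\<Psi> \<omega>)) \<partial>M) \<le> ennreal (D * (t * p + \<xi>\<^sup>2 * C))"
  proof -
    note [measurable] = wm[OF pr(1,2)] rm[OF pr]
    have "(\<integral>\<^sup>+\<omega>. of_bool (wc (\<Phi> \<omega>) (\<Omega> \<omega>)) * ennreal (res (\<Phi> \<omega>) (\<Omega> \<omega>) (\<Psi> \<omega>)) \<partial>M)
      = (\<integral>\<^sup>+\<Phi>. \<integral>\<^sup>+\<Omega>. \<integral>\<^sup>+\<Psi>. of_bool (wc \<Phi> \<Omega>) * ennreal (res \<Phi> \<Omega> \<Psi>) \<partial>gauss_mat d m \<partial>gauss_mat n s \<partial>gauss_mat n l)"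
      by (rule triple[of "\<lambda>\<Phi> \<Omega> \<Psi>. of_bool (wc \<Phi> \<Omega>) * ennreal (res \<Phi> \<Omega> \<Psi>)"]) (simp add: case_prod_beta)
    \<comment> \<open>\<Psi> is averaged first, with \<Phi> and \<Omega> fixed; the event does not
      depend on \<Psi>, so its indicator passes through.\<close>
    also have "\<dots> \<le> (\<integral>\<^sup>+\<Phi>. ennreal D * (\<integral>\<^sup>+\<Omega>. of_bool (wc \<Phi> \<Omega>) * ennreal (err \<Phi> \<Omega>) \<partial>gauss_mat n s) \<partial>gauss_mat n l)"
    proof (rule nn_integral_mono)
      fix \<Phi> assume "\<Phi> \<in> space (gauss_mat n l)"
      then have \<Phi>: "\<Phi> \<in> carrier_mat n l" by (simp add: sets_eq_imp_space_eq[OF sets_gauss_mat])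
      note [measurable] = wm[OF mat_borel_const[OF \<Phi>] measurable_ident_gauss_mat] em[OF mat_borel_const[OF \<Phi>] measurable_ident_gauss_mat]
      have "(\<integral>\<^sup>+\<Omega>. \<integral>\<^sup>+\<Psi>. of_bool (wc \<Phi> \<Omega>) * ennreal (res \<Phi> \<Omega> \<Psi>) \<partial>gauss_mat d m \<partial>gauss_mat n s)
        \<le> (\<integral>\<^sup>+\<Omega>. ennreal D * (of_bool (wc \<Phi> \<Omega>) * ennreal (err \<Phi> \<Omega>)) \<partial>gauss_mat n s)"
      proof (rule nn_integral_mono)
        fix \<Omega> assume "\<Omega> \<in> space (gauss_mat n s)"
        then have \<Omega>: "\<Omega> \<in> carrier_mat n s" by (simp add: sets_eq_imp_space_eq[OF sets_gauss_mat])
        note Qp = spi_Q_props[OF qr A \<Omega> \<Phi>]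
        have "s + 2 \<le> d" using assms(13) by simp
        note sk = nn_integral_sketch_error[OF Qp(1,2) A pos(3) this qr(3), folded D_def err_def]
        have "(\<integral>\<^sup>+\<Psi>. ennreal (res \<Phi> \<Omega> \<Psi>) \<partial>gauss_mat d m) \<le> ennreal D * ennreal (err \<Phi> \<Omega>)"
          using sk D0 unfolding res_def spi_B_def Let_def by (simp add: ennreal_mult' err_def)
        then show "(\<integral>\<^sup>+\<Psi>. of_bool (wc \<Phi> \<Omega>) * ennreal (res \<Phi> \<Omega> \<Psi>) \<partial>gauss_mat d m) \<le> ennreal D * (of_bool (wc \<Phi> \<Omega>) * ennreal (err \<Phi> \<Omega>))"
          by (cases "wc \<Phi> \<Omega>") auto
      qed
      also have "\<dots> = ennreal D * (\<integral>\<^sup>+\<Omega>. of_bool (wc \<Phi> \<Omega>) * ennreal (err \<Phi> \<Omega>) \<partial>gauss_mat n s)"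
        by (rule nn_integral_cmult) measurable
      finally show "(\<integral>\<^sup>+\<Omega>. \<integral>\<^sup>+\<Psi>. of_bool (wc \<Phi> \<Omega>) * ennreal (res \<Phi> \<Omega> \<Psi>) \<partial>gauss_mat d m \<partial>gauss_mat n s) \<le> \<dots>" .
    qed
    also have "\<dots> = ennreal D * (\<integral>\<^sup>+\<Phi>. \<integral>\<^sup>+\<Omega>. of_bool (wc \<Phi> \<Omega>) * ennreal (err \<Phi> \<Omega>) \<partial>gauss_mat n s \<partial>gauss_mat n l)"
    proof (rule nn_integral_cmult)
      have f: "fst \<in> measurable (gauss_mat n l \<Otimes>\<^sub>M gauss_mat n s) (mat_borel n l)" "snd \<in> measurable (gauss_mat n l \<Otimes>\<^sub>M gauss_mat n s) (mat_borel n s)"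
        using measurable_fst[of "gauss_mat n l" "gauss_mat n s"] measurable_snd[of "gauss_mat n l" "gauss_mat n s"]
        by (simp_all cong: measurable_cong_sets)
      note [measurable] = wm[OF f] em[OF f]
      show "(\<lambda>\<Phi>. \<integral>\<^sup>+\<Omega>. of_bool (wc \<Phi> \<Omega>) * ennreal (err \<Phi> \<Omega>) \<partial>gauss_mat n s) \<in> borel_measurable (gauss_mat n l)"
        by (intro GY.borel_measurable_nn_integral) (simp add: case_prod_beta)
    qed
    also have "\<dots> \<le> ennreal D * ennreal (t * p + \<xi>\<^sup>2 * C)" by (rule mult_left_mono[OF range]) simp
    also have "\<dots> = ennreal (D * (t * p + \<xi>\<^sup>2 * C))" using D0 by (simp add: ennreal_mult')
    finally show ?thesis .
  qed
  define f where "f = (\<lambda>\<omega>. res (\<Phi> \<omega>) (\<Omega> \<omega>) (\<Psi> \<omega>))"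
  have f_eq: "(\<lambda>\<omega>. (frob_norm (A - Q \<omega> * B \<omega>))\<^sup>2) = f"
    unfolding f_def res_def assms(19,20) frob_norm_sq ..
  have fm: "f \<in> borel_measurable (uniform_measure M EF)"
    using rm[OF mX mY mZ] unfolding f_def by (simp cong: measurable_cong_sets)
  have f0: "0 \<le> f \<omega>" for \<omega> unfolding f_def res_def by simp
  have "(\<integral>\<^sup>+\<omega>. ennreal (f \<omega>) \<partial>uniform_measure M EF) = (\<integral>\<^sup>+\<omega>. ennreal (f \<omega>) * indicator EF \<omega> \<partial>M) / emeasure M EF"
    using fm by (intro nn_integral_uniform_measure) (auto cong: measurable_cong_sets)
  also have "(\<integral>\<^sup>+\<omega>. ennreal (f \<omega>) * indicator EF \<omega> \<partial>M) = (\<integral>\<^sup>+\<omega>. of_bool (wc (\<Phi> \<omega>) (\<Omega> \<omega>)) * ennreal (res (\<Phi> \<omega>) (\<Omega> \<omega>) (\<Psi> \<omega>)) \<partial>M)"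
    by (rule nn_integral_cong) (simp add: EF indicator_def f_def)
  also have "\<dots> / emeasure M EF \<le> ennreal (D * (t * p + \<xi>\<^sup>2 * C)) / ennreal p"
    unfolding emEF by (rule divide_right_mono_ennreal[OF total])
  \<comment> \<open>Dividing by p returns t to coefficient 1 and turns \<xi>^2 / p into
    \<open>\<xi>h\<^sup>2\<close>.\<close>
  also have "\<dots> = ennreal (D * (t + \<xi>h\<^sup>2 * C))"
    using p0 D0 nn(1) C0 by (subst divide_ennreal) (auto simp: assms(25) p_def[symmetric] power_divide field_simps)
  finally have fin: "(\<integral>\<^sup>+\<omega>. ennreal (f \<omega>) \<partial>uniform_measure M EF) \<le> ennreal (D * (t + \<xi>h\<^sup>2 * C))" .
  \<comment> \<open>Integrability is read off the finite bound just obtained; it was not assumed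
    anywhere.\<close>
  have int: "integrable (uniform_measure M EF) f"
    by (rule integrableI_nonneg[OF fm]) (use f0 fin in \<open>auto simp: ennreal_less_top intro: le_less_trans\<close>)
  have "ennreal (LINT \<omega>|uniform_measure M EF. f \<omega>) \<le> ennreal (D * (t + \<xi>h\<^sup>2 * C))"
    using nn_integral_eq_integral[OF int] f0 fin by simp
  then have "(LINT \<omega>|uniform_measure M EF. f \<omega>) \<le> D * (t + \<xi>h\<^sup>2 * C)"
    by (rule ennreal_le_iff[THEN iffD1, rotated]) (use D0 nn(1) C0 in auto)
  also have "\<dots> = D * ((1 + \<epsilon> * \<xi>h\<^sup>2) * t + \<delta> * \<xi>h\<^sup>2 * (S6 / sing_val A \<rho> ^ 4) + \<mu> * \<xi>h\<^sup>2 * t * (S4 / sing_val A \<rho> ^ 4))"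
    by (simp add: C_def \<kappa>_def algebra_simps)
  finally show ?thesis using int unfolding f_eq t_def D_def S4_def S6_def by simp
qed

end
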